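(* Let $k$ be a field and let $I$ be a homogeneous ideal of $A=k[X_1,\dots,X_n]$ generated by forms in degree $d$. Set $\mathfrak m=(X_1,\dots,X_n)$, $R=R_A(I)$, $l=l(I)$ and $s=n-\mathrm{depth}_{(\mathfrak mR)}(R)$. Then there is a finite set of integers $\{\alpha_{pi}\mid0\le p\le s,\ 1\le i\le k_p\}$ and polynomials $\{Q_{\alpha_{pi}}(j)\mid0\le p\le s,\ 1\le i\le k_p\}$ of degree $\le l-1$ such that the graded minimal free resolution of $I^j$ for $j$ large enough is $$0\to D_s^j\to\dots\to D_0^j\to I^j\to0,$$ with $D_p^j=\bigoplus_iA(-\alpha_{pi}-dj)^{\beta_{pi}^j}$ and $\beta_{pi}^j=Q_{\alpha_{pi}}(j)$.
   Context: $A$ has the usual grading. $R_A(I)=\bigoplus_{j\ge0}I^jt^j\subset A[t]$ is the Rees algebra; $l(I)=\dim\bigoplus_{j\ge0}I^j/\mathfrak mI^j$ is the analytic spread; $\mathrm{depth}_{(\mathfrak mR)}(R)$ is the grade of the ideal $\mathfrak mR$ on $R$, i.e. the length of a maximal $R$-regular sequence contained in $\mathfrak mR$. The polynomial attached to the index $p$ and the integer $\alpha_{pi}$ may depend on both. *)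

theory Defs
  imports
    "HOL-Library.Poly_Mapping"
    "HOL-Library.Cardinality"
    "HOL-Library.Extended_Nat"
    "HOL-Computational_Algebra.Polynomial"
    "HOL-Algebra.Ideal_Product"
    "HOL-Algebra.Algebraic_Closure_Type"
begin

section \<open>Ideals of the polynomial ring\<close>

text \<open>
  \<^typ>\<open>('n \<Rightarrow>\<^sub>0 nat) \<Rightarrow>\<^sub>0 'k\<close> is the polynomial ring over \<open>'k\<close> with one variable for each element
  of \<open>'n\<close>; a polynomial maps exponent vectors to coefficients. As an object of HOL-Algebra
  it is \<^const>\<open>ring_of_type_algebra\<close>, whose carrier is the whole type.
\<close>

type_synonym ('n, 'k) mpoly = "('n \<Rightarrow>\<^sub>0 nat) \<Rightarrow>\<^sub>0 'k"

abbreviation mpoly_ring :: "('n::finite, 'k::field) mpoly ring" where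
  "mpoly_ring \<equiv> ring_of_type_algebra"

definition mvar :: "'n::finite \<Rightarrow> ('n, 'k::field) mpoly" where
  "mvar i = Poly_Mapping.single (Poly_Mapping.single i 1) 1"

definition irrelevant_ideal :: "('n::finite, 'k::field) mpoly set" where
  "irrelevant_ideal = genideal mpoly_ring (range mvar)"

text \<open>The homogeneous component of degree \<open>e\<close>; it is zero for negative \<open>e\<close>.\<close>

definition forms :: "int \<Rightarrow> ('n::finite, 'k::field) mpoly set" where
  "forms e = {f. \<forall>u \<in> Poly_Mapping.keys f. int (\<Sum>i\<in>UNIV. Poly_Mapping.lookup u i) = e}"

text \<open>The product of the monoid \<^term>\<open>ideals_set R\<close> is the product of ideals and its unit is
  \<^term>\<open>carrier R\<close>, so that the zeroth power of an ideal is the unit ideal.\<close>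

abbreviation ideal_power :: "('n::finite, 'k::field) mpoly set \<Rightarrow> nat \<Rightarrow> ('n, 'k) mpoly set" where
  "ideal_power I j \<equiv> I [^]\<^bsub>ideals_set mpoly_ring\<^esub> j"


section \<open>Krull dimension and grade\<close>

definition krull_dim :: "('a, 'b) ring_scheme \<Rightarrow> enat" where
  "krull_dim R = Sup {enat r | r. \<exists>P :: nat \<Rightarrow> 'a set.
     (\<forall>i\<le>r. primeideal (P i) R) \<and> (\<forall>i<r. P i \<subset> P (Suc i))}"

text \<open>
  The second clause says that \<open>xs ! i\<close> is a nonzerodivisor on \<open>R\<close> modulo the ideal generated
  by the preceding entries.
\<close>

definition regular_sequence :: "('a, 'b) ring_scheme \<Rightarrow> 'a list \<Rightarrow> bool" where
  "regular_sequence R xs \<longleftrightarrow>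
     set xs \<subseteq> carrier R \<and>
     (\<forall>i<length xs. \<forall>y\<in>carrier R.
        xs ! i \<otimes>\<^bsub>R\<^esub> y \<in> genideal R (set (take i xs)) \<longrightarrow> y \<in> genideal R (set (take i xs))) \<and>
     genideal R (set xs) \<noteq> carrier R"

text \<open>
  In a Noetherian ring all maximal regular sequences in a proper ideal have the same length,
  which is therefore the supremum of the lengths of the regular sequences in the ideal.
\<close>

definition grade :: "('a, 'b) ring_scheme \<Rightarrow> 'a set \<Rightarrow> enat" where
  "grade R J = Sup {enat (length xs) | xs. regular_sequence R xs \<and> set xs \<subseteq> J}"


section \<open>Rees algebra and analytic spread\<close>

definition rees_ring :: "('n::finite, 'k::field) mpoly set \<Rightarrow> ('n, 'k) mpoly poly ring" where
  "rees_ring I = ring_of_type_algebra \<lparr>carrier := {p. \<forall>j. poly.coeff p j \<in> ideal_power I j}\<rparr>"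

definition irrelevant_rees :: "('n::finite, 'k::field) mpoly set \<Rightarrow> ('n, 'k) mpoly poly set" where
  "irrelevant_rees I = genideal (rees_ring I) ((\<lambda>a. [:a:]) ` irrelevant_ideal)"

definition fiber_denom :: "('n::finite, 'k::field) mpoly set \<Rightarrow> nat \<Rightarrow> ('n, 'k) mpoly set" where
  "fiber_denom I j = ideal_prod mpoly_ring irrelevant_ideal (ideal_power I j)"

text \<open>
  The direct sum of the quotients of \<^term>\<open>ideal_power I j\<close> by \<^term>\<open>fiber_denom I j\<close>: an
  element is a sequence of cosets, almost all of them zero. The product is induced by
  the products \<open>I\<^sup>i \<times> I\<^sup>j \<rightarrow> I\<^sup>i\<^sup>+\<^sup>j\<close> of representatives.
\<close>

definition fiber_ring :: "('n::finite, 'k::field) mpoly set \<Rightarrow> (nat \<Rightarrow> ('n, 'k) mpoly set) ring" where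
  "fiber_ring I =
     \<lparr>carrier = {F. (\<forall>j. \<exists>x\<in>ideal_power I j. F j = fiber_denom I j +>\<^bsub>mpoly_ring\<^esub> x) \<and>
                    finite {j. F j \<noteq> fiber_denom I j}},
      monoid.mult = (\<lambda>F G j. {z. \<exists>x y. (\<forall>i\<le>j. x i \<in> F i \<and> y i \<in> G i) \<and>
                        z \<in> fiber_denom I j +>\<^bsub>mpoly_ring\<^esub> (\<Sum>i\<le>j. x i * y (j - i))}),
      one = (\<lambda>j. if j = 0 then fiber_denom I 0 +>\<^bsub>mpoly_ring\<^esub> 1 else fiber_denom I j),
      zero = fiber_denom I,
      add = (\<lambda>F G j. F j <+>\<^bsub>mpoly_ring\<^esub> G j)\<rparr>"

definition analytic_spread :: "('n::finite, 'k::field) mpoly set \<Rightarrow> enat" where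
  "analytic_spread I = krull_dim (fiber_ring I)"


section \<open>Graded free resolutions\<close>

text \<open>
  A list \<open>[b\<^sub>0, \<dots>, b\<^sub>r\<^sub>-\<^sub>1]\<close> of integers encodes the graded free module \<open>\<Oplus>\<^sub>i A(-b\<^sub>i)\<close>. Its elements are
  the sequences of polynomials supported on the indices below \<open>r\<close>. Since \<open>A(-b)\<close> in degree \<open>e\<close>
  is \<open>A\<close> in degree \<open>e - b\<close>, the \<open>i\<close>-th basis element has degree \<open>b\<^sub>i\<close>.
\<close>

definition gfree :: "int list \<Rightarrow> (nat \<Rightarrow> ('n::finite, 'k::field) mpoly) set" where
  "gfree bs = {v. \<forall>i\<ge>length bs. v i = 0}"

definition gfree_component :: "int list \<Rightarrow> int \<Rightarrow> (nat \<Rightarrow> ('n::finite, 'k::field) mpoly) set" where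
  "gfree_component bs e = {v \<in> gfree bs. \<forall>i<length bs. v i \<in> forms (e - bs ! i)}"

text \<open>Homogeneous homomorphisms of degree zero into \<open>A\<close> and between graded free modules.\<close>

definition graded_functional ::
    "int list \<Rightarrow> ((nat \<Rightarrow> ('n::finite, 'k::field) mpoly) \<Rightarrow> ('n, 'k) mpoly) \<Rightarrow> bool" where
  "graded_functional bs f \<longleftrightarrow>
     (\<forall>v\<in>gfree bs. \<forall>w\<in>gfree bs. f (\<lambda>i. v i + w i) = f v + f w) \<and>
     (\<forall>a. \<forall>v\<in>gfree bs. f (\<lambda>i. a * v i) = a * f v) \<and>
     (\<forall>e. f ` gfree_component bs e \<subseteq> forms e)"

definition graded_hom :: "int list \<Rightarrow> int list \<Rightarrow>
    ((nat \<Rightarrow> ('n::finite, 'k::field) mpoly) \<Rightarrow> (nat \<Rightarrow> ('n, 'k) mpoly)) \<Rightarrow> bool" where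
  "graded_hom bs cs f \<longleftrightarrow>
     f ` gfree bs \<subseteq> gfree cs \<and>
     (\<forall>v\<in>gfree bs. \<forall>w\<in>gfree bs. f (\<lambda>i. v i + w i) = (\<lambda>i. f v i + f w i)) \<and>
     (\<forall>a. \<forall>v\<in>gfree bs. f (\<lambda>i. a * v i) = (\<lambda>i. a * f v i)) \<and>
     (\<forall>e. f ` gfree_component bs e \<subseteq> gfree_component cs e)"

text \<open>
  There are maps \<open>\<dots> \<rightarrow> D\<^sub>1 \<rightarrow> D\<^sub>0 \<rightarrow> M \<rightarrow> 0\<close>, with \<open>\<phi> p\<close> going from \<open>D\<^sub>p\<^sub>+\<^sub>1\<close> to \<open>D\<^sub>p\<close>, that form a
  graded minimal free resolution of the homogeneous ideal \<open>M\<close>. The last clause is minimality: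
  the image of \<open>\<phi> p\<close> lies in \<open>\<mm> D\<^sub>p\<close>. A resolution of length at most \<open>s\<close> has \<open>D p = []\<close> for
  all \<open>p > s\<close>.
\<close>

definition has_graded_minimal_free_resolution ::
    "('n::finite, 'k::field) mpoly set \<Rightarrow> (nat \<Rightarrow> int list) \<Rightarrow> bool" where
  "has_graded_minimal_free_resolution M D \<longleftrightarrow>
     (\<exists>(\<epsilon> :: (nat \<Rightarrow> ('n, 'k) mpoly) \<Rightarrow> ('n, 'k) mpoly)
        (\<phi> :: nat \<Rightarrow> (nat \<Rightarrow> ('n, 'k) mpoly) \<Rightarrow> (nat \<Rightarrow> ('n, 'k) mpoly)).
        graded_functional (D 0) \<epsilon> \<and>
        (\<forall>p. graded_hom (D (Suc p)) (D p) (\<phi> p)) \<and>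
        \<epsilon> ` gfree (D 0) = M \<and>
        \<phi> 0 ` gfree (D 1) = {v \<in> gfree (D 0). \<epsilon> v = 0} \<and>
        (\<forall>p. \<phi> (Suc p) ` gfree (D (Suc (Suc p))) =
              {v \<in> gfree (D (Suc p)). \<phi> p v = (\<lambda>_. 0)}) \<and>
        (\<forall>p. \<forall>v\<in>gfree (D (Suc p)). \<forall>i. \<phi> p v i \<in> irrelevant_ideal))"

text \<open>The shifts (degrees of the basis elements) of \<open>\<Oplus>\<^sub>i A(-c\<^sub>i)\<^bsup>\<beta>\<^sub>i\<^esup>\<close>, where \<open>1 \<le> i \<le> r\<close>.\<close>

definition repeated_shifts :: "nat \<Rightarrow> (nat \<Rightarrow> int) \<Rightarrow> (nat \<Rightarrow> nat) \<Rightarrow> int list" where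
  "repeated_shifts r c \<beta> = concat (map (\<lambda>i. replicate (\<beta> i) (c i)) [1..<Suc r])"

end

theory Submission
  imports Defs "HOL-Library.Function_Algebras"
begin

text \<open>
  The Betti numbers \<open>\<beta>\<^bsub>p,e\<^esub>(I\<^sup>j)\<close> are the dimensions of the graded pieces of the Koszul homology
  \<open>H\<^sub>p(x; I\<^sup>j)\<close>, which for all \<open>j\<close> together is the homology of the Koszul complex of the Rees algebra
  \<open>R\<close>. That homology is finitely generated over \<open>R\<close> and killed by \<open>\<mm>\<close>, hence finitely generated over
  the fiber ring. As \<open>I\<close> is generated in degree \<open>d\<close>, the fiber ring is the algebra \<open>k[I\<^sub>d t]\<close>, which
  preserves the rows \<open>e = a + p + dj\<close> for fixed \<open>a\<close>; so only finitely many rows are nonzero and each is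
  a finitely generated graded module, whose Hilbert function is eventually a polynomial of degree
  less than the Krull dimension of the fiber ring. A regular sequence of length \<open>g\<close> in \<open>\<mm>R\<close> makes
  \<open>H\<^sub>p\<close> vanish for \<open>p > n - g\<close>.
\<close>

section \<open>Ascending chains of submodules\<close>

text \<open>Quotient modules never occur as objects. Homology and graded quotients are pairs of
  nested subspaces, and their dimensions are differences of two dimensions; only these numbers enter
  the statement. The resolution is built from the numbers: Koszul homology prescribes the shifts and
  iterated minimal covers realise them, because dimension shifting turns the minimal generators of
  each syzygy module into the next Betti numbers. This works for every j; only polynomiality needs j
  large. The delicate point is the degree bound. The analytic spread is a supremum of lengths of
  prime chains, so degrees of Hilbert polynomials are controlled by chains of graded primes: taking
  differences along a nonzerodivisor of degree one replaces a prime by strictly larger ones and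
  lowers the degree by one. Noetherianity is proved once, for families of modules over the Rees
  algebra, and then transported to single rows and to the fiber ring. Rows start at a = 0 because
  I^j vanishes below degree dj.\<close>

definition opsub :: "('v::ab_group_add \<Rightarrow> 'v) set \<Rightarrow> 'v set \<Rightarrow> bool" where
  "opsub T N \<longleftrightarrow> 0 \<in> N \<and> (\<forall>u\<in>N. \<forall>v\<in>N. u - v \<in> N) \<and> (\<forall>f\<in>T. \<forall>v\<in>N. f v \<in> N)"

text \<open>Noetherianity of \<open>W\<close> in operator form. A set \<open>T\<close> of additive
  maps replaces a ring of scalars, so that field scalars, variables and multiplications raising the
  power of the ideal are treated alike and can be adjoined one at a time. With
  \<open>T = {}\<close>, \<open>opsub\<close> means a plain subgroup.\<close>

definition acc :: "('v::ab_group_add \<Rightarrow> 'v) set \<Rightarrow> 'v set \<Rightarrow> bool" where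
  "acc T W \<longleftrightarrow> (\<forall>N::nat \<Rightarrow> 'v set. (\<forall>i. opsub T (N i) \<and> N i \<subseteq> W \<and> N i \<subseteq> N (Suc i))
      \<longrightarrow> (\<exists>m. \<forall>i\<ge>m. N i = N m))"

text \<open>The operator form of the polynomial extension W[z]: the sum of all z^l W. The sequence
  \<open>w\<close> is total with values in \<open>W\<close>, and only its first \<open>m\<close>
  terms count.\<close>

definition adjoin :: "('v::ab_group_add \<Rightarrow> 'v) \<Rightarrow> 'v set \<Rightarrow> 'v set" where
  "adjoin z W = {\<Sum>l<m. (z ^^ l) (w l) | m w. \<forall>l. w l \<in> W}"

lemma opsub_0: "opsub T N \<Longrightarrow> 0 \<in> N"
  and opsub_diff: "opsub T N \<Longrightarrow> u \<in> N \<Longrightarrow> v \<in> N \<Longrightarrow> u - v \<in> N"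
  and opsub_op: "opsub T N \<Longrightarrow> f \<in> T \<Longrightarrow> v \<in> N \<Longrightarrow> f v \<in> N"
  by (auto simp: opsub_def)

lemma opsub_add:
  assumes "opsub T N" "u \<in> N" "v \<in> N"
  shows "u + v \<in> N"
proof -
  have "0 - v \<in> N" using assms opsub_0 opsub_diff by blast
  then have "u - (0 - v) \<in> N" using assms opsub_diff by blast
  then show ?thesis by simp
qed

lemma opsub_uminus: "opsub T N \<Longrightarrow> u \<in> N \<Longrightarrow> - u \<in> N"
  using opsub_diff[of T N 0 u] opsub_0 by fastforce

lemma opsub_sum:
  assumes "opsub T N" "\<And>i. i \<in> I \<Longrightarrow> f i \<in> N"
  shows "sum f I \<in> N"
  using assms(2) by (induction I rule: infinite_finite_induct)
    (auto intro: opsub_0 opsub_add assms(1))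

lemma opsub_mono: "opsub T N \<Longrightarrow> S \<subseteq> T \<Longrightarrow> opsub S N"
  by (auto simp: opsub_def)

lemma additive_funpow: "additive z \<Longrightarrow> additive (z ^^ l)" for z :: "'v::ab_group_add \<Rightarrow> 'v"
  by (induction l) (auto simp: additive_def)

lemma commute_funpow: "(\<And>v. f (z v) = z (f v)) \<Longrightarrow> f ((z ^^ l) v) = (z ^^ l) (f v)"
  by (induction l) auto

lemma adjoinI: "(\<And>l. w l \<in> W) \<Longrightarrow> v = (\<Sum>l<m. (z ^^ l) (w l)) \<Longrightarrow> v \<in> adjoin z W"
  unfolding adjoin_def by (intro CollectI exI conjI allI) auto

lemma opsub_adjoin:
  assumes W: "opsub T W" and z: "additive z"
    and T: "\<And>f. f \<in> T \<Longrightarrow> additive f" "\<And>f v. f \<in> T \<Longrightarrow> f (z v) = z (f v)"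
  shows "opsub (insert z T) (adjoin z W)" "W \<subseteq> adjoin z W"
proof -
  \<comment> \<open>Sums of different lengths are padded with zeros to a common length, so that they
    can be subtracted termwise.\<close>
  have pad: "\<exists>w'. (\<forall>l. w' l \<in> W) \<and> (\<Sum>l<m. (z ^^ l) (w l)) = (\<Sum>l<m'. (z ^^ l) (w' l))"
    if "\<forall>l. w l \<in> W" "m \<le> m'" for m m' :: nat and w
  proof (intro exI[of _ "\<lambda>l. if l < m then w l else 0"] conjI allI)
    show "(if l < m then w l else 0) \<in> W" for l using that W opsub_0 by auto
    show "(\<Sum>l<m. (z ^^ l) (w l)) = (\<Sum>l<m'. (z ^^ l) (if l < m then w l else 0))"
      using that(2) additive.zero[OF additive_funpow[OF z]]
      by (intro sum.mono_neutral_cong_left) auto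
  qed
  have "u - v \<in> adjoin z W" if u: "u \<in> adjoin z W" and v: "v \<in> adjoin z W" for u v
  proof -
    obtain m w m' w' where *: "u = (\<Sum>l<m. (z ^^ l) (w l))" "\<forall>l. w l \<in> W"
       "v = (\<Sum>l<m'. (z ^^ l) (w' l))" "\<forall>l. w' l \<in> W"
      using u v unfolding adjoin_def by blast
    obtain y where y: "\<forall>l. y l \<in> W" "u = (\<Sum>l<max m m'. (z ^^ l) (y l))"
      using pad[OF *(2), of m "max m m'"] *(1) by auto
    obtain y' where y': "\<forall>l. y' l \<in> W" "v = (\<Sum>l<max m m'. (z ^^ l) (y' l))"
      using pad[OF *(4), of m' "max m m'"] *(3) by auto
    have "u - v = (\<Sum>l<max m m'. (z ^^ l) (y l - y' l))"
      unfolding y(2) y'(2) sum_subtractf[symmetric]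
      by (intro sum.cong refl) (simp add: additive.diff[OF additive_funpow[OF z]])
    moreover have "\<And>l. y l - y' l \<in> W" using y y' opsub_diff[OF W] by blast
    ultimately show ?thesis by (intro adjoinI)
  qed
  moreover have "0 \<in> adjoin z W"
    unfolding adjoin_def using opsub_0[OF W]
    by (intro CollectI exI[of _ "0::nat"] exI[of _ "\<lambda>_. 0"]) auto
  moreover have "f u \<in> adjoin z W" if f: "f \<in> T" and u: "u \<in> adjoin z W" for f u
  proof -
    obtain m w where *: "u = (\<Sum>l<m. (z ^^ l) (w l))" "\<forall>l. w l \<in> W"
      using u unfolding adjoin_def by blast
    have "f u = (\<Sum>l<m. (z ^^ l) (f (w l)))"
      unfolding *(1) additive.sum[OF T(1)[OF f]] using commute_funpow[of f z] T(2)[OF f] by simp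
    moreover have "\<And>l. f (w l) \<in> W" using * opsub_op[OF W f] by blast
    ultimately show ?thesis by (intro adjoinI)
  qed
  moreover have "z u \<in> adjoin z W" if u: "u \<in> adjoin z W" for u
  proof -
    obtain m w where *: "u = (\<Sum>l<m. (z ^^ l) (w l))" "\<forall>l. w l \<in> W"
      using u unfolding adjoin_def by blast
    have "z u = (\<Sum>l<Suc m. (z ^^ l) (case l of 0 \<Rightarrow> 0 | Suc l \<Rightarrow> w l))"
      unfolding *(1) additive.sum[OF z] by (subst sum.lessThan_Suc_shift) simp
    moreover have "\<And>l. (case l of 0 \<Rightarrow> 0 | Suc l \<Rightarrow> w l) \<in> W"
      using * opsub_0[OF W] by (auto split: nat.splits)
    ultimately show ?thesis by (intro adjoinI)
  qed
  ultimately show "opsub (insert z T) (adjoin z W)" unfolding opsub_def by blast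
  show "W \<subseteq> adjoin z W"
  proof
    fix w assume "w \<in> W"
    then show "w \<in> adjoin z W" unfolding adjoin_def
      by (intro CollectI exI[of _ "1::nat"] exI[of _ "\<lambda>_. w"]) auto
  qed
qed

text \<open>Leading coefficients of degree \<open>i\<close>, as in Hilbert's basis theorem. Elements of
  \<^term>\<open>adjoin z W\<close> need not have a unique expansion in powers of \<open>z\<close>; this does no harm.\<close>

definition lead :: "('v::ab_group_add \<Rightarrow> 'v) \<Rightarrow> 'v set \<Rightarrow> nat \<Rightarrow> 'v set \<Rightarrow> 'v set" where
  "lead z W i N = {w \<in> W. \<exists>u. (\<forall>l. u l \<in> W) \<and> (\<Sum>l<i. (z ^^ l) (u l)) + (z ^^ i) w \<in> N}"

text \<open>Operators in \<open>T\<close> commute with \<open>z\<close> and therefore act on the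
  coefficients of an expansion. Applying \<open>z\<close> moves the top coefficient from degree
  \<open>i\<close> to \<open>Suc i\<close>, whence the inclusion.\<close>

lemma opsub_lead:
  assumes W: "opsub T W" and z: "additive z"
    and T: "\<And>f. f \<in> T \<Longrightarrow> additive f" "\<And>f v. f \<in> T \<Longrightarrow> f (z v) = z (f v)"
    and N: "opsub (insert z T) N"
  shows "opsub T (lead z W i N)" "lead z W i N \<subseteq> lead z W (Suc i) N"
proof -
  note zadd = additive_funpow[OF z]
  have "u - v \<in> lead z W i N" if u: "u \<in> lead z W i N" and v: "v \<in> lead z W i N" for u v
  proof -
    obtain y y' where *: "\<forall>l. y l \<in> W" "(\<Sum>l<i. (z ^^ l) (y l)) + (z ^^ i) u \<in> N"
      "\<forall>l. y' l \<in> W" "(\<Sum>l<i. (z ^^ l) (y' l)) + (z ^^ i) v \<in> N"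
      using u v unfolding lead_def by blast
    have "(\<Sum>l<i. (z ^^ l) (y l - y' l)) + (z ^^ i) (u - v) =
       ((\<Sum>l<i. (z ^^ l) (y l)) + (z ^^ i) u) - ((\<Sum>l<i. (z ^^ l) (y' l)) + (z ^^ i) v)"
      by (simp add: additive.diff[OF zadd] sum_subtractf)
    then have "(\<Sum>l<i. (z ^^ l) (y l - y' l)) + (z ^^ i) (u - v) \<in> N"
      using opsub_diff[OF N *(2) *(4)] by simp
    moreover have "\<forall>l. y l - y' l \<in> W" using * W opsub_diff by blast
    moreover have "u - v \<in> W" using u v opsub_diff[OF W] unfolding lead_def by blast
    ultimately show ?thesis unfolding lead_def
      by (intro CollectI conjI exI[of _ "\<lambda>l. y l - y' l"])
  qed
  moreover have "0 \<in> lead z W i N"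
    unfolding lead_def using opsub_0[OF W] opsub_0[OF N]
    by (auto intro!: exI[of _ "\<lambda>_. 0"] simp: additive.zero[OF zadd])
  moreover have "f u \<in> lead z W i N" if f: "f \<in> T" and u: "u \<in> lead z W i N" for f u
  proof -
    obtain y where *: "\<forall>l. y l \<in> W" "(\<Sum>l<i. (z ^^ l) (y l)) + (z ^^ i) u \<in> N"
      using u unfolding lead_def by blast
    have "f ((\<Sum>l<i. (z ^^ l) (y l)) + (z ^^ i) u) = (\<Sum>l<i. (z ^^ l) (f (y l))) + (z ^^ i) (f u)"
      using commute_funpow[of f z] T(2)[OF f]
      by (simp add: additive.add[OF T(1)[OF f]] additive.sum[OF T(1)[OF f]])
    moreover have "f ((\<Sum>l<i. (z ^^ l) (y l)) + (z ^^ i) u) \<in> N"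
      using opsub_op[OF N _ *(2)] f by blast
    ultimately have "(\<Sum>l<i. (z ^^ l) (f (y l))) + (z ^^ i) (f u) \<in> N" by simp
    moreover have "\<forall>l. f (y l) \<in> W" using * f W opsub_op by blast
    moreover have "f u \<in> W" using u f opsub_op[OF W] unfolding lead_def by blast
    ultimately show ?thesis unfolding lead_def
      by (intro CollectI conjI exI[of _ "\<lambda>l. f (y l)"])
  qed
  ultimately show "opsub T (lead z W i N)" unfolding opsub_def by blast
  show "lead z W i N \<subseteq> lead z W (Suc i) N"
  proof
    fix u assume u: "u \<in> lead z W i N"
    obtain y where *: "\<forall>l. y l \<in> W" "(\<Sum>l<i. (z ^^ l) (y l)) + (z ^^ i) u \<in> N"
      using u unfolding lead_def by blast
    have "z ((\<Sum>l<i. (z ^^ l) (y l)) + (z ^^ i) u)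
        = (\<Sum>l<Suc i. (z ^^ l) (case l of 0 \<Rightarrow> 0 | Suc l \<Rightarrow> y l)) + (z ^^ Suc i) u"
      by (subst sum.lessThan_Suc_shift) (simp add: additive.add[OF z] additive.sum[OF z])
    moreover have "z ((\<Sum>l<i. (z ^^ l) (y l)) + (z ^^ i) u) \<in> N"
      using opsub_op[OF N _ *(2)] by blast
    ultimately have "(\<Sum>l<Suc i. (z ^^ l) (case l of 0 \<Rightarrow> 0 | Suc l \<Rightarrow> y l)) + (z ^^ Suc i) u \<in> N"
      by simp
    moreover have "\<forall>l. (case l of 0 \<Rightarrow> 0 | Suc l \<Rightarrow> y l) \<in> W"
      using * W opsub_0 by (auto split: nat.splits)
    moreover have "u \<in> W" using u unfolding lead_def by blast
    ultimately show "u \<in> lead z W (Suc i) N" unfolding lead_def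
      by (intro CollectI conjI exI[of _ "\<lambda>l. case l of 0 \<Rightarrow> 0 | Suc l \<Rightarrow> y l"])
  qed
qed

text \<open>Induction on the length of an expansion of an element of \<open>N'\<close>: subtracting
  an element of \<open>N\<close> with the same top coefficient leaves an element of
  \<open>N'\<close> with a shorter expansion.\<close>

lemma lead_eq_imp_subset:
  assumes W: "opsub T W" and z: "additive z"
    and N: "opsub (insert z T) N" and N': "opsub (insert z T) N'"
    and NN: "N \<subseteq> N'" "N' \<subseteq> adjoin z W" and L: "\<And>i. lead z W i N' \<subseteq> lead z W i N"
  shows "N' \<subseteq> N"
proof -
  have "v \<in> N" if "v \<in> N'" "v = (\<Sum>l<m. (z ^^ l) (w l))" "\<forall>l. w l \<in> W" for v m w
    using that
  proof (induction m arbitrary: v w)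
    case 0
    then show ?case using opsub_0[OF N] by simp
  next
    case (Suc m)
    then have "w m \<in> lead z W m N'" unfolding lead_def by auto
    then have "w m \<in> lead z W m N" using L by blast
    then obtain u where u: "\<forall>l. u l \<in> W" "(\<Sum>l<m. (z ^^ l) (u l)) + (z ^^ m) (w m) \<in> N"
      unfolding lead_def by blast
    let ?y = "(\<Sum>l<m. (z ^^ l) (u l)) + (z ^^ m) (w m)"
    have "v - ?y = (\<Sum>l<m. (z ^^ l) (w l - u l))"
      by (simp add: additive.diff[OF additive_funpow[OF z]] sum_subtractf Suc.prems)
    moreover have "v - ?y \<in> N'" using opsub_diff[OF N' Suc.prems(1)] u(2) NN by blast
    moreover have "\<forall>l. w l - u l \<in> W" using u Suc.prems opsub_diff[OF W] by blast
    ultimately have "v - ?y \<in> N" using Suc.IH[of "v - ?y" "\<lambda>l. w l - u l"] by simp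
    then have "v - ?y + ?y \<in> N" using opsub_add[OF N] u(2) by blast
    then show ?case by simp
  qed
  then show ?thesis using NN(2) unfolding adjoin_def by blast
qed

lemma chain_mono: "(\<And>i. N i \<subseteq> N (Suc i)) \<Longrightarrow> i \<le> j \<Longrightarrow> N i \<subseteq> N j" for N :: "nat \<Rightarrow> 'a set"
  using lift_Suc_mono_le[of N i j] by auto

text \<open>Hilbert's basis theorem. The groups \<open>L i k\<close> of leading coefficients
  increase in the degree \<open>i\<close> and in the chain index \<open>k\<close>. The diagonal is
  constant from \<open>M\<close> on, and each of the finitely many rows \<open>i \<le> M\<close> is
  constant from \<open>m i\<close> on; past the maximum \<open>K\<close> of these bounds all rows
  are constant.\<close>

lemma acc_adjoin:
  assumes acc: "acc T W" and W: "opsub T W" and z: "additive z"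
    and T: "\<And>f. f \<in> T \<Longrightarrow> additive f" "\<And>f v. f \<in> T \<Longrightarrow> f (z v) = z (f v)"
  shows "acc (insert z T) (adjoin z W)"
  unfolding acc_def
proof (intro allI impI)
  fix N :: "nat \<Rightarrow> 'a set"
  assume "\<forall>i. opsub (insert z T) (N i) \<and> N i \<subseteq> adjoin z W \<and> N i \<subseteq> N (Suc i)"
  then have N: "opsub (insert z T) (N i)" "N i \<subseteq> adjoin z W" "N i \<subseteq> N (Suc i)" for i by auto
  define L where "L i k = lead z W i (N k)" for i k
  have L: "opsub T (L i k)" "L i k \<subseteq> W" for i k
    using opsub_lead(1)[OF W z T N(1)] by (auto simp: L_def lead_def)
  have L1: "i \<le> i' \<Longrightarrow> L i k \<subseteq> L i' k" for i i' k
    by (rule chain_mono) (use opsub_lead(2)[OF W z T N(1)] in \<open>auto simp: L_def\<close>)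
  have L2: "k \<le> k' \<Longrightarrow> L i k \<subseteq> L i k'" for i k k'
    by (rule chain_mono) (use N(3) in \<open>auto simp: L_def lead_def\<close>)
  have "\<exists>m. \<forall>k\<ge>m. L i k = L i m" for i
    using acc[unfolded acc_def, rule_format, of "L i"] L L2[of _ _ i] by simp
  then obtain m where m: "\<And>i k. k \<ge> m i \<Longrightarrow> L i k = L i (m i)" by metis
  have "L i i \<subseteq> L (Suc i) (Suc i)" for i
    using L1[of i "Suc i" i] L2[of i "Suc i" "Suc i"] by auto
  then obtain M where M: "\<And>i. i \<ge> M \<Longrightarrow> L i i = L M M"
    using acc[unfolded acc_def, rule_format, of "\<lambda>i. L i i"] L by auto
  define K where "K = Max (insert M (m ` {..M}))"
  have K: "K \<ge> M" "i \<le> M \<Longrightarrow> K \<ge> m i" for i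
    unfolding K_def by (auto simp del: Max_insert intro!: Max_ge)
  have key: "L i k \<subseteq> L i K" if "k \<ge> K" for i k
  proof (cases "i \<le> M")
    case True
    then show ?thesis using m[of i k] m[of i K] K(2)[of i] that by auto
  next
    case False
    \<comment> \<open>A row beyond \<open>M\<close> lies below a diagonal group and above
      \<open>L M M\<close>, and these two coincide.\<close>
    have "L i k \<subseteq> L (max i k) (max i k)" using L1[of i "max i k" k] L2[of k "max i k" "max i k"] by auto
    also have "\<dots> = L M M" using M[of "max i k"] False by auto
    also have "\<dots> \<subseteq> L i K" using L1[of M i M] L2[of M K i] False K by auto
    finally show ?thesis .
  qed
  show "\<exists>m. \<forall>i\<ge>m. N i = N m"
  proof (intro exI allI impI)
    fix k assume k: "k \<ge> K"
    have "N K \<subseteq> N k" by (rule chain_mono) (use N(3) k in auto)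
    moreover have "N k \<subseteq> N K"
      using lead_eq_imp_subset[OF W z N(1) N(1) \<open>N K \<subseteq> N k\<close> N(2)] key[OF k] unfolding L_def by blast
    ultimately show "N k = N K" by blast
  qed
qed

text \<open>The operators of \<open>Z\<close> are adjoined one after the other. Each must commute
  with all operators already present, hence the asymmetric commutation hypothesis: one of the two
  operators ranges over \<open>T \<union> Z\<close>, the other over \<open>Z\<close>.\<close>

lemma acc_extend_finite:
  assumes "finite Z" "acc T W" "opsub T W"
    and "\<And>f. f \<in> T \<union> Z \<Longrightarrow> additive f" "\<And>f g v. f \<in> T \<union> Z \<Longrightarrow> g \<in> Z \<Longrightarrow> f (g v) = g (f v)"
  shows "\<exists>W'. W \<subseteq> W' \<and> opsub (T \<union> Z) W' \<and> acc (T \<union> Z) W'"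
  using assms
proof (induction Z rule: finite_induct)
  case (insert z Z)
  have "\<exists>W'. W \<subseteq> W' \<and> opsub (T \<union> Z) W' \<and> acc (T \<union> Z) W'"
    by (rule insert.IH[OF insert.prems(1,2)]; rule insert.prems(3,4); blast)
  then obtain W' where W': "W \<subseteq> W'" "opsub (T \<union> Z) W'" "acc (T \<union> Z) W'"
    by blast
  have *: "additive z" "\<And>f. f \<in> T \<union> Z \<Longrightarrow> additive f" "\<And>f v. f \<in> T \<union> Z \<Longrightarrow> f (z v) = z (f v)"
    using insert.prems(3) apply blast
    using insert.prems(3) apply blast
    using insert.prems(4) by blast
  have "acc (insert z (T \<union> Z)) (adjoin z W')" by (rule acc_adjoin[OF W'(3,2) *])
  moreover have "opsub (insert z (T \<union> Z)) (adjoin z W')" "W' \<subseteq> adjoin z W'"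
    using opsub_adjoin[OF W'(2) *] by auto
  moreover have "T \<union> insert z Z = insert z (T \<union> Z)" by simp
  ultimately show ?case using W'(1) by (intro exI[of _ "adjoin z W'"]) auto
qed auto

text \<open>The maximal principle equivalent to the chain condition, transported along an order embedding
  into submodules.\<close>

lemma acc_max:
  fixes F :: "'c \<Rightarrow> 'v::ab_group_add set"
  assumes acc: "acc T W" and ne: "\<exists>c. P c"
    and F: "\<And>c. P c \<Longrightarrow> opsub T (F c) \<and> F c \<subseteq> W"
  shows "\<exists>c. P c \<and> (\<forall>c'. P c' \<and> F c \<subseteq> F c' \<longrightarrow> F c' = F c)"
proof (rule ccontr)
  assume "\<not> ?thesis"
  then have step: "\<exists>c'. P c' \<and> F c \<subset> F c'" if "P c" for c using that by blast
  obtain c0 where c0: "P c0" using ne by blast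
  obtain f where f: "\<And>n. P (f n) \<and> F (f n) \<subset> F (f (Suc n))"
    using dependent_nat_choice[of "\<lambda>_. P" "\<lambda>_ c c'. F c \<subset> F c'"] c0 step by metis
  have "\<exists>m. \<forall>i\<ge>m. F (f i) = F (f m)"
    using acc[unfolded acc_def, rule_format, of "\<lambda>i. F (f i)"] f F by blast
  then show False using f by (metis le_Suc_eq order_refl psubset_eq)
qed

section \<open>Finite-dimensional subspaces\<close>

text \<open>The library dimension is 0 for a space without a finite basis, so comparisons of
  dimensions need finiteness as an explicit hypothesis. The span operator is a parameter because
  several vector space structures occur.\<close>

definition fdim :: "('b set \<Rightarrow> 'b set) \<Rightarrow> 'b set \<Rightarrow> bool" where
  "fdim sp V \<longleftrightarrow> (\<exists>B. finite B \<and> V \<subseteq> sp B)"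

lemma fdim_mono: "fdim sp V \<Longrightarrow> W \<subseteq> V \<Longrightarrow> fdim sp W"
  unfolding fdim_def by blast

context vector_space
begin

lemma basis_extension:
  assumes "fdim span V" "subspace U" "subspace V" "U \<subseteq> V"
  obtains B C where "B \<subseteq> C" "independent C" "finite C" "span B = U" "span C = V"
    "card B = dim U" "card C = dim V"
proof -
  obtain B where B: "B \<subseteq> U" "independent B" "U \<subseteq> span B"
    using maximal_independent_subset[of U] by blast
  obtain C where C: "B \<subseteq> C" "C \<subseteq> V" "independent C" "V \<subseteq> span C"
    using maximal_independent_subset_extend[OF _ B(2), of V] B(1) assms(4) by blast
  have sC: "span C = V" using C assms(3) by (metis span_mono span_eq_iff subset_antisym)
  have sB: "span B = U" using B assms(2) by (metis span_mono span_eq_iff subset_antisym)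
  have "finite C"
    using assms(1) C independent_span_bound unfolding fdim_def by (metis order_trans)
  then show ?thesis using that[OF C(1,3) _ sB sC] basis_card_eq_dim[OF B(1,3,2)]
      basis_card_eq_dim[OF C(2,4,3)] by blast
qed

lemma dim_mono_fdim:
  assumes "fdim span V" "subspace U" "subspace V" "U \<subseteq> V"
  shows "dim U \<le> dim V"
  using basis_extension[OF assms] by (metis card_mono)

lemma dim_eq_fdim:
  assumes "fdim span V" "subspace U" "subspace V" "U \<subseteq> V" "dim U = dim V"
  shows "U = V"
  using basis_extension[OF assms(1-4)] assms(5) by (metis card_subset_eq)

lemma span_Int_complement:
  assumes "independent C" "finite C" "B \<subseteq> C" "x \<in> span B" "x \<in> span (C - B)"
  shows "x = 0"
proof -
  have fin: "finite B" "finite (C - B)" using assms finite_subset by auto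
  obtain u where u: "x = (\<Sum>v\<in>B. scale (u v) v)"
    using assms(4) unfolding span_finite[OF fin(1)] by blast
  obtain w where w: "x = (\<Sum>v\<in>C - B. scale (w v) v)"
    using assms(5) unfolding span_finite[OF fin(2)] by blast
  let ?c = "\<lambda>v. if v \<in> B then u v else - w v"
  have "(\<Sum>v\<in>C. scale (?c v) v) = (\<Sum>v\<in>C - B. scale (?c v) v) + (\<Sum>v\<in>B. scale (?c v) v)"
    by (rule sum.subset_diff[OF assms(3,2)])
  also have "(\<Sum>v\<in>C - B. scale (?c v) v) = - x"
    unfolding w sum_negf[symmetric] by (intro sum.cong) auto
  also have "(\<Sum>v\<in>B. scale (?c v) v) = x"
    unfolding u by (intro sum.cong) auto
  finally have "(\<Sum>v\<in>C. scale (?c v) v) = 0" by simp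
  then have "?c v = 0" if "v \<in> C" for v
    using independentD[OF assms(1,2), of ?c v] that by blast
  then have "u v = 0" if "v \<in> B" for v using assms(3) that by (metis subsetD)
  then show ?thesis unfolding u by (simp add: sum.neutral)
qed

text \<open>Replaces a basis of V/U: extend a basis of \<open>U\<close> to one of \<open>V\<close>
  and keep the added vectors. The last two properties say that \<open>S\<close> generates modulo
  \<open>U\<close> and is independent modulo \<open>U\<close>.\<close>

lemma quotient_basis:
  assumes "fdim span V" "subspace U" "subspace V" "U \<subseteq> V"
  obtains S where "finite S" "S \<subseteq> V" "card S = dim V - dim U"
    "\<And>v. v \<in> V \<Longrightarrow> \<exists>c. v - (\<Sum>s\<in>S. scale (c s) s) \<in> U"
    "\<And>c s. (\<Sum>s\<in>S. scale (c s) s) \<in> U \<Longrightarrow> s \<in> S \<Longrightarrow> c s = 0"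
proof -
  obtain B C where BC: "B \<subseteq> C" "independent C" "finite C" "span B = U" "span C = V"
    "card B = dim U" "card C = dim V" by (rule basis_extension[OF assms])
  have fin: "finite (C - B)" "finite B" using BC finite_subset by auto
  show ?thesis
  proof (rule that[of "C - B"])
    show "C - B \<subseteq> V" using BC(5) span_superset by blast
    show "card (C - B) = dim V - dim U" using BC fin by (metis card_Diff_subset)
    fix v assume "v \<in> V"
    then obtain c where c: "v = (\<Sum>s\<in>C. scale (c s) s)"
      using BC(5) unfolding span_finite[OF BC(3)] by blast
    have "v - (\<Sum>s\<in>C - B. scale (c s) s) = (\<Sum>s\<in>B. scale (c s) s)"
      unfolding c sum.subset_diff[OF BC(1,3)] by simp
    also have "\<dots> \<in> U" unfolding BC(4)[symmetric] span_finite[OF fin(2)] by blast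
    finally show "\<exists>c. v - (\<Sum>s\<in>C - B. scale (c s) s) \<in> U" by blast
  next
    fix c s assume *: "(\<Sum>s\<in>C - B. scale (c s) s) \<in> U" "s \<in> C - B"
    have "(\<Sum>s\<in>C - B. scale (c s) s) \<in> span (C - B)" unfolding span_finite[OF fin(1)] by blast
    then have "(\<Sum>s\<in>C - B. scale (c s) s) = 0"
      using span_Int_complement[OF BC(2,3,1)] * BC(4) by blast
    moreover have "independent (C - B)" using independent_mono[OF BC(2)] by blast
    ultimately show "c s = 0" using independentD[of "C - B" "C - B" c s] fin *(2) by blast
  qed (use fin in auto)
qed

lemma acc_fdim:
  assumes "fdim span V" "subspace V" "\<And>i. subspace (N i)" "\<And>i. N i \<subseteq> V" "\<And>i::nat. N i \<subseteq> N (Suc i)"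
  shows "\<exists>m. \<forall>i\<ge>m. N i = N m"
proof -
  have mono: "N i \<subseteq> N j" if "i \<le> j" for i j using lift_Suc_mono_le[of N i j] assms(5) that by blast
  have bd: "dim (N i) \<le> dim V" for i using dim_mono_fdim assms by blast
  then obtain m where m: "\<And>i. dim (N i) \<le> dim (N m)"
    using ex_has_greatest_nat[of "\<lambda>_. True" 0 "\<lambda>i. dim (N i)" "Suc (dim V)"]
    by (metis le_imp_less_Suc less_imp_le)
  have "N i = N m" if "i \<ge> m" for i
  proof -
    have "dim (N m) \<le> dim (N i)"
      by (rule dim_mono_fdim[OF fdim_mono[OF assms(1) assms(4)] assms(3,3) mono[OF that]])
    then show ?thesis
      using dim_eq_fdim[OF fdim_mono[OF assms(1) assms(4)] assms(3,3) mono[OF that]] m[of i] by simp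
  qed
  then show ?thesis by blast
qed

end

text \<open>Formulated for a finite-dimensional subspace \<open>W\<close>, since the ambient
  function spaces are infinite-dimensional. A basis \<open>B\<close> of the kernel is extended to a
  basis \<open>C\<close> of \<open>W\<close>; the map is injective on the span of
  \<open>C - B\<close>.\<close>

lemma (in vector_space_pair) rank_nullity:
  assumes f: "Vector_Spaces.linear s1 s2 f" and W: "vs1.subspace W" "fdim vs1.span W"
  shows "vs1.dim W = vs1.dim {w\<in>W. f w = 0} + vs2.dim (f ` W)"
proof -
  interpret f: Vector_Spaces.linear s1 s2 f by (rule f)
  let ?U = "{w\<in>W. f w = 0}"
  have U: "vs1.subspace ?U"
    using W(1) by (auto simp: vs1.subspace_def f.add f.scale f.zero)
  obtain B C where BC: "B \<subseteq> C" "vs1.independent C" "finite C" "vs1.span B = ?U" "vs1.span C = W"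
    "card B = vs1.dim ?U" "card C = vs1.dim W"
    by (rule vs1.basis_extension[OF W(2) U W(1)]) auto
  have inj: "inj_on f (vs1.span (C - B))"
  proof (rule inj_onI)
    fix x y assume *: "x \<in> vs1.span (C - B)" "y \<in> vs1.span (C - B)" "f x = f y"
    have "x - y \<in> vs1.span (C - B)" using * vs1.span_diff by blast
    moreover from this have "x - y \<in> vs1.span B"
      using BC(5) vs1.span_mono[of "C - B" C] *(3) unfolding BC(4) by (auto simp: f.diff)
    ultimately have "x - y = 0" using vs1.span_Int_complement[OF BC(2,3,1)] by blast
    then show "x = y" by simp
  qed
  have "vs2.independent (f ` (C - B))"
    using linear_independent_injective_image[OF f vs1.independent_mono[OF BC(2)] inj] by blast
  moreover have "f ` W = vs2.span (f ` (C - B))"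
  proof -
    have "f ` W = vs2.span (f ` C)" using BC(5) f.span_image by metis
    also have "f ` C = f ` (C - B) \<union> f ` B" using BC(1) by blast
    also have "f ` B \<subseteq> {0}" using BC(4) vs1.span_superset[of B] by blast
    then have "vs2.span (f ` (C - B) \<union> f ` B) = vs2.span (f ` (C - B))"
      by (smt (verit) insert_Diff_single subset_singletonD sup_bot.right_neutral Un_insert_right vs2.span_insert_0)
    finally show ?thesis .
  qed
  ultimately have "vs2.dim (f ` W) = card (f ` (C - B))"
    by (metis vs2.dim_span_eq_card_independent)
  also have "\<dots> = card (C - B)"
    using inj by (meson card_image inj_on_subset vs1.span_superset)
  also have "\<dots> = vs1.dim W - vs1.dim ?U" using BC finite_subset[OF BC(1)] by (metis card_Diff_subset)
  finally show ?thesis using vs1.dim_mono_fdim[OF W(2) U W(1)] by auto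
qed

text \<open>The graph of an isomorphism \<open>W / (f\<^sup>-\<^sup>1 B) \<cong> Z / B\<close>, read off dimensions.\<close>

lemma (in vector_space_pair) dim_quotient_preimage:
  assumes f: "Vector_Spaces.linear s1 s2 f" and W: "vs1.subspace W" "fdim vs1.span W" and Z: "f ` W = Z"
    and B: "vs2.subspace B" "B \<subseteq> Z"
  shows "int (vs1.dim W) - int (vs1.dim {w\<in>W. f w \<in> B}) = int (vs2.dim Z) - int (vs2.dim B)"
proof -
  interpret f: Vector_Spaces.linear s1 s2 f by (rule f)
  let ?U = "{w\<in>W. f w \<in> B}"
  have U: "vs1.subspace ?U"
    using W(1) B by (auto simp: vs1.subspace_def vs2.subspace_def f.add f.scale f.zero)
  have "f ` ?U = B" using B Z by auto
  moreover have "{w\<in>?U. f w = 0} = {w\<in>W. f w = 0}" using B vs2.subspace_0 by auto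
  ultimately have "vs1.dim ?U = vs1.dim {w\<in>W. f w = 0} + vs2.dim B"
    using rank_nullity[OF f U fdim_mono[OF W(2)]] by auto
  then show ?thesis using rank_nullity[OF f W] Z by simp
qed

section \<open>The Koszul complex\<close>

text \<open>Basis vectors of the exterior powers are indexed by finite sets \<open>T\<close>. The
  sign is that of sorting e_l into e_T past the smaller indices.\<close>

definition ksign :: "nat \<Rightarrow> nat set \<Rightarrow> 'a::comm_ring_1" where
  "ksign l T = (- 1) ^ card {t \<in> T. t < l}"

definition kos :: "('a::comm_ring_1 \<Rightarrow> 'v::ab_group_add \<Rightarrow> 'v) \<Rightarrow> nat \<Rightarrow> (nat \<Rightarrow> 'a) \<Rightarrow>
    (nat set \<Rightarrow> 'v) \<Rightarrow> nat set \<Rightarrow> 'v" where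
  "kos s n x v = (\<lambda>T. \<Sum>l<n. if l \<in> T then 0 else s (ksign l T * x l) (v (insert l T)))"

text \<open>Exterior multiplication by e_l, the homotopy between multiplication by
  \<open>x l\<close> and zero on the Koszul complex.\<close>

definition wedge :: "('a::comm_ring_1 \<Rightarrow> 'v::ab_group_add \<Rightarrow> 'v) \<Rightarrow> nat \<Rightarrow>
    (nat set \<Rightarrow> 'v) \<Rightarrow> nat set \<Rightarrow> 'v" where
  "wedge s l v = (\<lambda>T. if l \<in> T then s (ksign l (T - {l})) (v (T - {l})) else 0)"

text \<open>Chains are total functions vanishing off the p-element subsets, so \<open>kos\<close>
  needs no degree argument. \<open>M\<close> is an arbitrary set: a homogeneous component, a power
  of the ideal or a whole ring.\<close>

definition kchains :: "nat \<Rightarrow> 'v::zero set \<Rightarrow> nat \<Rightarrow> (nat set \<Rightarrow> 'v) set" where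
  "kchains n M p = {v. \<forall>T. if T \<subseteq> {..<n} \<and> card T = p then v T \<in> M else v T = 0}"

lemma ksign_insert:
  assumes "m \<notin> S"
  shows "ksign l (insert m S) = (if m < l then - ksign l S else ksign l S)"
proof -
  have "{t \<in> insert m S. t < l} = (if m < l then insert m {t \<in> S. t < l} else {t \<in> S. t < l})"
    by auto
  moreover have "finite {t \<in> S. t < l}" by simp
  ultimately show ?thesis using assms by (simp add: ksign_def)
qed

lemma ksign_square: "ksign l S * ksign l S = 1"
  by (simp add: ksign_def flip: power_mult_distrib)

lemma ksign_cases: "ksign l S = 1 \<or> ksign l S = - 1"
  unfolding ksign_def by (metis neg_one_even_power neg_one_odd_power)

text \<open>The diagonal has a hypothesis of its own because antisymmetry does not force it to
  vanish in characteristic 2.\<close>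

lemma sum_antisym:
  fixes F :: "nat \<Rightarrow> nat \<Rightarrow> 'v::ab_group_add"
  assumes "\<And>l m. F l m = - F m l" "\<And>l. F l l = 0"
  shows "(\<Sum>l<n. \<Sum>m<n. F l m) = 0"
proof (induction n)
  case (Suc n)
  have "(\<Sum>l<n. F l n) = - (\<Sum>m<n. F n m)"
    unfolding sum_negf[symmetric] by (intro sum.cong refl assms(1))
  then show ?case using Suc assms(2) by (simp add: sum.distrib)
qed simp

lemma sum_fun_apply: "(\<Sum>i\<in>I. f i) x = (\<Sum>i\<in>I. f i x)" for f :: "'i \<Rightarrow> 'b \<Rightarrow> 'v::comm_monoid_add"
  by (induction I rule: infinite_finite_induct) auto

lemma kchainsD: "v \<in> kchains n M p \<Longrightarrow> T \<subseteq> {..<n} \<Longrightarrow> card T = p \<Longrightarrow> v T \<in> M"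
  and kchains_outside: "v \<in> kchains n M p \<Longrightarrow> \<not> (T \<subseteq> {..<n} \<and> card T = p) \<Longrightarrow> v T = 0"
  unfolding kchains_def by (auto dest!: spec[of _ T])

lemma kchainsI:
  assumes "\<And>T. T \<subseteq> {..<n} \<Longrightarrow> card T = p \<Longrightarrow> v T \<in> M"
    and "\<And>T. \<not> (T \<subseteq> {..<n} \<and> card T = p) \<Longrightarrow> v T = 0"
  shows "v \<in> kchains n M p"
  using assms unfolding kchains_def by auto

lemma kchains_mem: "v \<in> kchains n M p \<Longrightarrow> 0 \<in> M \<Longrightarrow> v T \<in> M"
  using kchainsD kchains_outside by metis

lemma kchains_gt: "p > n \<Longrightarrow> v \<in> kchains n M p \<Longrightarrow> v = 0"
proof (rule ext)
  fix T assume "p > n" "v \<in> kchains n M p"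
  moreover have "\<not> (T \<subseteq> {..<n} \<and> card T = p)"
    using \<open>p > n\<close> card_mono[of "{..<n}" T] by auto
  ultimately have "v T = 0" using kchains_outside by blast
  then show "v T = 0 T" by simp
qed

context Modules.module
begin

lemma ksign_scale_mem:
  assumes "opsub S M" "v \<in> M"
  shows "scale (ksign l T) v \<in> M"
proof -
  have "ksign l T = (1 :: 'a) \<or> ksign l T = (- 1 :: 'a)" by (rule ksign_cases)
  then show ?thesis
  proof
    assume "ksign l T = (- 1 :: 'a)"
    then have "scale (ksign l T) v = - v" by (simp only: scale_minus_left scale_one)
    then show ?thesis using opsub_uminus[OF assms] by simp
  qed (simp add: assms)
qed

lemma kos_add: "kos scale n x (u + v) = kos scale n x u + kos scale n x v"
  unfolding kos_def
  by (rule ext) (simp add: scale_right_distrib flip: sum.distrib cong: if_cong, rule sum.cong, auto simp: scale_right_distrib scale_right_diff_distrib)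

lemma kos_diff: "kos scale n x (u - v) = kos scale n x u - kos scale n x v"
  unfolding kos_def
  by (rule ext) (simp add: scale_right_diff_distrib flip: sum_subtractf cong: if_cong, rule sum.cong, auto simp: scale_right_distrib scale_right_diff_distrib)

lemma kos_0 [simp]: "kos scale n x 0 = 0"
  unfolding kos_def by (rule ext) (simp add: sum.neutral)

lemma kos_scale: "kos scale n x (\<lambda>T. scale a (v T)) = (\<lambda>T. scale a (kos scale n x v T))"
  unfolding kos_def
  by (rule ext) (auto simp: scale_sum_right ac_simps intro!: sum.cong)

lemma kos_sum: "kos scale n x (\<Sum>i\<in>I. f i) = (\<Sum>i\<in>I. kos scale n x (f i))"
proof -
  have "additive (kos scale n x)" unfolding additive_def using kos_add by blast
  then show ?thesis by (rule additive.sum)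
qed

text \<open>Inserting two indices into \<open>T\<close> in the two possible orders gives opposite
  signs, so the double sum is antisymmetric.\<close>

lemma kos_kos [simp]: "kos scale n x (kos scale n x v) = 0"
proof (rule ext)
  fix T
  define F where "F l m = (if l \<in> T \<or> m \<in> T \<or> l = m then 0 else
     scale (ksign l T * x l * (ksign m (insert l T) * x m)) (v (insert m (insert l T))))" for l m
  have "kos scale n x (kos scale n x v) T = (\<Sum>l<n. \<Sum>m<n. F l m)"
    unfolding kos_def F_def by (auto simp: scale_sum_right intro!: sum.cong)
  also have "\<dots> = 0"
  proof (rule sum_antisym)
    fix l m
    show "F l m = - F m l"
    proof (cases "l \<in> T \<or> m \<in> T \<or> l = m")
      case False
      then have "ksign l T * x l * (ksign m (insert l T) * x m)
          = - (ksign m T * x m * (ksign l (insert m T) * x l))"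
        by (simp add: ksign_insert)
      then show ?thesis using False unfolding F_def by (simp add: insert_commute)
    qed (auto simp: F_def)
  qed (simp add: F_def)
  finally show "kos scale n x (kos scale n x v) T = 0 T" by simp
qed

text \<open>The homotopy formula, which makes variables act as zero on Koszul homology. If
  \<open>l\<close> is not in \<open>T\<close>, a single summand survives; otherwise the summands
  with index other than \<open>l\<close> cancel in pairs by the sign rule for
  \<open>insert\<close>.\<close>

lemma kos_wedge:
  assumes "l < n"
  shows "kos scale n x (wedge scale l v) T + wedge scale l (kos scale n x v) T = scale (x l) (v T)"
proof (cases "l \<in> T")
  case False
  have "kos scale n x (wedge scale l v) T = (\<Sum>m<n. if m = l then scale (x l) (v T) else 0)"
    unfolding kos_def wedge_def using False
    by (intro sum.cong refl)
      (auto simp: ac_simps insert_absorb ksign_square[unfolded mult.assoc] simp flip: mult.assoc)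
  then show ?thesis using assms False by (simp add: wedge_def)
next
  case True
  define S where "S = T - {l}"
  have S: "l \<notin> S" "T = insert l S" using True by (auto simp: S_def)
  have "wedge scale l (kos scale n x v) T
      = (\<Sum>m<n. scale (ksign l S) (if m \<in> S then 0 else scale (ksign m S * x m) (v (insert m S))))"
    unfolding wedge_def kos_def S_def scale_sum_right by (simp only: True if_True)
  then have "kos scale n x (wedge scale l v) T + wedge scale l (kos scale n x v) T
     = (\<Sum>m<n. (if m \<in> T then 0 else scale (ksign m T * x m) (wedge scale l v (insert m T)))
         + scale (ksign l S) (if m \<in> S then 0 else scale (ksign m S * x m) (v (insert m S))))"
    unfolding kos_def sum.distrib by (rule arg_cong2[where f = "(+)", OF refl])
  also have "\<dots> = (\<Sum>m<n. if m = l then scale (x l) (v T) else 0)"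
  proof (intro sum.cong refl)
    fix m
    consider "m = l" | "m \<noteq> l" "m \<in> S" | "m \<noteq> l" "m \<notin> S" by blast
    then show "(if m \<in> T then 0 else scale (ksign m T * x m) (wedge scale l v (insert m T)))
         + scale (ksign l S) (if m \<in> S then 0 else scale (ksign m S * x m) (v (insert m S)))
         = (if m = l then scale (x l) (v T) else 0)"
    proof cases
      case 1
      then show ?thesis using S by (simp add: ksign_square flip: mult.assoc)
    next
      case 3
      have eq: "insert m (insert l S) - {l} = insert m S" using S 3 by auto
      have "ksign m (insert l S) * x m * ksign l (insert m S) = - (ksign l S * (ksign m S * x m))"
        using S(1) 3 by (simp add: ksign_insert)
      then show ?thesis using 3 S by (simp add: wedge_def eq)
    qed (use S in auto)
  qed
  also have "\<dots> = scale (x l) (v T)" using assms by simp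
  finally show ?thesis .
qed

text \<open>Separate coefficient sets \<open>M\<close> and \<open>M'\<close> let one lemma serve the
  graded case, where the variables raise the degree of the coefficients, and the case of a submodule
  with \<open>M = M'\<close>.\<close>

lemma kos_kchains:
  assumes v: "v \<in> kchains n M (Suc p)"
    and M': "opsub S M'"
    and x: "\<And>l a. l < n \<Longrightarrow> a \<in> M \<Longrightarrow> scale (x l) a \<in> M'"
  shows "kos scale n x v \<in> kchains n M' p"
proof (rule kchainsI)
  fix T assume T: "T \<subseteq> {..<n}" "card T = p"
  have summand: "scale (ksign l T * x l) (v (insert l T)) \<in> M'" if "l < n" "l \<notin> T" for l
  proof -
    have "finite T" using T finite_subset by blast
    then have "scale (x l) (v (insert l T)) \<in> M'"
      using T that by (intro x kchainsD[OF v]) auto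
    then have "scale (ksign l T) (scale (x l) (v (insert l T))) \<in> M'"
      by (rule ksign_scale_mem[OF M'])
    then show ?thesis by simp
  qed
  show "kos scale n x v T \<in> M'"
    unfolding kos_def
  proof (rule opsub_sum[OF M'])
    fix l assume l: "l \<in> {..<n}"
    show "(if l \<in> T then 0 else scale (ksign l T * x l) (v (insert l T))) \<in> M'"
    proof (cases "l \<in> T")
      case True
      then show ?thesis using opsub_0[OF M'] by (simp only: if_True)
    next
      case False
      show ?thesis unfolding if_not_P[OF False] by (rule summand[OF l[unfolded lessThan_iff] False])
    qed
  qed
next
  fix T assume T: "\<not> (T \<subseteq> {..<n} \<and> card T = p)"
  have "v (insert l T) = 0" if "l < n" "l \<notin> T" for l
  proof (rule kchains_outside[OF v])
    show "\<not> (insert l T \<subseteq> {..<n} \<and> card (insert l T) = Suc p)"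
    proof
      assume *: "insert l T \<subseteq> {..<n} \<and> card (insert l T) = Suc p"
      then have "finite T" by (meson finite_insert finite_lessThan finite_subset)
      then show False using T that * by simp
    qed
  qed
  then show "kos scale n x v T = 0" unfolding kos_def by (intro sum.neutral) auto
qed

lemma kos_kchains_0: "v \<in> kchains n M 0 \<Longrightarrow> kos scale n x v = 0"
proof (rule ext)
  fix T assume v: "v \<in> kchains n M 0"
  have "v (insert l T) = 0" if "l < n" for l
    by (rule kchains_outside[OF v]) (metis card_eq_0_iff finite_lessThan finite_subset insert_not_empty)
  then show "kos scale n x v T = 0 T" unfolding kos_def by (simp add: sum.neutral)
qed

lemma wedge_kchains:
  assumes v: "v \<in> kchains n M p" and l: "l < n" and M: "opsub S M"
  shows "wedge scale l v \<in> kchains n M (Suc p)"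
proof (rule kchainsI)
  fix T assume T: "T \<subseteq> {..<n}" "card T = Suc p"
  have "finite T" using T by (metis card.infinite nat.simps(3))
  then have "v (T - {l}) \<in> M" if "l \<in> T" using T that by (intro kchainsD[OF v]) auto
  then show "wedge scale l v T \<in> M"
    using ksign_scale_mem[OF M] opsub_0[OF M] by (simp add: wedge_def)
next
  fix T assume T: "\<not> (T \<subseteq> {..<n} \<and> card T = Suc p)"
  have "v (T - {l}) = 0" if "l \<in> T"
  proof (rule kchains_outside[OF v])
    show "\<not> (T - {l} \<subseteq> {..<n} \<and> card (T - {l}) = p)"
    proof
      assume *: "T - {l} \<subseteq> {..<n} \<and> card (T - {l}) = p"
      then have "finite T" by (meson finite_Diff_insert finite.emptyI finite_Diff2 finite_lessThan finite_subset finite_insert)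
      then have "card T = Suc (card (T - {l}))" using that by (rule card.remove)
      then have "card T = Suc p" using * by (simp only:)
      moreover have "T \<subseteq> {..<n}" using * l by blast
      ultimately show False using T by blast
    qed
  qed
  then show "wedge scale l v T = 0" by (simp add: wedge_def)
qed

end

lemma module_mult: "Modules.module ((*) :: 'a::comm_ring_1 \<Rightarrow> 'a \<Rightarrow> 'a)"
  by standard (auto simp: algebra_simps)

interpretation mult: Modules.module "(*) :: 'a::comm_ring_1 \<Rightarrow> 'a \<Rightarrow> 'a"
  by (rule module_mult)

text \<open>The grade is detected by Koszul homology: passing from \<open>R/J\<^sub>k\<close> to \<open>R/J\<^sub>k\<^sub>+\<^sub>1\<close> with
  \<open>J\<^sub>k\<^sub>+\<^sub>1 = J\<^sub>k + y\<^sub>k R\<close> shifts the vanishing by one, because \<open>y\<^sub>k \<in> (x)\<close> kills the homology.\<close>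

lemma koszul_vanishing:
  fixes R :: "'a::comm_ring_1 set"
  assumes R: "opsub {} R" "\<And>a b. a \<in> R \<Longrightarrow> b \<in> R \<Longrightarrow> a * b \<in> R"
    and x: "\<And>l. l < n \<Longrightarrow> x l \<in> R"
    and J: "\<And>k. opsub {} (J k)" "\<And>k a b. a \<in> R \<Longrightarrow> b \<in> J k \<Longrightarrow> a * b \<in> J k"
    and y: "\<And>k. k < g \<Longrightarrow> y k = (\<Sum>l<n. x l * r k l)" "\<And>k l. k < g \<Longrightarrow> l < n \<Longrightarrow> r k l \<in> R"
    and J_Suc: "\<And>k a. k < g \<Longrightarrow> a \<in> J (Suc k) \<Longrightarrow> \<exists>j\<in>J k. \<exists>u\<in>R. a = j + y k * u"
      "\<And>k j u. k < g \<Longrightarrow> j \<in> J k \<Longrightarrow> u \<in> R \<Longrightarrow> j + y k * u \<in> J (Suc k)"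
    and reg: "\<And>k u. k < g \<Longrightarrow> u \<in> R \<Longrightarrow> y k * u \<in> J k \<Longrightarrow> u \<in> J k"
  shows "k \<le> g \<Longrightarrow> n + k < i + g \<Longrightarrow> v \<in> kchains n R i \<Longrightarrow> (\<And>T. kos (*) n x v T \<in> J k) \<Longrightarrow>
    \<exists>w\<in>kchains n R (Suc i). \<forall>T. v T - kos (*) n x w T \<in> J k"
proof (induction k arbitrary: i v rule: inc_induct)
  \<comment> \<open>At \<open>k = g\<close> the condition on the degrees reads n < i, and every
    chain in such a degree is zero.\<close>
  case base
  then have v: "v = 0" using kchains_gt[of n i v R] by simp
  have "0 \<in> kchains n R (Suc i)" by (simp add: kchains_def opsub_0[OF R(1)])
  moreover have "v T - kos (*) n x 0 T \<in> J g" for T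
    unfolding v mult.kos_0 by (simp add: opsub_0[OF J(1)])
  ultimately show ?case by blast
next
  case (step k)
  \<comment> \<open>A homotopy for multiplication by \<open>y k\<close>: the exterior
    multiplications combined with the coefficients that express \<open>y k\<close> through
    \<open>x\<close>.\<close>
  define h where "h u T = (\<Sum>l<n. r k l * wedge (*) l u T)" for u T
  have h_chain: "h u \<in> kchains n R (Suc p)" if u: "u \<in> kchains n R p" for u p
  proof (rule kchainsI)
    fix T assume T: "T \<subseteq> {..<n}" "card T = Suc p"
    show "h u T \<in> R" unfolding h_def
      using kchainsD[OF mult.wedge_kchains[OF u _ R(1)] T] R(2)[OF y(2)[OF step.hyps(2)]]
      by (intro opsub_sum[OF R(1)]) auto
  next
    fix T assume T: "\<not> (T \<subseteq> {..<n} \<and> card T = Suc p)"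
    show "h u T = 0" unfolding h_def
      using kchains_outside[OF mult.wedge_kchains[OF u _ R(1)] T] by (intro sum.neutral) auto
  qed
  have htp: "kos (*) n x (h u) T + h (kos (*) n x u) T = y k * u T" for u T
  proof -
    have "kos (*) n x (h u) T = (\<Sum>l<n. r k l * kos (*) n x (wedge (*) l u) T)"
    proof -
      have eq: "h u = (\<Sum>l<n. (\<lambda>T. r k l * wedge (*) l u T))"
        by (rule ext) (simp only: h_def sum_fun_apply)
      show ?thesis by (simp only: eq mult.kos_sum mult.kos_scale sum_fun_apply)
    qed
    then have "kos (*) n x (h u) T + h (kos (*) n x u) T
        = (\<Sum>l<n. r k l * (kos (*) n x (wedge (*) l u) T + wedge (*) l (kos (*) n x u) T))"
      by (simp add: h_def sum.distrib distrib_left)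
    also have "\<dots> = (\<Sum>l<n. r k l * (x l * u T))"
      by (intro sum.cong refl) (simp add: mult.kos_wedge)
    also have "\<dots> = (\<Sum>l<n. x l * r k l) * u T"
      unfolding sum_distrib_right by (intro sum.cong refl) (simp only: ac_simps)
    finally show ?thesis unfolding y(1)[OF step.hyps(2)] .
  qed
  have yR: "y k \<in> R" unfolding y(1)[OF step.hyps(2)]
    using R(2)[OF x y(2)[OF step.hyps(2)]] by (intro opsub_sum[OF R(1)]) auto
  have vR: "v T \<in> R" for T using kchains_mem[OF step.prems(2) opsub_0[OF R(1)]] .
  have hJ: "h u T \<in> J k" if "\<And>T. u T \<in> J k" for u T
  proof -
    have "wedge (*) l u T \<in> J k" for l
      using mult.ksign_scale_mem[OF J(1) that] opsub_0[OF J(1)] by (simp add: wedge_def)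
    then show ?thesis unfolding h_def
      using J(2)[OF y(2)[OF step.hyps(2)]] by (intro opsub_sum[OF J(1)]) auto
  qed
  have kosJ: "kos (*) n x u T \<in> J k" if "\<And>T. u T \<in> J k" for u T
  proof -
    note u = that
    have "ksign l T * x l * u (insert l T) \<in> J k" if l: "l < n" for l
      unfolding mult.assoc by (rule mult.ksign_scale_mem[OF J(1) J(2)[OF x[OF l] u]])
    then show ?thesis unfolding kos_def using opsub_0[OF J(1)] by (intro opsub_sum[OF J(1)]) simp
  qed
  \<comment> \<open>As \<open>v\<close> is a cycle modulo \<open>J k\<close>, the boundary of
    \<open>h v\<close> is \<open>y k * v\<close> modulo \<open>J k\<close>, hence zero modulo
    \<open>J (Suc k)\<close>. The induction hypothesis thus applies to \<open>h v\<close> in chain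
    degree i + 1.\<close>
  have "kos (*) n x (h v) T \<in> J (Suc k)" for T
  proof -
    have "kos (*) n x (h v) T = - h (kos (*) n x v) T + y k * v T"
      unfolding htp[symmetric] by simp
    moreover have "- h (kos (*) n x v) T + y k * v T \<in> J (Suc k)"
      by (rule J_Suc(2)[OF step.hyps(2) opsub_uminus[OF J(1) hJ[OF step.prems(3)]] vR])
    ultimately show ?thesis by simp
  qed
  then have "\<exists>w\<in>kchains n R (Suc (Suc i)). \<forall>T. h v T - kos (*) n x w T \<in> J (Suc k)"
    using step.prems(1) by (intro step.IH h_chain[OF step.prems(2)]) auto
  then obtain w where w: "w \<in> kchains n R (Suc (Suc i))"
      "\<And>T. h v T - kos (*) n x w T \<in> J (Suc k)" by blast
  have "\<forall>T. \<exists>j u. j \<in> J k \<and> u \<in> R \<and> h v T - kos (*) n x w T = j + y k * u"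
    using J_Suc(1)[OF step.hyps(2) w(2)] by blast
  then obtain c u0 where c: "\<And>T. c T \<in> J k" "\<And>T. u0 T \<in> R"
      "\<And>T. h v T - kos (*) n x w T = c T + y k * u0 T" by metis
  text \<open>Outside the support of \<^term>\<open>h v\<close> the decomposition is replaced by the trivial one.\<close>
  define S where "S T \<longleftrightarrow> T \<subseteq> {..<n} \<and> card T = Suc i" for T
  define u where "u T = (if S T then u0 T else 0)" for T
  define c' where "c' T = (if S T then c T else 0)" for T
  have kw: "kos (*) n x w \<in> kchains n R (Suc i)"
    by (rule mult.kos_kchains[OF w(1) R(1)]) (rule R(2)[OF x])
  have u: "u \<in> kchains n R (Suc i)" using c(2) by (intro kchainsI) (auto simp: u_def S_def)
  have dec: "h v T - kos (*) n x w T = c' T + y k * u T" for T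
  proof (cases "S T")
    case True
    then show ?thesis using c(3)[of T] by (simp add: u_def c'_def)
  next
    case False
    then show ?thesis
      using kchains_outside[OF kw, of T] kchains_outside[OF h_chain[OF step.prems(2)], of T]
      unfolding S_def[symmetric] by (simp add: u_def c'_def)
  qed
  \<comment> \<open>With d the Koszul differential, h v = dw + c' + y u. Applying d and the homotopy
    formula gives y (v - du) = dc' + h(dv), which lies in \<open>J k\<close>; regularity of
    \<open>y k\<close> modulo \<open>J k\<close> cancels y.\<close>
  have "v T - kos (*) n x u T \<in> J k" for T
  proof (rule reg[OF step.hyps(2)])
    have "kos (*) n x u \<in> kchains n R i"
      by (rule mult.kos_kchains[OF u R(1)]) (rule R(2)[OF x])
    then show "v T - kos (*) n x u T \<in> R"
      by (intro opsub_diff[OF R(1) vR] kchains_mem[OF _ opsub_0[OF R(1)]])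
    have "kos (*) n x (h v) T = kos (*) n x (h v - kos (*) n x w) T"
      by (simp only: mult.kos_diff mult.kos_kos diff_0_right)
    also have "h v - kos (*) n x w = c' + (\<lambda>T. y k * u T)" by (rule ext) (simp add: dec)
    also have "kos (*) n x \<dots> T = kos (*) n x c' T + y k * kos (*) n x u T"
      by (simp only: mult.kos_add mult.kos_scale plus_fun_apply)
    finally have "y k * (v T - kos (*) n x u T) = kos (*) n x c' T + h (kos (*) n x v) T"
      unfolding right_diff_distrib htp[symmetric] by simp
    moreover have "kos (*) n x c' T + h (kos (*) n x v) T \<in> J k"
    proof (rule opsub_add[OF J(1) kosJ hJ[OF step.prems(3)]])
      show "c' T \<in> J k" for T using c(1) opsub_0[OF J(1)] by (simp add: c'_def)
    qed
    ultimately show "y k * (v T - kos (*) n x u T) \<in> J k" by simp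
  qed
  then show ?case by (intro bexI[OF _ u]) blast
qed

section \<open>Homogeneous polynomials\<close>

definition cst :: "'k \<Rightarrow> ('n::finite, 'k::field) mpoly" where
  "cst c = Poly_Mapping.single 0 c"

definition tdeg :: "('n::finite \<Rightarrow>\<^sub>0 nat) \<Rightarrow> int" where
  "tdeg u = int (\<Sum>i\<in>UNIV. Poly_Mapping.lookup u i)"

definition rst :: "('a \<Rightarrow> bool) \<Rightarrow> ('a \<Rightarrow>\<^sub>0 'k) \<Rightarrow> 'a \<Rightarrow>\<^sub>0 'k::zero" where
  "rst P f = Poly_Mapping.mapp (\<lambda>u c. if P u then c else 0) f"

abbreviation hpart :: "int \<Rightarrow> ('n::finite, 'k::field) mpoly \<Rightarrow> ('n, 'k) mpoly" where
  "hpart e \<equiv> rst (\<lambda>u. tdeg u = e)"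

text \<open>Koszul chains are indexed by sets of natural numbers, variables by an arbitrary finite
  type; a chosen enumeration connects the two.\<close>

definition ix :: "nat \<Rightarrow> 'n::finite" where
  "ix = (SOME f. bij_betw f {..<CARD('n)} UNIV)"

abbreviation xv :: "nat \<Rightarrow> ('n::finite, 'k::field) mpoly" where
  "xv l \<equiv> mvar (ix l)"

lemma bij_ix: "bij_betw (ix :: nat \<Rightarrow> 'n::finite) {..<CARD('n)} UNIV"
proof -
  have "\<exists>h. bij_betw h {..<CARD('n)} (UNIV :: 'n set)"
    using ex_bij_betw_nat_finite[of "UNIV :: 'n set"] by (simp add: atLeast0LessThan)
  then show ?thesis unfolding ix_def by (rule someI_ex)
qed

lemma ix_eq_iff: "l < CARD('n) \<Longrightarrow> m < CARD('n) \<Longrightarrow> (ix l :: 'n::finite) = ix m \<longleftrightarrow> l = m"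
  using bij_ix[where 'n = 'n] unfolding bij_betw_def inj_on_def by blast

lemma ix_surj: "\<exists>l<CARD('n). (i :: 'n::finite) = ix l"
  using bij_ix[where 'n = 'n] unfolding bij_betw_def by (metis UNIV_I imageE lessThan_iff)

lemma lookup_rst: "Poly_Mapping.lookup (rst P f) u = (if P u then Poly_Mapping.lookup f u else 0)"
  by (simp add: rst_def lookup_mapp when_def in_keys_iff)

lemma rst_add: "rst P (f + g) = rst P f + rst P g"
  by (rule poly_mapping_eqI) (simp add: lookup_rst lookup_add)

lemma rst_0 [simp]: "rst P 0 = 0"
  by (rule poly_mapping_eqI) (simp add: lookup_rst)

lemma additive_rst: "additive (rst P :: ('a \<Rightarrow>\<^sub>0 'k::ab_group_add) \<Rightarrow> _)"
  unfolding additive_def using rst_add by blast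

lemma rst_split: "f = rst P f + rst (\<lambda>u. \<not> P u) f" for f :: "'a \<Rightarrow>\<^sub>0 'k::comm_monoid_add"
  by (rule poly_mapping_eqI) (simp add: lookup_rst lookup_add)

lemmas rst_sum = additive.sum[OF additive_rst]
lemmas rst_diff = additive.diff[OF additive_rst]

lemma monomial_sum: "f = (\<Sum>u\<in>Poly_Mapping.keys f. Poly_Mapping.single u (Poly_Mapping.lookup f u))"
  for f :: "'a \<Rightarrow>\<^sub>0 'k::ab_group_add"
proof (rule poly_mapping_eqI)
  fix v
  have "Poly_Mapping.lookup (\<Sum>u\<in>Poly_Mapping.keys f. Poly_Mapping.single u (Poly_Mapping.lookup f u)) v
     = (\<Sum>u\<in>Poly_Mapping.keys f. if u = v then Poly_Mapping.lookup f v else 0)"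
    unfolding lookup_sum lookup_single when_def by (intro sum.cong refl) auto
  also have "\<dots> = Poly_Mapping.lookup f v" by (simp add: in_keys_iff)
  finally show "Poly_Mapping.lookup f v = Poly_Mapping.lookup (\<Sum>u\<in>Poly_Mapping.keys f. Poly_Mapping.single u (Poly_Mapping.lookup f u)) v"
    by simp
qed

text \<open>Reduces membership to monomials. Only a subgroup is asked for, so it applies to any
  additive condition on \<open>f\<close>.\<close>

lemma mpoly_closed:
  assumes "opsub {} M" "\<And>u. u \<in> Poly_Mapping.keys f \<Longrightarrow> Poly_Mapping.single u (Poly_Mapping.lookup f u) \<in> M"
  shows "f \<in> M"
  by (subst monomial_sum[of f]) (rule opsub_sum[OF assms])

lemma lookup_single_times:
  "Poly_Mapping.lookup (Poly_Mapping.single v c * f) (v + w) = c * Poly_Mapping.lookup f w"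
  for f :: "('n, 'k::field) mpoly"
proof -
  have eq: "Poly_Mapping.single v c * f = (\<Sum>u\<in>Poly_Mapping.keys f. Poly_Mapping.single (v + u) (c * Poly_Mapping.lookup f u))"
    by (subst monomial_sum[of f]) (simp add: sum_distrib_left mult_single)
  have "Poly_Mapping.lookup (Poly_Mapping.single v c * f) (v + w)
     = (\<Sum>u\<in>Poly_Mapping.keys f. if u = w then c * Poly_Mapping.lookup f w else 0)"
    unfolding eq lookup_sum lookup_single when_def by (intro sum.cong refl) auto
  also have "\<dots> = c * Poly_Mapping.lookup f w" by (simp add: in_keys_iff)
  finally show ?thesis .
qed

lemma lookup_mvar_times: "Poly_Mapping.lookup (mvar i * f) (Poly_Mapping.single i 1 + w) = Poly_Mapping.lookup f w"
  using lookup_single_times[of "Poly_Mapping.single i 1" 1 f w] by (simp add: mvar_def)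

lemma cst_add: "cst (a + b) = cst a + cst b"
  and cst_mult: "cst (a * b) = cst a * cst b"
  and cst_1 [simp]: "cst 1 = 1"
  and cst_0 [simp]: "cst 0 = 0"
  by (simp_all add: cst_def single_add mult_single single_uminus)

lemma tdeg_add: "tdeg (u + v) = tdeg u + tdeg v"
  by (simp add: tdeg_def lookup_add sum.distrib)

lemma tdeg_single [simp]: "tdeg (Poly_Mapping.single i c) = int c"
proof -
  have "(\<Sum>j\<in>UNIV. Poly_Mapping.lookup (Poly_Mapping.single i c) j) = (\<Sum>j\<in>UNIV. if j = i then c else 0)"
    by (intro sum.cong) (auto simp: lookup_single when_def)
  then show ?thesis by (simp add: tdeg_def)
qed

lemma tdeg_0 [simp]: "tdeg 0 = 0"
  by (simp add: tdeg_def)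

lemma tdeg_nonneg: "0 \<le> tdeg u"
  unfolding tdeg_def by (rule of_nat_0_le_iff)

lemma tdeg_eq_0: "tdeg u = 0 \<Longrightarrow> u = 0"
  by (rule poly_mapping_eqI) (simp add: tdeg_def flip: of_nat_sum)

lemma in_forms: "f \<in> forms e \<longleftrightarrow> (\<forall>u. Poly_Mapping.lookup f u \<noteq> 0 \<longrightarrow> tdeg u = e)"
  unfolding forms_def tdeg_def by (auto simp: in_keys_iff)

lemma opsub_keys:
  "opsub {} {f :: 'a \<Rightarrow>\<^sub>0 'k::ab_group_add. \<forall>u. Poly_Mapping.lookup f u \<noteq> 0 \<longrightarrow> P u}"
  unfolding opsub_def
proof (intro conjI ballI)
  fix f g :: "'a \<Rightarrow>\<^sub>0 'k"
  assume *: "f \<in> {f. \<forall>u. Poly_Mapping.lookup f u \<noteq> 0 \<longrightarrow> P u}"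
    "g \<in> {f. \<forall>u. Poly_Mapping.lookup f u \<noteq> 0 \<longrightarrow> P u}"
  have "P u" if "Poly_Mapping.lookup (f - g) u \<noteq> 0" for u
  proof -
    have "Poly_Mapping.lookup f u \<noteq> 0 \<or> Poly_Mapping.lookup g u \<noteq> 0"
      using that by (auto simp: lookup_minus)
    then show ?thesis using * by blast
  qed
  then show "f - g \<in> {f. \<forall>u. Poly_Mapping.lookup f u \<noteq> 0 \<longrightarrow> P u}" by blast
qed simp_all

lemma opsub_forms: "opsub {} (forms e :: ('n::finite, 'k::field) mpoly set)"
proof -
  have "(forms e :: ('n, 'k) mpoly set) = {f. \<forall>u. Poly_Mapping.lookup f u \<noteq> 0 \<longrightarrow> tdeg u = e}" using in_forms by blast
  then show ?thesis by (simp only: opsub_keys)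
qed

lemma single_in_forms: "tdeg u = e \<Longrightarrow> Poly_Mapping.single u c \<in> forms e"
  unfolding in_forms by (auto simp: lookup_single when_def)

lemma cst_in_forms: "cst c \<in> forms 0"
  unfolding cst_def by (rule single_in_forms) simp

lemma mvar_in_forms: "mvar i \<in> forms 1"
  unfolding mvar_def by (rule single_in_forms) simp

lemma forms_mult: "f \<in> forms a \<Longrightarrow> g \<in> forms b \<Longrightarrow> f * g \<in> forms (a + b)"
proof -
  assume f: "f \<in> forms a" and g: "g \<in> forms b"
  have "f * g = (\<Sum>u\<in>Poly_Mapping.keys f. Poly_Mapping.single u (Poly_Mapping.lookup f u))
      * (\<Sum>v\<in>Poly_Mapping.keys g. Poly_Mapping.single v (Poly_Mapping.lookup g v))"
    by (rule arg_cong2[where f = "(*)", OF monomial_sum monomial_sum])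
  also have "\<dots> = (\<Sum>u\<in>Poly_Mapping.keys f. \<Sum>v\<in>Poly_Mapping.keys g.
      Poly_Mapping.single (u + v) (Poly_Mapping.lookup f u * Poly_Mapping.lookup g v))"
    by (simp add: sum_product mult_single)
  also have "\<dots> \<in> forms (a + b)"
    using f g by (intro opsub_sum[OF opsub_forms] single_in_forms) (auto simp: in_forms tdeg_add in_keys_iff)
  finally show ?thesis .
qed

lemma forms_neg: "e < 0 \<Longrightarrow> f \<in> forms e \<Longrightarrow> f = 0"
  by (rule poly_mapping_eqI) (metis in_forms leD lookup_zero tdeg_nonneg)

lemma forms_0: "f \<in> forms 0 \<Longrightarrow> f = cst (Poly_Mapping.lookup f 0)"
  by (rule poly_mapping_eqI) (auto simp: in_forms cst_def lookup_single when_def dest: tdeg_eq_0)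

lemma hpart_in_forms: "hpart e f \<in> forms e"
  by (simp add: in_forms lookup_rst)

lemma hpart_forms: "f \<in> forms e' \<Longrightarrow> hpart e f = (if e = e' then f else 0)"
  by (rule poly_mapping_eqI) (auto simp: in_forms lookup_rst)

definition degs :: "('n::finite, 'k::field) mpoly \<Rightarrow> int set" where
  "degs f = tdeg ` Poly_Mapping.keys f"

lemma finite_degs [simp]: "finite (degs f)"
  by (simp add: degs_def)

lemma hpart_sum:
  assumes "finite E" "degs f \<subseteq> E"
  shows "f = (\<Sum>e\<in>E. hpart e f)"
proof (rule poly_mapping_eqI)
  fix u
  have "Poly_Mapping.lookup (\<Sum>e\<in>E. hpart e f) u = (\<Sum>e\<in>E. if tdeg u = e then Poly_Mapping.lookup f u else 0)"
    by (simp add: lookup_sum lookup_rst)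
  also have "\<dots> = Poly_Mapping.lookup f u"
    using assms by (auto simp: degs_def image_subset_iff in_keys_iff)
  finally show "Poly_Mapping.lookup f u = Poly_Mapping.lookup (\<Sum>e\<in>E. hpart e f) u" by simp
qed

lemma hpart_mult: "g \<in> forms a \<Longrightarrow> hpart e (g * f) = g * hpart (e - a) f"
proof -
  assume g: "g \<in> forms a"
  let ?E = "insert (e - a) (degs f)"
  have "hpart e (g * f) = (\<Sum>e'\<in>?E. hpart e (g * hpart e' f))"
    by (subst hpart_sum[of ?E f]) (auto simp: sum_distrib_left rst_sum)
  also have "\<dots> = (\<Sum>e'\<in>?E. if e' = e - a then g * hpart (e - a) f else 0)"
    by (intro sum.cong refl, subst hpart_forms[OF forms_mult[OF g hpart_in_forms]]) auto
  also have "\<dots> = g * hpart (e - a) f" by simp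
  finally show ?thesis .
qed

lemma divisible_by_mvar:
  fixes f :: "('n::finite, 'k::field) mpoly"
  assumes "\<And>u. Poly_Mapping.lookup f u \<noteq> 0 \<Longrightarrow> 0 < Poly_Mapping.lookup u i"
  shows "\<exists>g. f = mvar i * g"
proof -
  have "opsub {} (range ((*) (mvar i :: ('n, 'k) mpoly)))"
    unfolding opsub_def
  proof (intro conjI ballI)
    show "0 \<in> range ((*) (mvar i :: ('n, 'k) mpoly))" by (rule image_eqI[of _ _ 0]) simp_all
    fix a b :: "('n, 'k) mpoly" assume "a \<in> range ((*) (mvar i))" "b \<in> range ((*) (mvar i))"
    then obtain a' b' where "a = mvar i * a'" "b = mvar i * b'" by blast
    then have "a - b = mvar i * (a' - b')" by (simp only: right_diff_distrib)
    then show "a - b \<in> range ((*) (mvar i))" by blast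
  qed simp
  then have "f \<in> range ((*) (mvar i))"
  proof (rule mpoly_closed)
    fix u assume "u \<in> Poly_Mapping.keys f"
    then have "0 < Poly_Mapping.lookup u i" using assms by (simp add: in_keys_iff)
    then have "u = Poly_Mapping.single i 1 + (u - Poly_Mapping.single i 1)"
      by (intro poly_mapping_eqI) (auto simp: lookup_add lookup_minus lookup_single when_def)
    then have "Poly_Mapping.single u (Poly_Mapping.lookup f u)
       = mvar i * Poly_Mapping.single (u - Poly_Mapping.single i 1) (Poly_Mapping.lookup f u)"
      unfolding mvar_def mult_single by simp
    then show "Poly_Mapping.single u (Poly_Mapping.lookup f u) \<in> range ((*) (mvar i))" by blast
  qed
  then show ?thesis by blast
qed

text \<open>Each monomial of positive degree is divisible by some variable. Zero coefficients are
  allowed so that the sum runs over all variables, which is the shape of the boundary of a Koszul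
  1-chain.\<close>

lemma forms_pos_decomp:
  fixes f :: "('n::finite, 'k::field) mpoly"
  assumes "f \<in> forms e" "0 < e"
  shows "\<exists>g. (\<forall>l. g l \<in> forms (e - 1)) \<and> f = (\<Sum>l<CARD('n). xv l * g l)"
proof -
  define M where "M = {\<Sum>l<CARD('n). xv l * g l | g :: nat \<Rightarrow> ('n, 'k) mpoly. \<forall>l. g l \<in> forms (e - 1)}"
  have "opsub {} M"
    unfolding opsub_def
  proof (intro conjI ballI)
    show "0 \<in> M" unfolding M_def using opsub_0[OF opsub_forms]
      by (intro CollectI exI[of _ "\<lambda>_. 0"]) auto
    fix u v assume "u \<in> M" "v \<in> M"
    then obtain g h where *: "u = (\<Sum>l<CARD('n). xv l * g l)" "\<forall>l. g l \<in> forms (e - 1)"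
      "v = (\<Sum>l<CARD('n). xv l * h l)" "\<forall>l. h l \<in> forms (e - 1)" unfolding M_def by blast
    then have "u - v = (\<Sum>l<CARD('n). xv l * (g l - h l))"
      by (simp add: right_diff_distrib sum_subtractf)
    moreover have "\<forall>l. g l - h l \<in> forms (e - 1)" using * opsub_diff[OF opsub_forms] by blast
    ultimately show "u - v \<in> M" unfolding M_def by (intro CollectI exI[of _ "\<lambda>l. g l - h l"]) simp
  qed simp
  then have "f \<in> M"
  proof (rule mpoly_closed)
    fix u assume "u \<in> Poly_Mapping.keys f"
    then have deg: "tdeg u = e" using assms by (simp add: in_forms in_keys_iff)
    then have "u \<noteq> 0" using assms(2) by auto
    then obtain i where i: "0 < Poly_Mapping.lookup u i"
      by (metis gr0I lookup_zero poly_mapping_eqI)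
    obtain m where m: "m < CARD('n)" "i = ix m" using ix_surj by blast
    let ?w = "u - Poly_Mapping.single i 1"
    have u: "u = Poly_Mapping.single i 1 + ?w"
      using i by (intro poly_mapping_eqI) (auto simp: lookup_add lookup_minus lookup_single when_def)
    then have "tdeg u = 1 + tdeg ?w" by (metis tdeg_add tdeg_single of_nat_1)
    then have w: "Poly_Mapping.single ?w (Poly_Mapping.lookup f u) \<in> forms (e - 1)"
      by (intro single_in_forms) (simp add: deg)
    have "Poly_Mapping.single u (Poly_Mapping.lookup f u) = xv m * Poly_Mapping.single ?w (Poly_Mapping.lookup f u)"
      unfolding mvar_def mult_single m(2)[symmetric] using u by simp
    also have "\<dots> = (\<Sum>l<CARD('n). xv l * (if l = m then Poly_Mapping.single ?w (Poly_Mapping.lookup f u) else 0))"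
      using m by (simp add: if_distrib[of "\<lambda>x. _ * x"] cong: if_cong)
    finally show "Poly_Mapping.single u (Poly_Mapping.lookup f u) \<in> M"
      unfolding M_def using w opsub_0[OF opsub_forms]
      by (intro CollectI exI[of _ "\<lambda>l. if l = m then Poly_Mapping.single ?w (Poly_Mapping.lookup f u) else 0"]) auto
  qed
  then show ?thesis unfolding M_def by blast
qed

text \<open>The variables form a regular sequence, so the Koszul complex of the polynomial ring is acyclic.\<close>

lemma koszul_acyclic_mpoly:
  fixes v :: "nat set \<Rightarrow> ('n::finite, 'k::field) mpoly"
  assumes v: "v \<in> kchains CARD('n) UNIV i" and i: "0 < i" and cyc: "kos (*) CARD('n) xv v = 0"
  shows "\<exists>w\<in>kchains CARD('n) UNIV (Suc i). v = kos (*) CARD('n) xv w"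
proof -
  \<comment> \<open>\<open>J k\<close> is the ideal of the first \<open>k\<close> variables,
    described by monomials. The minimum keeps the indices in the range where \<open>ix\<close> is
    injective.\<close>
  define J :: "nat \<Rightarrow> ('n, 'k) mpoly set" where
    "J k = {f. \<forall>u. Poly_Mapping.lookup f u \<noteq> 0 \<longrightarrow> (\<exists>l<min k CARD('n). 0 < Poly_Mapping.lookup u (ix l))}" for k
  have "\<exists>w\<in>kchains CARD('n) UNIV (Suc i). \<forall>T. v T - kos (*) CARD('n) xv w T \<in> J 0"
  proof (rule koszul_vanishing[where R = UNIV and g = "CARD('n)" and k = 0 and J = J and y = xv
        and r = "\<lambda>k l. if l = k then 1 else 0"])
    show J: "opsub {} (J k)" for k
      unfolding J_def by (rule opsub_keys)
    show "f * g \<in> J k" if g: "g \<in> J k" for f g k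
    proof -
      have "opsub {} {f. f * g \<in> J k}"
        unfolding opsub_def left_diff_distrib mem_Collect_eq mult_zero_left
        using opsub_diff[OF J] opsub_0[OF J] by blast
      then have "f \<in> {f. f * g \<in> J k}"
      proof (rule mpoly_closed)
        fix u
        let ?c = "Poly_Mapping.lookup f u"
        have eq: "Poly_Mapping.single u ?c * g
          = (\<Sum>w\<in>Poly_Mapping.keys g. Poly_Mapping.single (u + w) (?c * Poly_Mapping.lookup g w))"
          by (subst monomial_sum[of g]) (simp add: sum_distrib_left mult_single)
        have "Poly_Mapping.single u ?c * g \<in> J k"
          unfolding eq
        proof (rule opsub_sum[OF J])
          fix w assume "w \<in> Poly_Mapping.keys g"
          then obtain l where "l < min k CARD('n)" "0 < Poly_Mapping.lookup w (ix l)"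
            using g unfolding J_def in_keys_iff by blast
          then show "Poly_Mapping.single (u + w) (?c * Poly_Mapping.lookup g w) \<in> J k"
            unfolding J_def by (auto simp: lookup_single when_def lookup_add intro!: exI[of _ l])
        qed
        then show "Poly_Mapping.single u ?c \<in> {f. f * g \<in> J k}" by simp
      qed
      then show ?thesis by simp
    qed
    show "xv k = (\<Sum>l<CARD('n). xv l * (if l = k then 1 else 0))" if "k < CARD('n)" for k
      using that by (simp add: if_distrib[of "\<lambda>x. _ * x"] cong: if_cong)
    show "\<exists>j\<in>J k. \<exists>u\<in>UNIV. a = j + xv k * u" if k: "k < CARD('n)" and a: "a \<in> J (Suc k)" for k a
    proof -
      \<comment> \<open>The monomials of \<open>a\<close> divisible by one of the first
        \<open>k\<close> variables form a polynomial in \<open>J k\<close>; each remaining monomial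
        must be divisible by variable number \<open>k\<close>.\<close>
      let ?P = "\<lambda>u. \<exists>l<min k CARD('n). 0 < Poly_Mapping.lookup u (ix l :: 'n)"
      have "0 < Poly_Mapping.lookup u (ix k)" if "Poly_Mapping.lookup (rst (\<lambda>u. \<not> ?P u) a) u \<noteq> 0" for u
      proof -
        have *: "\<not> ?P u" "Poly_Mapping.lookup a u \<noteq> 0" using that by (auto simp: lookup_rst split: if_splits)
        obtain l where l: "l < min (Suc k) CARD('n)" "0 < Poly_Mapping.lookup u (ix l)"
          using a *(2) unfolding J_def by blast
        have "\<not> l < min k CARD('n)" using l *(1) by blast
        then show ?thesis using l k by (metis less_Suc_eq min_less_iff_conj)
      qed
      then obtain g where g: "rst (\<lambda>u. \<not> ?P u) a = xv k * g" using divisible_by_mvar by blast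
      have "a = rst ?P a + rst (\<lambda>u. \<not> ?P u) a"
        by (rule rst_split)
      moreover have "rst ?P a \<in> J k" unfolding J_def by (simp add: lookup_rst)
      ultimately show ?thesis using g by auto
    qed
    show "j + xv k * u \<in> J (Suc k)" if k: "k < CARD('n)" and j: "j \<in> J k" for k j u
    proof -
      have "j \<in> J (Suc k)"
        unfolding J_def
      proof (intro CollectI allI impI)
        fix u assume "Poly_Mapping.lookup j u \<noteq> 0"
        then obtain l where "l < min k CARD('n)" "0 < Poly_Mapping.lookup u (ix l)"
          using j unfolding J_def by blast
        then show "\<exists>l<min (Suc k) CARD('n). 0 < Poly_Mapping.lookup u (ix l)"
          by (intro exI[of _ l]) auto
      qed
      moreover have "xv k \<in> J (Suc k)"
        unfolding J_def
      proof (intro CollectI allI impI)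
        fix u assume "Poly_Mapping.lookup (xv k :: ('n, 'k) mpoly) u \<noteq> 0"
        then have "u = Poly_Mapping.single (ix k) 1"
          by (simp add: mvar_def lookup_single when_def split: if_splits)
        then show "\<exists>l<min (Suc k) CARD('n). 0 < Poly_Mapping.lookup u (ix l)"
          using k by (intro exI[of _ k]) auto
      qed
      then have "u * xv k \<in> J (Suc k)" by (rule \<open>\<And>k g f. g \<in> J k \<Longrightarrow> f * g \<in> J k\<close>)
      ultimately show ?thesis using opsub_add[OF J] by (simp add: mult.commute)
    qed
    show "u \<in> J k" if k: "k < CARD('n)" and u: "xv k * u \<in> J k" for k u
      unfolding J_def
    proof (intro CollectI allI impI)
      fix w assume "Poly_Mapping.lookup u w \<noteq> 0"
      then have "Poly_Mapping.lookup (xv k * u) (Poly_Mapping.single (ix k) 1 + w) \<noteq> 0"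
        by (simp only: lookup_mvar_times not_False_eq_True)
      then obtain l where l: "l < min k CARD('n)" "0 < Poly_Mapping.lookup (Poly_Mapping.single (ix k) 1 + w) (ix l)"
        using u unfolding J_def by blast
      then have "(ix k :: 'n) \<noteq> ix l" using ix_eq_iff[where 'n = 'n, of k l] k by auto
      then show "\<exists>l<min k CARD('n). 0 < Poly_Mapping.lookup w (ix l)"
        using l by (auto simp: lookup_add lookup_single when_def intro!: exI[of _ l])
    qed
    show "kos (*) CARD('n) xv v T \<in> J 0" for T
      using cyc opsub_0[OF J] by simp
  qed (use v i in \<open>auto simp: opsub_def\<close>)
  moreover have "J 0 = {0}" unfolding J_def by (auto intro: poly_mapping_eqI)
  ultimately obtain w where w: "w \<in> kchains CARD('n) UNIV (Suc i)"
    "\<And>T. v T - kos (*) CARD('n) xv w T \<in> {0}" by auto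
  have "v = kos (*) CARD('n) xv w"
  proof (rule ext)
    show "v T = kos (*) CARD('n) xv w T" for T using w(2)[of T] by simp
  qed
  then show ?thesis using w(1) by blast
qed

section \<open>Graded modules and their Koszul homology\<close>

text \<open>A module over the polynomial ring. The sublocale restricts scalars along
  \<open>cst\<close> and thereby provides spans and dimensions over the ground field.\<close>

locale amod = Modules.module s
  for s :: "('n::finite, 'k::field) mpoly \<Rightarrow> 'v::ab_group_add \<Rightarrow> 'v"
begin

sublocale k: vector_space "\<lambda>c. s (cst c)"
  by standard (simp_all add: scale_right_distrib scale_left_distrib cst_add cst_mult)

end

abbreviation (input) fsc :: "('a \<Rightarrow> 'v \<Rightarrow> 'v) \<Rightarrow> 'a \<Rightarrow> ('i \<Rightarrow> 'v) \<Rightarrow> 'i \<Rightarrow> 'v" where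
  "fsc s \<equiv> \<lambda>a v i. s a (v i)"

abbreviation kspan :: "(('n::finite, 'k::field) mpoly \<Rightarrow> 'v::ab_group_add \<Rightarrow> 'v) \<Rightarrow> 'v set \<Rightarrow> 'v set" where
  "kspan s \<equiv> Modules.module.span (\<lambda>c. s (cst c))"

abbreviation ksub :: "(('n::finite, 'k::field) mpoly \<Rightarrow> 'v::ab_group_add \<Rightarrow> 'v) \<Rightarrow> 'v set \<Rightarrow> bool" where
  "ksub s \<equiv> Modules.module.subspace (\<lambda>c. s (cst c))"

abbreviation kdim :: "(('n::finite, 'k::field) mpoly \<Rightarrow> 'v::ab_group_add \<Rightarrow> 'v) \<Rightarrow> 'v set \<Rightarrow> nat" where
  "kdim s \<equiv> vector_space.dim (\<lambda>c. s (cst c))"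

abbreviation klinear where
  "klinear s t \<equiv> Vector_Spaces.linear (\<lambda>c. s (cst c)) (\<lambda>c. t (cst c))"

lemma amod_mult: "amod ((*) :: ('n::finite, 'k::field) mpoly \<Rightarrow> _)"
  by (simp add: amod_def module_mult)

lemma amod_fun: "amod s \<Longrightarrow> amod (fsc s)"
proof -
  assume "amod s"
  then interpret amod s .
  show ?thesis
    by standard (simp_all add: fun_eq_iff scale_right_distrib scale_left_distrib)
qed

lemma klinearI:
  assumes "amod s" "amod t" "\<And>u v. f (u + v) = f u + f v" "\<And>c v. f (s (cst c) v) = t (cst c) (f v)"
  shows "klinear s t f"
proof -
  interpret a: amod s by fact
  interpret b: amod t by fact
  show ?thesis
    by (rule Vector_Spaces.linear.intro[OF a.k.vector_space_axioms b.k.vector_space_axioms])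
      (unfold_locales, simp_all add: assms(3,4))
qed

text \<open>A graded module is a family of subgroups of one ambient module. Directness of their sum
  is kept apart, in \<open>direct\<close>, because Koszul homology in a fixed degree is defined
  without it.\<close>

definition gmod :: "(('n::finite, 'k::field) mpoly \<Rightarrow> 'v::ab_group_add \<Rightarrow> 'v) \<Rightarrow> (int \<Rightarrow> 'v set) \<Rightarrow> bool" where
  "gmod s M \<longleftrightarrow> (\<forall>e. opsub {} (M e)) \<and> (\<forall>i e. \<forall>a\<in>forms i. \<forall>u\<in>M e. s a u \<in> M (e + i))"

lemma gmod_opsub: "gmod s M \<Longrightarrow> opsub {} (M e)"
  and gmod_scale: "gmod s M \<Longrightarrow> a \<in> forms i \<Longrightarrow> u \<in> M e \<Longrightarrow> e' = e + i \<Longrightarrow> s a u \<in> M e'"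
  unfolding gmod_def by blast+

lemma (in amod) opsub_imp_subspace:
  assumes "opsub {} M" "\<And>c v. v \<in> M \<Longrightarrow> s (cst c) v \<in> M"
  shows "k.subspace M"
  unfolding k.subspace_def using opsub_0[OF assms(1)] opsub_add[OF assms(1)] assms(2) by blast

lemma (in amod) gmod_subspace: "gmod s M \<Longrightarrow> k.subspace (M e)"
  by (rule opsub_imp_subspace[OF gmod_opsub]) (auto intro: gmod_scale[OF _ cst_in_forms])

lemma (in amod) subspace_imp_opsub: "k.subspace M \<Longrightarrow> opsub {} M"
  unfolding opsub_def using k.subspace_0 k.subspace_diff by blast

lemma fdim_fun:
  fixes s :: "('n::finite, 'k::field) mpoly \<Rightarrow> 'v::ab_group_add \<Rightarrow> 'v" and \<Omega> :: "'i set"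
  assumes "amod s" "finite \<Omega>" "\<And>w. w \<in> \<Omega> \<Longrightarrow> fdim (kspan s) (V w)"
  shows "fdim (kspan (fsc s)) {v. (\<forall>w\<in>\<Omega>. v w \<in> V w) \<and> (\<forall>w. w \<notin> \<Omega> \<longrightarrow> v w = 0)}"
proof -
  interpret a: amod s by fact
  interpret f: amod "fsc s :: _ \<Rightarrow> ('i \<Rightarrow> 'v) \<Rightarrow> _" by (rule amod_fun) fact
  define \<delta> :: "'i \<Rightarrow> 'v \<Rightarrow> 'i \<Rightarrow> 'v" where "\<delta> w b = (\<lambda>x. if x = w then b else 0)" for w b
  obtain B where B: "\<And>w. w \<in> \<Omega> \<Longrightarrow> finite (B w) \<and> V w \<subseteq> kspan s (B w)"
    using assms(3) unfolding fdim_def by metis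
  have lin: "klinear s (fsc s) (\<delta> w)" for w
    by (rule klinearI[OF assms(1) amod_fun[OF assms(1)]]) (auto simp: \<delta>_def)
  let ?C = "\<Union>w\<in>\<Omega>. \<delta> w ` B w"
  have "v \<in> kspan (fsc s) ?C" if v: "\<forall>w\<in>\<Omega>. v w \<in> V w" "\<forall>w. w \<notin> \<Omega> \<longrightarrow> v w = 0" for v
  proof -
    have "v = (\<Sum>w\<in>\<Omega>. \<delta> w (v w))"
    proof (rule ext)
      fix x
      show "v x = (\<Sum>w\<in>\<Omega>. \<delta> w (v w)) x"
        unfolding sum_fun_apply \<delta>_def using assms(2) v(2) by (cases "x \<in> \<Omega>") (simp_all)
    qed
    also have "\<dots> \<in> kspan (fsc s) ?C"
    proof (rule f.k.span_sum)
      fix w assume w: "w \<in> \<Omega>"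
      interpret l: Vector_Spaces.linear "\<lambda>c. s (cst c)" "\<lambda>c. fsc s (cst c)" "\<delta> w" by (rule lin)
      have "\<delta> w (v w) \<in> \<delta> w ` kspan s (B w)" using B[OF w] v(1) w by blast
      also have "\<dots> = kspan (fsc s) (\<delta> w ` B w)" by (rule l.span_image[symmetric])
      also have "\<dots> \<subseteq> kspan (fsc s) ?C" by (rule f.k.span_mono) (use w in blast)
      finally show "\<delta> w (v w) \<in> kspan (fsc s) ?C" .
    qed
    finally show ?thesis .
  qed
  moreover have "finite ?C" using B assms(2) by blast
  ultimately show ?thesis unfolding fdim_def by blast
qed

lemma finite_tdeg: "finite {u :: 'n::finite \<Rightarrow>\<^sub>0 nat. tdeg u = e}"
proof -
  have "Poly_Mapping.lookup u i \<le> nat e" if "tdeg u = e" for u :: "'n \<Rightarrow>\<^sub>0 nat" and i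
  proof -
    have "Poly_Mapping.lookup u i \<le> (\<Sum>i\<in>UNIV. Poly_Mapping.lookup u i)"
      by (rule member_le_sum) auto
    then show ?thesis using that unfolding tdeg_def by linarith
  qed
  then have "Poly_Mapping.lookup ` {u :: 'n \<Rightarrow>\<^sub>0 nat. tdeg u = e} \<subseteq> (UNIV \<rightarrow>\<^sub>E {..nat e})"
    by auto
  then have "finite (Poly_Mapping.lookup ` {u :: 'n \<Rightarrow>\<^sub>0 nat. tdeg u = e})"
    by (rule finite_subset) (intro finite_PiE, auto)
  then show ?thesis by (rule finite_imageD) (simp add: inj_on_def lookup_inject)
qed

lemma fdim_forms: "fdim (kspan (*)) (forms e :: ('n::finite, 'k::field) mpoly set)"
proof -
  interpret a: amod "(*) :: ('n, 'k) mpoly \<Rightarrow> _" by (rule amod_mult)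
  let ?B = "(\<lambda>u. Poly_Mapping.single u 1 :: ('n, 'k) mpoly) ` {u. tdeg u = e}"
  have "f \<in> kspan (*) ?B" if "f \<in> forms e" for f :: "('n, 'k) mpoly"
  proof (rule mpoly_closed)
    show "opsub {} (kspan (*) ?B)" by (rule a.subspace_imp_opsub[OF a.k.subspace_span])
    fix u assume "u \<in> Poly_Mapping.keys f"
    then have "tdeg u = e" using that by (simp add: in_forms in_keys_iff)
    then have "cst (Poly_Mapping.lookup f u) * Poly_Mapping.single u 1 \<in> kspan (*) ?B"
      by (intro a.k.span_scale a.k.span_base) blast
    then show "Poly_Mapping.single u (Poly_Mapping.lookup f u) \<in> kspan (*) ?B"
      by (simp add: cst_def mult_single)
  qed
  then show ?thesis unfolding fdim_def using finite_tdeg[of e] by blast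
qed

text \<open>The Koszul basis vector of a p-element set has degree p, so a chain of total degree
  \<open>e\<close> has coefficients in degree e - p. In \<open>BB\<close> the bounding chains have p
  + 1 indices and coefficients one degree lower.\<close>

definition ZZ :: "(('n::finite, 'k::field) mpoly \<Rightarrow> 'v::ab_group_add \<Rightarrow> 'v) \<Rightarrow> (int \<Rightarrow> 'v set) \<Rightarrow> nat \<Rightarrow> int
    \<Rightarrow> (nat set \<Rightarrow> 'v) set" where
  "ZZ s M p e = {v \<in> kchains CARD('n) (M (e - int p)) p. kos s CARD('n) xv v = 0}"

definition BB :: "(('n::finite, 'k::field) mpoly \<Rightarrow> 'v::ab_group_add \<Rightarrow> 'v) \<Rightarrow> (int \<Rightarrow> 'v set) \<Rightarrow> nat \<Rightarrow> int
    \<Rightarrow> (nat set \<Rightarrow> 'v) set" where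
  "BB s M p e = kos s CARD('n) xv ` kchains CARD('n) (M (e - int (Suc p))) (Suc p)"

text \<open>The graded Betti numbers \<open>\<beta>\<^bsub>p,e\<^esub> = dim Tor\<^sub>p(k, M)\<^sub>e\<close>, computed by Koszul homology.\<close>

definition hb :: "(('n::finite, 'k::field) mpoly \<Rightarrow> 'v::ab_group_add \<Rightarrow> 'v) \<Rightarrow> (int \<Rightarrow> 'v set) \<Rightarrow> nat \<Rightarrow> int
    \<Rightarrow> int" where
  "hb s M p e = int (kdim (fsc s) (ZZ s M p e)) - int (kdim (fsc s) (BB s M p e))"

text \<open>The degree \<open>e\<close> part of \<open>\<mm>M\<close>.\<close>

definition mpart :: "(('n::finite, 'k::field) mpoly \<Rightarrow> 'v::ab_group_add \<Rightarrow> 'v) \<Rightarrow> (int \<Rightarrow> 'v set) \<Rightarrow> int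
    \<Rightarrow> 'v set" where
  "mpart s M e = {\<Sum>l<CARD('n). s (xv l) (g l) | g :: nat \<Rightarrow> 'v. \<forall>l. g l \<in> M (e - 1)}"

lemma klinear_kos:
  fixes s :: "('n::finite, 'k::field) mpoly \<Rightarrow> 'v::ab_group_add \<Rightarrow> 'v"
  assumes "amod s" shows "klinear (fsc s) (fsc s) (kos s CARD('n) xv)"
proof -
  interpret amod s by fact
  show ?thesis by (intro klinearI amod_fun assms kos_add kos_scale)
qed

lemma opsub_kchains:
  assumes "opsub {} M" shows "opsub {} (kchains n M p)"
  unfolding opsub_def
proof (intro conjI ballI)
  show "0 \<in> kchains n M p" using opsub_0[OF assms] by (intro kchainsI) auto
  fix u v assume *: "u \<in> kchains n M p" "v \<in> kchains n M p"
  show "u - v \<in> kchains n M p"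
    using kchainsD[OF *(1)] kchainsD[OF *(2)] kchains_outside[OF *(1)] kchains_outside[OF *(2)]
    by (intro kchainsI) (simp_all add: opsub_diff[OF assms])
qed simp

lemma subspace_kchains:
  fixes s :: "('n::finite, 'k::field) mpoly \<Rightarrow> 'v::ab_group_add \<Rightarrow> 'v"
  assumes s: "amod s" and M: "gmod s M"
  shows "ksub (fsc s) (kchains n (M e) p)"
proof -
  interpret amod s by fact
  interpret f: amod "fsc s :: _ \<Rightarrow> (nat set \<Rightarrow> 'v) \<Rightarrow> _" by (rule amod_fun) fact
  show ?thesis
  proof (rule f.opsub_imp_subspace[OF opsub_kchains[OF gmod_opsub[OF M]]])
    fix c and v :: "nat set \<Rightarrow> 'v" assume v: "v \<in> kchains n (M e) p"
    show "(\<lambda>T. s (cst c) (v T)) \<in> kchains n (M e) p"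
      by (intro kchainsI gmod_scale[OF M cst_in_forms kchainsD[OF v]])
        (simp_all add: kchains_outside[OF v])
  qed
qed

lemma fdim_kchains:
  assumes s: "amod s" and M: "fdim (kspan s) M"
  shows "fdim (kspan (fsc s)) (kchains n M p)"
proof -
  let ?\<Omega> = "{T. T \<subseteq> {..<n} \<and> card T = p}"
  have "finite ?\<Omega>" by (rule finite_subset[of _ "Pow {..<n}"]) auto
  then have "fdim (kspan (fsc s)) {v. (\<forall>w\<in>?\<Omega>. v w \<in> M) \<and> (\<forall>w. w \<notin> ?\<Omega> \<longrightarrow> v w = 0)}"
    by (rule fdim_fun[OF s]) (rule M)
  moreover have "kchains n M p \<subseteq> {v. (\<forall>w\<in>?\<Omega>. v w \<in> M) \<and> (\<forall>w. w \<notin> ?\<Omega> \<longrightarrow> v w = 0)}"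
    using kchainsD kchains_outside by blast
  ultimately show ?thesis by (rule fdim_mono)
qed

lemma kos_graded:
  fixes s :: "('n::finite, 'k::field) mpoly \<Rightarrow> 'v::ab_group_add \<Rightarrow> 'v"
  assumes s: "amod s" and M: "gmod s M" and v: "v \<in> kchains CARD('n) (M (e - int (Suc p))) (Suc p)"
  shows "kos s CARD('n) xv v \<in> kchains CARD('n) (M (e - int p)) p"
proof -
  interpret amod s by fact
  show ?thesis
    by (rule kos_kchains[OF v gmod_opsub[OF M]]) (erule gmod_scale[OF M mvar_in_forms], simp)
qed

lemma BB_subset_ZZ:
  assumes "amod s" "gmod s M" shows "BB s M p e \<subseteq> ZZ s M p e"
proof -
  interpret amod s by fact
  show ?thesis unfolding BB_def ZZ_def using kos_graded[OF assms] kos_kos by blast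
qed

lemma subspace_ZZ:
  fixes s :: "('n::finite, 'k::field) mpoly \<Rightarrow> 'v::ab_group_add \<Rightarrow> 'v"
  assumes "amod s" "gmod s M" shows "ksub (fsc s) (ZZ s M p e)"
proof -
  interpret f: amod "fsc s :: _ \<Rightarrow> (nat set \<Rightarrow> 'v) \<Rightarrow> _" by (rule amod_fun) fact
  interpret l: Vector_Spaces.linear "\<lambda>c. fsc s (cst c)" "\<lambda>c. fsc s (cst c)" "kos s CARD('n) xv"
    by (rule klinear_kos[OF assms(1)])
  have "ZZ s M p e = kchains CARD('n) (M (e - int p)) p \<inter> {v. kos s CARD('n) xv v = 0}"
    unfolding ZZ_def by blast
  then show ?thesis
    using f.k.subspace_inter[OF subspace_kchains[OF assms] l.subspace_kernel] by simp
qed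

lemma subspace_BB:
  fixes s :: "('n::finite, 'k::field) mpoly \<Rightarrow> 'v::ab_group_add \<Rightarrow> 'v"
  assumes "amod s" "gmod s M" shows "ksub (fsc s) (BB s M p e)"
proof -
  interpret l: Vector_Spaces.linear "\<lambda>c. fsc s (cst c)" "\<lambda>c. fsc s (cst c)" "kos s CARD('n) xv"
    by (rule klinear_kos[OF assms(1)])
  show ?thesis unfolding BB_def by (rule l.subspace_image[OF subspace_kchains[OF assms]])
qed

lemma fdim_ZZ: "amod s \<Longrightarrow> fdim (kspan s) (M (e - int p)) \<Longrightarrow> fdim (kspan (fsc s)) (ZZ s M p e)"
  by (rule fdim_mono[OF fdim_kchains]) (auto simp: ZZ_def)

lemma hb_nonneg:
  fixes s :: "('n::finite, 'k::field) mpoly \<Rightarrow> 'v::ab_group_add \<Rightarrow> 'v"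
  assumes "amod s" "gmod s M" "\<And>e. fdim (kspan s) (M e)"
  shows "0 \<le> hb s M p e"
proof -
  interpret f: amod "fsc s :: _ \<Rightarrow> (nat set \<Rightarrow> 'v) \<Rightarrow> _" by (rule amod_fun) fact
  show ?thesis unfolding hb_def
    using f.k.dim_mono_fdim[OF fdim_ZZ[OF assms(1,3)] subspace_BB[OF assms(1,2)] subspace_ZZ[OF assms(1,2)]
      BB_subset_ZZ[OF assms(1,2)]] by simp
qed

text \<open>Dimension shifting along \<open>0 \<rightarrow> N \<rightarrow> D \<rightarrow> M \<rightarrow> 0\<close> with \<open>D\<close> acyclic and \<open>N \<subseteq> \<mm>D\<close>. Both homologies are
  quotients of the space \<open>W\<close> of chains of \<open>D\<close> that become cycles in \<open>M\<close>, by the same subspace.\<close>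

lemma hb_shift:
  fixes s :: "('n::finite, 'k::field) mpoly \<Rightarrow> 'v::ab_group_add \<Rightarrow> 'v"
    and t :: "('n, 'k) mpoly \<Rightarrow> 'w::ab_group_add \<Rightarrow> 'w"
  assumes s: "amod s" and t: "amod t"
    and \<phi>: "\<And>u v. \<phi> (u + v) = \<phi> u + \<phi> v" "\<And>a v. \<phi> (s a v) = t a (\<phi> v)"
    and D: "gmod s D" "\<And>e. fdim (kspan s) (D e)"
    and N: "gmod s N" "\<And>e. N e = {v \<in> D e. \<phi> v = 0}" and M: "gmod t M" "\<And>e. M e = \<phi> ` D e"
    and acyclic: "\<And>p e. 0 < p \<Longrightarrow> ZZ s D p e \<subseteq> BB s D p e"
    and minimal: "\<And>e. N e \<subseteq> mpart s D e"
  shows "hb t M (Suc p) e = hb s N p e"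
proof -
  interpret a: amod s by fact
  interpret b: amod t by fact
  interpret fa: amod "fsc s :: _ \<Rightarrow> (nat set \<Rightarrow> 'v) \<Rightarrow> _" by (rule amod_fun) fact
  interpret fb: amod "fsc t :: _ \<Rightarrow> (nat set \<Rightarrow> 'w) \<Rightarrow> _" by (rule amod_fun) fact
  let ?n = "CARD('n)"
  let ?ds = "kos s ?n xv" and ?dt = "kos t ?n xv"
  define \<Phi> :: "(nat set \<Rightarrow> 'v) \<Rightarrow> nat set \<Rightarrow> 'w" where "\<Phi> w = (\<lambda>T. \<phi> (w T))" for w
  have add\<phi>: "additive \<phi>" unfolding additive_def using \<phi>(1) by blast
  have \<phi>0: "\<phi> 0 = 0" by (rule additive.zero[OF add\<phi>])
  have \<Phi>_diff: "\<Phi> (u - v) = \<Phi> u - \<Phi> v" for u v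
    by (rule ext) (simp add: \<Phi>_def additive.diff[OF add\<phi>])
  have lin\<Phi>: "klinear (fsc s) (fsc t) \<Phi>"
    by (intro klinearI amod_fun s t) (auto simp: \<Phi>_def \<phi>)
  have lind: "klinear (fsc s) (fsc s) ?ds" by (rule klinear_kos[OF s])
  have \<Phi>_kos: "?dt (\<Phi> w) = \<Phi> (?ds w)" for w
  proof (rule ext)
    show "?dt (\<Phi> w) T = \<Phi> (?ds w) T" for T
      unfolding \<Phi>_def kos_def additive.sum[OF add\<phi>]
      by (intro sum.cong refl) (simp add: \<phi>0 \<phi>(2))
  qed
  have \<Phi>_chain: "\<Phi> w \<in> kchains ?n (M e') q" if "w \<in> kchains ?n (D e') q" for w q e'
    using kchainsD[OF that] kchains_outside[OF that] by (intro kchainsI) (auto simp: \<Phi>_def M(2) \<phi>0)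
  have lift: "\<exists>w\<in>kchains ?n (D e') q. \<Phi> w = z" if z: "z \<in> kchains ?n (M e') q" for z q e'
  proof -
    have "\<forall>T. \<exists>w. if T \<subseteq> {..<?n} \<and> card T = q then w \<in> D e' \<and> \<phi> w = z T else w = 0"
      using kchainsD[OF z] unfolding M(2) by (metis (no_types, lifting) imageE)
    then obtain w where w: "\<And>T. if T \<subseteq> {..<?n} \<and> card T = q then w T \<in> D e' \<and> \<phi> (w T) = z T else w T = 0"
      by metis
    have "w \<in> kchains ?n (D e') q" using w by (intro kchainsI) metis+
    moreover have "\<Phi> w = z"
    proof (rule ext)
      show "\<Phi> w T = z T" for T
        using w[of T] kchains_outside[OF z, of T] by (auto simp: \<Phi>_def \<phi>0 split: if_splits)
    qed
    ultimately show ?thesis by blast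
  qed
  have kerN: "w \<in> kchains ?n (N e') q" if "w \<in> kchains ?n (D e') q" "\<Phi> w = 0" for w q e'
    using kchainsD[OF that(1)] kchains_outside[OF that(1)] that(2)
    by (intro kchainsI) (auto simp: N(2) \<Phi>_def fun_eq_iff)
  have NK: "\<Phi> w = 0 \<and> w \<in> kchains ?n (D e') q" if "w \<in> kchains ?n (N e') q" for w q e'
  proof
    show "w \<in> kchains ?n (D e') q"
      using kchainsD[OF that] kchains_outside[OF that] by (intro kchainsI) (auto simp: N(2))
    show "\<Phi> w = 0"
    proof (rule ext)
      show "\<Phi> w T = 0 T" for T
        using kchainsD[OF that, of T] kchains_outside[OF that, of T]
        by (cases "T \<subseteq> {..<?n} \<and> card T = q") (auto simp: \<Phi>_def N(2) \<phi>0)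
    qed
  qed
  define W where "W = {w \<in> kchains ?n (D (e - int (Suc p))) (Suc p). ?ds w \<in> kchains ?n (N (e - int p)) p}"
  have W: "ksub (fsc s) W" "fdim (kspan (fsc s)) W"
  proof -
    interpret l: Vector_Spaces.linear "\<lambda>c. fsc s (cst c)" "\<lambda>c. fsc s (cst c)" ?ds by (rule lind)
    have "W = kchains ?n (D (e - int (Suc p))) (Suc p) \<inter> (?ds -` kchains ?n (N (e - int p)) p)"
      unfolding W_def by blast
    then show "ksub (fsc s) W"
      using fa.k.subspace_inter[OF subspace_kchains[OF s D(1)] l.subspace_vimage[OF subspace_kchains[OF s N(1)]]]
      by simp
    show "fdim (kspan (fsc s)) W"
      by (rule fdim_mono[OF fdim_kchains[OF s D(2)]]) (auto simp: W_def)
  qed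
  have img\<Phi>: "\<Phi> ` W = ZZ t M (Suc p) e"
  proof (intro equalityI subsetI)
    fix z assume "z \<in> \<Phi> ` W"
    then obtain w where w: "w \<in> W" "z = \<Phi> w" by blast
    then have "?dt z = 0" unfolding w(2) \<Phi>_kos using NK unfolding W_def by blast
    then show "z \<in> ZZ t M (Suc p) e" unfolding ZZ_def w(2) using \<Phi>_chain w(1) unfolding W_def by blast
  next
    fix z assume z: "z \<in> ZZ t M (Suc p) e"
    then obtain w where w: "w \<in> kchains ?n (D (e - int (Suc p))) (Suc p)" "\<Phi> w = z"
      using lift unfolding ZZ_def by blast
    have "\<Phi> (?ds w) = 0" using z unfolding \<Phi>_kos[symmetric] w(2) ZZ_def by blast
    then have "?ds w \<in> kchains ?n (N (e - int p)) p"
      by (rule kerN[OF kos_graded[OF s D(1) w(1)]])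
    then show "z \<in> \<Phi> ` W" using w unfolding W_def by blast
  qed
  have imgd: "?ds ` W = ZZ s N p e"
  proof (intro equalityI subsetI)
    fix z assume "z \<in> ?ds ` W"
    then show "z \<in> ZZ s N p e" unfolding W_def ZZ_def using a.kos_kos by blast
  next
    fix z assume z: "z \<in> ZZ s N p e"
    then have zN: "z \<in> kchains ?n (N (e - int p)) p" unfolding ZZ_def by blast
    \<comment> \<open>For p > 0 the complex of \<open>D\<close> has no homology. For p = 0 its
      homology is D/mD, and minimality takes over: \<open>z {}\<close> is a combination of the
      variables, hence the boundary of a 1-chain with coefficients \<open>g\<close>.\<close>
    have "\<exists>w\<in>kchains ?n (D (e - int (Suc p))) (Suc p). z = ?ds w"
    proof (cases "0 < p")
      case True
      have "z \<in> ZZ s D p e" using z NK unfolding ZZ_def by blast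
      then show ?thesis using acyclic[OF True] unfolding BB_def by blast
    next
      case False
      then have p: "p = 0" by simp
      have "z {} \<in> N e" using kchainsD[OF zN, of "{}"] p by simp
      then obtain g where g: "z {} = (\<Sum>l<?n. s (xv l) (g l))" "\<And>l. g l \<in> D (e - 1)"
        using minimal unfolding mpart_def by blast
      define w where "w T = (if T \<subseteq> {..<?n} \<and> card T = 1 then g (the_elem T) else 0)" for T
      have w: "w \<in> kchains ?n (D (e - int (Suc p))) (Suc p)"
        using g(2) p by (intro kchainsI) (auto simp: w_def)
      have "z = ?ds w"
      proof (rule ext)
        fix T
        show "z T = ?ds w T"
        proof (cases "T = {}")
          case True
          have "?ds w {} = (\<Sum>l<?n. s (xv l) (g l))"
            unfolding kos_def by (intro sum.cong refl) (simp add: w_def ksign_def)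
          then show ?thesis using g(1) True by simp
        next
          case False
          then have "\<not> (T \<subseteq> {..<?n} \<and> card T = p)"
            unfolding p using finite_subset[of T "{..<?n}"] by (metis card_0_eq finite_lessThan)
          then show ?thesis
            using kchains_outside[OF zN] kchains_outside[OF kos_graded[OF s D(1) w]] by simp
        qed
      qed
      then show ?thesis using w by blast
    qed
    then show "z \<in> ?ds ` W" using zN unfolding W_def by blast
  qed
  \<comment> \<open>If the image of w in M is a boundary, lift the bounding chain to D: up to a
    boundary, w then has coefficients in N. Conversely, if w and a chain of N have the same
    boundary, their difference is a cycle of D in chain degree p + 1, hence a boundary.\<close>
  have same: "{w \<in> W. \<Phi> w \<in> BB t M (Suc p) e} = {w \<in> W. ?ds w \<in> BB s N p e}"
  proof (intro equalityI subsetI)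
    fix w assume "w \<in> {w \<in> W. \<Phi> w \<in> BB t M (Suc p) e}"
    then have w: "w \<in> W" "\<Phi> w \<in> BB t M (Suc p) e" by auto
    then obtain y where y: "y \<in> kchains ?n (M (e - int (Suc (Suc p)))) (Suc (Suc p))" "\<Phi> w = ?dt y"
      unfolding BB_def by blast
    obtain y' where y': "y' \<in> kchains ?n (D (e - int (Suc (Suc p)))) (Suc (Suc p))" "\<Phi> y' = y"
      using lift[OF y(1)] by blast
    have "w - ?ds y' \<in> kchains ?n (D (e - int (Suc p))) (Suc p)"
      using w(1) kos_graded[OF s D(1) y'(1)] unfolding W_def
      by (intro opsub_diff[OF opsub_kchains[OF gmod_opsub[OF D(1)]]]) blast+
    moreover have "\<Phi> (w - ?ds y') = 0"
      unfolding \<Phi>_diff y(2) \<Phi>_kos[symmetric] y'(2) by simp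
    ultimately have "w - ?ds y' \<in> kchains ?n (N (e - int (Suc p))) (Suc p)" by (rule kerN)
    moreover have "?ds w = ?ds (w - ?ds y')" by (simp only: a.kos_diff a.kos_kos diff_0_right)
    ultimately show "w \<in> {w \<in> W. ?ds w \<in> BB s N p e}" using w(1) unfolding BB_def by blast
  next
    fix w assume "w \<in> {w \<in> W. ?ds w \<in> BB s N p e}"
    then have w: "w \<in> W" "?ds w \<in> BB s N p e" by auto
    then obtain y where y: "y \<in> kchains ?n (N (e - int (Suc p))) (Suc p)" "?ds w = ?ds y"
      unfolding BB_def by blast
    have yD: "\<Phi> y = 0" "y \<in> kchains ?n (D (e - int (Suc p))) (Suc p)" using NK[OF y(1)] by auto
    have "w - y \<in> kchains ?n (D (e - int (Suc p))) (Suc p)"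
      using w(1) yD(2) unfolding W_def
      by (intro opsub_diff[OF opsub_kchains[OF gmod_opsub[OF D(1)]]]) blast+
    moreover have "?ds (w - y) = 0" by (simp only: a.kos_diff y(2) diff_self)
    ultimately have "w - y \<in> BB s D (Suc p) e" using acyclic[of "Suc p" e] unfolding ZZ_def by blast
    then obtain x where x: "x \<in> kchains ?n (D (e - int (Suc (Suc p)))) (Suc (Suc p))" "w - y = ?ds x"
      unfolding BB_def by blast
    have "\<Phi> w = \<Phi> (w - y)" by (simp only: \<Phi>_diff yD(1) diff_0_right)
    also have "\<dots> = ?dt (\<Phi> x)" unfolding x(2) \<Phi>_kos ..
    finally show "w \<in> {w \<in> W. \<Phi> w \<in> BB t M (Suc p) e}"
      using w(1) \<Phi>_chain[OF x(1)] unfolding BB_def by blast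
  qed
  interpret p1: vector_space_pair "\<lambda>c. fsc s (cst c) :: (nat set \<Rightarrow> 'v) \<Rightarrow> _" "\<lambda>c. fsc t (cst c) :: (nat set \<Rightarrow> 'w) \<Rightarrow> _"
    by (intro vector_space_pair.intro fa.k.vector_space_axioms fb.k.vector_space_axioms)
  interpret p2: vector_space_pair "\<lambda>c. fsc s (cst c) :: (nat set \<Rightarrow> 'v) \<Rightarrow> _" "\<lambda>c. fsc s (cst c) :: (nat set \<Rightarrow> 'v) \<Rightarrow> _"
    by (intro vector_space_pair.intro fa.k.vector_space_axioms fb.k.vector_space_axioms)
  show ?thesis
    unfolding hb_def
    using p1.dim_quotient_preimage[OF lin\<Phi> W img\<Phi> subspace_BB[OF t M(1)] BB_subset_ZZ[OF t M(1)]]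
      p2.dim_quotient_preimage[OF lind W imgd subspace_BB[OF s N(1)] BB_subset_ZZ[OF s N(1)]] same
    by simp
qed

declare mult.scale_scale [simp del]

section \<open>Subrings of a commutative ring and their ideals\<close>

definition subrng :: "'a::comm_ring_1 set \<Rightarrow> bool" where
  "subrng S \<longleftrightarrow> opsub {} S \<and> 1 \<in> S \<and> (\<forall>a\<in>S. \<forall>b\<in>S. a * b \<in> S)"

text \<open>Rings with explicit carrier are restricted to subsets of a type with its own operations;
  the lemmas below translate their ideals into closure conditions on sets.\<close>

abbreviation sring :: "'a::comm_ring_1 set \<Rightarrow> 'a ring" where
  "sring S \<equiv> ring_of_type_algebra\<lparr>carrier := S\<rparr>"

lemma sring_simps:
  "carrier (sring S) = S" "(x \<otimes>\<^bsub>sring S\<^esub> y) = x * y" "(x \<oplus>\<^bsub>sring S\<^esub> y) = x + y"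
  "\<one>\<^bsub>sring S\<^esub> = 1" "\<zero>\<^bsub>sring S\<^esub> = 0"
  "(x \<otimes>\<^bsub>ring_of_type_algebra\<^esub> y) = x * y" "(x \<oplus>\<^bsub>ring_of_type_algebra\<^esub> y) = x + y"
  by (simp_all add: ring_of_type_algebra_def)

lemma subrng_UNIV: "subrng UNIV"
  by (simp add: subrng_def opsub_def)

lemma sring_UNIV: "sring UNIV = ring_of_type_algebra"
  by (simp add: ring_of_type_algebra_def)

lemma cring_sring:
  assumes "subrng S" shows "cring (sring S)"
proof -
  have S: "opsub {} S" "1 \<in> S" "\<And>a b. a \<in> S \<Longrightarrow> b \<in> S \<Longrightarrow> a * b \<in> S"
    using assms unfolding subrng_def by blast+
  have inv: "\<exists>y\<in>S. y + x = 0" if "x \<in> S" for x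
    by (rule bexI[OF _ opsub_uminus[OF S(1) that]]) simp
  show ?thesis
    by (intro cringI abelian_groupI comm_monoidI; unfold sring_simps)
      (assumption | rule opsub_0[OF S(1)] opsub_add[OF S(1)] S(2,3) inv add.assoc add.commute
        mult.assoc mult.commute distrib_right add_0_left mult_1_left)+
qed

lemma ideal_sring_iff:
  assumes "subrng S"
  shows "ideal J (sring S) \<longleftrightarrow> J \<subseteq> S \<and> opsub {} J \<and> (\<forall>a\<in>S. \<forall>b\<in>J. a * b \<in> J)"
proof -
  interpret cring "sring S" by (rule cring_sring[OF assms])
  have S: "opsub {} S" "1 \<in> S" using assms unfolding subrng_def by blast+
  have neg: "\<ominus>\<^bsub>sring S\<^esub> x = - x" if "x \<in> S" for x
    using minus_equality[of "- x" x] that opsub_uminus[OF S(1) that] by (simp add: sring_simps)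
  show ?thesis
  proof (intro iffI conjI ballI)
    assume J: "ideal J (sring S)"
    interpret ideal J "sring S" by (rule J)
    show JS: "J \<subseteq> S" using Icarr by (auto simp: sring_simps)
    show "opsub {} J" unfolding opsub_def
    proof (intro conjI ballI)
      show "0 \<in> J" using zero_closed by (simp add: sring_simps)
      fix u v assume *: "u \<in> J" "v \<in> J"
      have "- v \<in> J" unfolding neg[symmetric, OF subsetD[OF JS *(2)]] by (rule a_inv_closed[OF *(2)])
      then show "u - v \<in> J" using a_closed[OF *(1), of "- v"] unfolding sring_simps by simp
    qed simp
    show "a * b \<in> J" if "a \<in> S" "b \<in> J" for a b
      using I_l_closed[of b a] that unfolding sring_simps by blast
  next
    assume J: "J \<subseteq> S \<and> opsub {} J \<and> (\<forall>a\<in>S. \<forall>b\<in>J. a * b \<in> J)"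
    show "ideal J (sring S)"
    proof (rule idealI)
      show "ring (sring S)" by (rule ring_axioms)
      show "subgroup J (add_monoid (sring S))"
      proof
        show "J \<subseteq> carrier (add_monoid (sring S))" using J by (simp add: sring_simps)
        have J': "opsub {} J" using J by blast
        show "x \<otimes>\<^bsub>add_monoid (sring S)\<^esub> y \<in> J" if "x \<in> J" "y \<in> J" for x y
          using opsub_add[OF J' that] by (simp add: sring_simps)
        show "\<one>\<^bsub>add_monoid (sring S)\<^esub> \<in> J" using opsub_0[OF J'] by (simp add: sring_simps)
        show "inv\<^bsub>add_monoid (sring S)\<^esub> x \<in> J" if "x \<in> J" for x
        proof -
          have "x \<in> S" using J that by blast
          then show ?thesis
            using opsub_uminus[OF J' that] by (simp only: neg a_inv_def[symmetric])
        qed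
      qed
      show "x \<otimes>\<^bsub>sring S\<^esub> a \<in> J" if "a \<in> J" "x \<in> carrier (sring S)" for a x
        using that J unfolding sring_simps by blast
      show "a \<otimes>\<^bsub>sring S\<^esub> x \<in> J" if "a \<in> J" "x \<in> carrier (sring S)" for a x
        using that J unfolding sring_simps mult.commute[of a] by blast
    qed
  qed
qed

lemma ideal_type_algebra_iff: "ideal J (ring_of_type_algebra :: 'a::comm_ring_1 ring) \<longleftrightarrow> mult.subspace J"
proof -
  have "opsub {} J" if "mult.subspace J"
    unfolding opsub_def using mult.subspace_0[OF that] mult.subspace_diff[OF that] by blast
  moreover have "mult.subspace J" if "opsub {} J" "\<forall>a. \<forall>b\<in>J. a * b \<in> J"
    unfolding mult.subspace_def using opsub_0[OF that(1)] opsub_add[OF that(1)] that(2) by blast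
  ultimately show ?thesis
    using ideal_sring_iff[OF subrng_UNIV, of J] mult.subspace_scale[of J] unfolding sring_UNIV by blast
qed

lemma genideal_eq_span: "genideal (ring_of_type_algebra :: 'a::comm_ring_1 ring) S = mult.span S"
proof -
  interpret ring "ring_of_type_algebra :: 'a ring"
    using cring.axioms(1)[OF cring_sring[OF subrng_UNIV]] unfolding sring_UNIV .
  have S: "S \<subseteq> carrier (ring_of_type_algebra :: 'a ring)" by (simp add: ring_of_type_algebra_def)
  show ?thesis
  proof
    show "genideal ring_of_type_algebra S \<subseteq> mult.span S"
      by (rule genideal_minimal) (auto simp: ideal_type_algebra_iff mult.span_base)
    show "mult.span S \<subseteq> genideal ring_of_type_algebra S"
      using genideal_ideal[OF S] genideal_self[OF S]
      by (intro mult.span_minimal) (auto simp: ideal_type_algebra_iff)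
  qed
qed

lemma irrelevant_ideal_eq_span: "irrelevant_ideal = mult.span (range mvar)"
  unfolding irrelevant_ideal_def genideal_eq_span ..

lemma irrelevant_ideal_mvar: "mvar i * a \<in> irrelevant_ideal"
  unfolding irrelevant_ideal_eq_span
  by (subst mult.commute) (intro mult.span_scale mult.span_base rangeI)

lemma irrelevant_ideal_cases:
  assumes "a \<in> irrelevant_ideal"
  shows "\<exists>g. a = (\<Sum>l<CARD('n). xv l * g l)"
    "Poly_Mapping.lookup (a :: ('n::finite, 'k::field) mpoly) 0 = 0"
proof -
  let ?M = "{\<Sum>l<CARD('n). xv l * g l | g :: nat \<Rightarrow> ('n, 'k) mpoly. True}"
  have "mult.subspace ?M"
    unfolding mult.subspace_def
  proof (intro conjI ballI allI)
    show "0 \<in> ?M" by (intro CollectI exI[of _ "\<lambda>_. 0"]) simp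
    fix u assume "u \<in> ?M"
    then obtain g where g: "u = (\<Sum>l<CARD('n). xv l * g l)" by blast
    show "c * u \<in> ?M" for c unfolding g
      by (intro CollectI exI[of _ "\<lambda>l. c * g l"]) (simp add: sum_distrib_left ac_simps)
    fix v assume "v \<in> ?M"
    then obtain h where h: "v = (\<Sum>l<CARD('n). xv l * h l)" by blast
    show "u + v \<in> ?M" unfolding g h
      by (intro CollectI exI[of _ "\<lambda>l. g l + h l"]) (simp add: distrib_left sum.distrib)
  qed
  moreover have "range mvar \<subseteq> ?M"
  proof clarify
    fix i :: 'n
    obtain m where m: "m < CARD('n)" "i = ix m" using ix_surj by blast
    show "\<exists>g :: nat \<Rightarrow> ('n, 'k) mpoly. mvar i = (\<Sum>l<CARD('n). xv l * g l) \<and> True"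
      using m by (intro exI[of _ "\<lambda>l. if l = m then 1 else 0"])
        (simp add: if_distrib[of "\<lambda>x. _ * x"] cong: if_cong)
  qed
  ultimately have "irrelevant_ideal \<subseteq> ?M"
    unfolding irrelevant_ideal_eq_span by (intro mult.span_minimal)
  then obtain g where g: "a = (\<Sum>l<CARD('n). xv l * g l)" using assms by blast
  then show "\<exists>g. a = (\<Sum>l<CARD('n). xv l * g l)" by blast
  have "Poly_Mapping.lookup (xv l * g l) 0 = 0" for l
  proof -
    have "hpart 0 (xv l * g l) = xv l * hpart (0 - 1) (g l)" by (rule hpart_mult[OF mvar_in_forms])
    also have "hpart (0 - 1) (g l) = 0" using forms_neg[OF _ hpart_in_forms[of "0 - 1"]] by simp
    finally have "Poly_Mapping.lookup (hpart 0 (xv l * g l)) 0 = 0" by simp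
    then show ?thesis by (simp add: lookup_rst)
  qed
  then show "Poly_Mapping.lookup a 0 = 0" unfolding g lookup_sum by simp
qed

section \<open>Minimal graded free resolutions\<close>

abbreviation (input) vsc :: "('n::finite, 'k::field) mpoly \<Rightarrow> (nat \<Rightarrow> ('n, 'k) mpoly) \<Rightarrow> nat \<Rightarrow> ('n, 'k) mpoly" where
  "vsc \<equiv> \<lambda>a v i. a * v i"

lemma amod_vsc: "amod vsc"
  by (rule amod_fun[OF amod_mult])

lemma in_gfree_component:
  "v \<in> gfree_component bs e \<longleftrightarrow> (\<forall>i<length bs. v i \<in> forms (e - bs ! i)) \<and> (\<forall>i\<ge>length bs. v i = 0)"
  unfolding gfree_component_def gfree_def by blast

lemma forms_mult': "f \<in> forms a \<Longrightarrow> g \<in> forms b \<Longrightarrow> c = a + b \<Longrightarrow> f * g \<in> forms c"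
  using forms_mult by blast

lemma gmod_gfree: "gmod vsc (gfree_component bs :: int \<Rightarrow> (nat \<Rightarrow> ('n::finite, 'k::field) mpoly) set)"
  unfolding gmod_def
proof (intro conjI allI ballI)
  show "opsub {} (gfree_component bs e :: (nat \<Rightarrow> ('n, 'k) mpoly) set)" for e
    unfolding opsub_def
    by (intro conjI ballI) (auto simp: in_gfree_component opsub_0[OF opsub_forms] intro!: opsub_diff[OF opsub_forms])
  fix i e and a :: "('n, 'k) mpoly" and u :: "nat \<Rightarrow> ('n, 'k) mpoly"
  assume "a \<in> forms i" "u \<in> gfree_component bs e"
  then show "(\<lambda>j. a * u j) \<in> gfree_component bs (e + i)"
    unfolding in_gfree_component by (auto intro!: forms_mult'[of a i])
qed

lemma fdim_gfree: "fdim (kspan vsc) (gfree_component bs e :: (nat \<Rightarrow> ('n::finite, 'k::field) mpoly) set)"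
proof -
  have "fdim (kspan vsc) {v :: nat \<Rightarrow> ('n, 'k) mpoly. (\<forall>i\<in>{..<length bs}. v i \<in> forms (e - bs ! i)) \<and> (\<forall>i. i \<notin> {..<length bs} \<longrightarrow> v i = 0)}"
    by (rule fdim_fun[OF amod_mult]) (auto intro: fdim_forms)
  then show ?thesis by (rule fdim_mono) (auto simp: in_gfree_component)
qed

lemma kos_fun_apply: "kos (fsc s) n x v T i = kos s n x (\<lambda>T. v T i) T"
  unfolding kos_def sum_fun_apply by (intro sum.cong refl) simp

lemma hpart_kos:
  fixes w :: "nat set \<Rightarrow> ('n::finite, 'k::field) mpoly"
  shows "kos (*) CARD('n) xv (\<lambda>T. hpart a (w T)) T = hpart (a + 1) (kos (*) CARD('n) xv w T)"
  unfolding kos_def rst_sum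
proof (intro sum.cong refl)
  fix l
  have "ksign l T * xv l \<in> (forms 1 :: ('n, 'k) mpoly set)"
    using mult.ksign_scale_mem[OF opsub_forms mvar_in_forms] .
  then show "(if l \<in> T then 0 else ksign l T * xv l * hpart a (w (insert l T)))
    = hpart (a + 1) (if l \<in> T then 0 else ksign l T * xv l * w (insert l T))"
    by (simp add: hpart_mult)
qed

text \<open>Each coordinate is a cycle over the polynomial ring and bounds there, without control of
  degrees. Cutting the bounding chain down to degree e - p - 1 - b_i in coordinate i restores
  homogeneity, because the differential raises coefficient degrees by one.\<close>

lemma koszul_acyclic_gfree:
  assumes "0 < p"
  shows "ZZ vsc (gfree_component bs) p e \<subseteq> BB vsc (gfree_component bs :: int \<Rightarrow> (nat \<Rightarrow> ('n::finite, 'k::field) mpoly) set) p e"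
proof
  let ?n = "CARD('n)"
  let ?G = "gfree_component bs :: int \<Rightarrow> (nat \<Rightarrow> ('n, 'k) mpoly) set"
  fix v assume "v \<in> ZZ vsc ?G p e"
  then have v: "v \<in> kchains ?n (?G (e - int p)) p" "kos vsc ?n xv v = 0" unfolding ZZ_def by blast+
  have "\<exists>w\<in>kchains ?n UNIV (Suc p). (\<lambda>T. v T i) = kos (*) ?n xv w" for i
  proof (rule koszul_acyclic_mpoly[OF _ assms])
    show "(\<lambda>T. v T i) \<in> kchains ?n UNIV p"
      using kchains_outside[OF v(1)] by (intro kchainsI) auto
    show "kos (*) ?n xv (\<lambda>T. v T i) = 0"
    proof (rule ext)
      show "kos (*) ?n xv (\<lambda>T. v T i) T = 0 T" for T
        using v(2) kos_fun_apply[of "(*)" ?n xv v T i] by simp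
    qed
  qed
  then obtain w where w: "\<And>i. w i \<in> kchains ?n UNIV (Suc p)" "\<And>i. (\<lambda>T. v T i) = kos (*) ?n xv (w i)"
    by metis
  define y where "y T i = (if i < length bs then hpart (e - int (Suc p) - bs ! i) (w i T) else 0)" for T i
  have "y \<in> kchains ?n (?G (e - int (Suc p))) (Suc p)"
  proof (rule kchainsI)
    show "y T \<in> ?G (e - int (Suc p))" for T
      unfolding in_gfree_component y_def by (simp add: hpart_in_forms)
    show "y T = 0" if "\<not> (T \<subseteq> {..<?n} \<and> card T = Suc p)" for T
      by (rule ext) (simp add: y_def kchains_outside[OF w(1) that])
  qed
  moreover have "kos vsc ?n xv y = v"
  proof (intro ext)
    fix T i
    show "kos vsc ?n xv y T i = v T i"
    proof (cases "i < length bs")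
      case True
      have "kos vsc ?n xv y T i = kos (*) ?n xv (\<lambda>T. hpart (e - int (Suc p) - bs ! i) (w i T)) T"
        unfolding kos_fun_apply using True by (simp add: y_def)
      also have "\<dots> = hpart (e - int p - bs ! i) (v T i)"
        unfolding hpart_kos w(2)[symmetric] by (simp add: algebra_simps)
      also have "\<dots> = v T i"
      proof (cases "T \<subseteq> {..<?n} \<and> card T = p")
        case T: True
        then have "v T i \<in> forms (e - int p - bs ! i)"
          using kchainsD[OF v(1)] True unfolding in_gfree_component by blast
        then show ?thesis by (simp add: hpart_forms)
      next
        case False
        then have "v T = 0" by (rule kchains_outside[OF v(1)])
        then show ?thesis by simp
      qed
      finally show ?thesis .
    next
      case False
      have "v T i = 0"
      proof (cases "T \<subseteq> {..<?n} \<and> card T = p")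
        case True
        then have "v T \<in> ?G (e - int p)" using kchainsD[OF v(1)] by blast
        then show ?thesis using False by (simp add: in_gfree_component)
      next
        case F: False
        then have "v T = 0" by (rule kchains_outside[OF v(1)])
        then show ?thesis by simp
      qed
      moreover have "kos vsc ?n xv y T i = 0"
        unfolding kos_fun_apply unfolding y_def kos_def using False by (simp add: sum.neutral)
      ultimately show ?thesis by simp
    qed
  qed
  ultimately show "v \<in> BB vsc ?G p e" unfolding BB_def by blast
qed

text \<open>In chain degree zero everything is a cycle; evaluation at the empty set is injective and
  maps cycles onto M_e and boundaries onto the degree e part of mM.\<close>

lemma (in amod) hb_0:
  assumes M: "gmod s M" "\<And>e. fdim (kspan s) (M e)"
  shows "hb s M 0 e = int (k.dim (M e)) - int (k.dim (mpart s M e))"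
    and subspace_mpart: "k.subspace (mpart s M e)"
proof -
  have s: "amod s" by unfold_locales
  interpret f: amod "fsc s :: _ \<Rightarrow> (nat set \<Rightarrow> 'v) \<Rightarrow> _" by (rule amod_fun[OF s])
  define E :: "(nat set \<Rightarrow> 'v) \<Rightarrow> 'v" where "E v = v {}" for v
  have lin: "klinear (fsc s) s E" by (intro klinearI amod_fun s) (auto simp: E_def)
  interpret l: Vector_Spaces.linear "\<lambda>c. (fsc s (cst c) :: (nat set \<Rightarrow> 'v) \<Rightarrow> _)" "\<lambda>c. s (cst c)" E by (rule lin)
  interpret p: vector_space_pair "\<lambda>c. (fsc s (cst c) :: (nat set \<Rightarrow> 'v) \<Rightarrow> _)" "\<lambda>c. s (cst c)"
    by (intro vector_space_pair.intro f.k.vector_space_axioms k.vector_space_axioms)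
  have ZK: "ZZ s M 0 e \<subseteq> kchains CARD('n) (M e) 0" unfolding ZZ_def by simp
  have ker: "{v \<in> Z. E v = 0} = {0}" if Z: "Z \<subseteq> kchains CARD('n) (M e) 0" "0 \<in> Z" for Z
  proof -
    have "v = 0" if "v \<in> Z" "E v = 0" for v
    proof (rule ext)
      fix T
      have v: "v \<in> kchains CARD('n) (M e) 0" using that Z by blast
      show "v T = 0 T"
      proof (cases "T = {}")
        case False
        then have "\<not> (T \<subseteq> {..<CARD('n)} \<and> card T = 0)"
          using finite_subset[of T "{..<CARD('n)}"] by (metis card_0_eq finite_lessThan)
        then show ?thesis using kchains_outside[OF v] by simp
      qed (use that in \<open>simp add: E_def\<close>)
    qed
    then show ?thesis using Z(2) l.zero by blast
  qed
  have dim0: "f.k.dim {0 :: nat set \<Rightarrow> 'v} = 0"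
    using f.k.dim_eq_card_independent[OF f.k.independent_empty] f.k.dim_span[of "{}"]
    by (simp add: f.k.span_empty)
  have dimE: "f.k.dim Z = k.dim (E ` Z)" if "Z \<subseteq> ZZ s M 0 e" "f.k.subspace Z" for Z
  proof -
    have "Z \<subseteq> kchains CARD('n) (M e) 0" using that ZK by blast
    moreover have "fdim (kspan (fsc s)) Z"
      by (rule fdim_mono[OF fdim_ZZ[OF s M(2)] that(1)])
    ultimately show ?thesis
      using p.rank_nullity[OF lin that(2)] ker[OF _ f.k.subspace_0[OF that(2)]] dim0 by simp
  qed
  have "E ` ZZ s M 0 e = M e"
  proof (intro equalityI subsetI)
    fix u assume "u \<in> E ` ZZ s M 0 e"
    then show "u \<in> M e" using ZK kchainsD[of _ "CARD('n)" "M e" 0 "{}"] unfolding E_def by auto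
  next
    fix u assume u: "u \<in> M e"
    define v where "v T = (if T = {} then u else 0)" for T :: "nat set"
    have v: "v \<in> kchains CARD('n) (M e) 0"
      using u finite_subset[of _ "{..<CARD('n)}"] by (intro kchainsI) (auto simp: v_def)
    then have "v \<in> ZZ s M 0 e" unfolding ZZ_def using kos_kchains_0 by simp
    moreover have "E v = u" by (simp add: E_def v_def)
    ultimately show "u \<in> E ` ZZ s M 0 e" by blast
  qed
  moreover have EB: "E ` BB s M 0 e = mpart s M e"
  proof (intro equalityI subsetI)
    fix u assume "u \<in> E ` BB s M 0 e"
    then obtain v where v: "v \<in> kchains CARD('n) (M (e - 1)) 1" "u = kos s CARD('n) xv v {}"
      unfolding BB_def E_def by auto
    have u: "u = (\<Sum>l<CARD('n). s (xv l) (if l < CARD('n) then v {l} else 0))"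
      unfolding v(2) kos_def by (intro sum.cong refl) (simp add: ksign_def)
    have "\<forall>l. (if l < CARD('n) then v {l} else 0) \<in> M (e - 1)"
      using kchainsD[OF v(1)] opsub_0[OF gmod_opsub[OF M(1)]] by simp
    then show "u \<in> mpart s M e"
      unfolding mpart_def using u by (intro CollectI exI[of _ "\<lambda>l. if l < CARD('n) then v {l} else 0"] conjI)
  next
    fix u assume "u \<in> mpart s M e"
    then obtain g where g: "u = (\<Sum>l<CARD('n). s (xv l) (g l))" "\<And>l. g l \<in> M (e - 1)"
      unfolding mpart_def by blast
    define w where "w T = (if T \<subseteq> {..<CARD('n)} \<and> card T = 1 then g (the_elem T) else 0)" for T
    have w: "w \<in> kchains CARD('n) (M (e - int (Suc 0))) (Suc 0)"
      using g(2) by (intro kchainsI) (auto simp: w_def)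
    have "kos s CARD('n) xv w {} = u"
      unfolding kos_def g(1) by (intro sum.cong refl) (simp add: w_def ksign_def)
    then show "u \<in> E ` BB s M 0 e" unfolding BB_def E_def using w by blast
  qed
  ultimately show "hb s M 0 e = int (k.dim (M e)) - int (k.dim (mpart s M e))"
    unfolding hb_def using dimE[OF order_refl subspace_ZZ[OF s M(1)]]
      dimE[OF BB_subset_ZZ[OF s M(1)] subspace_BB[OF s M(1)]] by simp
  show "k.subspace (mpart s M e)"
    unfolding EB[symmetric] by (rule l.subspace_image[OF subspace_BB[OF s M(1)]])
qed

section \<open>Minimal covers by graded free modules and their kernels\<close>

definition comb :: "(('n::finite, 'k::field) mpoly \<Rightarrow> 'v::ab_group_add \<Rightarrow> 'v) \<Rightarrow> int list \<Rightarrow> (nat \<Rightarrow> 'v)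
    \<Rightarrow> (nat \<Rightarrow> ('n, 'k) mpoly) \<Rightarrow> 'v" where
  "comb s cs g v = (\<Sum>i<length cs. s (v i) (g i))"

text \<open>\<open>comb s cs g\<close> sends the i-th basis vector, of degree \<open>cs ! i\<close>,
  to \<open>g i\<close>. The last clause is minimality: homogeneous relations have all coefficients
  in m.\<close>

definition cover :: "(('n::finite, 'k::field) mpoly \<Rightarrow> 'v::ab_group_add \<Rightarrow> 'v) \<Rightarrow> int list \<Rightarrow> (int \<Rightarrow> 'v set)
    \<Rightarrow> (nat \<Rightarrow> 'v) \<Rightarrow> bool" where
  "cover s cs M g \<longleftrightarrow> (\<forall>i<length cs. g i \<in> M (cs ! i)) \<and>
     (\<forall>e. comb s cs g ` gfree_component cs e = M e) \<and>
     (\<forall>e. {v \<in> gfree_component cs e. comb s cs g v = 0} \<subseteq> mpart vsc (gfree_component cs) e)"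

lemma mpart_subset:
  fixes s :: "('n::finite, 'k::field) mpoly \<Rightarrow> 'v::ab_group_add \<Rightarrow> 'v"
  assumes M: "gmod s M" shows "mpart s M e \<subseteq> M e"
proof
  fix u assume "u \<in> mpart s M e"
  then obtain g where g: "u = (\<Sum>l<CARD('n). s (xv l) (g l))" "\<And>l. g l \<in> M (e - 1)"
    unfolding mpart_def by blast
  show "u \<in> M e" unfolding g(1)
    by (rule opsub_sum[OF gmod_opsub[OF M]]) (rule gmod_scale[OF M mvar_in_forms g(2)], simp)
qed

context amod
begin

lemma amod: "amod s"
  by unfold_locales

lemma comb_add: "comb s cs g (u + v) = comb s cs g u + comb s cs g v"
  unfolding comb_def by (simp add: scale_left_distrib sum.distrib)

lemma comb_scale: "comb s cs g (\<lambda>i. a * v i) = s a (comb s cs g v)"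
  unfolding comb_def by (simp add: scale_sum_right)

lemma comb_sum: "comb s cs g (\<Sum>i\<in>I. f i) = (\<Sum>i\<in>I. comb s cs g (f i))"
proof -
  have "additive (comb s cs g)" unfolding additive_def using comb_add by blast
  then show ?thesis by (rule additive.sum)
qed

lemma comb_mem:
  assumes M: "gmod s M" and g: "\<forall>i<length cs. g i \<in> M (cs ! i)" and v: "v \<in> gfree_component cs e"
  shows "comb s cs g v \<in> M e"
  unfolding comb_def
proof (rule opsub_sum[OF gmod_opsub[OF M]])
  fix i assume "i \<in> {..<length cs}"
  then have "v i \<in> forms (e - cs ! i)" "g i \<in> M (cs ! i)" using g v by (auto simp: in_gfree_component)
  then show "s (v i) (g i) \<in> M e" by (rule gmod_scale[OF M]) simp
qed

text \<open>Lift a basis of \<open>M/\<mm>M\<close>; surjectivity is the graded Nakayama lemma.\<close>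

lemma minimal_cover:
  assumes M: "gmod s M" "\<And>e. fdim (kspan s) (M e)" and bd: "\<And>e. e < low \<Longrightarrow> M e = {0}"
    and cs: "\<And>e. int (count_list cs e) = hb s M 0 e"
  shows "\<exists>g. cover s cs M g"
proof -
  \<comment> \<open>The basis vectors of degree \<open>e\<close>. By the hypothesis on
    \<open>cs\<close> there are dim M_e - dim (mM)_e of them, so they can be matched with a basis
    modulo mM.\<close>
  define pos where "pos e = {i. i < length cs \<and> cs ! i = e}" for e
  have card_pos: "card (pos e) = count_list cs e" and fin_pos: "finite (pos e)" for e
    unfolding pos_def count_list_eq_length_filter length_filter_conv_card by (auto simp: eq_commute)
  define Q where "Q e S \<longleftrightarrow> finite S \<and> S \<subseteq> M e \<and> card S = card (pos e) \<and>
    (\<forall>v\<in>M e. \<exists>c. v - (\<Sum>b\<in>S. s (cst (c b)) b) \<in> mpart s M e) \<and>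
    (\<forall>c. (\<Sum>b\<in>S. s (cst (c b)) b) \<in> mpart s M e \<longrightarrow> (\<forall>b\<in>S. c b = 0))" for e S
  have "\<exists>S. Q e S" for e
  proof -
    obtain S where S: "finite S" "S \<subseteq> M e" "card S = k.dim (M e) - k.dim (mpart s M e)"
      "\<And>v. v \<in> M e \<Longrightarrow> \<exists>c. v - (\<Sum>b\<in>S. s (cst (c b)) b) \<in> mpart s M e"
      "\<And>c b. (\<Sum>b\<in>S. s (cst (c b)) b) \<in> mpart s M e \<Longrightarrow> b \<in> S \<Longrightarrow> c b = 0"
      by (rule k.quotient_basis[OF M(2) subspace_mpart[OF M] gmod_subspace[OF M(1)] mpart_subset[OF M(1)]]) blast
    have "card S = card (pos e)"
      unfolding card_pos S(3) using cs[of e] hb_0[OF M, of e] by linarith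
    then have "Q e S" unfolding Q_def
      by (intro conjI ballI allI impI) (assumption | rule S(1,2) S(4) S(5))+
    then show ?thesis by blast
  qed
  then have "\<forall>e. \<exists>S. Q e S" by blast
  then obtain S where Q: "\<forall>e. Q e (S e)" by (rule choice[THEN exE])
  have S: "finite (S e)" "S e \<subseteq> M e" "card (S e) = card (pos e)" for e
    using Q[rule_format, of e] unfolding Q_def by blast+
  have gen: "\<exists>c. v - (\<Sum>b\<in>S e. s (cst (c b)) b) \<in> mpart s M e" if "v \<in> M e" for e v
    using Q[rule_format, of e] that unfolding Q_def by blast
  have ind: "c b = 0" if "(\<Sum>b\<in>S e. s (cst (c b)) b) \<in> mpart s M e" "b \<in> S e" for e c b
    using Q[rule_format, of e] that unfolding Q_def by blast
  have "\<exists>h. bij_betw h (pos e) (S e)" for e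
    by (rule finite_same_card_bij[OF fin_pos S(1) S(3)[symmetric]])
  then have "\<forall>e. \<exists>h. bij_betw h (pos e) (S e)" by blast
  then obtain h where h': "\<forall>e. bij_betw (h e) (pos e) (S e)" by (rule choice[THEN exE])
  then have h: "bij_betw (h e) (pos e) (S e)" for e by blast
  define g where "g i = h (cs ! i) i" for i
  have gM: "\<forall>i<length cs. g i \<in> M (cs ! i)"
    using h S(2) unfolding g_def pos_def bij_betw_def by blast
  have pos_sum: "(\<Sum>i\<in>pos e. s (cst (c (g i))) (g i)) = (\<Sum>b\<in>S e. s (cst (c b)) b)" for e c
  proof -
    have "(\<Sum>i\<in>pos e. s (cst (c (g i))) (g i)) = (\<Sum>i\<in>pos e. s (cst (c (h e i))) (h e i))"
      by (intro sum.cong refl) (simp add: g_def pos_def)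
    also have "\<dots> = (\<Sum>b\<in>S e. s (cst (c b)) b)"
      by (rule sum.reindex_bij_betw[OF h, of "\<lambda>b. s (cst (c b)) b"])
    finally show ?thesis .
  qed
  \<comment> \<open>Induction on the degree, starting at the bound \<open>low\<close> below which
    \<open>M\<close> vanishes. The component in mM is a combination of elements of degree e - 1,
    which are covered already.\<close>
  have onto: "\<forall>e<low + int m. M e \<subseteq> comb s cs g ` gfree_component cs e" for m
  proof (induction m)
    case 0
    have "0 \<in> comb s cs g ` gfree_component cs e" for e
    proof (rule image_eqI)
      show "0 = comb s cs g 0" by (simp add: comb_def)
    qed (rule opsub_0[OF gmod_opsub[OF gmod_gfree]])
    then show ?case using bd by simp
  next
    case (Suc m)
    have "v \<in> comb s cs g ` gfree_component cs e" if v: "v \<in> M e" and e: "e < low + int (Suc m)" for e v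
    proof -
      obtain c where "v - (\<Sum>b\<in>S e. s (cst (c b)) b) \<in> mpart s M e" using gen[OF v] by blast
      then obtain u where u: "v - (\<Sum>b\<in>S e. s (cst (c b)) b) = (\<Sum>l<CARD('n). s (xv l) (u l))"
        "\<And>l. u l \<in> M (e - 1)" unfolding mpart_def by blast
      have "\<forall>l. \<exists>w. w \<in> gfree_component cs (e - 1) \<and> u l = comb s cs g w"
        using Suc.IH[rule_format, of "e - 1"] e u(2) by auto
      then obtain w where w: "\<And>l. w l \<in> gfree_component cs (e - 1)" "\<And>l. u l = comb s cs g (w l)"
        by metis
      define y :: "nat \<Rightarrow> ('n, 'k) mpoly" where "y i = (if i \<in> pos e then cst (c (g i)) else 0)" for i
      have y: "y \<in> gfree_component cs e"
        unfolding in_gfree_component y_def using opsub_0[OF opsub_forms] cst_in_forms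
        by (auto simp: pos_def)
      have "comb s cs g y = (\<Sum>i\<in>{..<length cs}. if i \<in> pos e then s (cst (c (g i))) (g i) else 0)"
        unfolding comb_def y_def by (intro sum.cong refl) auto
      also have "\<dots> = (\<Sum>i\<in>{..<length cs} \<inter> pos e. s (cst (c (g i))) (g i))"
        by (rule sum.inter_restrict[symmetric]) simp
      also have "{..<length cs} \<inter> pos e = pos e" by (auto simp: pos_def)
      finally have cy: "comb s cs g y = (\<Sum>b\<in>S e. s (cst (c b)) b)" unfolding pos_sum .
      let ?z = "y + (\<Sum>l<CARD('n). (\<lambda>i. xv l * w l i))"
      have "?z \<in> gfree_component cs e"
        by (intro opsub_add[OF gmod_opsub[OF gmod_gfree] y] opsub_sum[OF gmod_opsub[OF gmod_gfree]]
            gmod_scale[OF gmod_gfree mvar_in_forms w(1)]) simp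
      moreover have "comb s cs g ?z = v"
        unfolding comb_add comb_sum comb_scale cy w(2)[symmetric] u(1)[symmetric] by simp
      ultimately show ?thesis by blast
    qed
    then show ?case by blast
  qed
  have img: "comb s cs g ` gfree_component cs e = M e" for e
  proof
    show "M e \<subseteq> comb s cs g ` gfree_component cs e"
      using onto[of "nat (e - low + 1)", rule_format, of e] by simp
    show "comb s cs g ` gfree_component cs e \<subseteq> M e" using comb_mem[OF M(1) gM] by blast
  qed
  \<comment> \<open>In a relation of degree \<open>e\<close>, basis vectors of smaller degree have
    coefficients of positive degree and contribute to mM, and those of larger degree have
    coefficient zero. The remaining coefficients are constants; they vanish because the chosen
    generators are independent modulo mM.\<close>
  have ker: "v \<in> mpart vsc (gfree_component cs) e"
    if v: "v \<in> gfree_component cs e" "comb s cs g v = 0" for v e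
  proof -
    define c where "c b = Poly_Mapping.lookup (v (inv_into (pos e) (h e) b)) 0" for b
    have vform: "v i \<in> forms (e - cs ! i)" if "i < length cs" for i
      using v(1) that unfolding in_gfree_component by blast
    have "(\<Sum>i\<in>{..<length cs} - pos e. s (v i) (g i)) \<in> mpart s M e"
    proof (rule opsub_sum[OF subspace_imp_opsub[OF subspace_mpart[OF M]]])
      fix i assume i: "i \<in> {..<length cs} - pos e"
      then have ne: "cs ! i \<noteq> e" and il: "i < length cs" by (auto simp: pos_def)
      show "s (v i) (g i) \<in> mpart s M e"
      proof (cases "cs ! i < e")
        case True
        then obtain u where u: "\<And>l. u l \<in> forms (e - cs ! i - 1)" "v i = (\<Sum>l<CARD('n). xv l * u l)"
          using forms_pos_decomp[OF vform[OF il]] by auto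
        have "s (v i) (g i) = (\<Sum>l<CARD('n). s (xv l) (s (u l) (g i)))"
          unfolding u(2) scale_sum_left by simp
        moreover have "\<forall>l. s (u l) (g i) \<in> M (e - 1)"
        proof
          show "s (u l) (g i) \<in> M (e - 1)" for l
            by (rule gmod_scale[OF M(1) u(1) gM[rule_format, OF il]]) simp
        qed
        ultimately show ?thesis unfolding mpart_def
          by (intro CollectI exI[of _ "\<lambda>l. s (u l) (g i)"] conjI)
      next
        case False
        then have "v i = 0" using forms_neg[OF _ vform[OF il]] ne by simp
        then show ?thesis using opsub_0[OF subspace_imp_opsub[OF subspace_mpart[OF M]]] by simp
      qed
    qed
    then have "- (\<Sum>i\<in>{..<length cs} - pos e. s (v i) (g i)) \<in> mpart s M e"
      by (rule opsub_uminus[OF subspace_imp_opsub[OF subspace_mpart[OF M]]])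
    also have "- (\<Sum>i\<in>{..<length cs} - pos e. s (v i) (g i)) = (\<Sum>i\<in>pos e. s (v i) (g i))"
    proof -
      have "pos e \<subseteq> {..<length cs}" by (auto simp: pos_def)
      then show ?thesis using v(2) sum.subset_diff[of "pos e" "{..<length cs}" "\<lambda>i. s (v i) (g i)"]
        unfolding comb_def by (simp add: add_eq_0_iff)
    qed
    also have "\<dots> = (\<Sum>i\<in>pos e. s (cst (c (g i))) (g i))"
    proof (intro sum.cong refl)
      fix i assume i: "i \<in> pos e"
      then have "inv_into (pos e) (h e) (g i) = i"
        using h[of e] unfolding g_def bij_betw_def by (simp add: pos_def inv_into_f_f)
      moreover have "v i = cst (Poly_Mapping.lookup (v i) 0)"
        using vform[of i] i by (intro forms_0) (simp add: pos_def)
      ultimately show "s (v i) (g i) = s (cst (c (g i))) (g i)" by (simp add: c_def)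
    qed
    also have "\<dots> = (\<Sum>b\<in>S e. s (cst (c b)) b)" by (rule pos_sum)
    finally have zero: "c b = 0" if "b \<in> S e" for b
      by (rule ind) (rule that)
    have v0: "v i = 0" if "i \<in> pos e" for i
    proof -
      have "h e i \<in> S e" "inv_into (pos e) (h e) (h e i) = i"
        using h[of e] that unfolding bij_betw_def by (auto simp: inv_into_f_f)
      then have "Poly_Mapping.lookup (v i) 0 = 0" using zero[of "h e i"] by (simp add: c_def)
      moreover have "v i = cst (Poly_Mapping.lookup (v i) 0)"
        using vform[of i] that by (intro forms_0) (simp add: pos_def)
      ultimately show ?thesis by (metis cst_0)
    qed
    have "\<exists>u. (\<forall>l. u l \<in> forms (e - 1 - cs ! i)) \<and> v i = (\<Sum>l<CARD('n). xv l * u l)"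
      if il: "i < length cs" for i
    proof (cases "cs ! i < e")
      case True
      then show ?thesis using forms_pos_decomp[OF vform[OF il]] by (simp add: algebra_simps)
    next
      case False
      then have "v i = 0" using forms_neg[OF _ vform[OF il]] v0[of i] il by (cases "cs ! i = e") (auto simp: pos_def)
      then show ?thesis using opsub_0[OF opsub_forms] by (intro exI[of _ "\<lambda>_. 0"]) simp
    qed
    then obtain u where u: "\<And>i l. i < length cs \<Longrightarrow> u i l \<in> forms (e - 1 - cs ! i)"
      "\<And>i. i < length cs \<Longrightarrow> v i = (\<Sum>l<CARD('n). xv l * u i l)" by metis
    define w where "w l i = (if i < length cs then u i l else 0)" for l i
    have "w l \<in> gfree_component cs (e - 1)" for l
      unfolding in_gfree_component w_def using u(1) by simp
    moreover have "v = (\<Sum>l<CARD('n). (\<lambda>i. xv l * w l i))"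
    proof (rule ext)
      show "v i = (\<Sum>l<CARD('n). (\<lambda>i. xv l * w l i)) i" for i
        unfolding sum_fun_apply w_def using u(2)[of i] v(1)
        by (cases "i < length cs") (auto simp: in_gfree_component)
    qed
    ultimately show ?thesis unfolding mpart_def by (intro CollectI exI[of _ w] conjI allI)
  qed
  show ?thesis unfolding cover_def using gM img ker by blast
qed

end

lemma gfree_decomp:
  assumes "v \<in> gfree cs"
  shows "\<exists>E w. finite E \<and> (\<forall>e. w e \<in> gfree_component cs e) \<and> v = (\<Sum>e\<in>E. w e)"
proof -
  define E where "E = (\<Union>i<length cs. (\<lambda>d. d + cs ! i) ` degs (v i))"
  define w where "w e i = (if i < length cs then hpart (e - cs ! i) (v i) else 0)" for e i
  have "finite E" unfolding E_def by simp
  moreover have "w e \<in> gfree_component cs e" for e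
    unfolding in_gfree_component w_def by (simp add: hpart_in_forms)
  moreover have "v = (\<Sum>e\<in>E. w e)"
  proof (rule ext)
    fix i
    show "v i = (\<Sum>e\<in>E. w e) i"
    proof (cases "i < length cs")
      case True
      have "v i = (\<Sum>d\<in>(\<lambda>e. e - cs ! i) ` E. hpart d (v i))"
        by (rule hpart_sum) (use \<open>finite E\<close> True in \<open>force simp: E_def\<close>)+
      also have "\<dots> = (\<Sum>e\<in>E. hpart (e - cs ! i) (v i))"
        by (subst sum.reindex) (auto simp: inj_on_def)
      finally show ?thesis using True unfolding sum_fun_apply w_def by simp
    next
      case False
      then show ?thesis using assms unfolding sum_fun_apply w_def gfree_def by simp
    qed
  qed
  ultimately show ?thesis by blast
qed

text \<open>Uniqueness of homogeneous components. It is what lets exactness in every single degree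
  be lifted to exactness of the whole modules.\<close>

definition direct :: "(int \<Rightarrow> 'v::ab_group_add set) \<Rightarrow> bool" where
  "direct M \<longleftrightarrow> (\<forall>E u. finite E \<and> (\<forall>e. u e \<in> M e) \<and> (\<Sum>e\<in>E. u e) = 0 \<longrightarrow> (\<forall>e\<in>E. u e = 0))"

lemma directD:
  assumes "direct M" "finite E" "\<And>e. u e \<in> M e" "(\<Sum>e\<in>E. u e) = 0" "e \<in> E"
  shows "u e = 0"
proof -
  have "finite E \<and> (\<forall>e. u e \<in> M e) \<and> (\<Sum>e\<in>E. u e) = 0" using assms by simp
  then show ?thesis using assms(1)[unfolded direct_def] assms(5) by meson
qed

lemma direct_forms: "direct forms"
  unfolding direct_def
proof (intro allI impI ballI)
  fix E :: "int set" and u :: "int \<Rightarrow> ('n::finite, 'k::field) mpoly" and d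
  assume *: "finite E \<and> (\<forall>e. u e \<in> forms e) \<and> (\<Sum>e\<in>E. u e) = 0" and d: "d \<in> E"
  have "0 = hpart d (\<Sum>e\<in>E. u e)" using * by simp
  also have "\<dots> = (\<Sum>e\<in>E. if e = d then u d else 0)"
    unfolding rst_sum
  proof (intro sum.cong refl)
    fix e
    have "u e \<in> forms e" using * by blast
    then show "hpart d (u e) = (if e = d then u d else 0)" by (auto simp: hpart_forms)
  qed
  also have "\<dots> = u d" using * d by simp
  finally show "u d = 0" by simp
qed

lemma direct_gfree: "direct (gfree_component bs)"
  unfolding direct_def
proof (intro allI impI ballI)
  fix E :: "int set" and u :: "int \<Rightarrow> nat \<Rightarrow> ('n::finite, 'k::field) mpoly" and d
  assume *: "finite E \<and> (\<forall>e. u e \<in> gfree_component bs e) \<and> (\<Sum>e\<in>E. u e) = 0" and d: "d \<in> E"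
  show "u d = 0"
  proof (rule ext)
    fix i
    show "u d i = 0 i"
    proof (cases "i < length bs")
      case True
      let ?w = "\<lambda>e. u (e + bs ! i) i"
      have "(\<Sum>e\<in>(\<lambda>e. e - bs ! i) ` E. ?w e) = (\<Sum>e\<in>E. u e i)"
        by (subst sum.reindex) (auto simp: inj_on_def)
      also have "\<dots> = 0" using * unfolding sum_fun_apply[symmetric] by simp
      finally have "(\<Sum>e\<in>(\<lambda>e. e - bs ! i) ` E. ?w e) = 0" .
      moreover have "\<forall>e. ?w e \<in> forms e"
      proof
        fix e
        have "?w e \<in> forms (e + bs ! i - bs ! i)" using * True unfolding in_gfree_component by blast
        then show "?w e \<in> forms e" by simp
      qed
      ultimately have "?w (d - bs ! i) = 0"
        using direct_forms[unfolded direct_def, rule_format, of "(\<lambda>e. e - bs ! i) ` E" ?w] * d by blast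
      then show ?thesis by simp
    next
      case False
      then show ?thesis using * by (simp add: in_gfree_component)
    qed
  qed
qed

lemma direct_mono: "direct M \<Longrightarrow> (\<And>e. N e \<subseteq> M e) \<Longrightarrow> direct N"
  unfolding direct_def by blast

text \<open>The map is homogeneous, so the images of the homogeneous components of \<open>v\<close>
  are the components of 0; as the sum of the \<open>M e\<close> is direct, each of them
  vanishes.\<close>

lemma (in amod) comb_kernel_total:
  assumes M: "gmod s M" "direct M" and g: "\<forall>i<length cs. g i \<in> M (cs ! i)"
    and v: "v \<in> gfree cs" "comb s cs g v = 0"
  shows "\<exists>E w. finite E \<and> (\<forall>e\<in>E. w e \<in> gfree_component cs e \<and> comb s cs g (w e) = 0) \<and> v = (\<Sum>e\<in>E. w e)"
proof -
  obtain E w where w: "finite E" "\<forall>e. w e \<in> gfree_component cs e" "v = (\<Sum>e\<in>E. w e)"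
    using gfree_decomp[OF v(1)] by blast
  have "comb s cs g (w e) = 0" if "e \<in> E" for e
  proof (rule directD[OF M(2) w(1) _ _ that])
    show "comb s cs g (w e) \<in> M e" for e using comb_mem[OF M(1) g] w(2) by blast
    show "(\<Sum>e\<in>E. comb s cs g (w e)) = 0" using v(2) unfolding w(3) comb_sum .
  qed
  then show ?thesis using w by (intro exI[of _ E] exI[of _ w]) simp
qed

abbreviation ker_comb :: "(('n::finite, 'k::field) mpoly \<Rightarrow> 'v::ab_group_add \<Rightarrow> 'v) \<Rightarrow> int list \<Rightarrow> (nat \<Rightarrow> 'v)
    \<Rightarrow> int \<Rightarrow> (nat \<Rightarrow> ('n, 'k) mpoly) set" where
  "ker_comb s cs g e \<equiv> {v \<in> gfree_component cs e. comb s cs g v = 0}"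

lemma (in amod) gmod_ker: "gmod vsc (ker_comb s cs g)"
  unfolding gmod_def
proof (intro conjI allI ballI)
  fix e
  show "opsub {} (ker_comb s cs g e)"
    unfolding opsub_def
  proof (intro conjI ballI)
    show "0 \<in> ker_comb s cs g e"
      using opsub_0[OF gmod_opsub[OF gmod_gfree]] by (simp add: comb_def)
    fix u v assume *: "u \<in> ker_comb s cs g e" "v \<in> ker_comb s cs g e"
    have "comb s cs g ((u - v) + v) = comb s cs g (u - v) + comb s cs g v" by (rule comb_add)
    then show "u - v \<in> ker_comb s cs g e"
      using * opsub_diff[OF gmod_opsub[OF gmod_gfree], of u cs e v] by simp
  qed simp
  fix i and a :: "('n, 'k) mpoly" and u assume "a \<in> forms i" "u \<in> ker_comb s cs g e"
  then show "(\<lambda>j. a * u j) \<in> ker_comb s cs g (e + i)"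
    using gmod_scale[OF gmod_gfree, of a i u cs e] by (simp add: comb_scale)
qed

lemma gfree_component_below:
  assumes "\<And>i. i < length cs \<Longrightarrow> e < cs ! i"
  shows "gfree_component cs e = {0}"
proof -
  have "v = 0" if v: "v \<in> gfree_component cs e" for v
  proof (rule ext)
    show "v i = 0 i" for i
      using v assms[of i] forms_neg[of "e - cs ! i" "v i"] unfolding in_gfree_component
      by (cases "i < length cs") auto
  qed
  then show ?thesis using opsub_0[OF gmod_opsub[OF gmod_gfree]] by blast
qed

text \<open>Dimension shifting applies since graded free modules are Koszul acyclic and the kernel
  of a minimal cover lies in m times the free module.\<close>

lemma (in amod) ker_step:
  assumes M: "gmod s M" "\<And>e. fdim (kspan s) (M e)" and c: "cover s cs M g"
  shows "hb s M (Suc p) e = hb vsc (ker_comb s cs g) p e"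
  by (rule hb_shift[OF amod_vsc amod comb_add comb_scale gmod_gfree fdim_gfree gmod_ker refl M(1) _
        koszul_acyclic_gfree]) (use c in \<open>auto simp: cover_def\<close>)

lemma gfree_component_subset: "gfree_component bs e \<subseteq> gfree bs"
  unfolding gfree_component_def by blast

lemma gfree_sum: "(\<And>i. i \<in> I \<Longrightarrow> f i \<in> gfree bs) \<Longrightarrow> (\<Sum>i\<in>I. f i) \<in> gfree bs"
  unfolding gfree_def by (simp add: sum_fun_apply)

text \<open>Minimal covers are iterated on syzygies. The shifts \<open>D p\<close> are the right
  ones at every step: by dimension shifting, the zeroth Betti numbers of the p-th syzygy module are
  the p-th Betti numbers of \<open>I\<close>.\<close>

lemma minimal_resolution:
  fixes I :: "('n::finite, 'k::field) mpoly set"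
  assumes I: "mult.subspace I" and hom: "\<And>f e. f \<in> I \<Longrightarrow> hpart e f \<in> I"
    and D: "\<And>p e. int (count_list (D p) e) = hb (*) (\<lambda>e. I \<inter> forms e) p e"
  shows "has_graded_minimal_free_resolution I D"
proof -
  let ?M0 = "\<lambda>e. I \<inter> forms e"
  let ?s0 = "(*) :: ('n, 'k) mpoly \<Rightarrow> ('n, 'k) mpoly \<Rightarrow> ('n, 'k) mpoly"
  interpret a: amod ?s0 by (rule amod_mult)
  interpret v: amod "vsc :: ('n, 'k) mpoly \<Rightarrow> _" by (rule amod_vsc)
  have opI: "opsub {} I" unfolding opsub_def
    using mult.subspace_0[OF I] mult.subspace_diff[OF I] by blast
  have M0: "gmod (*) ?M0"
    unfolding gmod_def opsub_def
    using opsub_0[OF opsub_forms] opsub_diff[OF opsub_forms] opsub_0[OF opI] opsub_diff[OF opI]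
      mult.subspace_scale[OF I] by (auto intro: forms_mult')
  have fd0: "fdim (kspan (*)) (?M0 e)" for e by (rule fdim_mono[OF fdim_forms]) blast
  have bd0: "?M0 e = {0}" if "e < 0" for e
    using forms_neg[OF that] opsub_0[OF opI] opsub_0[OF opsub_forms] by blast
  obtain g0 where g0: "cover (*) (D 0) ?M0 g0"
    using a.minimal_cover[OF M0 fd0 bd0 D] by blast
  \<comment> \<open>The invariant of the recursion: \<open>fst x\<close> is the syzygy module inside
    the free module of \<open>D p\<close>, contained in m times it, with Betti numbers those of
    \<open>I\<close> shifted by p + 1; \<open>snd x\<close> gives a minimal cover of it with shifts
    \<open>D (Suc p)\<close>.\<close>
  define P where "P p x \<longleftrightarrow> gmod vsc (fst x) \<and> (\<forall>e. fst x e \<subseteq> gfree_component (D p) e) \<and>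
     (\<forall>e. fst x e \<subseteq> mpart vsc (gfree_component (D p)) e) \<and>
     (\<forall>q e. hb vsc (fst x) q e = hb (*) ?M0 (Suc p + q) e) \<and> cover vsc (D (Suc p)) (fst x) (snd x)"
    for p and x :: "(int \<Rightarrow> (nat \<Rightarrow> ('n, 'k) mpoly) set) \<times> (nat \<Rightarrow> nat \<Rightarrow> ('n, 'k) mpoly)"
  have fdsub: "fdim (kspan vsc) (N e)" if "\<forall>e. N e \<subseteq> gfree_component bs e"
    for N :: "int \<Rightarrow> (nat \<Rightarrow> ('n, 'k) mpoly) set" and bs e
    by (rule fdim_mono[OF fdim_gfree]) (use that in blast)
  have next_cover: "\<exists>g. P p (N, g)"
    if N: "gmod vsc N" "\<forall>e. N e \<subseteq> gfree_component (D p) e" "\<forall>e. N e \<subseteq> mpart vsc (gfree_component (D p)) e"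
      "\<forall>q e. hb vsc N q e = hb (*) ?M0 (Suc p + q) e" for N p
  proof -
    have "\<exists>g. cover vsc (D (Suc p)) N g"
    \<comment> \<open>A submodule of the free module vanishes below the smallest shift; the inserted
      0 handles an empty list of shifts.\<close>
    proof (rule v.minimal_cover[OF N(1) fdsub[OF N(2)], where low = "Min (insert 0 (set (D p)))"])
      fix e assume e: "e < Min (insert 0 (set (D p)))"
      have "gfree_component (D p) e = ({0} :: (nat \<Rightarrow> ('n, 'k) mpoly) set)"
        by (rule gfree_component_below) (use e in auto)
      then show "N e = {0}" using N(2) opsub_0[OF gmod_opsub[OF N(1)]] by blast
    qed (use N(4) D in simp)
    then show ?thesis unfolding P_def using N by auto
  qed
  have "\<exists>g. P 0 (ker_comb (*) (D 0) g0, g)"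
    by (rule next_cover[OF a.gmod_ker]) (use g0 a.ker_step[OF M0 fd0 g0] in \<open>auto simp: cover_def\<close>)
  then obtain h0 where h0: "P 0 (ker_comb (*) (D 0) g0, h0)" by blast
  define R where "R p x y \<longleftrightarrow> fst y = ker_comb vsc (D (Suc p)) (snd x)"
    for p :: nat and x y :: "(int \<Rightarrow> (nat \<Rightarrow> ('n, 'k) mpoly) set) \<times> (nat \<Rightarrow> nat \<Rightarrow> ('n, 'k) mpoly)"
  \<comment> \<open>The clause for p = 0 pins the start of the sequence to the kernel of the cover
    of \<open>I\<close>, which \<open>P 0\<close> alone does not do.\<close>
  have "\<exists>f. (\<forall>p. (P p (f p) \<and> (p = 0 \<longrightarrow> fst (f p) = ker_comb (*) (D 0) g0)) \<and> R p (f p) (f (Suc p)))"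
  proof (rule dependent_nat_choice)
    show "\<exists>x. P 0 x \<and> (0 = (0::nat) \<longrightarrow> fst x = ker_comb (*) (D 0) g0)" using h0 by (intro exI[of _ "(ker_comb (*) (D 0) g0, h0)"]) simp
    fix x p assume x: "P p x \<and> (p = 0 \<longrightarrow> fst x = ker_comb (*) (D 0) g0)"
    let ?N = "ker_comb vsc (D (Suc p)) (snd x)"
    have x': "gmod vsc (fst x)" "\<forall>e. fst x e \<subseteq> gfree_component (D p) e"
      "\<forall>q e. hb vsc (fst x) q e = hb (*) ?M0 (Suc p + q) e" "cover vsc (D (Suc p)) (fst x) (snd x)"
      using x unfolding P_def by blast+
    have "\<exists>g. P (Suc p) (?N, g)"
    proof (rule next_cover[OF v.gmod_ker])
      show "\<forall>e. ?N e \<subseteq> mpart vsc (gfree_component (D (Suc p))) e" using x'(4) unfolding cover_def by blast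
      show "\<forall>q e. hb vsc ?N q e = hb (*) ?M0 (Suc (Suc p) + q) e"
        using v.ker_step[OF x'(1) fdsub[OF x'(2)] x'(4)] x'(3) by (metis add_Suc_shift)
    qed blast
    then obtain g where "P (Suc p) (?N, g)" by blast
    then show "\<exists>y. (P (Suc p) y \<and> (Suc p = 0 \<longrightarrow> fst y = ker_comb (*) (D 0) g0)) \<and> R p x y"
      unfolding R_def by (intro exI[of _ "(?N, g)"]) simp
  qed
  then obtain f where f: "\<And>p. P p (f p)" "fst (f 0) = ker_comb (*) (D 0) g0" "\<And>p. R p (f p) (f (Suc p))"
    by blast
  define N where "N p = fst (f p)" for p
  define g where "g p = snd (f p)" for p
  have N: "gmod vsc (N p)" "N p e \<subseteq> gfree_component (D p) e" "N p e \<subseteq> mpart vsc (gfree_component (D p)) e"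
    "cover vsc (D (Suc p)) (N p) (g p)" for p e
    using f(1)[of p] unfolding P_def N_def g_def by blast+
  have N0: "N 0 = ker_comb (*) (D 0) g0" using f(2) unfolding N_def .
  have NS: "N (Suc p) = ker_comb vsc (D (Suc p)) (g p)" for p
    using f(3)[of p] unfolding R_def N_def g_def .
  have cov0: "\<forall>i<length (D 0). g0 i \<in> ?M0 (D 0 ! i)" "\<And>e. comb (*) (D 0) g0 ` gfree_component (D 0) e = ?M0 e"
    using g0 unfolding cover_def by blast+
  have cov: "\<forall>i<length (D (Suc p)). g p i \<in> N p (D (Suc p) ! i)"
    "\<And>e. comb vsc (D (Suc p)) (g p) ` gfree_component (D (Suc p)) e = N p e" for p
    using N(4)[of p] unfolding cover_def by blast+
  have g_free: "g p i \<in> gfree (D p)" if "i < length (D (Suc p))" for p i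
    using cov(1)[of p] that N(2)[of p] gfree_component_subset by blast
  define \<epsilon> where "\<epsilon> = comb (*) (D 0) g0"
  define \<phi> where "\<phi> p = comb vsc (D (Suc p)) (g p)" for p
  have \<phi>_free: "\<phi> p v \<in> gfree (D p)" for p v
    unfolding \<phi>_def comb_def
    by (rule gfree_sum) (use g_free[of _ p] in \<open>simp add: gfree_def\<close>)
  text \<open>Elements of total kernels decompose into homogeneous ones, which lie in the image of the next map.\<close>
  have into_image: "v \<in> \<phi> p ` gfree (D (Suc p))"
    if "finite E" "\<forall>e\<in>E. w e \<in> N p e" "v = (\<Sum>e\<in>E. w e)" for p E w v
  proof -
    have "\<forall>e\<in>E. \<exists>u. u \<in> gfree_component (D (Suc p)) e \<and> w e = \<phi> p u"
      using that(2) cov(2)[of p] unfolding \<phi>_def by blast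
    then obtain u where u: "\<forall>e\<in>E. u e \<in> gfree_component (D (Suc p)) e \<and> w e = \<phi> p (u e)"
      by (rule bchoice[THEN exE])
    have "v = \<phi> p (\<Sum>e\<in>E. u e)" unfolding that(3) \<phi>_def v.comb_sum
      using u by (intro sum.cong refl) (simp add: \<phi>_def)
    moreover have "(\<Sum>e\<in>E. u e) \<in> gfree (D (Suc p))"
      using u gfree_component_subset by (intro gfree_sum) blast
    ultimately show ?thesis by blast
  qed
  have graded0: "graded_functional (D 0) \<epsilon>"
    unfolding graded_functional_def
  proof (intro conjI ballI allI)
    show "\<epsilon> (\<lambda>i. v i + w i) = \<epsilon> v + \<epsilon> w" for v w
      using a.comb_add[of "D 0" g0 v w] unfolding \<epsilon>_def plus_fun_def .
    show "\<epsilon> (\<lambda>i. b * v i) = b * \<epsilon> v" for b v unfolding \<epsilon>_def by (rule a.comb_scale)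
    show "\<epsilon> ` gfree_component (D 0) e \<subseteq> forms e" for e unfolding \<epsilon>_def using cov0(2)[of e] by blast
  qed
  have graded: "graded_hom (D (Suc p)) (D p) (\<phi> p)" for p
    unfolding graded_hom_def
  proof (intro conjI ballI allI)
    show "\<phi> p ` gfree (D (Suc p)) \<subseteq> gfree (D p)" using \<phi>_free by blast
    show "\<phi> p (\<lambda>i. v i + w i) = (\<lambda>i. \<phi> p v i + \<phi> p w i)" for v w
      using v.comb_add[of "D (Suc p)" "g p" v w] unfolding \<phi>_def plus_fun_def .
    show "\<phi> p (\<lambda>i. b * v i) = (\<lambda>i. b * \<phi> p v i)" for b v unfolding \<phi>_def by (rule v.comb_scale)
    show "\<phi> p ` gfree_component (D (Suc p)) e \<subseteq> gfree_component (D p) e" for e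
      unfolding \<phi>_def using cov(2)[of p e] N(2)[of p e] by blast
  qed
  have onto: "\<epsilon> ` gfree (D 0) = I"
  proof (intro equalityI subsetI)
    fix x assume "x \<in> \<epsilon> ` gfree (D 0)"
    then obtain v where "x = comb (*) (D 0) g0 v" unfolding \<epsilon>_def by blast
    then show "x \<in> I" unfolding comb_def
      using cov0(1) by (auto intro!: mult.subspace_sum[OF I] mult.subspace_scale[OF I])
  next
    fix x assume x: "x \<in> I"
    have "\<forall>e\<in>degs x. \<exists>u. u \<in> gfree_component (D 0) e \<and> hpart e x = \<epsilon> u"
    proof
      fix e
      have "hpart e x \<in> ?M0 e" using hom[OF x] hpart_in_forms by blast
      then show "\<exists>u. u \<in> gfree_component (D 0) e \<and> hpart e x = \<epsilon> u"
        using cov0(2)[of e] unfolding \<epsilon>_def by blast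
    qed
    then obtain u where u: "\<forall>e\<in>degs x. u e \<in> gfree_component (D 0) e \<and> hpart e x = \<epsilon> (u e)"
      by (rule bchoice[THEN exE])
    have "x = (\<Sum>e\<in>degs x. hpart e x)" by (rule hpart_sum) auto
    also have "\<dots> = \<epsilon> (\<Sum>e\<in>degs x. u e)" unfolding \<epsilon>_def a.comb_sum
      using u by (intro sum.cong refl) (simp add: \<epsilon>_def)
    finally have "x = \<epsilon> (\<Sum>e\<in>degs x. u e)" .
    moreover have "(\<Sum>e\<in>degs x. u e) \<in> gfree (D 0)"
      using u gfree_component_subset by (intro gfree_sum) blast
    ultimately show "x \<in> \<epsilon> ` gfree (D 0)" by blast
  qed
  have ex0: "\<phi> 0 ` gfree (D 1) = {v \<in> gfree (D 0). \<epsilon> v = 0}"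
  proof (intro equalityI subsetI)
    fix x assume "x \<in> \<phi> 0 ` gfree (D 1)"
    then obtain v where v: "x = \<phi> 0 v" by blast
    have "\<epsilon> (g 0 i) = 0" if "i < length (D 1)" for i
      using cov(1)[of 0] that unfolding N0 \<epsilon>_def by auto
    then have "\<epsilon> x = 0" unfolding v \<phi>_def comb_def[of "vsc"] \<epsilon>_def a.comb_sum a.comb_scale
      by (intro sum.neutral) (simp add: \<epsilon>_def)
    then show "x \<in> {v \<in> gfree (D 0). \<epsilon> v = 0}" using \<phi>_free v by blast
  next
    fix x assume "x \<in> {v \<in> gfree (D 0). \<epsilon> v = 0}"
    then obtain E w where "finite E" "\<forall>e\<in>E. w e \<in> gfree_component (D 0) e \<and> comb (*) (D 0) g0 (w e) = 0"
      "x = (\<Sum>e\<in>E. w e)"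
      using a.comb_kernel_total[OF M0 direct_mono[OF direct_forms] cov0(1)] unfolding \<epsilon>_def by blast
    then have "x \<in> \<phi> 0 ` gfree (D (Suc 0))" by (intro into_image) (auto simp: N0)
    then show "x \<in> \<phi> 0 ` gfree (D 1)" by simp
  qed
  have ex: "\<phi> (Suc p) ` gfree (D (Suc (Suc p))) = {v \<in> gfree (D (Suc p)). \<phi> p v = (\<lambda>_. 0)}" for p
  proof (intro equalityI subsetI)
    fix x assume "x \<in> \<phi> (Suc p) ` gfree (D (Suc (Suc p)))"
    then obtain v where v: "x = \<phi> (Suc p) v" by blast
    have "\<phi> p (g (Suc p) i) = 0" if "i < length (D (Suc (Suc p)))" for i
      using cov(1)[of "Suc p"] that unfolding NS \<phi>_def by auto
    then have "\<phi> p x = 0"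
      unfolding v \<phi>_def[of "Suc p"] comb_def unfolding \<phi>_def v.comb_sum v.comb_scale
      by (intro sum.neutral) (auto simp: fun_eq_iff)
    then have "\<phi> p x = (\<lambda>_. 0)" unfolding zero_fun_def .
    then show "x \<in> {v \<in> gfree (D (Suc p)). \<phi> p v = (\<lambda>_. 0)}" using \<phi>_free v by blast
  next
    fix x assume "x \<in> {v \<in> gfree (D (Suc p)). \<phi> p v = (\<lambda>_. 0)}"
    then have x: "x \<in> gfree (D (Suc p))" "comb vsc (D (Suc p)) (g p) x = 0"
      unfolding \<phi>_def zero_fun_def by blast+
    obtain E w where "finite E" "\<forall>e\<in>E. w e \<in> gfree_component (D (Suc p)) e \<and> comb vsc (D (Suc p)) (g p) (w e) = 0"
      "x = (\<Sum>e\<in>E. w e)"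
      using v.comb_kernel_total[OF N(1) direct_mono[OF direct_gfree N(2)] cov(1) x] by blast
    then show "x \<in> \<phi> (Suc p) ` gfree (D (Suc (Suc p)))" by (intro into_image) (auto simp: NS)
  qed
  have min: "\<phi> p v i \<in> irrelevant_ideal" for p v i
  proof -
    have "g p j i \<in> irrelevant_ideal" if "j < length (D (Suc p))" for j
    proof -
      have "g p j \<in> mpart vsc (gfree_component (D p)) (D (Suc p) ! j)" using cov(1)[of p] that N(3) by blast
      then obtain h where "g p j = (\<Sum>l<CARD('n). (\<lambda>i. xv l * h l i))" unfolding mpart_def by blast
      then have "g p j i = (\<Sum>l<CARD('n). xv l * h l i)" by (simp add: sum_fun_apply)
      moreover have "xv l * h l i \<in> mult.span (range mvar)" for l
        using irrelevant_ideal_mvar unfolding irrelevant_ideal_eq_span .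
      ultimately show ?thesis unfolding irrelevant_ideal_eq_span by (simp only: mult.span_sum)
    qed
    then show ?thesis
      unfolding \<phi>_def comb_def sum_fun_apply irrelevant_ideal_eq_span
      by (intro mult.span_sum mult.span_scale) simp
  qed
  show ?thesis
    unfolding has_graded_minimal_free_resolution_def
    using graded0 graded onto ex0 ex min by (intro exI[of _ \<epsilon>] exI[of _ \<phi>]) blast
qed

section \<open>Eventually polynomial functions\<close>

text \<open>The degree bound is a set \<open>S\<close> of admissible exponents instead of a number.
  It can then be the set of lengths of chains of primes, whether or not these are bounded, and
  \<open>S = {}\<close> expresses that \<open>h\<close> is eventually zero.\<close>

definition eventual_poly :: "nat set \<Rightarrow> (nat \<Rightarrow> int) \<Rightarrow> bool" where
  "eventual_poly S h \<longleftrightarrow> (\<exists>Q :: rat poly. (\<forall>i. Polynomial.coeff Q i \<noteq> 0 \<longrightarrow> i \<in> S) \<and>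
     (\<exists>J. \<forall>j\<ge>J. of_int (h j) = poly Q (of_nat j)))"

lemma eventual_poly_mono: "eventual_poly S h \<Longrightarrow> S \<subseteq> S' \<Longrightarrow> eventual_poly S' h"
  unfolding eventual_poly_def by blast

lemma eventual_poly_eventually_0: "(\<And>j. j \<ge> J \<Longrightarrow> h j = 0) \<Longrightarrow> eventual_poly S h"
  unfolding eventual_poly_def by (intro exI[of _ 0]) auto

lemma eventual_poly_add:
  assumes "eventual_poly S h" "eventual_poly S h'" "\<And>j. g j = h j + h' j"
  shows "eventual_poly S g"
proof -
  obtain Q J where Q: "\<forall>i. Polynomial.coeff Q i \<noteq> 0 \<longrightarrow> i \<in> S" "\<forall>j\<ge>J. of_int (h j) = poly Q (of_nat j :: rat)"
    using assms(1) unfolding eventual_poly_def by blast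
  obtain Q' J' where Q': "\<forall>i. Polynomial.coeff Q' i \<noteq> 0 \<longrightarrow> i \<in> S" "\<forall>j\<ge>J'. of_int (h' j) = poly Q' (of_nat j :: rat)"
    using assms(2) unfolding eventual_poly_def by blast
  show ?thesis unfolding eventual_poly_def
  proof (intro exI[of _ "Q + Q'"] conjI allI impI exI[of _ "max J J'"])
    show "i \<in> S" if "Polynomial.coeff (Q + Q') i \<noteq> 0" for i
    proof -
      have "Polynomial.coeff Q i \<noteq> 0 \<or> Polynomial.coeff Q' i \<noteq> 0" using that by auto
      then show ?thesis using Q(1) Q'(1) by blast
    qed
  qed (use Q(2) Q'(2) assms(3) in auto)
qed

lemma eventual_poly_of_degree:
  assumes S: "\<And>i j. j \<in> S \<Longrightarrow> i \<le> j \<Longrightarrow> i \<in> S" and Q: "Q = 0 \<or> degree Q \<in> S"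
    and h: "\<And>j. j \<ge> J \<Longrightarrow> of_int (h j) = poly Q (of_nat j :: rat)"
  shows "eventual_poly S h"
  unfolding eventual_poly_def
proof (intro exI[of _ Q] conjI allI impI exI[of _ J])
  fix i assume i: "Polynomial.coeff Q i \<noteq> 0"
  then have "Q \<noteq> 0" "i \<le> degree Q" using le_degree by auto
  then show "i \<in> S" using Q S by blast
qed (use h in auto)

lemma eventual_poly_degree:
  assumes "eventual_poly S h"
  obtains Q J where "Q = 0 \<or> degree Q \<in> S" "\<And>j. j \<ge> J \<Longrightarrow> of_int (h j) = poly Q (of_nat j :: rat)"
proof -
  obtain Q J where Q: "\<forall>i. Polynomial.coeff Q i \<noteq> 0 \<longrightarrow> i \<in> S" "\<forall>j\<ge>J. of_int (h j) = poly Q (of_nat j :: rat)"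
    using assms unfolding eventual_poly_def by blast
  have "Q = 0 \<or> degree Q \<in> S" using Q(1) leading_coeff_neq_0 by blast
  then show ?thesis using that Q(2) by blast
qed

text \<open>A shift of the argument is composition with a linear polynomial and preserves the
  degree. The shift \<open>c\<close> is rational so that it may be negative.\<close>

lemma eventual_poly_pcompose:
  assumes S: "\<And>i j. j \<in> S \<Longrightarrow> i \<le> j \<Longrightarrow> i \<in> S" and h: "eventual_poly S h"
    and g: "\<And>j. j \<ge> J' \<Longrightarrow> \<exists>i. of_nat i = (of_nat j + c :: rat) \<and> g j = h i"
  shows "eventual_poly S g"
proof -
  obtain Q J where Q: "Q = 0 \<or> degree Q \<in> S" "\<And>j. j \<ge> J \<Longrightarrow> of_int (h j) = poly Q (of_nat j :: rat)"
    using eventual_poly_degree[OF h] by blast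
  obtain m :: nat where m: "of_nat J - c < of_nat m" using reals_Archimedean2[of "of_nat J - c"] by blast
  show ?thesis
  proof (rule eventual_poly_of_degree[OF S, where Q = "pcompose Q [:c, 1:]" and J = "max J' m"])
    show "pcompose Q [:c, 1:] = 0 \<or> degree (pcompose Q [:c, 1:]) \<in> S"
      using Q(1) by (auto simp: degree_pcompose)
    fix j assume j: "j \<ge> max J' m"
    then obtain i where i: "of_nat i = (of_nat j + c :: rat)" "g j = h i" using g by auto
    have "of_nat m \<le> (of_nat j :: rat)" using j by simp
    then have "(of_nat J :: rat) \<le> of_nat i" using m unfolding i(1) by linarith
    then have "J \<le> i" by simp
    then show "of_int (g j) = poly (pcompose Q [:c, 1:]) (of_nat j :: rat)"
      unfolding i(2) using Q(2)[of i] by (simp add: poly_pcompose i(1) add.commute)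
  qed
qed

text \<open>In the basis of falling factorials the difference operator is a shift.\<close>

fun ffp :: "nat \<Rightarrow> rat poly" where
  "ffp 0 = 1"
| "ffp (Suc k) = ffp k * [:- of_nat k, 1:]"

lemma ffp_monic: "degree (ffp k) = k \<and> lead_coeff (ffp k) = 1"
proof (induction k)
  case (Suc k)
  then have "ffp k \<noteq> 0" by auto
  moreover have "Polynomial.coeff (ffp k) k = 1" using Suc by metis
  ultimately show ?case
    unfolding ffp.simps using Suc degree_mult_eq[of "ffp k" "[:- of_nat k, 1:]"] lead_coeff_mult[of "ffp k" "[:- of_nat k, 1:]"]
    by (simp del: mult_pCons_right)
qed simp

lemma ffp_shift: "poly (ffp (Suc k)) (x + 1) = (x + 1) * poly (ffp k) x"
  by (induction k) (simp_all add: algebra_simps)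

lemma ffp_diff: "poly (ffp (Suc k)) (x + 1) - poly (ffp (Suc k)) x = (of_nat k + 1) * poly (ffp k) x"
  unfolding ffp_shift by (simp add: algebra_simps)

text \<open>Induction on the degree: subtracting a multiple of the falling factorial removes the
  leading term of \<open>Q\<close>, and falling factorials have explicit antidifferences.\<close>

lemma antidifference: "\<exists>R :: rat poly. degree R \<le> Suc (degree Q) \<and> (\<forall>x. poly R (x + 1) - poly R x = poly Q x)"
proof (induction "degree Q" arbitrary: Q rule: less_induct)
  case less
  define d where "d = degree Q"
  define Q' where "Q' = Q - smult (lead_coeff Q) (ffp d)"
  \<comment> \<open>The difference of the falling factorial of degree d + 1 is d + 1 times that of
    degree d, which explains the denominator.\<close>
  define R0 where "R0 = smult (lead_coeff Q / (of_nat d + 1)) (ffp (Suc d))"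
  have R0: "poly R0 (x + 1) - poly R0 x = lead_coeff Q * poly (ffp d) x" for x
  proof -
    have "poly R0 (x + 1) - poly R0 x = lead_coeff Q / (of_nat d + 1) * ((of_nat d + 1) * poly (ffp d) x)"
      unfolding R0_def poly_smult right_diff_distrib[symmetric] ffp_diff ..
    also have "\<dots> = lead_coeff Q * poly (ffp d) x"
    proof -
      have "(of_nat d + 1 :: rat) \<noteq> 0" by (metis of_nat_Suc of_nat_eq_0_iff nat.simps(3) add.commute)
      then show ?thesis by simp
    qed
    finally show ?thesis .
  qed
  have degR0: "degree R0 \<le> Suc d" unfolding R0_def
    using degree_smult_le[of _ "ffp (Suc d)"] ffp_monic[of "Suc d"] by metis
  show ?case
  proof (cases "Q' = 0")
    case True
    then have "poly Q x = lead_coeff Q * poly (ffp d) x" for x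
      unfolding Q'_def by (metis eq_iff_diff_eq_0 poly_smult)
    then show ?thesis using R0 degR0 unfolding d_def by metis
  next
    case False
    have "degree Q' \<le> d" unfolding Q'_def
      by (rule degree_diff_le) (use degree_smult_le[of _ "ffp d"] ffp_monic[of d] in \<open>auto simp: d_def\<close>)
    moreover
    have "Polynomial.coeff (ffp d) d = 1" using ffp_monic[of d] by metis
    then have "Polynomial.coeff Q' d = 0" unfolding Q'_def by (simp add: d_def)
    ultimately have "degree Q' < d" using False leading_coeff_neq_0[of Q'] by (metis le_neq_implies_less)
    then obtain R where R: "degree R \<le> Suc (degree Q')" "\<And>x. poly R (x + 1) - poly R x = poly Q' x"
      using less.hyps[of Q'] unfolding d_def by blast
    have "degree (R + R0) \<le> Suc d" using R(1) \<open>degree Q' < d\<close> degR0 by (intro degree_add_le) auto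
    moreover have "poly (R + R0) (x + 1) - poly (R + R0) x = poly Q x" for x
    proof -
      have "poly (R + R0) (x + 1) - poly (R + R0) x
        = (poly R (x + 1) - poly R x) + (poly R0 (x + 1) - poly R0 x)" by simp
      also have "\<dots> = poly Q x" unfolding R(2) R0 Q'_def by simp
      finally show ?thesis .
    qed
    ultimately show ?thesis unfolding d_def by blast
  qed
qed

text \<open>An antidifference of the polynomial of the differences agrees with \<open>h\<close>
  eventually up to a constant. The membership of 0 in \<open>S\<close> makes room for this constant
  when the differences vanish.\<close>

lemma eventual_poly_difference:
  assumes S: "\<And>i j. j \<in> S \<Longrightarrow> i \<le> j \<Longrightarrow> i \<in> S" "0 \<in> S"
    and h: "eventual_poly {i. Suc i \<in> S} (\<lambda>j. h (Suc j) - h j)"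
  shows "eventual_poly S h"
proof -
  obtain Q J where Q: "Q = 0 \<or> degree Q \<in> {i. Suc i \<in> S}"
    "\<And>j. j \<ge> J \<Longrightarrow> of_int (h (Suc j) - h j) = poly Q (of_nat j :: rat)"
    using eventual_poly_degree[OF h] by blast
  obtain R where R: "degree R \<le> Suc (degree Q)" "\<And>x. poly R (x + 1) - poly R x = poly Q x"
    using antidifference by blast
  \<comment> \<open>For \<open>Q = 0\<close> the bound on the degree of \<open>R\<close> would still
    allow degree 1, hence the separate choice 0.\<close>
  define R' where "R' = (if Q = 0 then 0 else R)"
  have R': "poly R' (x + 1) - poly R' x = poly Q x" for x using R(2)[of x] by (simp add: R'_def)
  define c where "c = of_int (h J) - poly R' (of_nat J)"
  have "of_int (h (J + m)) = poly (R' + [:c:]) (of_nat (J + m))" for m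
  proof (induction m)
    case (Suc m)
    have "of_int (h (J + Suc m)) = of_int (h (J + m)) + (poly R' (of_nat (J + m) + 1) - poly R' (of_nat (J + m)))"
      unfolding R' using Q(2)[of "J + m"] by simp
    then show ?case unfolding Suc by (simp add: add.commute add.left_commute)
  qed (simp add: c_def)
  then have val: "of_int (h j) = poly (R' + [:c:]) (of_nat j)" if "j \<ge> J" for j
    using that by (metis le_Suc_ex)
  have deg: "degree (R' + [:c:]) \<in> S"
  proof (cases "Q = 0")
    case True
    then show ?thesis using S(2) by (simp add: R'_def)
  next
    case False
    then have "Suc (degree Q) \<in> S" using Q(1) by simp
    moreover have "degree (R' + [:c:]) \<le> Suc (degree Q)"
      using R(1) False by (intro degree_add_le) (auto simp: R'_def)
    ultimately show ?thesis using S(1) by blast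
  qed
  show ?thesis
    by (rule eventual_poly_of_degree[where Q = "R' + [:c:]" and J = J], erule (1) S(1), rule disjI2, rule deg, rule val)
qed

section \<open>Hilbert functions and chains of graded primes\<close>

text \<open>The isomorphism of (N + fW)/N with the quotient of W by the preimage of N, on the level
  of dimensions: a basis of \<open>N\<close> and the images of representatives of that quotient form
  a basis of the sum.\<close>

lemma (in vector_space_pair) dim_sum_image:
  assumes f: "Vector_Spaces.linear s1 s2 f" and W: "vs1.subspace W" "fdim vs1.span W"
    and N: "vs2.subspace N" "fdim vs2.span N"
  shows "int (vs2.dim {u + f w | u w. u \<in> N \<and> w \<in> W}) - int (vs2.dim N)
    = int (vs1.dim W) - int (vs1.dim {w \<in> W. f w \<in> N})"
proof -
  interpret f: Vector_Spaces.linear s1 s2 f by (rule f)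
  let ?U = "{w \<in> W. f w \<in> N}" and ?V = "{u + f w | u w. u \<in> N \<and> w \<in> W}"
  have U: "vs1.subspace ?U"
    using W(1) N(1) by (auto simp: vs1.subspace_def vs2.subspace_def f.add f.scale f.zero)
  obtain S where S: "finite S" "S \<subseteq> W" "card S = vs1.dim W - vs1.dim ?U"
    "\<And>v. v \<in> W \<Longrightarrow> \<exists>c. v - (\<Sum>s\<in>S. s1 (c s) s) \<in> ?U"
    "\<And>c s. (\<Sum>s\<in>S. s1 (c s) s) \<in> ?U \<Longrightarrow> s \<in> S \<Longrightarrow> c s = 0"
    by (rule vs1.quotient_basis[OF W(2) U W(1)]) blast+
  obtain B C where "B \<subseteq> C" and E: "vs2.independent C" "finite C" "vs2.span C = N" "card C = vs2.dim N"
    by (rule vs2.basis_extension[OF N(2) N(1) N(1) order_refl])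
  have SW: "(\<Sum>s\<in>S. s1 (c s) s) \<in> W" for c
    using S(2) W(1) by (intro vs1.subspace_sum vs1.subspace_scale) auto
  have indS: "c s = 0" if "f (\<Sum>s\<in>S. s1 (c s) s) \<in> N" "s \<in> S" for c s
    by (rule S(5)[OF _ that(2)]) (use that(1) SW in blast)
  have inj: "inj_on f S"
  proof (rule inj_onI, rule ccontr)
    fix a b assume *: "a \<in> S" "b \<in> S" "f a = f b" "a \<noteq> b"
    let ?c = "\<lambda>s. if s = a then (1 :: 'a) else if s = b then - 1 else 0"
    have "(\<Sum>s\<in>S. s1 (?c s) s) = (\<Sum>s\<in>{a, b}. s1 (?c s) s)"
      using * S(1) by (intro sum.mono_neutral_right) auto
    also have "\<dots> = a - b" using *(4) by simp
    finally have "f (\<Sum>s\<in>S. s1 (?c s) s) = 0" using *(3) by (simp add: f.diff)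
    then have "?c a = 0" using indS[of ?c a] vs2.subspace_0[OF N(1)] *(1) by simp
    then show False by simp
  qed
  have key: "(\<forall>x\<in>C. g x = 0) \<and> (\<forall>s\<in>S. g' s = 0)"
    if z: "(\<Sum>x\<in>C. s2 (g x) x) + (\<Sum>s\<in>S. s2 (g' s) (f s)) = 0" for g g'
  proof -
    have CN: "(\<Sum>x\<in>C. s2 (g x) x) \<in> N" unfolding E(3)[symmetric] by (intro vs2.span_sum vs2.span_scale vs2.span_base)
    have fs: "f (\<Sum>s\<in>S. s1 (g' s) s) = (\<Sum>s\<in>S. s2 (g' s) (f s))" by (simp add: f.sum f.scale)
    have "(\<Sum>s\<in>S. s2 (g' s) (f s)) = - (\<Sum>x\<in>C. s2 (g x) x)" using z by (simp add: add_eq_0_iff)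
    then have "f (\<Sum>s\<in>S. s1 (g' s) s) \<in> N" unfolding fs using vs2.subspace_neg[OF N(1) CN] by simp
    then have g': "\<forall>s\<in>S. g' s = 0" using indS by blast
    then have "(\<Sum>s\<in>S. s2 (g' s) (f s)) = 0" by (intro sum.neutral) simp
    then have "(\<Sum>x\<in>C. s2 (g x) x) = 0" using z by simp
    then have "\<forall>x\<in>C. g x = 0" using vs2.independentD[OF E(1,2) order_refl] by blast
    then show ?thesis using g' by blast
  qed
  have disj: "C \<inter> f ` S = {}"
  proof (rule ccontr)
    assume "C \<inter> f ` S \<noteq> {}"
    then obtain a where a: "a \<in> S" "f a \<in> C" by blast
    have "(\<Sum>x\<in>C. s2 (if x = f a then 1 else 0) x) + (\<Sum>s\<in>S. s2 (if s = a then - 1 else 0) (f s)) = 0"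
      using a E(2) S(1) by (simp add: if_distrib[of "\<lambda>c. s2 c _"] cong: if_cong)
    from conjunct2[OF key[OF this]] a(1) have "(if a = a then - 1 else 0) = (0 :: 'a)" by (rule bspec)
    then show False by simp
  qed
  have "vs2.dim ?V = card (C \<union> f ` S)"
  proof (rule vs2.dim_unique)
    show "C \<union> f ` S \<subseteq> ?V"
    proof -
      have "x \<in> ?V" if "x \<in> C" for x
        using vs2.span_base[OF that] vs1.subspace_0[OF W(1)] unfolding E(3)
        by (intro CollectI exI[of _ x] exI[of _ 0]) (simp add: f.zero)
      moreover have "f w \<in> ?V" if "w \<in> S" for w
        using that S(2) vs2.subspace_0[OF N(1)] by (intro CollectI exI[of _ 0] exI[of _ w]) auto
      ultimately show ?thesis by blast
    qed
    show "?V \<subseteq> vs2.span (C \<union> f ` S)"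
    proof
      fix v assume "v \<in> ?V"
      then obtain u w where uw: "v = u + f w" "u \<in> N" "w \<in> W" by blast
      obtain c where c: "w - (\<Sum>s\<in>S. s1 (c s) s) \<in> ?U" using S(4)[OF uw(3)] by blast
      have "v = (u + f (w - (\<Sum>s\<in>S. s1 (c s) s))) + (\<Sum>s\<in>S. s2 (c s) (f s))"
        unfolding uw(1) f.diff f.sum f.scale by simp
      moreover have "u + f (w - (\<Sum>s\<in>S. s1 (c s) s)) \<in> vs2.span (C \<union> f ` S)"
      proof -
        have "f (w - (\<Sum>s\<in>S. s1 (c s) s)) \<in> N" using c by blast
        then have "u + f (w - (\<Sum>s\<in>S. s1 (c s) s)) \<in> vs2.span C"
          unfolding E(3) by (rule vs2.subspace_add[OF N(1) uw(2)])
        then show ?thesis using vs2.span_mono[of C "C \<union> f ` S"] by blast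
      qed
      moreover have "(\<Sum>s\<in>S. s2 (c s) (f s)) \<in> vs2.span (C \<union> f ` S)"
        by (intro vs2.span_sum vs2.span_scale vs2.span_base) blast
      ultimately show "v \<in> vs2.span (C \<union> f ` S)" by (simp only: vs2.span_add)
    qed
    show "vs2.independent (C \<union> f ` S)"
    proof (rule vs2.independent_if_scalars_zero)
      show "finite (C \<union> f ` S)" using E(2) S(1) by blast
      fix g x assume z: "(\<Sum>x\<in>C \<union> f ` S. s2 (g x) x) = 0" and x: "x \<in> C \<union> f ` S"
      have "(\<Sum>x\<in>C \<union> f ` S. s2 (g x) x) = (\<Sum>x\<in>C. s2 (g x) x) + (\<Sum>x\<in>f ` S. s2 (g x) x)"
        by (rule sum.union_disjoint[OF E(2) finite_imageI[OF S(1)] disj])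
      also have "(\<Sum>x\<in>f ` S. s2 (g x) x) = (\<Sum>s\<in>S. s2 (g (f s)) (f s))"
        by (rule sum.reindex_cong[OF inj refl refl])
      finally have "(\<Sum>x\<in>C. s2 (g x) x) + (\<Sum>s\<in>S. s2 (g (f s)) (f s)) = 0" unfolding z by (rule sym)
      then have "(\<forall>x\<in>C. g x = 0) \<and> (\<forall>s\<in>S. g (f s) = 0)" by (rule key)
      then show "g x = 0" using x by blast
    qed
  qed (rule refl)
  also have "\<dots> = card C + card (f ` S)"
    by (rule card_Un_disjoint[OF E(2) finite_imageI[OF S(1)] disj])
  also have "card (f ` S) = card S" by (rule card_image[OF inj])
  finally have "vs2.dim ?V = vs2.dim N + card S" using E(4) by simp
  moreover have "vs1.dim ?U \<le> vs1.dim W" by (rule vs1.dim_mono_fdim[OF W(2) U W(1)]) blast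
  ultimately show ?thesis unfolding S(3) by simp
qed

text \<open>A graded algebra over the field, given by its components inside the polynomial ring.
  Generation in degree one is expressed as an induction principle: a subgroup containing all
  products of \<open>G 1\<close> and \<open>G j\<close> contains \<open>G (Suc j)\<close>.\<close>

locale galg =
  fixes G :: "nat \<Rightarrow> ('n::finite, 'k::field) mpoly set"
  assumes G_opsub: "opsub {} (G j)" and G_0: "G 0 = range cst"
    and G_mult: "a \<in> G i \<Longrightarrow> b \<in> G j \<Longrightarrow> a * b \<in> G (i + j)"
    and G_gen: "opsub {} M \<Longrightarrow> (\<And>a b. a \<in> G 1 \<Longrightarrow> b \<in> G j \<Longrightarrow> a * b \<in> M) \<Longrightarrow> G (Suc j) \<subseteq> M"
    and G_fdim: "fdim (kspan (*)) (G j)"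
begin

definition gm :: "(('n, 'k) mpoly \<Rightarrow> 'v::ab_group_add \<Rightarrow> 'v) \<Rightarrow> (nat \<Rightarrow> 'v set) \<Rightarrow> bool" where
  "gm s N \<longleftrightarrow> (\<forall>j. opsub {} (N j)) \<and> (\<forall>i j. \<forall>a\<in>G i. \<forall>v\<in>N j. s a v \<in> N (i + j))"

definition gideal :: "(nat \<Rightarrow> ('n, 'k) mpoly set) \<Rightarrow> bool" where
  "gideal P \<longleftrightarrow> gm (*) P \<and> P \<le> G"

text \<open>Primality is tested on homogeneous elements only; this is what maximal annihilators of
  homogeneous elements satisfy.\<close>

definition gprime :: "(nat \<Rightarrow> ('n, 'k) mpoly set) \<Rightarrow> bool" where
  "gprime P \<longleftrightarrow> gideal P \<and> 1 \<notin> P 0 \<and>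
     (\<forall>i j. \<forall>a\<in>G i. \<forall>b\<in>G j. a * b \<in> P (i + j) \<longrightarrow> a \<in> P i \<or> b \<in> P j)"

text \<open>\<open>P\<close> is the smallest member of a chain of graded primes with
  \<open>r\<close> strict inclusions. The recursion prepends a prime, as the induction on primes
  does.\<close>

fun chain :: "(nat \<Rightarrow> ('n, 'k) mpoly set) \<Rightarrow> nat \<Rightarrow> bool" where
  "chain P 0 \<longleftrightarrow> gprime P"
| "chain P (Suc r) \<longleftrightarrow> gprime P \<and> (\<exists>P'. P < P' \<and> chain P' r)"

abbreviation hilb :: "(('n, 'k) mpoly \<Rightarrow> 'v::ab_group_add \<Rightarrow> 'v) \<Rightarrow> (nat \<Rightarrow> 'v set) \<Rightarrow> (nat \<Rightarrow> 'v set) \<Rightarrow> nat \<Rightarrow> int" where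
  "hilb s Z B j \<equiv> int (kdim s (Z j)) - int (kdim s (B j))"

lemma chain_mono: "chain P r \<Longrightarrow> r' \<le> r \<Longrightarrow> chain P r'"
proof (induction r' arbitrary: P r)
  case 0
  then show ?case by (cases r) auto
next
  case (Suc r')
  then obtain r'' where r: "r = Suc r''" by (cases r) auto
  then obtain P' where "P < P'" "chain P' r''" using Suc.prems(1) by auto
  then show ?case using Suc.IH[of P' r''] Suc.prems r by auto
qed

lemma gm_opsub: "gm s N \<Longrightarrow> opsub {} (N j)"
  and gm_scale: "gm s N \<Longrightarrow> a \<in> G i \<Longrightarrow> v \<in> N j \<Longrightarrow> s a v \<in> N (i + j)"
  unfolding gm_def by blast+

lemma gm_subspace: "amod s \<Longrightarrow> gm s N \<Longrightarrow> ksub s (N j)"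
proof -
  assume "amod s" and N: "gm s N"
  then interpret amod s by blast
  show ?thesis
  proof (rule opsub_imp_subspace[OF gm_opsub[OF N]])
    fix c v assume "v \<in> N j"
    then show "s (cst c) v \<in> N j" using gm_scale[OF N, of "cst c" 0 v j] G_0 by auto
  qed
qed

lemma gm_G: "gm (*) G"
  unfolding gm_def using G_opsub G_mult by blast

lemma gidealD: "gideal P \<Longrightarrow> gm (*) P" "gideal P \<Longrightarrow> P j \<subseteq> G j"
  unfolding gideal_def le_fun_def by blast+

lemma one_G: "1 \<in> G 0"
  unfolding G_0 by (rule image_eqI[of _ _ 1]) simp_all

text \<open>A prime filtration in the form of a maximality argument. Among the submodules between
  \<open>B\<close> and \<open>Z\<close> with a good Hilbert function choose a maximal
  \<open>N\<close>. If \<open>N \<noteq> Z\<close>, a homogeneous element whose annihilator modulo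
  \<open>N\<close> is maximal has a prime annihilator \<open>P\<close>, and adding it to
  \<open>N\<close> contributes a shifted Hilbert function of G/P. Only primes containing the
  annihilator of Z/B arise, and this restriction of the hypothesis \<open>primes\<close> drives the
  later induction.\<close>

lemma hilbert_module:
  fixes s :: "('n, 'k) mpoly \<Rightarrow> 'v::ab_group_add \<Rightarrow> 'v"
  assumes s: "amod s" and Z: "gm s Z" "\<And>j. fdim (kspan s) (Z j)" and B: "gm s B" "B \<le> Z"
    and noethG: "\<And>\<C>. \<C> \<noteq> {} \<Longrightarrow> (\<And>P. P \<in> \<C> \<Longrightarrow> gideal P) \<Longrightarrow> \<exists>P\<in>\<C>. \<forall>P'\<in>\<C>. P \<le> P' \<longrightarrow> P' = P"
    and noethZ: "\<And>\<C>. \<C> \<noteq> {} \<Longrightarrow> (\<And>N. N \<in> \<C> \<Longrightarrow> gm s N \<and> B \<le> N \<and> N \<le> Z) \<Longrightarrow> \<exists>N\<in>\<C>. \<forall>N'\<in>\<C>. N \<le> N' \<longrightarrow> N' = N"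
    and S: "\<And>i j. j \<in> S \<Longrightarrow> i \<le> j \<Longrightarrow> i \<in> S"
    and primes: "\<And>P. gprime P \<Longrightarrow> (\<And>i a. a \<in> G i \<Longrightarrow> (\<And>j v. v \<in> Z j \<Longrightarrow> s a v \<in> B (i + j)) \<Longrightarrow> a \<in> P i)
       \<Longrightarrow> eventual_poly S (hilb (*) G P)"
  shows "eventual_poly S (hilb s Z B)"
proof -
  interpret a: amod s by (rule s)
  interpret A: amod "(*) :: ('n, 'k) mpoly \<Rightarrow> _" by (rule amod_mult)
  define Good where "Good = {N. gm s N \<and> B \<le> N \<and> N \<le> Z \<and> eventual_poly S (hilb s N B)}"
  have "B \<in> Good" unfolding Good_def using B by (auto intro!: eventual_poly_eventually_0)
  then have "\<exists>N\<in>Good. \<forall>N'\<in>Good. N \<le> N' \<longrightarrow> N' = N"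
    by (intro noethZ) (auto simp: Good_def)
  then obtain N where N: "gm s N" "B \<le> N" "N \<le> Z" "eventual_poly S (hilb s N B)"
    and Nmax: "\<And>N'. N' \<in> Good \<Longrightarrow> N \<le> N' \<Longrightarrow> N' = N" unfolding Good_def by blast
  have "N = Z"
  proof (rule ccontr)
    assume "N \<noteq> Z"
    define ann where "ann e z = (\<lambda>i. {a \<in> G i. s a z \<in> N (i + e)})" for e :: nat and z
    have ann_ideal: "gideal (ann e z)" for e z
      unfolding gideal_def gm_def
    proof (intro conjI allI ballI)
      show "opsub {} (ann e z j)" for j
        unfolding opsub_def ann_def
        using opsub_0[OF G_opsub] opsub_0[OF gm_opsub[OF N(1)]] opsub_diff[OF G_opsub] opsub_diff[OF gm_opsub[OF N(1)]]
        by (simp add: a.scale_left_diff_distrib)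
      show "ann e z \<le> G" unfolding le_fun_def ann_def by blast
      fix i j x y assume "x \<in> G i" "y \<in> ann e z j"
      then show "x * y \<in> ann e z (i + j)"
        using gm_scale[OF N(1), of x i "s y z" "j + e"] G_mult[of x i y j] unfolding ann_def
        by (simp add: add.assoc)
    qed
    define \<C> where "\<C> = {ann e z | e z. z \<in> Z e \<and> z \<notin> N e}"
    have "\<C> \<noteq> {}"
    proof -
      have "\<exists>e. \<not> Z e \<subseteq> N e" using \<open>N \<noteq> Z\<close> N(3) unfolding le_fun_def by (meson ext subset_antisym)
      then show ?thesis unfolding \<C>_def by blast
    qed
    then have "\<exists>P\<in>\<C>. \<forall>P'\<in>\<C>. P \<le> P' \<longrightarrow> P' = P"
      by (rule noethG) (use ann_ideal in \<open>auto simp: \<C>_def\<close>)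
    then obtain e z where z: "z \<in> Z e" "z \<notin> N e"
      and zmax: "\<And>e' z'. z' \<in> Z e' \<Longrightarrow> z' \<notin> N e' \<Longrightarrow> ann e z \<le> ann e' z' \<Longrightarrow> ann e' z' = ann e z"
      unfolding \<C>_def by blast
    let ?P = "ann e z"
    \<comment> \<open>If y z is not in \<open>N\<close>, its annihilator contains that of z and
      hence equals it by maximality; so x y z in \<open>N\<close> already puts x into the
      annihilator of z.\<close>
    have prime: "gprime ?P"
      unfolding gprime_def
    proof (intro conjI allI ballI impI ann_ideal)
      show "1 \<notin> ?P 0" using z(2) unfolding ann_def by simp
      fix i j x y assume xy: "x \<in> G i" "y \<in> G j" "x * y \<in> ?P (i + j)"
      show "x \<in> ?P i \<or> y \<in> ?P j"
      proof (cases "y \<in> ?P j")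
        case False
        then have out: "s y z \<notin> N (j + e)" using xy(2) unfolding ann_def by blast
        have le: "ann e z \<le> ann (j + e) (s y z)"
        proof (rule le_funI, rule subsetI)
          fix k w assume "w \<in> ann e z k"
          then have w: "w \<in> G k" "s w z \<in> N (k + e)" unfolding ann_def by auto
          have "s y (s w z) \<in> N (j + (k + e))" by (rule gm_scale[OF N(1) xy(2) w(2)])
          moreover have "s y (s w z) = s w (s y z)" by (simp add: mult.commute)
          moreover have "j + (k + e) = k + (j + e)" by simp
          ultimately show "w \<in> ann (j + e) (s y z) k" unfolding ann_def using w(1) by simp
        qed
        have "ann (j + e) (s y z) = ann e z"
          by (rule zmax[OF gm_scale[OF Z(1) xy(2) z(1)] out le])
        moreover have "x \<in> ann (j + e) (s y z) i"
          using xy unfolding ann_def by (simp add: add.assoc)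
        ultimately show ?thesis by simp
      qed simp
    qed
    have HPP: "eventual_poly S (hilb (*) G ?P)"
    proof (rule primes[OF prime])
      fix i x assume x: "x \<in> G i" "\<And>j v. v \<in> Z j \<Longrightarrow> s x v \<in> B (i + j)"
      then have "s x z \<in> N (i + e)" using z(1) N(2) unfolding le_fun_def by blast
      then show "x \<in> ?P i" unfolding ann_def using x(1) by simp
    qed
    \<comment> \<open>The submodule N + Gz. Since z has degree \<open>e\<close>, its multiples
      contribute nothing in degrees below \<open>e\<close>.\<close>
    define N' where "N' j = {u + s x z | u x. u \<in> N j \<and> x \<in> (if e \<le> j then G (j - e) else {0})}" for j
    have le: "N \<le> N'"
    proof (rule le_funI, rule subsetI)
      fix j u assume "u \<in> N j"
      then show "u \<in> N' j" unfolding N'_def using opsub_0[OF G_opsub]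
        by (intro CollectI exI[of _ u] exI[of _ 0]) auto
    qed
    have "z \<in> N' e"
      unfolding N'_def using opsub_0[OF gm_opsub[OF N(1)]] one_G
      by (intro CollectI exI[of _ 0] exI[of _ 1]) auto
    then have ne: "N' \<noteq> N" using z(2) by metis
    have "N' \<in> Good"
      unfolding Good_def
    proof (intro CollectI conjI)
      show "B \<le> N'" using N(2) le by (rule order_trans)
      show "N' \<le> Z"
      proof (rule le_funI, rule subsetI)
        fix j v assume "v \<in> N' j"
        then obtain u x where v: "v = u + s x z" "u \<in> N j" "x \<in> (if e \<le> j then G (j - e) else {0})"
          unfolding N'_def by blast
        have "s x z \<in> Z j"
          using v(3) gm_scale[OF Z(1), of x "j - e" z e] z(1) opsub_0[OF gm_opsub[OF Z(1)]]
          by (cases "e \<le> j") auto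
        moreover have "u \<in> Z j" using v(2) N(3) unfolding le_fun_def by blast
        ultimately show "v \<in> Z j" unfolding v(1) by (intro opsub_add[OF gm_opsub[OF Z(1)]])
      qed
      show "gm s N'"
        unfolding gm_def
      proof (intro conjI allI ballI)
        fix j
        have opG: "opsub {} (if e \<le> j then G (j - e) else {0})"
          using G_opsub by (simp add: opsub_def)
        show "opsub {} (N' j)"
          unfolding opsub_def
        proof (intro conjI ballI)
          show "0 \<in> N' j" using le opsub_0[OF gm_opsub[OF N(1)]] unfolding le_fun_def by blast
          fix v v' assume "v \<in> N' j" "v' \<in> N' j"
          then obtain u x u' x' where v: "v = u + s x z" "u \<in> N j" "x \<in> (if e \<le> j then G (j - e) else {0})"
            "v' = u' + s x' z" "u' \<in> N j" "x' \<in> (if e \<le> j then G (j - e) else {0})"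
            unfolding N'_def by blast
          have "v - v' = (u - u') + s (x - x') z" unfolding v(1,4) by (simp add: a.scale_left_diff_distrib)
          then show "v - v' \<in> N' j"
            unfolding N'_def using opsub_diff[OF gm_opsub[OF N(1)] v(2,5)] opsub_diff[OF opG v(3,6)] by blast
        qed simp
        fix i y v assume y: "y \<in> G i" and "v \<in> N' j"
        then obtain u x where v: "v = u + s x z" "u \<in> N j" "x \<in> (if e \<le> j then G (j - e) else {0})"
          unfolding N'_def by blast
        have "s y v = s y u + s (y * x) z" unfolding v(1) by (simp add: a.scale_right_distrib)
        moreover have "s y u \<in> N (i + j)" by (rule gm_scale[OF N(1) y v(2)])
        moreover have "y * x \<in> (if e \<le> i + j then G (i + j - e) else {0})"
        proof (cases "e \<le> j")
          case True
          then have "i + j - e = i + (j - e)" by simp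
          then show ?thesis using G_mult[OF y, of x "j - e"] v(3) True by simp
        next
          case False
          then show ?thesis using v(3) opsub_0[OF G_opsub] by simp
        qed
        ultimately show "s y v \<in> N' (i + j)" unfolding N'_def by blast
      qed
      have sub: "ksub s (N j)" for j by (rule gm_subspace[OF s N(1)])
      have fdN: "fdim (kspan s) (N j)" for j
        by (rule fdim_mono[OF Z(2)[of j]]) (use N(3) in \<open>simp add: le_fun_def\<close>)
      have lin: "klinear (*) s (\<lambda>x. s x z)"
        by (intro klinearI amod_mult s) (simp_all add: a.scale_left_distrib)
      interpret p: vector_space_pair "\<lambda>c. (*) (cst c) :: ('n, 'k) mpoly \<Rightarrow> _" "\<lambda>c. s (cst c)"
        by (intro vector_space_pair.intro A.k.vector_space_axioms a.k.vector_space_axioms)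
      \<comment> \<open>N'/N is isomorphic to G/P shifted by \<open>e\<close>.\<close>
      have dim: "hilb s N' N j = (if e \<le> j then hilb (*) G ?P (j - e) else 0)" for j
      proof (cases "e \<le> j")
        case True
        have "N' j = {u + s x z | u x. u \<in> N j \<and> x \<in> G (j - e)}" unfolding N'_def using True by simp
        moreover have "{x \<in> G (j - e). s x z \<in> N j} = ?P (j - e)" unfolding ann_def using True by simp
        ultimately show ?thesis
          using p.dim_sum_image[OF lin gm_subspace[OF amod_mult gm_G] G_fdim sub fdN, of j "j - e"] True by simp
      next
        case False
        then have "N' j = N j" unfolding N'_def by simp
        then show ?thesis using False by simp
      qed
      have "eventual_poly S (\<lambda>j. if e \<le> j then hilb (*) G ?P (j - e) else 0)"
        by (rule eventual_poly_pcompose[OF S HPP, where J' = e and c = "- of_nat e"])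
          (auto intro!: exI[of _ "_ - e"] simp: of_nat_diff)
      then show "eventual_poly S (hilb s N' B)"
        by (rule eventual_poly_add[OF N(4)]) (simp flip: dim)
    qed
    then show False using Nmax le ne by blast
  qed
  then show ?thesis using N(4) by simp
qed

text \<open>Noetherian induction on graded primes. If x of degree one is outside \<open>P\<close>,
  multiplication by x is injective on G/P, so the difference of its Hilbert function is that of G/J
  with J = P + xG. Primes containing J lie strictly above \<open>P\<close>, so their chains become
  longer by one when \<open>P\<close> is prepended; summation raises the degree by one
  accordingly.\<close>

lemma hilbert_prime:
  assumes noethG: "\<And>\<C>. \<C> \<noteq> {} \<Longrightarrow> (\<And>P. P \<in> \<C> \<Longrightarrow> gideal P) \<Longrightarrow> \<exists>P\<in>\<C>. \<forall>P'\<in>\<C>. P \<le> P' \<longrightarrow> P' = P"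
    and P: "gprime P"
  shows "eventual_poly {i. chain P (Suc i)} (hilb (*) G P)"
proof (rule ccontr)
  assume bad: "\<not> eventual_poly {i. chain P (Suc i)} (hilb (*) G P)"
  let ?Bad = "{P. gprime P \<and> \<not> eventual_poly {i. chain P (Suc i)} (hilb (*) G P)}"
  have "\<exists>P\<in>?Bad. \<forall>P'\<in>?Bad. P \<le> P' \<longrightarrow> P' = P"
    by (rule noethG) (use P bad in \<open>auto simp: gprime_def\<close>)
  then obtain P where P: "gprime P" "\<not> eventual_poly {i. chain P (Suc i)} (hilb (*) G P)"
    and max: "\<And>P'. gprime P' \<Longrightarrow> P < P' \<Longrightarrow> eventual_poly {i. chain P' (Suc i)} (hilb (*) G P')"
    unfolding less_le by blast
  interpret A: amod "(*) :: ('n, 'k) mpoly \<Rightarrow> _" by (rule amod_mult)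
  have Pid: "gideal P" using P(1) unfolding gprime_def by blast
  note Pgm = gidealD(1)[OF Pid]
  show False
  proof (cases "G 1 \<subseteq> P 1")
    case True
    have "G (Suc j) \<subseteq> P (Suc j)" for j
    proof (rule G_gen[OF gm_opsub[OF Pgm]])
      fix x y assume "x \<in> G 1" "y \<in> G j"
      then have "y * x \<in> P (j + 1)" using gm_scale[OF Pgm, of y j x 1] True by blast
      then show "x * y \<in> P (Suc j)" by (simp add: mult.commute)
    qed
    then have "G (Suc j) = P (Suc j)" for j
      using gidealD(2)[OF Pid, of "Suc j"] by (intro subset_antisym)
    then have "hilb (*) G P j = 0" if "j \<ge> 1" for j using that by (cases j) simp_all
    then have "eventual_poly {i. chain P (Suc i)} (hilb (*) G P)" by (rule eventual_poly_eventually_0)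
    then show False using P(2) by simp
  next
    case False
    then obtain x where x: "x \<in> G 1" "x \<notin> P 1" by blast
    \<comment> \<open>The ideal P + xG; as x has degree one, its part in degree 0 is just
      \<open>P 0\<close>.\<close>
    define J where "J j = {u + x * y | u y. u \<in> P j \<and> y \<in> (case j of 0 \<Rightarrow> {0} | Suc i \<Rightarrow> G i)}" for j
    have opc: "opsub {} (case j of 0 \<Rightarrow> {0} | Suc i \<Rightarrow> G i)" for j
      using G_opsub by (cases j) (simp_all add: opsub_def)
    have PJ: "P j \<subseteq> J j" for j
    proof
      fix u assume "u \<in> P j"
      then show "u \<in> J j" unfolding J_def using opsub_0[OF opc]
        by (intro CollectI exI[of _ u] exI[of _ 0]) simp
    qed
    have xJ: "x \<in> J 1" unfolding J_def using opsub_0[OF gm_opsub[OF Pgm]] one_G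
      by (intro CollectI exI[of _ 0] exI[of _ 1]) simp
    have JG: "J \<le> G"
    proof (rule le_funI, rule subsetI)
      fix j v assume "v \<in> J j"
      then obtain u y where v: "v = u + x * y" "u \<in> P j" "y \<in> (case j of 0 \<Rightarrow> {0} | Suc i \<Rightarrow> G i)"
        unfolding J_def by blast
      have "x * y \<in> G j" using v(3) opsub_0[OF G_opsub] G_mult[OF x(1), of y]
        by (cases j) auto
      then show "v \<in> G j" unfolding v(1) using v(2) gidealD(2)[OF Pid, of j] by (intro opsub_add[OF G_opsub]) auto
    qed
    have Jgm: "gm (*) J"
      unfolding gm_def
    proof (intro conjI allI ballI)
      fix j
      show "opsub {} (J j)"
        unfolding opsub_def
      proof (intro conjI ballI)
        show "0 \<in> J j" using PJ opsub_0[OF gm_opsub[OF Pgm]] by blast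
        fix v v' assume "v \<in> J j" "v' \<in> J j"
        then obtain u y u' y' where v: "v = u + x * y" "u \<in> P j" "y \<in> (case j of 0 \<Rightarrow> {0} | Suc i \<Rightarrow> G i)"
          "v' = u' + x * y'" "u' \<in> P j" "y' \<in> (case j of 0 \<Rightarrow> {0} | Suc i \<Rightarrow> G i)"
          unfolding J_def by blast
        have "v - v' = (u - u') + x * (y - y')" unfolding v(1,4) by (simp add: right_diff_distrib)
        then show "v - v' \<in> J j"
          unfolding J_def using opsub_diff[OF gm_opsub[OF Pgm] v(2,5)] opsub_diff[OF opc v(3,6)] by blast
      qed simp
      fix i w v assume w: "w \<in> G i" and "v \<in> J j"
      then obtain u y where v: "v = u + x * y" "u \<in> P j" "y \<in> (case j of 0 \<Rightarrow> {0} | Suc i \<Rightarrow> G i)"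
        unfolding J_def by blast
      have "w * v = w * u + x * (w * y)" unfolding v(1) by (simp add: distrib_left mult.left_commute ac_simps)
      moreover have "w * u \<in> P (i + j)" by (rule gm_scale[OF Pgm w v(2)])
      moreover have "w * y \<in> (case i + j of 0 \<Rightarrow> {0} | Suc i \<Rightarrow> G i)"
      proof (cases j)
        case 0
        then have "w * y = 0" using v(3) by simp
        then show ?thesis using opsub_0[OF opc] by simp
      next
        case (Suc j')
        then show ?thesis using v(3) G_mult[OF w, of y j'] by simp
      qed
      ultimately show "w * v \<in> J (i + j)" unfolding J_def by blast
    qed
    have HJ: "eventual_poly {i. chain P (Suc (Suc i))} (hilb (*) G J)"
    proof (rule hilbert_module[OF amod_mult gm_G G_fdim Jgm JG noethG])
      show "\<exists>N\<in>\<C>. \<forall>N'\<in>\<C>. N \<le> N' \<longrightarrow> N' = N"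
        if "\<C> \<noteq> {}" "\<And>N. N \<in> \<C> \<Longrightarrow> gm (*) N \<and> J \<le> N \<and> N \<le> G" for \<C>
        by (rule noethG[OF that(1)]) (use that(2) in \<open>auto simp: gideal_def\<close>)
      show "i \<in> {i. chain P (Suc (Suc i))}" if "j \<in> {i. chain P (Suc (Suc i))}" "i \<le> j" for i j
        using that chain_mono[of P "Suc (Suc j)" "Suc (Suc i)"] by simp
      fix P' assume P': "gprime P'" and sub: "\<And>i a. a \<in> G i \<Longrightarrow> (\<And>j v. v \<in> G j \<Longrightarrow> a * v \<in> J (i + j)) \<Longrightarrow> a \<in> P' i"
      \<comment> \<open>The ideal J annihilates G/J, so every prime to be considered contains
        it.\<close>
      have JP': "J i \<subseteq> P' i" for i
      proof
        fix y assume y: "y \<in> J i"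
        show "y \<in> P' i"
        proof (rule sub)
          show "y \<in> G i" using y JG unfolding le_fun_def by blast
          fix j v assume "v \<in> G j"
          then have "v * y \<in> J (j + i)" using gm_scale[OF Jgm] y by blast
          then show "y * v \<in> J (i + j)" by (simp add: ac_simps)
        qed
      qed
      then have "P \<le> P'" using PJ unfolding le_fun_def by blast
      moreover have "P \<noteq> P'" using x(2) xJ JP' by blast
      ultimately have lt: "P < P'" by simp
      then have "eventual_poly {i. chain P' (Suc i)} (hilb (*) G P')" by (rule max[OF P'])
      then show "eventual_poly {i. chain P (Suc (Suc i))} (hilb (*) G P')"
        by (rule eventual_poly_mono) (use P(1) lt in auto)
    qed
    have fdP: "fdim (kspan (*)) (P j)" for j by (rule fdim_mono[OF G_fdim gidealD(2)[OF Pid]])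
    have lin: "klinear (*) (*) ((*) x)"
      by (intro klinearI amod_mult) (simp_all add: distrib_left mult.left_commute ac_simps)
    interpret p: vector_space_pair "\<lambda>c. (*) (cst c) :: ('n, 'k) mpoly \<Rightarrow> _" "\<lambda>c. (*) (cst c) :: ('n, 'k) mpoly \<Rightarrow> _"
      by (intro vector_space_pair.intro A.k.vector_space_axioms)
    have step: "hilb (*) G P (Suc j) - hilb (*) G P j = hilb (*) G J (Suc j)" for j
    proof -
      have "J (Suc j) = {u + x * y | u y. u \<in> P (Suc j) \<and> y \<in> G j}" unfolding J_def by simp
      moreover have "{y \<in> G j. x * y \<in> P (Suc j)} = P j"
      proof (intro equalityI subsetI)
        fix y assume "y \<in> {y \<in> G j. x * y \<in> P (Suc j)}"
        then have y: "y \<in> G j" "x * y \<in> P (1 + j)" by simp_all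
        then have "x \<in> P 1 \<or> y \<in> P j" using P(1) x(1) unfolding gprime_def by blast
        then show "y \<in> P j" using x(2) by blast
      next
        fix y assume y: "y \<in> P j"
        have "x * y \<in> P (1 + j)" by (rule gm_scale[OF Pgm x(1) y])
        then show "y \<in> {y \<in> G j. x * y \<in> P (Suc j)}" using y gidealD(2)[OF Pid, of j] by auto
      qed
      ultimately show ?thesis
        using p.dim_sum_image[OF lin gm_subspace[OF amod_mult gm_G] G_fdim gm_subspace[OF amod_mult Pgm] fdP, of "Suc j" j]
        by simp
    qed
    have P0: "P 0 \<subseteq> {0}"
    proof
      fix y assume y: "y \<in> P 0"
      then obtain c where c: "y = cst c" using gidealD(2)[OF Pid, of 0] G_0 by auto
      have "cst (inverse c) \<in> G 0" unfolding G_0 by blast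
      then have "cst (inverse c) * y \<in> P 0" using gm_scale[OF Pgm _ y, of "cst (inverse c)" 0] by simp
      then have "cst (inverse c * c) \<in> P 0" unfolding c cst_mult .
      then have "c = 0" using P(1) unfolding gprime_def by (cases "c = 0") auto
      then show "y \<in> {0}" unfolding c by simp
    qed
    \<comment> \<open>A graded prime containing all elements of positive degree. It lies strictly
      above \<open>P\<close> because x is outside \<open>P\<close>, and so supplies the exponent 0
      needed for the constant of summation.\<close>
    define M where "M j = (if j = 0 then P 0 else G j)" for j
    have "gprime M"
      unfolding gprime_def gideal_def gm_def
    proof (intro conjI allI ballI impI)
      show "opsub {} (M j)" for j unfolding M_def using gm_opsub[OF Pgm] G_opsub by simp
      show "M \<le> G" unfolding le_fun_def M_def using gidealD(2)[OF Pid] by simp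
      show "1 \<notin> M 0" using P(1) unfolding M_def gprime_def by simp
      show "a * b \<in> M (i + j)" if a: "a \<in> G i" and b: "b \<in> M j" for i j a b
      proof (cases "i + j = 0")
        case True
        then show ?thesis using gm_scale[OF Pgm a, of b j] b unfolding M_def by simp
      next
        case False
        have "b \<in> G j" using b gidealD(2)[OF Pid, of 0] unfolding M_def by (auto split: if_splits)
        then have "a * b \<in> G (i + j)" by (rule G_mult[OF a])
        then show ?thesis unfolding M_def using False by (simp only: if_False)
      qed
      show "a \<in> M i \<or> b \<in> M j" if "a \<in> G i" "b \<in> G j" "a * b \<in> M (i + j)" for i j a b
      proof (cases "i = 0 \<and> j = 0")
        case True
        then have "a * b \<in> P (0 + 0)" using that(3) unfolding M_def by simp
        then show ?thesis using P(1) that(1,2) True unfolding gprime_def M_def by fastforce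
      next
        case False
        then show ?thesis using that(1,2) unfolding M_def by auto
      qed
    qed
    moreover have "P < M"
    proof -
      have "P \<le> M" unfolding le_fun_def M_def using gidealD(2)[OF Pid] by simp
      moreover have "P \<noteq> M" using x unfolding M_def by (metis one_neq_zero)
      ultimately show ?thesis by simp
    qed
    ultimately have "chain P (Suc 0)" using P(1) by auto
    have "eventual_poly {i. chain P (Suc i)} (hilb (*) G P)"
    proof (rule eventual_poly_difference)
      show "i \<in> {i. chain P (Suc i)}" if "j \<in> {i. chain P (Suc i)}" "i \<le> j" for i j
        using that chain_mono[of P "Suc j" "Suc i"] by simp
      show "0 \<in> {i. chain P (Suc i)}" using \<open>chain P (Suc 0)\<close> by simp
      have "eventual_poly {i. chain P (Suc (Suc i))} (\<lambda>j. hilb (*) G J (Suc j))"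
        by (rule eventual_poly_pcompose[OF _ HJ, where J' = 0 and c = 1])
          (use chain_mono[of P] in \<open>auto simp del: chain.simps intro!: exI[of _ "Suc _"]\<close>)
      then show "eventual_poly {i. Suc i \<in> {i. chain P (Suc i)}} (\<lambda>j. hilb (*) G P (Suc j) - hilb (*) G P j)"
        unfolding step by simp
    qed
    then show False using P(2) by simp
  qed
qed

end

section \<open>Powers of an ideal generated in one degree\<close>

locale rees =
  fixes I :: "('n::finite, 'k::field) mpoly set" and d :: nat and Gs :: "('n, 'k) mpoly set"
  assumes Gs: "Gs \<subseteq> forms (int d)" and I: "I = mult.span Gs"
begin

abbreviation V :: "('n, 'k) mpoly set" where "V \<equiv> I \<inter> forms (int d)"

abbreviation pw :: "nat \<Rightarrow> ('n, 'k) mpoly set" where "pw \<equiv> ideal_power I"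

text \<open>The span over the field of the products of j elements of I_d, that is, the degree j part
  of the fiber ring, realised by polynomials of degree dj.\<close>

fun GG :: "nat \<Rightarrow> ('n, 'k) mpoly set" where
  "GG 0 = range cst"
| "GG (Suc j) = kspan (*) {f * g | f g. f \<in> V \<and> g \<in> GG j}"

sublocale A: amod "(*) :: ('n, 'k) mpoly \<Rightarrow> _" by (rule amod_mult)

lemma I_subspace: "mult.subspace I" unfolding I by (rule mult.subspace_span)

lemma V_scale: "f \<in> V \<Longrightarrow> cst c * f \<in> V"
  using mult.subspace_scale[OF I_subspace] by (auto intro: forms_mult'[OF cst_in_forms])

lemma opsub_I: "opsub {} I"
  unfolding opsub_def using mult.subspace_0[OF I_subspace] mult.subspace_diff[OF I_subspace] by blast

lemma opsub_V: "opsub {} V"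
  unfolding opsub_def
  by (intro conjI ballI IntI) (simp_all add: opsub_0[OF opsub_I] opsub_0[OF opsub_forms] opsub_diff[OF opsub_I]
    opsub_diff[OF opsub_forms])

lemma Gs_V: "Gs \<subseteq> V"
  using Gs mult.span_base I by blast

lemma subspace_GG: "A.k.subspace (GG j)"
proof (cases j)
  case 0
  have "A.k.subspace (range cst)"
    unfolding A.k.subspace_def
  proof (intro conjI ballI allI)
    show "0 \<in> range (cst :: 'k \<Rightarrow> ('n, 'k) mpoly)" by (rule image_eqI[of _ _ 0]) simp_all
  qed (auto simp flip: cst_add cst_mult)
  then show ?thesis using 0 by simp
qed (simp add: A.k.subspace_span)

lemma opsub_GG: "opsub {} (GG j)"
  by (rule A.subspace_imp_opsub[OF subspace_GG])

lemma GG_forms: "GG j \<subseteq> forms (int d * int j)"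
proof (induction j)
  case 0
  then show ?case using cst_in_forms by auto
next
  case (Suc j)
  have "A.k.subspace (forms (int d * int (Suc j)))"
    by (rule A.opsub_imp_subspace[OF opsub_forms]) (auto intro: forms_mult'[OF cst_in_forms])
  moreover have "{f * g | f g. f \<in> V \<and> g \<in> GG j} \<subseteq> forms (int d * int (Suc j))"
    using Suc by (auto intro!: forms_mult'[of _ "int d" _ "int d * int j"] simp: algebra_simps)
  ultimately show ?case unfolding GG.simps by (intro A.k.span_minimal)
qed

text \<open>\<open>V\<close> is closed under field scalars, so scalars are absorbed into the first
  factor and a subgroup \<open>M\<close> suffices instead of a subspace.\<close>

lemma GG_gen:
  assumes M: "opsub {} M" and prod: "\<And>f g. f \<in> V \<Longrightarrow> g \<in> GG j \<Longrightarrow> f * g \<in> M"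
  shows "GG (Suc j) \<subseteq> M"
proof
  fix x assume "x \<in> GG (Suc j)"
  then obtain t r where x: "x = (\<Sum>a\<in>t. cst (r a) * a)" "t \<subseteq> {f * g | f g. f \<in> V \<and> g \<in> GG j}"
    unfolding GG.simps A.k.span_explicit by blast
  show "x \<in> M" unfolding x(1)
  proof (rule opsub_sum[OF M])
    fix a assume "a \<in> t"
    then obtain f g where fg: "a = f * g" "f \<in> V" "g \<in> GG j" using x(2) by blast
    have "(cst (r a) * f) * g \<in> M" by (rule prod[OF V_scale[OF fg(2)] fg(3)])
    then show "cst (r a) * a \<in> M" unfolding fg(1) by (simp only: mult.assoc)
  qed
qed

lemma GG_prod: "f \<in> V \<Longrightarrow> g \<in> GG j \<Longrightarrow> f * g \<in> GG (Suc j)"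
  unfolding GG.simps by (rule A.k.span_base) blast

lemma GG_1: "GG 1 = V"
proof
  have "GG (Suc 0) \<subseteq> V"
  proof (rule GG_gen[OF opsub_V])
    fix f g assume "f \<in> V" "g \<in> GG 0"
    then obtain c where "g = cst c" "f \<in> V" by auto
    then have "cst c * f \<in> V" "f * g = cst c * f" using V_scale by (simp_all only: mult.commute)
    then show "f * g \<in> V" by simp
  qed
  then show "GG 1 \<subseteq> V" by simp
  have "f * cst 1 \<in> GG (Suc 0)" if "f \<in> V" for f by (rule GG_prod[OF that]) (simp only: GG.simps rangeI)
  then show "V \<subseteq> GG 1" by auto
qed

lemma GG_mult: "a \<in> GG i \<Longrightarrow> b \<in> GG j \<Longrightarrow> a * b \<in> GG (i + j)"
proof (induction i arbitrary: a)
  case 0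
  then obtain c where "a = cst c" by auto
  then show ?case using A.k.subspace_scale[OF subspace_GG] 0 by simp
next
  case (Suc i)
  have "opsub {} {a. a * b \<in> GG (Suc i + j)}"
    unfolding opsub_def left_diff_distrib mem_Collect_eq mult_zero_left
    using opsub_0[OF opsub_GG] opsub_diff[OF opsub_GG] by blast
  then have "GG (Suc i) \<subseteq> {a. a * b \<in> GG (Suc i + j)}"
  proof (rule GG_gen)
    fix f g assume "f \<in> V" "g \<in> GG i"
    then have "f * (g * b) \<in> GG (Suc (i + j))" using Suc.IH[OF _ Suc.prems(2)] by (intro GG_prod)
    then show "f * g \<in> {a. a * b \<in> GG (Suc i + j)}" by (simp add: mult.assoc)
  qed
  then show ?case using Suc.prems by blast
qed

lemma fdim_GG: "fdim (kspan (*)) (GG j)"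
  by (rule fdim_mono[OF fdim_forms GG_forms])

sublocale galg GG
proof
  show "GG (Suc j) \<subseteq> M" if "opsub {} M" "\<And>a b. a \<in> GG 1 \<Longrightarrow> b \<in> GG j \<Longrightarrow> a * b \<in> M" for M j
    using that by (intro GG_gen) (simp_all only: GG_1)
qed (rule opsub_GG, simp, erule (1) GG_mult, rule fdim_GG)

lemma pw_0: "pw 0 = UNIV"
  by (simp add: ideals_set_def ring_of_type_algebra_def nat_pow_def)

lemma pw_Suc: "pw (Suc j) = ideal_prod mpoly_ring (pw j) I"
  by (simp add: ideals_set_def nat_pow_def)

text \<open>Connects the powers in the monoid of ideals with \<open>GG\<close>. The inclusion from
  left to right reduces a product of elements of I^j and I, factor by factor, to products of
  elements of \<open>GG j\<close> and generators in \<open>Gs\<close>.\<close>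

lemma pw_eq_span: "pw j = mult.span (GG j)"
proof (induction j)
  case 0
  have "x \<in> mult.span (GG 0)" for x
  proof -
    have "x * cst 1 \<in> mult.span (GG 0)"
      by (intro mult.span_scale mult.span_base) (simp only: GG.simps rangeI)
    then show ?thesis by simp
  qed
  then show ?case unfolding pw_0 by blast
next
  case (Suc j)
  interpret R: ring "mpoly_ring :: ('n, 'k) mpoly ring"
    using cring.axioms(1)[OF cring_sring[OF subrng_UNIV]] unfolding sring_UNIV .
  have id: "ideal (pw j) mpoly_ring" "ideal I mpoly_ring"
    unfolding ideal_type_algebra_iff Suc by (rule mult.subspace_span, rule I_subspace)
  have sub: "mult.subspace (pw (Suc j))"
    unfolding pw_Suc ideal_type_algebra_iff[symmetric] by (rule R.ideal_prod_is_ideal[OF id])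
  show ?case
  proof
    show "mult.span (GG (Suc j)) \<subseteq> pw (Suc j)"
    proof (rule mult.span_minimal[OF _ sub], rule GG_gen)
      show "opsub {} (pw (Suc j))" unfolding opsub_def
        using mult.subspace_0[OF sub] mult.subspace_diff[OF sub] by blast
      fix f g assume "f \<in> V" "g \<in> GG j"
      then have "g \<in> pw j" "f \<in> I" unfolding Suc using mult.span_base by blast+
      then have "g \<otimes>\<^bsub>mpoly_ring\<^esub> f \<in> pw (Suc j)" unfolding pw_Suc by (rule ideal_prod.prod)
      then show "f * g \<in> pw (Suc j)" by (simp add: sring_simps mult.commute)
    qed
    show "pw (Suc j) \<subseteq> mult.span (GG (Suc j))"
    proof
      fix x assume "x \<in> pw (Suc j)"
      then show "x \<in> mult.span (GG (Suc j))" unfolding pw_Suc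
      proof (induction rule: ideal_prod.induct)
        case (prod a b)
        have op: "mult.subspace {b. \<forall>a\<in>mult.span (GG j). a * b \<in> mult.span (GG (Suc j))}"
          unfolding mult.subspace_def
          by (auto simp: distrib_left mult.left_commute mult.span_zero intro: mult.span_add mult.span_scale)
        have "a * f \<in> mult.span (GG (Suc j))" if f: "f \<in> Gs" and a: "a \<in> mult.span (GG j)" for a f
        proof -
          have "mult.subspace {a. a * f \<in> mult.span (GG (Suc j))}"
            unfolding mult.subspace_def
            by (simp add: distrib_right mult.assoc mult.span_zero mult.span_add mult.span_scale)
          moreover have "GG j \<subseteq> {a. a * f \<in> mult.span (GG (Suc j))}"
          proof
            fix g assume "g \<in> GG j"
            then have "f * g \<in> GG (Suc j)" using f Gs_V by (intro GG_prod) blast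
            then show "g \<in> {a. a * f \<in> mult.span (GG (Suc j))}"
              using mult.span_base by (simp add: mult.commute)
          qed
          ultimately have "mult.span (GG j) \<subseteq> {a. a * f \<in> mult.span (GG (Suc j))}"
            by (intro mult.span_minimal)
          then show ?thesis using a by blast
        qed
        then have "Gs \<subseteq> {b. \<forall>a\<in>mult.span (GG j). a * b \<in> mult.span (GG (Suc j))}" by blast
        then have "mult.span Gs \<subseteq> {b. \<forall>a\<in>mult.span (GG j). a * b \<in> mult.span (GG (Suc j))}"
          by (rule mult.span_minimal[OF _ op])
        then have "I \<subseteq> {b. \<forall>a\<in>mult.span (GG j). a * b \<in> mult.span (GG (Suc j))}"
          by (rule order_trans[OF equalityD1[OF I]])
        then show ?case using prod unfolding Suc sring_simps by blast
      next
        case (sum s1 s2)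
        then show ?case unfolding sring_simps by (intro mult.span_add)
      qed
    qed
  qed
qed

lemma pw_subspace: "mult.subspace (pw j)"
  unfolding pw_eq_span by (rule mult.subspace_span)

lemma opsub_pw: "opsub {} (pw j)"
  unfolding opsub_def using mult.subspace_0[OF pw_subspace] mult.subspace_diff[OF pw_subspace] by blast

lemma pw_scale: "x \<in> pw j \<Longrightarrow> a * x \<in> pw j"
  by (rule mult.subspace_scale[OF pw_subspace])

lemma GG_pw: "GG j \<subseteq> pw j"
  unfolding pw_eq_span by (rule mult.span_superset)

lemma pw_explicit:
  assumes "x \<in> pw j"
  obtains t r where "finite t" "t \<subseteq> GG j" "x = (\<Sum>g\<in>t. r g * g)"
  using assms unfolding pw_eq_span mult.span_explicit by blast

lemma hpart_pw_sum:
  assumes "t \<subseteq> GG j"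
  shows "hpart e (\<Sum>g\<in>t. r g * g) = (\<Sum>g\<in>t. hpart (e - int d * int j) (r g) * g)"
  unfolding rst_sum
proof (intro sum.cong refl)
  fix g assume "g \<in> t"
  then have "g \<in> forms (int d * int j)" using assms GG_forms by blast
  then show "hpart e (r g * g) = hpart (e - int d * int j) (r g) * g"
    using hpart_mult[of g "int d * int j" e "r g"] by (simp add: mult.commute)
qed

lemma hpart_pw: "x \<in> pw j \<Longrightarrow> hpart e x \<in> pw j"
proof -
  assume "x \<in> pw j"
  then obtain t r where x: "t \<subseteq> GG j" "x = (\<Sum>g\<in>t. r g * g)" by (rule pw_explicit)
  show ?thesis unfolding x(2) hpart_pw_sum[OF x(1)] using x(1) GG_pw
    by (intro mult.subspace_sum[OF pw_subspace] pw_scale) blast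
qed

lemma hpart_pw_low: "x \<in> pw j \<Longrightarrow> e < int d * int j \<Longrightarrow> hpart e x = 0"
proof -
  assume "x \<in> pw j" and e: "e < int d * int j"
  then obtain t r where x: "t \<subseteq> GG j" "x = (\<Sum>g\<in>t. r g * g)" by (elim pw_explicit)
  have "hpart (e - int d * int j) y = 0" for y :: "('n, 'k) mpoly"
    by (rule forms_neg[OF _ hpart_in_forms]) (use e in simp)
  then show ?thesis unfolding x(2) hpart_pw_sum[OF x(1)] by simp
qed

text \<open>In a combination of elements of \<open>GG j\<close>, which have degree dj, only the
  constant terms of the coefficients contribute to degree dj.\<close>

lemma hpart_pw_GG: "x \<in> pw j \<Longrightarrow> hpart (int d * int j) x \<in> GG j"
proof -
  assume "x \<in> pw j"
  then obtain t r where x: "t \<subseteq> GG j" "x = (\<Sum>g\<in>t. r g * g)" by (rule pw_explicit)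
  show ?thesis unfolding x(2) hpart_pw_sum[OF x(1)]
  proof (rule opsub_sum[OF opsub_GG])
    fix g assume "g \<in> t"
    moreover have "hpart 0 (r g) = cst (Poly_Mapping.lookup (hpart 0 (r g)) 0)"
      by (rule forms_0[OF hpart_in_forms])
    ultimately show "hpart (int d * int j - int d * int j) (r g) * g \<in> GG j"
      using x(1) A.k.subspace_scale[OF subspace_GG, of g j] by (metis diff_self subsetD)
  qed
qed

lemma pw_mult:
  assumes "x \<in> pw i" "y \<in> pw j"
  shows "x * y \<in> pw (i + j)"
proof -
  obtain t r where x: "t \<subseteq> GG i" "x = (\<Sum>g\<in>t. r g * g)" using assms(1) by (rule pw_explicit)
  obtain t' r' where y: "t' \<subseteq> GG j" "y = (\<Sum>g\<in>t'. r' g * g)" using assms(2) by (rule pw_explicit)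
  have "x * y = (\<Sum>g\<in>t. \<Sum>g'\<in>t'. (r g * r' g') * (g * g'))"
    unfolding x(2) y(2) sum_product by (intro sum.cong refl) (simp add: ac_simps)
  also have "\<dots> \<in> pw (i + j)"
  proof (rule mult.subspace_sum[OF pw_subspace], rule mult.subspace_sum[OF pw_subspace])
    fix g g' assume "g \<in> t" "g' \<in> t'"
    then have "g \<in> GG i" "g' \<in> GG j" using x(1) y(1) by blast+
    then show "r g * r' g' * (g * g') \<in> pw (i + j)" by (rule pw_scale[OF subsetD[OF GG_pw GG_mult]])
  qed
  finally show ?thesis .
qed

section \<open>Noetherianity of the Rees algebra\<close>

text \<open>Submodules of \<open>\<Oplus>\<^sub>j (I\<^sup>j)\<^sup>\<Omega>\<close> over the Rees algebra, given by their components.\<close>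

definition rfam :: "'b set \<Rightarrow> (nat \<Rightarrow> ('b \<Rightarrow> ('n, 'k) mpoly) set) \<Rightarrow> bool" where
  "rfam \<Omega> N \<longleftrightarrow> (\<forall>j. opsub {} (N j)) \<and>
     (\<forall>j. \<forall>v\<in>N j. (\<forall>b\<in>\<Omega>. v b \<in> pw j) \<and> (\<forall>b. b \<notin> \<Omega> \<longrightarrow> v b = 0)) \<and>
     (\<forall>j a. \<forall>v\<in>N j. (\<lambda>b. a * v b) \<in> N j) \<and> (\<forall>j. \<forall>f\<in>V. \<forall>v\<in>N j. (\<lambda>b. f * v b) \<in> N (Suc j))"

lemma rfamD:
  assumes N: "rfam \<Omega> N"
  shows "opsub {} (N j)" "v \<in> N j \<Longrightarrow> b \<in> \<Omega> \<Longrightarrow> v b \<in> pw j" "v \<in> N j \<Longrightarrow> b \<notin> \<Omega> \<Longrightarrow> v b = 0"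
    "v \<in> N j \<Longrightarrow> (\<lambda>b. a * v b) \<in> N j" "f \<in> V \<Longrightarrow> v \<in> N j \<Longrightarrow> (\<lambda>b. f * v b) \<in> N (Suc j)"
proof -
  note D = N[unfolded rfam_def]
  show "opsub {} (N j)" by (rule D[THEN conjunct1, THEN spec])
  show "v b \<in> pw j" if "v \<in> N j" "b \<in> \<Omega>"
    by (rule D[THEN conjunct2, THEN conjunct1, THEN spec, THEN bspec, OF that(1), THEN conjunct1, THEN bspec, OF that(2)])
  show "v b = 0" if "v \<in> N j" "b \<notin> \<Omega>"
    by (rule D[THEN conjunct2, THEN conjunct1, THEN spec, THEN bspec, OF that(1), THEN conjunct2, THEN spec, THEN mp, OF that(2)])
  show "(\<lambda>b. a * v b) \<in> N j" if "v \<in> N j"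
    by (rule D[THEN conjunct2, THEN conjunct2, THEN conjunct1, THEN spec, THEN spec, THEN bspec, OF that])
  show "(\<lambda>b. f * v b) \<in> N (Suc j)" if "f \<in> V" "v \<in> N j"
    by (rule D[THEN conjunct2, THEN conjunct2, THEN conjunct2, THEN spec, THEN bspec, OF that(1), THEN bspec, OF that(2)])
qed

text \<open>The honest direct sum of the components. Multiplication by f t changes the component, so
  the operators of the basis theorem act on finitely supported sequences.\<close>

definition total :: "(nat \<Rightarrow> ('b \<Rightarrow> ('n, 'k) mpoly) set) \<Rightarrow> (nat \<Rightarrow> 'b \<Rightarrow> ('n, 'k) mpoly) set" where
  "total N = {v. (\<forall>j. v j \<in> N j) \<and> finite {j. v j \<noteq> 0}}"

abbreviation mul_op :: "('n, 'k) mpoly \<Rightarrow> (nat \<Rightarrow> 'b \<Rightarrow> ('n, 'k) mpoly) \<Rightarrow> nat \<Rightarrow> 'b \<Rightarrow> ('n, 'k) mpoly" where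
  "mul_op a \<equiv> \<lambda>v j b. a * v j b"

text \<open>Multiplication by f t.\<close>

definition shift_op :: "('n, 'k) mpoly \<Rightarrow> (nat \<Rightarrow> 'b \<Rightarrow> ('n, 'k) mpoly) \<Rightarrow> nat \<Rightarrow> 'b \<Rightarrow> ('n, 'k) mpoly" where
  "shift_op f v = (\<lambda>j b. case j of 0 \<Rightarrow> 0 | Suc i \<Rightarrow> f * v i b)"

text \<open>The starting point is the finite-dimensional space spanned by the unit vectors in
  component 0, with field scalars as operators. Adjoining the variables and f t for f in a finite
  spanning set of I_d yields a Noetherian \<open>W\<close> containing all sequences with entries in
  the powers of \<open>I\<close>.\<close>

lemma rees_acc:
  fixes \<Omega> :: "'b set"
  assumes fin: "finite \<Omega>"
  obtains T :: "((nat \<Rightarrow> 'b \<Rightarrow> ('n, 'k) mpoly) \<Rightarrow> (nat \<Rightarrow> 'b \<Rightarrow> ('n, 'k) mpoly)) set" and W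
  where "acc T W" "\<And>N. rfam \<Omega> N \<Longrightarrow> opsub T (total N) \<and> total N \<subseteq> W"
proof -
  let ?s = "\<lambda>a (v :: nat \<Rightarrow> 'b \<Rightarrow> ('n, 'k) mpoly) j b. a * v j b"
  have am: "amod ?s" by (rule amod_fun[OF amod_fun[OF amod_mult]])
  interpret s: amod ?s by (rule am)
  define \<delta> :: "nat \<Rightarrow> 'b \<Rightarrow> ('n, 'k) mpoly \<Rightarrow> nat \<Rightarrow> 'b \<Rightarrow> ('n, 'k) mpoly" where
    "\<delta> j b a = (\<lambda>j' b'. if j' = j \<and> b' = b then a else 0)" for j b a
  define W0 where "W0 = s.k.span ((\<lambda>b. \<delta> 0 b 1) ` \<Omega>)"
  define T0 where "T0 = range (\<lambda>c. ?s (cst c))"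
  have W0: "opsub T0 W0" unfolding opsub_def T0_def W0_def
    using s.k.span_zero s.k.span_diff s.k.span_scale by blast
  have acc0: "acc T0 W0"
    unfolding acc_def
  proof (intro allI impI)
    fix N assume N: "\<forall>i. opsub T0 (N i) \<and> N i \<subseteq> W0 \<and> N i \<subseteq> N (Suc i)"
    show "\<exists>m. \<forall>i\<ge>m. N i = N m"
    proof (rule s.k.acc_fdim)
      show "fdim s.k.span W0" unfolding fdim_def W0_def using fin by blast
      show "s.k.subspace W0" unfolding W0_def by (rule s.k.subspace_span)
      show "s.k.subspace (N i)" for i
      proof (rule s.opsub_imp_subspace)
        have N': "opsub T0 (N i)" using N by blast
        then show "opsub {} (N i)" by (rule opsub_mono) simp
        fix c v assume "v \<in> N i"
        then show "?s (cst c) v \<in> N i" using opsub_op[OF N', of "?s (cst c)"] unfolding T0_def by blast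
      qed
    qed (use N in blast)+
  qed
  \<comment> \<open>I_d is finite-dimensional; a finite spanning set is needed because operators are
    adjoined one at a time.\<close>
  obtain F where F: "finite F" "V \<subseteq> A.k.span F" "F \<subseteq> V"
  proof -
    have fd: "fdim A.k.span V" by (rule fdim_mono[OF fdim_forms]) blast
    have sub: "A.k.subspace V" by (rule A.opsub_imp_subspace[OF opsub_V V_scale])
    obtain B C where C: "B \<subseteq> C" "finite C" "A.k.span C = V"
      by (rule A.k.basis_extension[OF fd sub sub order_refl])
    have "C \<subseteq> V" unfolding C(3)[symmetric] by (rule A.k.span_superset)
    then show ?thesis by (intro that[OF C(2)]) (simp_all only: C(3) order_refl)
  qed
  define Z where "Z = (\<lambda>l. ?s (xv l)) ` {..<CARD('n)} \<union> (shift_op :: _ \<Rightarrow> (nat \<Rightarrow> 'b \<Rightarrow> ('n, 'k) mpoly) \<Rightarrow> _) ` F"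
  have mul_add: "additive (?s a)" for a
    unfolding additive_def by (simp add: fun_eq_iff distrib_left)
  have shift_add: "additive (shift_op f :: (nat \<Rightarrow> 'b \<Rightarrow> ('n, 'k) mpoly) \<Rightarrow> _)" for f
    unfolding additive_def shift_op_def by (simp add: fun_eq_iff distrib_left split: nat.split)
  have c1: "?s a (?s a' v) = ?s a' (?s a v)" for a a' v by (simp add: mult.left_commute)
  have c2: "?s a (shift_op f v) = shift_op f (?s a v)" for a f v
    unfolding shift_op_def by (simp add: fun_eq_iff mult.left_commute split: nat.split)
  have c3: "shift_op f (shift_op f' v) = shift_op f' (shift_op f v)" for f f' and v :: "nat \<Rightarrow> 'b \<Rightarrow> ('n, 'k) mpoly"
    unfolding shift_op_def by (simp add: fun_eq_iff mult.left_commute split: nat.split)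
  have "finite Z" unfolding Z_def using F by blast
  then have "\<exists>W'. W0 \<subseteq> W' \<and> opsub (T0 \<union> Z) W' \<and> acc (T0 \<union> Z) W'"
  proof (rule acc_extend_finite[OF _ acc0 W0])
    fix f assume "f \<in> T0 \<union> Z"
    then have f: "(\<exists>a. f = ?s a) \<or> (\<exists>a. f = shift_op a)" unfolding T0_def Z_def by blast
    then show "additive f" using mul_add shift_add by blast
    fix g v assume "g \<in> Z"
    then have "(\<exists>a. g = ?s a) \<or> (\<exists>a. g = shift_op a)" unfolding Z_def by blast
    then show "f (g v) = g (f v)" using f c1 c2 c3 by (elim disjE exE) (simp_all only:)
  qed
  then obtain W where W: "W0 \<subseteq> W" "opsub (T0 \<union> Z) W" "acc (T0 \<union> Z) W" by blast
  have op\<delta>: "opsub {} {a. \<delta> j b (a * g) \<in> W}" for j b g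
  proof -
    have "\<delta> j b ((x - y) * g) = \<delta> j b (x * g) - \<delta> j b (y * g)" for x y
      by (simp add: \<delta>_def fun_eq_iff left_diff_distrib)
    moreover have "\<delta> j b (0 * g) = 0" by (simp add: \<delta>_def fun_eq_iff)
    ultimately show ?thesis unfolding opsub_def mem_Collect_eq
      using opsub_0[OF W(2)] opsub_diff[OF W(2)] by simp
  qed
  have \<delta>_cst: "\<delta> j b (cst c * x) \<in> W" if "\<delta> j b x \<in> W" for j b c x
  proof -
    have "?s (cst c) (\<delta> j b x) \<in> W" by (rule opsub_op[OF W(2) _ that]) (auto simp: T0_def)
    moreover have "?s (cst c) (\<delta> j b x) = \<delta> j b (cst c * x)" by (simp add: \<delta>_def fun_eq_iff)
    ultimately show ?thesis by simp
  qed
  have \<delta>_xv: "\<delta> j b (xv l * x) \<in> W" if "\<delta> j b x \<in> W" "l < CARD('n)" for j b l x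
  proof -
    have "?s (xv l) (\<delta> j b x) \<in> W" by (rule opsub_op[OF W(2) _ that(1)]) (use that(2) in \<open>auto simp: Z_def\<close>)
    moreover have "?s (xv l) (\<delta> j b x) = \<delta> j b (xv l * x)" by (simp add: \<delta>_def fun_eq_iff)
    ultimately show ?thesis by simp
  qed
  have \<delta>_GG: "\<forall>g\<in>GG j. \<delta> j b g \<in> W" if b: "b \<in> \<Omega>" for j b
  proof (induction j)
    case 0
    have "\<delta> 0 b 1 \<in> W" using W(1) s.k.span_base[of "\<delta> 0 b 1" "(\<lambda>b. \<delta> 0 b 1) ` \<Omega>"] b unfolding W0_def by blast
    then have "\<delta> 0 b (cst c * 1) \<in> W" for c by (rule \<delta>_cst)
    then show ?case by auto
  next
    case (Suc j)
    have "GG (Suc j) \<subseteq> {a. \<delta> (Suc j) b (a * 1) \<in> W}"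
    proof (rule GG_gen[OF op\<delta>])
      fix f g assume f: "f \<in> V" and g: "g \<in> GG j"
      have "A.k.subspace {f. \<delta> (Suc j) b (f * g) \<in> W}"
        by (rule A.opsub_imp_subspace[OF op\<delta>]) (use \<delta>_cst in \<open>simp add: mult.assoc\<close>)
      moreover have "F \<subseteq> {f. \<delta> (Suc j) b (f * g) \<in> W}"
      proof
        fix f assume "f \<in> F"
        then have "shift_op f \<in> T0 \<union> Z" unfolding Z_def by blast
        moreover have "\<delta> j b g \<in> W" using Suc.IH g by blast
        ultimately have "shift_op f (\<delta> j b g) \<in> W" by (rule opsub_op[OF W(2)])
        moreover have "shift_op f (\<delta> j b g) = \<delta> (Suc j) b (f * g)"
          by (simp add: \<delta>_def shift_op_def fun_eq_iff split: nat.split)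
        ultimately show "f \<in> {f. \<delta> (Suc j) b (f * g) \<in> W}" by simp
      qed
      ultimately have "A.k.span F \<subseteq> {f. \<delta> (Suc j) b (f * g) \<in> W}" by (intro A.k.span_minimal)
      then have "f \<in> {f. \<delta> (Suc j) b (f * g) \<in> W}" using f F(2) by blast
      then show "f * g \<in> {a. \<delta> (Suc j) b (a * 1) \<in> W}" by simp
    qed
    then show ?case by (simp only: mult_1_right) blast
  qed
  \<comment> \<open>Stability under arbitrary polynomials is obtained from scalars and variables by
    induction on the degree of a monomial.\<close>
  have \<delta>_all: "\<delta> j b (a * g) \<in> W" if x: "\<delta> j b g \<in> W" for j b a g
  proof -
    have mono: "\<delta> j b (Poly_Mapping.single u c * g) \<in> W" if "tdeg u = int m" for u c m
      using that
    proof (induction m arbitrary: u)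
      case 0
      then have "u = 0" by (intro tdeg_eq_0) simp
      then show ?case using \<delta>_cst[OF x, of c] by (simp add: cst_def)
    next
      case (Suc m)
      then have "u \<noteq> 0" by auto
      then obtain i where i: "0 < Poly_Mapping.lookup u i"
        by (metis gr0I lookup_zero poly_mapping_eqI)
      obtain l where l: "l < CARD('n)" "i = ix l" using ix_surj by blast
      let ?w = "u - Poly_Mapping.single i 1"
      have u: "u = Poly_Mapping.single i 1 + ?w"
        using i by (intro poly_mapping_eqI) (auto simp: lookup_add lookup_minus lookup_single when_def)
      then have "tdeg u = 1 + tdeg ?w" by (metis tdeg_add tdeg_single of_nat_1)
      then have "\<delta> j b (xv l * (Poly_Mapping.single ?w c * g)) \<in> W"
        using Suc by (intro \<delta>_xv[OF _ l(1)] Suc.IH) simp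
      moreover have "xv l * (Poly_Mapping.single ?w c * g) = Poly_Mapping.single u c * g"
        unfolding mult.assoc[symmetric] mvar_def l(2)[symmetric] mult_single using u by simp
      ultimately show ?case by simp
    qed
    have "a \<in> {a. \<delta> j b (a * g) \<in> W}"
    proof (rule mpoly_closed[OF op\<delta>])
      fix u
      show "Poly_Mapping.single u (Poly_Mapping.lookup a u) \<in> {a. \<delta> j b (a * g) \<in> W}"
        using mono[of u "nat (tdeg u)"] tdeg_nonneg[of u] by simp
    qed
    then show ?thesis by simp
  qed
  have \<delta>_pw: "\<delta> j b x \<in> W" if b: "b \<in> \<Omega>" and x: "x \<in> pw j" for j b x
  proof -
    have op1: "opsub {} {a. \<delta> j b (a * 1) \<in> W}" by (rule op\<delta>)
    obtain t r where t: "t \<subseteq> GG j" "x = (\<Sum>g\<in>t. r g * g)" using x by (rule pw_explicit)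
    have "x \<in> {a. \<delta> j b (a * 1) \<in> W}" unfolding t(2)
    proof (rule opsub_sum[OF op1])
      fix g assume "g \<in> t"
      then have "\<delta> j b g \<in> W" using t(1) \<delta>_GG[OF b] by blast
      then have "\<delta> j b (r g * g) \<in> W" by (rule \<delta>_all)
      then show "r g * g \<in> {a. \<delta> j b (a * 1) \<in> W}" by simp
    qed
    then show ?thesis by simp
  qed
  have "opsub (T0 \<union> Z) (total N) \<and> total N \<subseteq> W" if N: "rfam \<Omega> N" for N
  proof
    note N1 = rfamD(1)[OF N] and N2 = rfamD(4)[OF N] and N4 = rfamD(2,3)[OF N]
    have N3: "(\<lambda>b. f * v b) \<in> N (Suc j)" if "v \<in> N j" "f \<in> V" for j v f by (rule rfamD(5)[OF N that(2,1)])
    show "opsub (T0 \<union> Z) (total N)"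
      unfolding opsub_def
    proof (intro conjI ballI)
      show "0 \<in> total N" unfolding total_def using opsub_0[OF N1] by simp
      show "u - v \<in> total N" if "u \<in> total N" "v \<in> total N" for u v
      proof -
        have "{j. (u - v) j \<noteq> 0} \<subseteq> {j. u j \<noteq> 0} \<union> {j. v j \<noteq> 0}" by auto
        moreover have "finite ({j. u j \<noteq> 0} \<union> {j. v j \<noteq> 0})" using that unfolding total_def by blast
        ultimately have "finite {j. (u - v) j \<noteq> 0}" by (rule finite_subset)
        moreover have "(u - v) j \<in> N j" for j
          using that opsub_diff[OF N1, of "u j" j "v j"] unfolding total_def by simp
        ultimately show ?thesis unfolding total_def by blast
      qed
      fix f v assume f: "f \<in> T0 \<union> Z" and v: "v \<in> total N"
      have mul: "?s a v \<in> total N" for a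
      proof -
        have "?s a v j = 0" if "v j = 0" for j using that by (simp add: fun_eq_iff)
        then have "{j. ?s a v j \<noteq> 0} \<subseteq> {j. v j \<noteq> 0}" by blast
        moreover have "finite {j. v j \<noteq> 0}" using v unfolding total_def by blast
        ultimately have "finite {j. ?s a v j \<noteq> 0}" by (rule finite_subset)
        moreover have "?s a v j \<in> N j" for j using N2[of "v j" j a] v unfolding total_def by blast
        ultimately show ?thesis unfolding total_def by blast
      qed
      have sh: "shift_op a v \<in> total N" if "a \<in> V" for a
      proof -
        have "{j. shift_op a v j \<noteq> 0} \<subseteq> Suc ` {j. v j \<noteq> 0}"
        proof
          fix j assume j: "j \<in> {j. shift_op a v j \<noteq> 0}"
          show "j \<in> Suc ` {j. v j \<noteq> 0}"
          proof (cases j)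
            case 0
            then show ?thesis using j by (simp add: shift_op_def zero_fun_def)
          next
            case (Suc i)
            then have "v i \<noteq> 0" using j by (auto simp: shift_op_def zero_fun_def)
            then show ?thesis using Suc by blast
          qed
        qed
        moreover have "shift_op a v j \<in> N j" for j
        proof (cases j)
          case 0
          then have "shift_op a v j = 0" by (simp add: shift_op_def fun_eq_iff)
          then show ?thesis using opsub_0[OF N1] by simp
        next
          case (Suc i)
          then show ?thesis using N3[of "v i" i a] v that unfolding total_def by (simp add: shift_op_def)
        qed
        moreover have "finite (Suc ` {j. v j \<noteq> 0})" using v unfolding total_def by blast
        ultimately show ?thesis unfolding total_def using finite_subset by blast
      qed
      show "f v \<in> total N" using f mul sh F(3) unfolding T0_def Z_def by blast
    qed
    show "total N \<subseteq> W"
    proof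
      fix v assume v: "v \<in> total N"
      let ?J = "{j. v j \<noteq> 0}"
      have fJ: "finite ?J" using v unfolding total_def by blast
      have vN: "v j \<in> N j" for j using v unfolding total_def by blast
      have "v = (\<Sum>j\<in>?J. \<Sum>b\<in>\<Omega>. \<delta> j b (v j b))"
      proof (intro ext)
        fix j' b'
        have "(\<Sum>j\<in>?J. \<Sum>b\<in>\<Omega>. \<delta> j b (v j b)) j' b' = (\<Sum>j\<in>?J. if j = j' then (\<Sum>b\<in>\<Omega>. if b = b' then v j' b' else 0) else 0)"
          unfolding sum_fun_apply \<delta>_def by (intro sum.cong refl) (auto intro!: sum.cong sum.neutral)
        also have "\<dots> = v j' b'"
        proof (cases "v j' = 0")
          case True
          then show ?thesis using fJ by simp
        next
          case False
          then show ?thesis using fJ fin N4(2)[OF vN, of b' j'] by simp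
        qed
        finally show "v j' b' = (\<Sum>j\<in>?J. \<Sum>b\<in>\<Omega>. \<delta> j b (v j b)) j' b'" by simp
      qed
      also have "\<dots> \<in> W"
      proof (rule opsub_sum[OF W(2)], rule opsub_sum[OF W(2)])
        fix j b assume "b \<in> \<Omega>"
        then show "\<delta> j b (v j b) \<in> W" using N4(1)[OF vN] by (intro \<delta>_pw)
      qed
      finally show "v \<in> W" .
    qed
  qed
  then show ?thesis using that[OF W(3)] by blast
qed

lemma total_mono_iff:
  assumes "rfam \<Omega> N" "rfam \<Omega> N'" "total N \<subseteq> total N'"
  shows "N \<le> N'"
proof (rule le_funI, rule subsetI)
  fix j v assume v: "v \<in> N j"
  let ?v = "\<lambda>i. if i = j then v else 0"
  have "0 \<in> N i" for i by (rule opsub_0[OF rfamD(1)[OF assms(1)]])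
  moreover have "{i. ?v i \<noteq> 0} \<subseteq> {j}" by auto
  ultimately have "?v \<in> total N" unfolding total_def using v by (auto intro: finite_subset)
  then have "?v \<in> total N'" using assms(3) by blast
  then have "\<forall>i. ?v i \<in> N' i" unfolding total_def mem_Collect_eq by (rule conjunct1)
  then have "?v j \<in> N' j" by (rule spec)
  then show "v \<in> N' j" by simp
qed

text \<open>Passing to \<open>total\<close> preserves and reflects inclusions, so the maximal
  principle for submodules carries over to families.\<close>

lemma rees_max:
  assumes fin: "finite \<Omega>" and ne: "\<C> \<noteq> {}" and rf: "\<And>N. N \<in> \<C> \<Longrightarrow> rfam \<Omega> N"
  shows "\<exists>N\<in>\<C>. \<forall>N'\<in>\<C>. N \<le> N' \<longrightarrow> N' = N"
proof -
  obtain T W where TW: "acc T W" "\<And>N. rfam \<Omega> N \<Longrightarrow> opsub T (total N) \<and> total N \<subseteq> W"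
    by (rule rees_acc[OF fin]) blast
  have "\<exists>N. N \<in> \<C> \<and> (\<forall>N'. N' \<in> \<C> \<and> total N \<subseteq> total N' \<longrightarrow> total N' = total N)"
    by (rule acc_max[OF TW(1)]) (use ne TW(2) rf in blast)+
  then obtain N where N: "N \<in> \<C>" "\<And>N'. N' \<in> \<C> \<Longrightarrow> total N \<subseteq> total N' \<Longrightarrow> total N' = total N"
    by blast
  have "N' = N" if N': "N' \<in> \<C>" "N \<le> N'" for N'
  proof -
    have "total N \<subseteq> total N'" using N'(2) unfolding total_def le_fun_def by blast
    then have "total N' = total N" by (rule N(2)[OF N'(1)])
    then have "N' \<le> N" using total_mono_iff[OF rf[OF N'(1)] rf[OF N(1)]] by simp
    then show ?thesis using N'(2) by simp
  qed
  then show ?thesis using N(1) by blast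
qed

end

section \<open>Betti numbers of the powers\<close>

abbreviation (input) hp :: "int \<Rightarrow> ('b \<Rightarrow> ('n::finite, 'k::field) mpoly) \<Rightarrow> 'b \<Rightarrow> ('n, 'k) mpoly" where
  "hp c v \<equiv> \<lambda>b. hpart c (v b)"

abbreviation (input) msc :: "('n::finite, 'k::field) mpoly \<Rightarrow> ('b \<Rightarrow> ('n, 'k) mpoly) \<Rightarrow> 'b \<Rightarrow> ('n, 'k) mpoly" where
  "msc a v \<equiv> \<lambda>b. a * v b"

text \<open>Every monomial other than 1 factors through a variable, and variables map all of
  \<open>Z\<close> into \<open>N\<close>. Hence above mZ stability under scalars is enough.\<close>

lemma closed_under_mult:
  fixes N Z :: "('b \<Rightarrow> ('n::finite, 'k::field) mpoly) set"
  assumes N: "opsub {} N" "N \<subseteq> Z" and Z: "\<And>a v. v \<in> Z \<Longrightarrow> msc a v \<in> Z"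
    and c: "\<And>c v. v \<in> N \<Longrightarrow> msc (cst c) v \<in> N"
    and x: "\<And>l v. l < CARD('n) \<Longrightarrow> v \<in> Z \<Longrightarrow> msc (xv l) v \<in> N"
    and v: "v \<in> N"
  shows "msc a v \<in> N"
proof -
  have "opsub {} {a. msc a v \<in> N}"
    unfolding opsub_def
  proof (intro conjI ballI)
    have "msc 0 v = 0" by (simp add: fun_eq_iff)
    then show "0 \<in> {a. msc a v \<in> N}" using opsub_0[OF N(1)] by simp
    fix a b assume *: "a \<in> {a. msc a v \<in> N}" "b \<in> {a. msc a v \<in> N}"
    have "msc (a - b) v = msc a v - msc b v" by (simp add: fun_eq_iff left_diff_distrib)
    then show "a - b \<in> {a. msc a v \<in> N}" using opsub_diff[OF N(1)] * by simp
  qed simp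
  then have "a \<in> {a. msc a v \<in> N}"
  proof (rule mpoly_closed)
    fix u
    let ?c = "Poly_Mapping.lookup a u"
    show "Poly_Mapping.single u ?c \<in> {a. msc a v \<in> N}"
    proof (cases "u = 0")
      case True
      then show ?thesis using c[OF v, of ?c] by (simp add: cst_def)
    next
      case False
      then obtain i where i: "0 < Poly_Mapping.lookup u i"
        by (metis gr0I lookup_zero poly_mapping_eqI)
      obtain l where l: "l < CARD('n)" "i = ix l" using ix_surj by blast
      let ?w = "u - Poly_Mapping.single i 1"
      have u: "u = Poly_Mapping.single i 1 + ?w"
        using i by (intro poly_mapping_eqI) (auto simp: lookup_add lookup_minus lookup_single when_def)
      have eq: "xv l * Poly_Mapping.single ?w ?c = Poly_Mapping.single u ?c"
        unfolding mvar_def l(2)[symmetric] mult_single using u by simp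
      have "msc (Poly_Mapping.single ?w ?c) v \<in> Z" using v N(2) by (intro Z) blast
      then have "msc (xv l) (msc (Poly_Mapping.single ?w ?c) v) \<in> N" by (rule x[OF l(1)])
      then show ?thesis unfolding mult.assoc[symmetric] eq by simp
    qed
  qed
  then show ?thesis by simp
qed

lemma hp_diff: "hp c (u - v) = hp c u - hp c v"
  by (simp add: fun_eq_iff rst_diff)

lemma hp_0: "hp c 0 = 0"
  by (simp add: fun_eq_iff)

lemma hpart_hpart: "hpart c (hpart c f) = hpart c f"
  using hpart_forms[OF hpart_in_forms[of c f], of c] by simp

lemma hp_msc: "a \<in> forms e \<Longrightarrow> hp c (msc a v) = msc a (hp (c - e) v)"
  by (simp add: hpart_mult)

context rees
begin

text \<open>A submodule \<open>N\<close> of the row \<open>a\<close> is encoded as the family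
  \<open>L N\<close> of all elements of \<open>Z\<close> whose component in row \<open>a\<close>
  lies in \<open>N\<close>. This is a module over the Rees algebra: a variable brings row a - 1 into
  \<open>B\<close>, hence into \<open>N\<close>, and f t preserves rows. The Noetherian property of
  Rees modules thus descends to modules over \<open>GG\<close>.\<close>

lemma strand_max:
  fixes Z B :: "nat \<Rightarrow> ('b \<Rightarrow> ('n, 'k) mpoly) set" and a :: int
  assumes fin: "finite \<Omega>" and Z: "rfam \<Omega> Z" and Zhp: "\<And>c j v. v \<in> Z j \<Longrightarrow> hp c v \<in> Z j"
    and B: "\<And>j l v. l < CARD('n) \<Longrightarrow> v \<in> Z j \<Longrightarrow> msc (xv l) (hp (a + int d * int j - 1) v) \<in> B j"
    and ne: "\<C> \<noteq> {}"
    and \<C>: "\<And>N. N \<in> \<C> \<Longrightarrow> gm (fsc (*)) N \<and> B \<le> N \<and> N \<le> (\<lambda>j. {v \<in> Z j. hp (a + int d * int j) v = v})"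
  shows "\<exists>N\<in>\<C>. \<forall>N'\<in>\<C>. N \<le> N' \<longrightarrow> N' = N"
proof -
  define L where "L N j = {v \<in> Z j. hp (a + int d * int j) v \<in> N j}" for N :: "nat \<Rightarrow> ('b \<Rightarrow> ('n, 'k) mpoly) set" and j
  note ZD = rfamD[OF Z]
  have "rfam \<Omega> (L N)" if "N \<in> \<C>" for N
    unfolding rfam_def
  proof (intro conjI allI ballI)
    have N: "gm (fsc (*)) N" "\<And>j. B j \<subseteq> N j" using \<C>[OF that] unfolding le_fun_def by blast+
    show op: "opsub {} (L N j)" for j
      unfolding opsub_def
    proof (intro conjI ballI)
      show "0 \<in> L N j"
        unfolding L_def mem_Collect_eq hp_0 using opsub_0[OF ZD(1)] opsub_0[OF gm_opsub[OF N(1)]] by blast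
      fix u v assume "u \<in> L N j" "v \<in> L N j"
      then show "u - v \<in> L N j"
        unfolding L_def mem_Collect_eq hp_diff
        using opsub_diff[OF ZD(1)] opsub_diff[OF gm_opsub[OF N(1)]] by blast
    qed simp
    show "v b \<in> pw j" if "v \<in> L N j" "b \<in> \<Omega>" for j v b using ZD(2) that unfolding L_def by blast
    show "b \<notin> \<Omega> \<longrightarrow> v b = 0" if "v \<in> L N j" for j v b using ZD(3) that unfolding L_def by blast
    show "msc y v \<in> L N j" if v: "v \<in> L N j" for j y v
    proof (rule closed_under_mult[OF op _ ZD(4) _ _ v])
      show "L N j \<subseteq> Z j" unfolding L_def by blast
      show "msc (cst c) w \<in> L N j" if "w \<in> L N j" for c w
      proof -
        have "hp (a + int d * int j) (msc (cst c) w) = msc (cst c) (hp (a + int d * int j) w)"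
          using hp_msc[OF cst_in_forms, of "a + int d * int j" c w] by simp
        moreover have "cst c \<in> GG 0" by simp
        then have "msc (cst c) (hp (a + int d * int j) w) \<in> N (0 + j)"
          using gm_scale[OF N(1)] that unfolding L_def by blast
        ultimately show ?thesis using ZD(4) that unfolding L_def by simp
      qed
      show "msc (xv l) w \<in> L N j" if "l < CARD('n)" "w \<in> Z j" for l w
      proof -
        have "hp (a + int d * int j) (msc (xv l) w) = msc (xv l) (hp (a + int d * int j - 1) w)"
          by (rule hp_msc[OF mvar_in_forms])
        then have "hp (a + int d * int j) (msc (xv l) w) \<in> N j" using B[OF that] N(2) by auto
        then show ?thesis using ZD(4)[OF that(2)] unfolding L_def by blast
      qed
    qed
    show "msc f v \<in> L N (Suc j)" if f: "f \<in> V" and v: "v \<in> L N j" for j f v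
    proof -
      have "f \<in> forms (int d)" using f by blast
      then have "hp (a + int d * int (Suc j)) (msc f v) = msc f (hp (a + int d * int (Suc j) - int d) v)"
        by (rule hp_msc)
      also have "a + int d * int (Suc j) - int d = a + int d * int j" by (simp add: algebra_simps)
      finally have eq: "hp (a + int d * int (Suc j)) (msc f v) = msc f (hp (a + int d * int j) v)" .
      have "f \<in> GG 1" using f unfolding GG_1 .
      then have "msc f (hp (a + int d * int j) v) \<in> N (1 + j)"
        using gm_scale[OF N(1)] v unfolding L_def by blast
      then have "hp (a + int d * int (Suc j)) (msc f v) \<in> N (Suc j)" unfolding eq by simp
      moreover have "msc f v \<in> Z (Suc j)" using ZD(5)[OF f] v unfolding L_def by blast
      ultimately show ?thesis unfolding L_def by blast
    qed
  qed
  then have "\<exists>K\<in>L ` \<C>. \<forall>K'\<in>L ` \<C>. K \<le> K' \<longrightarrow> K' = K"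
    using ne by (intro rees_max[OF fin]) blast+
  then obtain N where N: "N \<in> \<C>" "\<And>N'. N' \<in> \<C> \<Longrightarrow> L N \<le> L N' \<Longrightarrow> L N' = L N" by blast
  \<comment> \<open>\<open>N'\<close> is recovered as the part of \<open>L N'\<close> concentrated
    in row \<open>a\<close>, so a maximal \<open>L N\<close> comes from a maximal
    \<open>N\<close>.\<close>
  have rec: "N' j = {v \<in> L N' j. hp (a + int d * int j) v = v}" if "N' \<in> \<C>" for N' j
  proof (intro equalityI subsetI)
    fix v assume v: "v \<in> N' j"
    then have "v \<in> Z j \<and> hp (a + int d * int j) v = v" using \<C>[OF that] unfolding le_fun_def by blast
    then show "v \<in> {v \<in> L N' j. hp (a + int d * int j) v = v}" using v unfolding L_def by simp
  next
    fix v assume "v \<in> {v \<in> L N' j. hp (a + int d * int j) v = v}"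
    then have "hp (a + int d * int j) v \<in> N' j" "hp (a + int d * int j) v = v" unfolding L_def by blast+
    then show "v \<in> N' j" by simp
  qed
  have "N' = N" if N': "N' \<in> \<C>" "N \<le> N'" for N'
  proof -
    have "L N \<le> L N'" using N'(2) unfolding L_def le_fun_def by blast
    then have "L N' = L N" by (rule N(2)[OF N'(1)])
    then show ?thesis using rec[OF N'(1)] rec[OF N(1)] by (intro ext) simp
  qed
  then show ?thesis using N(1) by blast
qed

text \<open>The case of row 0 of the Rees algebra itself, with one coordinate and \<open>B\<close>
  zero: row -1 vanishes because I^j has no elements below degree dj.\<close>

lemma noeth_GG:
  assumes ne: "\<C> \<noteq> {}" and \<C>: "\<And>P. P \<in> \<C> \<Longrightarrow> gideal P"
  shows "\<exists>P\<in>\<C>. \<forall>P'\<in>\<C>. P \<le> P' \<longrightarrow> P' = P"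
proof -
  define E :: "(nat \<Rightarrow> ('n, 'k) mpoly set) \<Rightarrow> nat \<Rightarrow> (unit \<Rightarrow> ('n, 'k) mpoly) set" where
    "E P j = {v. v () \<in> P j}" for P j
  have E_mem: "(\<lambda>_. x) \<in> E P j \<longleftrightarrow> x \<in> P j" for x P j by (simp add: E_def)
  have "\<exists>N\<in>E ` \<C>. \<forall>N'\<in>E ` \<C>. N \<le> N' \<longrightarrow> N' = N"
  proof (rule strand_max[where \<Omega> = UNIV and Z = "E pw" and B = "\<lambda>_. {0}" and a = 0])
    show "rfam UNIV (E pw)"
      unfolding rfam_def opsub_def E_def
      using opsub_0[OF opsub_pw] opsub_diff[OF opsub_pw] pw_scale
        pw_mult[of _ 1] GG_pw[of 1] GG_1 by (auto simp: UNIV_unit)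
    show "hp c v \<in> E pw j" if "v \<in> E pw j" for c j v using hpart_pw that unfolding E_def by simp
    show "msc (xv l) (hp (0 + int d * int j - 1) v) \<in> {0}" if "v \<in> E pw j" for j l v
    proof -
      have "hpart (0 + int d * int j - 1) (v ()) = 0" using that by (intro hpart_pw_low[of _ j]) (auto simp: E_def)
      then have "msc (xv l) (hp (0 + int d * int j - 1) v) = 0" by (intro ext) (metis mult_zero_right old.unit.exhaust zero_fun_apply)
      then show ?thesis by simp
    qed
    fix N assume "N \<in> E ` \<C>"
    then obtain P where P: "P \<in> \<C>" "N = E P" by blast
    note Pg = gidealD(1)[OF \<C>[OF P(1)]]
    show "gm (fsc (*)) N \<and> (\<lambda>_. {0}) \<le> N \<and> N \<le> (\<lambda>j. {v \<in> E pw j. hp (0 + int d * int j) v = v})"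
    proof (intro conjI)
      show "gm (fsc (*)) N"
        unfolding gm_def P(2)
      proof (intro conjI allI ballI)
        show "opsub {} (E P j)" for j
          unfolding opsub_def E_def using opsub_0[OF gm_opsub[OF Pg]] opsub_diff[OF gm_opsub[OF Pg]] by simp
        show "msc x v \<in> E P (i + j)" if "x \<in> GG i" "v \<in> E P j" for i j x v
          using gm_scale[OF Pg that(1)] that(2) unfolding E_def by simp
      qed
      show "(\<lambda>_. {0}) \<le> N" unfolding P(2) E_def le_fun_def using opsub_0[OF gm_opsub[OF Pg]] by simp
      show "N \<le> (\<lambda>j. {v \<in> E pw j. hp (0 + int d * int j) v = v})"
        unfolding P(2) le_fun_def
      proof (intro allI subsetI CollectI conjI)
        fix j v assume "v \<in> E P j"
        then have v: "v () \<in> pw j" "v () \<in> forms (int d * int j)"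
          using gidealD(2)[OF \<C>[OF P(1)], of j] GG_pw[of j] GG_forms[of j] unfolding E_def by blast+
        then show "v \<in> E pw j" unfolding E_def by simp
        have "hpart (0 + int d * int j) (v ()) = v ()" using hpart_forms[OF v(2), of "int d * int j"] by simp
        then show "hp (0 + int d * int j) v = v" by (intro ext) (metis old.unit.exhaust)
      qed
    qed
  qed (use ne in auto)
  then obtain P where P: "P \<in> \<C>" "\<And>P'. P' \<in> \<C> \<Longrightarrow> E P \<le> E P' \<Longrightarrow> E P' = E P" by blast
  have "P' = P" if P': "P' \<in> \<C>" "P \<le> P'" for P'
  proof -
    have "E P \<le> E P'" using P'(2) unfolding E_def le_fun_def by blast
    then have eq: "E P' = E P" by (rule P(2)[OF P'(1)])
    have "x \<in> P' j \<longleftrightarrow> x \<in> P j" for x j using E_mem[of x P' j] E_mem[of x P j] unfolding eq by blast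
    then have "P' j = P j" for j by blast
    then show ?thesis by (rule ext)
  qed
  then show ?thesis using P(1) by blast
qed

section \<open>The Koszul complexes of all powers\<close>

abbreviation ks :: "(nat set \<Rightarrow> ('n, 'k) mpoly) \<Rightarrow> nat set \<Rightarrow> ('n, 'k) mpoly" where
  "ks \<equiv> kos (*) CARD('n) xv"

abbreviation kc :: "nat \<Rightarrow> nat \<Rightarrow> (nat set \<Rightarrow> ('n, 'k) mpoly) set" where
  "kc p j \<equiv> kchains CARD('n) (pw j) p"

text \<open>Unlike \<open>ZZ\<close> and \<open>BB\<close>, \<open>Zt\<close> and \<open>Bt\<close>
  fix no internal degree, so they form modules over the Rees algebra. Row \<open>a\<close> consists
  of their elements fixed by the projection to coefficient degree a + dj.\<close>

definition Zt :: "nat \<Rightarrow> nat \<Rightarrow> (nat set \<Rightarrow> ('n, 'k) mpoly) set" where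
  "Zt p j = {v \<in> kc p j. ks v = 0}"

definition Bt :: "nat \<Rightarrow> nat \<Rightarrow> (nat set \<Rightarrow> ('n, 'k) mpoly) set" where
  "Bt p j = ks ` kc (Suc p) j"

abbreviation M0 :: "nat \<Rightarrow> int \<Rightarrow> ('n, 'k) mpoly set" where
  "M0 j \<equiv> \<lambda>e. pw j \<inter> forms e"

definition supp :: "nat \<Rightarrow> nat set set" where
  "supp p = {T. T \<subseteq> {..<CARD('n)} \<and> card T = p}"

lemma finite_supp: "finite (supp p)"
  unfolding supp_def by (rule finite_subset[of _ "Pow {..<CARD('n)}"]) auto

lemma kc_mult: "x \<in> pw i \<Longrightarrow> v \<in> kc p j \<Longrightarrow> msc x v \<in> kc p (i + j)"
  by (intro kchainsI pw_mult) (auto dest: kchainsD kchains_outside)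

lemma kc_scale: "v \<in> kc p j \<Longrightarrow> msc a v \<in> kc p j"
  by (intro kchainsI pw_scale) (auto dest: kchainsD kchains_outside)

lemma kc_hp: "v \<in> kc p j \<Longrightarrow> hp c v \<in> kc p j"
  by (intro kchainsI hpart_pw) (auto dest: kchainsD kchains_outside)

lemma ks_kc: "v \<in> kc (Suc p) j \<Longrightarrow> ks v \<in> kc p j"
  by (rule A.kos_kchains[OF _ opsub_pw pw_scale])

lemma ks_hp: "ks (hp c v) = hp (c + 1) (ks v)"
  by (rule ext) (rule hpart_kos)

lemma ks_0: "ks 0 = 0"
  by (rule A.kos_0)

lemma ks_msc: "ks (msc a v) = msc a (ks v)"
  by (rule A.kos_scale)

lemma Zt_mult: "x \<in> pw i \<Longrightarrow> v \<in> Zt p j \<Longrightarrow> msc x v \<in> Zt p (i + j)"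
  unfolding Zt_def using kc_mult by (simp add: ks_msc fun_eq_iff)

lemma Zt_scale: "v \<in> Zt p j \<Longrightarrow> msc a v \<in> Zt p j"
  unfolding Zt_def using kc_scale by (simp add: ks_msc fun_eq_iff)

lemma Zt_hp: "v \<in> Zt p j \<Longrightarrow> hp c v \<in> Zt p j"
  unfolding Zt_def using kc_hp by (simp add: ks_hp fun_eq_iff)

lemma Bt_mult: "x \<in> pw i \<Longrightarrow> v \<in> Bt p j \<Longrightarrow> msc x v \<in> Bt p (i + j)"
  unfolding Bt_def by (auto simp flip: ks_msc intro!: imageI kc_mult)

lemma Bt_scale: "v \<in> Bt p j \<Longrightarrow> msc a v \<in> Bt p j"
  unfolding Bt_def by (auto simp flip: ks_msc intro!: imageI kc_scale)

lemma Bt_hp: "v \<in> Bt p j \<Longrightarrow> hp c v \<in> Bt p j"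
proof -
  assume "v \<in> Bt p j"
  then obtain w where w: "w \<in> kc (Suc p) j" "v = ks w" unfolding Bt_def by blast
  have "hp c v = ks (hp (c - 1) w)" unfolding w(2) ks_hp by simp
  then show ?thesis unfolding Bt_def using kc_hp[OF w(1)] by blast
qed

lemma Bt_Zt: "Bt p j \<subseteq> Zt p j"
  unfolding Bt_def Zt_def using ks_kc A.kos_kos by blast

lemma opsub_Zt: "opsub {} (Zt p j)"
proof -
  note kc = opsub_kchains[OF opsub_pw]
  show ?thesis unfolding opsub_def Zt_def
    using opsub_0[OF kc] opsub_diff[OF kc] by (simp add: A.kos_diff A.kos_0)
qed

lemma opsub_Bt: "opsub {} (Bt p j)"
proof -
  note kc = opsub_kchains[OF opsub_pw]
  show ?thesis unfolding opsub_def
  proof (intro conjI ballI)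
    have "ks 0 \<in> Bt p j" unfolding Bt_def by (rule imageI[OF opsub_0[OF kc]])
    then show "0 \<in> Bt p j" by (simp only: ks_0)
    fix u v assume "u \<in> Bt p j" "v \<in> Bt p j"
    then obtain x y where "x \<in> kc (Suc p) j" "u = ks x" "y \<in> kc (Suc p) j" "v = ks y" unfolding Bt_def by blast
    then show "u - v \<in> Bt p j" unfolding Bt_def
      using opsub_diff[OF kc, of x _ j "Suc p" y] A.kos_diff[of "CARD('n)" xv x y] by (metis image_eqI)
  qed simp
qed

text \<open>On a cycle the homotopy formula loses its second term, which leaves \<open>x l\<close>
  times the cycle as a boundary.\<close>

lemma xv_Zt_Bt: "v \<in> Zt p j \<Longrightarrow> l < CARD('n) \<Longrightarrow> msc (xv l) v \<in> Bt p j"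
proof -
  assume v: "v \<in> Zt p j" and l: "l < CARD('n)"
  have kv: "ks v = 0" and vk: "v \<in> kc p j" using v unfolding Zt_def by blast+
  have w0: "wedge (*) l (0 :: nat set \<Rightarrow> ('n, 'k) mpoly) T = 0" for T by (simp add: wedge_def)
  have "msc (xv l) v = ks (wedge (*) l v)"
  proof
    show "xv l * v T = ks (wedge (*) l v) T" for T
      using A.kos_wedge[OF l, of xv v T] unfolding kv w0 by simp
  qed
  then show ?thesis unfolding Bt_def using A.wedge_kchains[OF vk l opsub_pw] by blast
qed

lemma V_pw: "f \<in> V \<Longrightarrow> f \<in> pw 1"
  using GG_pw[of 1] GG_1 by blast

lemma rfam_Zt: "rfam (supp p) (Zt p)"
  unfolding rfam_def
proof (intro conjI allI ballI)
  show "opsub {} (Zt p j)" for j by (rule opsub_Zt)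
  show "v T \<in> pw j" if "v \<in> Zt p j" "T \<in> supp p" for j v T
    using that kchainsD[of v _ "pw j" p T] unfolding Zt_def supp_def by blast
  show "T \<notin> supp p \<longrightarrow> v T = 0" if "v \<in> Zt p j" for j v T
    using that kchains_outside[of v "CARD('n)" "pw j" p T] unfolding Zt_def supp_def by blast
  show "msc a v \<in> Zt p j" if "v \<in> Zt p j" for a v j by (rule Zt_scale[OF that])
  show "msc f v \<in> Zt p (Suc j)" if "f \<in> V" "v \<in> Zt p j" for f v j
    using Zt_mult[OF V_pw that(2)] that(1) by simp
qed

text \<open>Only finitely many rows of the bigraded Koszul homology are nonzero.\<close>

lemma finitely_many_rows:
  obtains b0 :: nat where "\<And>a j v. v \<in> Zt p j \<Longrightarrow> int b0 < a \<Longrightarrow> hp (a + int d * int j) v \<in> Bt p j"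
proof -
  \<comment> \<open>The cycles whose rows above \<open>b\<close> are boundaries. These Rees
    submodules increase with \<open>b\<close> and exhaust all cycles, as each cycle involves
    finitely many degrees; so one of them contains every cycle, for all j at once.\<close>
  define N where "N b j = {v \<in> Zt p j. \<forall>a > int b. hp (a + int d * int j) v \<in> Bt p j}" for b j
  have rf: "rfam (supp p) (N b)" for b
    unfolding rfam_def
  proof (intro conjI allI ballI)
    show op: "opsub {} (N b j)" for j
      unfolding opsub_def
    proof (intro conjI ballI)
      show "0 \<in> N b j" unfolding N_def
        using opsub_0[OF opsub_Zt] opsub_0[OF opsub_Bt] hp_0 by (simp add: zero_fun_def)
      fix u v assume *: "u \<in> N b j" "v \<in> N b j"
      have "hp (a + int d * int j) (u - v) \<in> Bt p j" if "int b < a" for a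
        unfolding hp_diff using * that unfolding N_def by (intro opsub_diff[OF opsub_Bt]) blast+
      then show "u - v \<in> N b j" using * opsub_diff[OF opsub_Zt, of u p j v] unfolding N_def by blast
    qed simp
    show "v T \<in> pw j" if "v \<in> N b j" "T \<in> supp p" for j v T
      using rfamD(2)[OF rfam_Zt] that unfolding N_def by blast
    show "T \<notin> supp p \<longrightarrow> v T = 0" if "v \<in> N b j" for j v T
      using rfamD(3)[OF rfam_Zt] that unfolding N_def by blast
    show "msc y v \<in> N b j" if v: "v \<in> N b j" for j y v
    proof (rule closed_under_mult[OF op _ Zt_scale _ _ v])
      show "N b j \<subseteq> Zt p j" unfolding N_def by blast
      show "msc (cst c) w \<in> N b j" if "w \<in> N b j" for c w
      proof -
        have "hp (a + int d * int j) (msc (cst c) w) \<in> Bt p j" if a: "int b < a" for a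
        proof -
          have "hp (a + int d * int j) (msc (cst c) w) = msc (cst c) (hp (a + int d * int j - 0) w)"
            by (rule hp_msc[OF cst_in_forms])
          moreover have "hp (a + int d * int j - 0) w \<in> Bt p j"
            using \<open>w \<in> N b j\<close> a unfolding N_def by simp
          ultimately show ?thesis using Bt_scale by simp
        qed
        then show ?thesis using Zt_scale that unfolding N_def by blast
      qed
      show "msc (xv l) w \<in> N b j" if "l < CARD('n)" "w \<in> Zt p j" for l w
        using Bt_hp[OF xv_Zt_Bt[OF that(2,1)]] Zt_scale[OF that(2)] unfolding N_def by blast
    qed
    show "msc f v \<in> N b (Suc j)" if f: "f \<in> V" and v: "v \<in> N b j" for j f v
    proof -
      have "hp (a + int d * int (Suc j)) (msc f v) \<in> Bt p (Suc j)" if a: "int b < a" for a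
      proof -
        have "f \<in> forms (int d)" using f by blast
        then have "hp (a + int d * int (Suc j)) (msc f v) = msc f (hp (a + int d * int (Suc j) - int d) v)"
          by (rule hp_msc)
        also have "a + int d * int (Suc j) - int d = a + int d * int j" by (simp add: algebra_simps)
        finally have eq: "hp (a + int d * int (Suc j)) (msc f v) = msc f (hp (a + int d * int j) v)" .
        have "hp (a + int d * int j) v \<in> Bt p j" using v a unfolding N_def by blast
        then have "msc f (hp (a + int d * int j) v) \<in> Bt p (1 + j)" by (rule Bt_mult[OF V_pw[OF f]])
        then show ?thesis unfolding eq by simp
      qed
      moreover have "msc f v \<in> Zt p (Suc j)" using rfamD(5)[OF rfam_Zt f] v unfolding N_def by blast
      ultimately show ?thesis unfolding N_def by blast
    qed
  qed
  have "\<exists>K\<in>range N. \<forall>K'\<in>range N. K \<le> K' \<longrightarrow> K' = K"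
    by (rule rees_max[OF finite_supp]) (use rf in blast)+
  then obtain b0 where b0: "\<And>b. N b0 \<le> N b \<Longrightarrow> N b = N b0" by blast
  have mono: "N b \<le> N b'" if "b \<le> b'" for b b' using that unfolding N_def le_fun_def by auto
  show ?thesis
  proof (rule that[of b0])
    fix a :: int and j v assume v: "v \<in> Zt p j" and a: "int b0 < a"
    define E where "E = (\<Union>T\<in>supp p. degs (v T))"
    have "finite E" unfolding E_def using finite_supp by simp
    define m where "m = Max (insert 0 E)"
    have m: "e \<le> m" if "e \<in> E" for e unfolding m_def using \<open>finite E\<close> that by (intro Max_ge) auto
    \<comment> \<open>Rows beyond the largest degree \<open>m\<close> of \<open>v\<close> are zero,
      which puts \<open>v\<close> into \<open>N ?b\<close>; taking the maximum with
      \<open>b0\<close> makes that family equal to \<open>N b0\<close>.\<close>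
    let ?b = "max b0 (nat \<bar>m\<bar>)"
    have "hp (a' + int d * int j) v = 0" if "int ?b < a'" for a'
    proof
      fix T
      show "hpart (a' + int d * int j) (v T) = 0 T"
      proof (cases "T \<in> supp p")
        case True
        have "Poly_Mapping.lookup (hpart (a' + int d * int j) (v T)) u = 0" for u
        proof (rule ccontr)
          assume "Poly_Mapping.lookup (hpart (a' + int d * int j) (v T)) u \<noteq> 0"
          then have "tdeg u = a' + int d * int j" "u \<in> Poly_Mapping.keys (v T)"
            by (auto simp: lookup_rst in_keys_iff split: if_splits)
          then have "a' + int d * int j \<in> E" using True unfolding E_def degs_def by (metis UN_iff imageI)
          then have "a' + int d * int j \<le> m" by (rule m)
          moreover have "0 \<le> int d * int j" by simp
          moreover have "m < a'" using that by linarith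
          ultimately show False by linarith
        qed
        then have "hpart (a' + int d * int j) (v T) = 0" by (intro poly_mapping_eqI) simp
        then show ?thesis by simp
      next
        case False
        then show ?thesis using rfamD(3)[OF rfam_Zt v] by simp
      qed
    qed
    then have "v \<in> N ?b j" unfolding N_def using v opsub_0[OF opsub_Bt] by (simp add: zero_fun_def)
    moreover have "N ?b = N b0" by (rule b0[OF mono]) simp
    ultimately have "v \<in> N b0 j" by simp
    then show "hp (a + int d * int j) v \<in> Bt p j" using a unfolding N_def by blast
  qed
qed

text \<open>The summand \<open>int p\<close> is the degree of the basis vectors: total degree a + dj
  + p means coefficients in degree a + dj.\<close>

lemma ZZ_eq: "ZZ (*) (M0 j) p (a + int d * int j + int p) = {v \<in> Zt p j. hp (a + int d * int j) v = v}"
proof (intro equalityI subsetI)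
  fix v assume "v \<in> ZZ (*) (M0 j) p (a + int d * int j + int p)"
  then have v: "v \<in> kchains CARD('n) (M0 j (a + int d * int j)) p" "ks v = 0" unfolding ZZ_def by simp_all
  have "v \<in> kc p j" using kchainsD[OF v(1)] kchains_outside[OF v(1)] by (intro kchainsI) auto
  moreover have "hp (a + int d * int j) v = v"
  proof
    fix T show "hpart (a + int d * int j) (v T) = v T"
    proof (cases "T \<subseteq> {..<CARD('n)} \<and> card T = p")
      case True
      then have "v T \<in> forms (a + int d * int j)" using kchainsD[OF v(1)] by blast
      then show ?thesis using hpart_forms[of "v T" "a + int d * int j" "a + int d * int j"] by simp
    next
      case False
      then show ?thesis using kchains_outside[OF v(1)] by simp
    qed
  qed
  ultimately show "v \<in> {v \<in> Zt p j. hp (a + int d * int j) v = v}" unfolding Zt_def using v(2) by blast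
next
  fix v assume "v \<in> {v \<in> Zt p j. hp (a + int d * int j) v = v}"
  then have v: "v \<in> kc p j" "ks v = 0" "hp (a + int d * int j) v = v" unfolding Zt_def by blast+
  have "v T \<in> forms (a + int d * int j)" for T
    using hpart_in_forms[of "a + int d * int j" "v T"] fun_cong[OF v(3), of T] by simp
  then have "v \<in> kchains CARD('n) (M0 j (a + int d * int j)) p"
    using kchainsD[OF v(1)] kchains_outside[OF v(1)] by (intro kchainsI) auto
  then show "v \<in> ZZ (*) (M0 j) p (a + int d * int j + int p)" unfolding ZZ_def using v(2) by simp
qed

lemma BB_eq: "BB (*) (M0 j) p (a + int d * int j + int p) = {v \<in> Bt p j. hp (a + int d * int j) v = v}"
proof (intro equalityI subsetI)
  fix v assume "v \<in> BB (*) (M0 j) p (a + int d * int j + int p)"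
  then obtain w where w: "w \<in> kchains CARD('n) (M0 j (a + int d * int j - 1)) (Suc p)" "v = ks w"
    unfolding BB_def by (auto simp: algebra_simps)
  have wk: "w \<in> kc (Suc p) j" using kchainsD[OF w(1)] kchains_outside[OF w(1)] by (intro kchainsI) auto
  have "hp (a + int d * int j - 1) w = w"
  proof
    fix T show "hpart (a + int d * int j - 1) (w T) = w T"
    proof (cases "T \<subseteq> {..<CARD('n)} \<and> card T = Suc p")
      case True
      then have "w T \<in> forms (a + int d * int j - 1)" using kchainsD[OF w(1)] by blast
      then show ?thesis using hpart_forms[of "w T" "a + int d * int j - 1" "a + int d * int j - 1"] by simp
    next
      case False
      then show ?thesis using kchains_outside[OF w(1)] by simp
    qed
  qed
  then have "hp (a + int d * int j) v = v" using ks_hp[of "a + int d * int j - 1" w] unfolding w(2) by simp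
  then show "v \<in> {v \<in> Bt p j. hp (a + int d * int j) v = v}" unfolding Bt_def using wk w(2) by blast
next
  fix v assume "v \<in> {v \<in> Bt p j. hp (a + int d * int j) v = v}"
  then obtain w where w: "w \<in> kc (Suc p) j" "v = ks w" "hp (a + int d * int j) v = v" unfolding Bt_def by blast
  let ?w = "hp (a + int d * int j - 1) w"
  have wM: "?w \<in> kchains CARD('n) (M0 j (a + int d * int j - 1)) (Suc p)"
    using kchainsD[OF kc_hp[OF w(1)]] kchains_outside[OF kc_hp[OF w(1)]] hpart_in_forms
    by (intro kchainsI IntI) blast+
  have deg: "a + int d * int j + int p - int (Suc p) = a + int d * int j - 1" by simp
  have "ks ?w \<in> BB (*) (M0 j) p (a + int d * int j + int p)"
    unfolding BB_def deg by (rule imageI[OF wM])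
  moreover have "ks ?w = v" using ks_hp[of "a + int d * int j - 1" w] w(2,3) by simp
  ultimately show "v \<in> BB (*) (M0 j) p (a + int d * int j + int p)" by (simp only:)
qed

text \<open>Row \<open>a\<close> of the Koszul homology is a graded module over \<open>GG\<close>
  with finite-dimensional components, so the prime filtration applies; each prime that arises bounds
  the exponents by its own chains.\<close>

lemma hb_polynomial:
  "eventual_poly {i. \<exists>P. chain P (Suc i)} (\<lambda>j. hb (*) (M0 j) p (a + int d * int j + int p))"
proof -
  let ?s = "fsc (*) :: ('n, 'k) mpoly \<Rightarrow> (nat set \<Rightarrow> ('n, 'k) mpoly) \<Rightarrow> _"
  let ?Z = "\<lambda>j. {v \<in> Zt p j. hp (a + int d * int j) v = v}"
  let ?B = "\<lambda>j. {v \<in> Bt p j. hp (a + int d * int j) v = v}"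
  have strand_gm: "gm ?s (\<lambda>j. {v \<in> N j. hp (a + int d * int j) v = v})"
    if N: "\<And>j. opsub {} (N j)" "\<And>i j x v. x \<in> pw i \<Longrightarrow> v \<in> N j \<Longrightarrow> msc x v \<in> N (i + j)" for N
    unfolding gm_def
  proof (intro conjI allI ballI)
    show "opsub {} {v \<in> N j. hp (a + int d * int j) v = v}" for j
      unfolding opsub_def
    proof (intro conjI ballI)
      show "0 \<in> {v \<in> N j. hp (a + int d * int j) v = v}" using opsub_0[OF N(1)] hp_0 by blast
      fix u v assume "u \<in> {v \<in> N j. hp (a + int d * int j) v = v}" "v \<in> {v \<in> N j. hp (a + int d * int j) v = v}"
      then show "u - v \<in> {v \<in> N j. hp (a + int d * int j) v = v}"
        using opsub_diff[OF N(1), of u j v] hp_diff[of "a + int d * int j" u v] by simp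
    qed simp
    fix i j x v assume x: "x \<in> GG i" and "v \<in> {v \<in> N j. hp (a + int d * int j) v = v}"
    then have v: "v \<in> N j" "hp (a + int d * int j) v = v" by blast+
    have "x \<in> forms (int d * int i)" "x \<in> pw i" using x GG_forms GG_pw by blast+
    then have "hp (a + int d * int (i + j)) (msc x v) = msc x (hp (a + int d * int (i + j) - int d * int i) v)"
      by (intro hp_msc)
    also have "a + int d * int (i + j) - int d * int i = a + int d * int j" by (simp add: algebra_simps)
    also have "msc x (hp (a + int d * int j) v) = msc x v"
      by (rule ext) (simp only: fun_cong[OF v(2)])
    finally show "msc x v \<in> {v \<in> N (i + j). hp (a + int d * int (i + j)) v = v}"
      using N(2)[OF \<open>x \<in> pw i\<close> v(1)] by blast
  qed
  have "eventual_poly {i. \<exists>P. chain P (Suc i)} (hilb ?s ?Z ?B)"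
  proof (rule hilbert_module[OF amod_fun[OF amod_mult] strand_gm _ strand_gm _ noeth_GG])
    show "opsub {} (Zt p j)" "opsub {} (Bt p j)" for j by (rule opsub_Zt opsub_Bt)+
    show "msc x v \<in> Zt p (i + j)" if "x \<in> pw i" "v \<in> Zt p j" for i j x v by (rule Zt_mult[OF that])
    show "msc x v \<in> Bt p (i + j)" if "x \<in> pw i" "v \<in> Bt p j" for i j x v by (rule Bt_mult[OF that])
    show "fdim (kspan ?s) (?Z j)" for j
      unfolding ZZ_eq[symmetric] by (rule fdim_ZZ[OF amod_mult fdim_mono[OF fdim_forms]]) blast
    show "?B \<le> ?Z" unfolding le_fun_def using Bt_Zt by blast
    show "\<exists>N\<in>\<C>. \<forall>N'\<in>\<C>. N \<le> N' \<longrightarrow> N' = N"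
      if "\<C> \<noteq> {}" "\<And>N. N \<in> \<C> \<Longrightarrow> gm ?s N \<and> ?B \<le> N \<and> N \<le> ?Z" for \<C>
    proof (rule strand_max[OF finite_supp rfam_Zt Zt_hp _ that(1) that(2)])
      fix j l v assume "l < CARD('n)" "v \<in> Zt p j"
      then have "msc (xv l) (hp (a + int d * int j - 1) v) \<in> Bt p j" by (intro xv_Zt_Bt Zt_hp)
      moreover have "hp (a + int d * int j) (msc (xv l) (hp (a + int d * int j - 1) v))
          = msc (xv l) (hp (a + int d * int j - 1) (hp (a + int d * int j - 1) v))"
        by (rule hp_msc[OF mvar_in_forms])
      ultimately show "msc (xv l) (hp (a + int d * int j - 1) v) \<in> ?B j" unfolding hpart_hpart by blast
    qed
    show "i \<in> {i. \<exists>P. chain P (Suc i)}" if "j \<in> {i. \<exists>P. chain P (Suc i)}" "i \<le> j" for i j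
      using that chain_mono[of _ "Suc j" "Suc i"] by blast
    show "eventual_poly {i. \<exists>P. chain P (Suc i)} (hilb (*) GG P)" if "gprime P" for P
      by (rule eventual_poly_mono[OF hilbert_prime[OF noeth_GG that]]) blast+
  qed
  then show ?thesis unfolding hb_def ZZ_eq BB_eq .
qed

text \<open>Negative rows vanish because I^j starts in degree dj, high rows by finite generation.
  The bound does not depend on j.\<close>

lemma hb_zero_outside:
  obtains b0 :: nat where "\<And>a j. a < 0 \<or> int b0 < a \<Longrightarrow> hb (*) (M0 j) p (a + int d * int j + int p) = 0"
proof -
  obtain b0 :: nat where b0: "\<And>a j v. v \<in> Zt p j \<Longrightarrow> int b0 < a \<Longrightarrow> hp (a + int d * int j) v \<in> Bt p j"
    by (rule finitely_many_rows) blast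
  show ?thesis
  proof (rule that[of b0])
    fix a j assume a: "a < 0 \<or> int b0 < a"
    have "ZZ (*) (M0 j) p (a + int d * int j + int p) \<subseteq> BB (*) (M0 j) p (a + int d * int j + int p)"
      unfolding ZZ_eq BB_eq
    proof
      fix v assume "v \<in> {v \<in> Zt p j. hp (a + int d * int j) v = v}"
      then have v: "v \<in> Zt p j" "hp (a + int d * int j) v = v" by blast+
      have "hp (a + int d * int j) v \<in> Bt p j"
      proof (cases "int b0 < a")
        case False
        then have low: "a + int d * int j < int d * int j" using a by simp
        have vk: "v \<in> kc p j" using v(1) unfolding Zt_def by blast
        have "hpart (a + int d * int j) (v T) = 0" for T
          by (rule hpart_pw_low[OF kchains_mem[OF vk opsub_0[OF opsub_pw]] low])
        then show ?thesis using opsub_0[OF opsub_Bt] by (simp add: zero_fun_def)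
      qed (rule b0[OF v(1)])
      then show "v \<in> {v \<in> Bt p j. hp (a + int d * int j) v = v}" using v(2) by simp
    qed
    moreover have "BB (*) (M0 j) p (a + int d * int j + int p) \<subseteq> ZZ (*) (M0 j) p (a + int d * int j + int p)"
      unfolding ZZ_eq BB_eq using Bt_Zt by blast
    ultimately show "hb (*) (M0 j) p (a + int d * int j + int p) = 0"
      unfolding hb_def by (simp add: subset_antisym)
  qed
qed

end

section \<open>The fiber ring\<close>

lemma primeideal_iso_image:
  assumes h: "h \<in> ring_iso R S" and R: "cring R" and S: "cring S" and J: "primeideal J R"
  shows "primeideal (h ` J) S"
proof -
  interpret R: cring R by (rule R)
  interpret S: cring S by (rule S)
  interpret J: primeideal J R by (rule J)
  interpret h: ring_hom_ring R S h
    by (rule ring_hom_ringI2[OF R.ring_axioms S.ring_axioms]) (use h in \<open>simp add: ring_iso_def\<close>)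
  note hE = ring_iso_memE[OF h]
  have inj: "inj_on h (carrier R)" and surj: "h ` carrier R = carrier S"
    using hE(5) unfolding bij_betw_def by blast+
  have JR: "J \<subseteq> carrier R" using J.Icarr by blast
  show ?thesis
  proof (rule primeidealI2[OF _ S])
    show "additive_subgroup (h ` J) S"
      using group_hom.subgroup_img_is_subgroup[OF h.a_group_hom J.a_subgroup]
      by (rule additive_subgroup.intro)
    show l: "x \<otimes>\<^bsub>S\<^esub> a \<in> h ` J" if a: "a \<in> h ` J" and x: "x \<in> carrier S" for a x
    proof -
      obtain b y where b: "b \<in> J" "a = h b" "y \<in> carrier R" "x = h y" using a x surj by blast
      then have "x \<otimes>\<^bsub>S\<^esub> a = h (y \<otimes>\<^bsub>R\<^esub> b)" using hE(2)[of y b] JR by auto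
      then show ?thesis using J.I_l_closed[OF b(1,3)] by blast
    qed
    show "a \<otimes>\<^bsub>S\<^esub> x \<in> h ` J" if a: "a \<in> h ` J" and x: "x \<in> carrier S" for a x
    proof -
      have "a \<in> carrier S" using a JR surj by blast
      then have "a \<otimes>\<^bsub>S\<^esub> x = x \<otimes>\<^bsub>S\<^esub> a" using x by (rule S.m_comm)
      then show ?thesis using l[OF a x] by simp
    qed
    show "carrier S \<noteq> h ` J"
    proof
      assume "carrier S = h ` J"
      then have "carrier R = J" unfolding surj[symmetric]
        using inj_on_image_eq_iff[OF inj order_refl JR] by blast
      then show False using J.I_notcarr by blast
    qed
    show "a \<in> h ` J \<or> b \<in> h ` J" if ab: "a \<in> carrier S" "b \<in> carrier S" "a \<otimes>\<^bsub>S\<^esub> b \<in> h ` J" for a b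
    proof -
      obtain x y where x: "x \<in> carrier R" "a = h x" "y \<in> carrier R" "b = h y" using ab surj by blast
      obtain z where z: "z \<in> J" "h (x \<otimes>\<^bsub>R\<^esub> y) = h z" using ab(3) hE(2)[OF x(1,3)] x by auto
      have "x \<otimes>\<^bsub>R\<^esub> y = z" using inj z x JR R.m_closed[OF x(1,3)] unfolding inj_on_def by blast
      then have "x \<in> J \<or> y \<in> J" using J.I_prime[OF x(1,3)] z(1) by simp
      then show ?thesis using x by blast
    qed
  qed
qed

lemma in_irrelevant_idealI:
  fixes f :: "('n::finite, 'k::field) mpoly"
  assumes "Poly_Mapping.lookup f 0 = 0"
  shows "f \<in> irrelevant_ideal"
proof -
  have sub: "mult.subspace (irrelevant_ideal :: ('n, 'k) mpoly set)"
    unfolding irrelevant_ideal_eq_span by (rule mult.subspace_span)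
  have "opsub {} (irrelevant_ideal :: ('n, 'k) mpoly set)"
    unfolding opsub_def using mult.subspace_0[OF sub] mult.subspace_diff[OF sub] by blast
  then show ?thesis
  proof (rule mpoly_closed)
    fix u assume "u \<in> Poly_Mapping.keys f"
    then have "u \<noteq> 0" using assms by (metis in_keys_iff)
    then obtain i where i: "0 < Poly_Mapping.lookup u i"
      by (metis gr0I lookup_zero poly_mapping_eqI)
    let ?w = "u - Poly_Mapping.single i 1"
    have "u = Poly_Mapping.single i 1 + ?w"
      using i by (intro poly_mapping_eqI) (auto simp: lookup_add lookup_minus lookup_single when_def)
    then have "Poly_Mapping.single u (Poly_Mapping.lookup f u)
        = mvar i * Poly_Mapping.single ?w (Poly_Mapping.lookup f u)"
      unfolding mvar_def mult_single by simp
    then show "Poly_Mapping.single u (Poly_Mapping.lookup f u) \<in> irrelevant_ideal"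
      using irrelevant_ideal_mvar by simp
  qed
qed

section \<open>Lowest forms and the comparison with the algebra generated by I_d t\<close>

context rees
begin

declare A.scale_scale [simp del]

lemma fiber_denom_subspace: "mult.subspace (fiber_denom I j)"
proof -
  interpret R: ring "mpoly_ring :: ('n, 'k) mpoly ring"
    using cring.axioms(1)[OF cring_sring[OF subrng_UNIV]] unfolding sring_UNIV .
  have "ideal irrelevant_ideal (mpoly_ring :: ('n, 'k) mpoly ring)" "ideal (pw j) mpoly_ring"
    unfolding ideal_type_algebra_iff irrelevant_ideal_eq_span
    by (rule mult.subspace_span, rule pw_subspace)
  then show ?thesis
    unfolding fiber_denom_def ideal_type_algebra_iff[symmetric] by (rule R.ideal_prod_is_ideal)
qed

lemma hpart_0_irrelevant: "a \<in> irrelevant_ideal \<Longrightarrow> hpart 0 (a * r) = (0 :: ('n, 'k) mpoly)"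
proof -
  assume a: "a \<in> irrelevant_ideal"
  have "r * a \<in> irrelevant_ideal" using a unfolding irrelevant_ideal_eq_span by (rule mult.span_scale)
  then have "Poly_Mapping.lookup (r * a) 0 = 0" by (rule irrelevant_ideal_cases(2))
  moreover have "hpart 0 (r * a) = cst (Poly_Mapping.lookup (hpart 0 (r * a)) 0)"
    by (rule forms_0[OF hpart_in_forms])
  ultimately have "hpart 0 (r * a) = 0" by (simp add: lookup_rst)
  then show ?thesis by (simp add: mult.commute)
qed

text \<open>The component of degree dj sees only the constant terms of the coefficients over
  \<open>GG j\<close>. If it vanishes, the constant terms can be subtracted from the coefficients,
  which leaves coefficients in m.\<close>

lemma fiber_denom_eq: "fiber_denom I j = {x \<in> pw j. hpart (int d * int j) x = 0}"
proof (intro equalityI subsetI)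
  fix x assume "x \<in> fiber_denom I j"
  then show "x \<in> {x \<in> pw j. hpart (int d * int j) x = 0}"
    unfolding fiber_denom_def
  proof (induction rule: ideal_prod.induct)
    case (prod a y)
    obtain t r where t: "t \<subseteq> GG j" "y = (\<Sum>g\<in>t. r g * g)" using prod(2) by (rule pw_explicit)
    have "a * y = (\<Sum>g\<in>t. (a * r g) * g)" unfolding t(2) by (simp add: sum_distrib_left mult.assoc)
    then have "hpart (int d * int j) (a * y) = 0"
      using hpart_pw_sum[OF t(1), of "int d * int j" "\<lambda>g. a * r g"] hpart_0_irrelevant[OF prod(1)] by simp
    then show ?case using pw_scale[OF prod(2), of a] by (simp add: sring_simps)
  next
    case (sum x y)
    then show ?case using opsub_add[OF opsub_pw] by (simp add: sring_simps rst_add)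
  qed
next
  fix x assume "x \<in> {x \<in> pw j. hpart (int d * int j) x = 0}"
  then have x: "x \<in> pw j" "hpart (int d * int j) x = 0" by blast+
  obtain t r where t: "t \<subseteq> GG j" "x = (\<Sum>g\<in>t. r g * g)" using x(1) by (rule pw_explicit)
  have "(\<Sum>g\<in>t. hpart 0 (r g) * g) = 0"
    using x(2) hpart_pw_sum[OF t(1), of "int d * int j" r] unfolding t(2) by simp
  then have eq: "x = (\<Sum>g\<in>t. (r g - hpart 0 (r g)) * g)" unfolding t(2) by (simp add: left_diff_distrib sum_subtractf)
  show "x \<in> fiber_denom I j" unfolding eq
  proof (rule mult.subspace_sum[OF fiber_denom_subspace])
    fix g assume "g \<in> t"
    then have g: "g \<in> pw j" using t(1) GG_pw by blast
    have "r g - hpart 0 (r g) \<in> irrelevant_ideal"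
      by (rule in_irrelevant_idealI) (simp add: lookup_minus lookup_rst)
    from ideal_prod.prod[OF this g, of mpoly_ring] show "(r g - hpart 0 (r g)) * g \<in> fiber_denom I j"
      unfolding fiber_denom_def by (simp add: sring_simps)
  qed
qed

text \<open>For \<open>g\<close> in \<open>GG j\<close> this is the coset of mI^j represented by
  \<open>g\<close>: elements of I^j are congruent exactly when they have the same component in
  degree dj.\<close>

definition cl :: "nat \<Rightarrow> ('n, 'k) mpoly \<Rightarrow> ('n, 'k) mpoly set" where
  "cl j g = {y \<in> pw j. hpart (int d * int j) y = g}"

lemma coset_eq_cl: "x \<in> pw j \<Longrightarrow> fiber_denom I j +>\<^bsub>mpoly_ring\<^esub> x = cl j (hpart (int d * int j) x)"
proof -
  assume x: "x \<in> pw j"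
  show ?thesis unfolding a_r_coset_def' cl_def
  proof (intro equalityI subsetI)
    fix y assume "y \<in> (\<Union>h\<in>fiber_denom I j. {h \<oplus>\<^bsub>mpoly_ring\<^esub> x})"
    then obtain h where h: "h \<in> fiber_denom I j" "y = h + x" by (auto simp: sring_simps)
    then show "y \<in> {y \<in> pw j. hpart (int d * int j) y = hpart (int d * int j) x}"
      using opsub_add[OF opsub_pw _ x] by (simp add: fiber_denom_eq rst_add)
  next
    fix y assume y: "y \<in> {y \<in> pw j. hpart (int d * int j) y = hpart (int d * int j) x}"
    then have "y - x \<in> fiber_denom I j"
      using opsub_diff[OF opsub_pw _ x] by (simp add: fiber_denom_eq rst_diff)
    moreover have "y = (y - x) \<oplus>\<^bsub>mpoly_ring\<^esub> x" by (simp add: sring_simps)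
    ultimately show "y \<in> (\<Union>h\<in>fiber_denom I j. {h \<oplus>\<^bsub>mpoly_ring\<^esub> x})" by blast
  qed
qed

lemma fiber_denom_cl: "fiber_denom I j = cl j 0"
  unfolding fiber_denom_eq cl_def ..

lemma hpart_GG: "g \<in> GG j \<Longrightarrow> hpart (int d * int j) g = g"
  using GG_forms[of j] hpart_forms[of g "int d * int j" "int d * int j"] by auto

lemma GG_in_cl: "g \<in> GG j \<Longrightarrow> g \<in> cl j g"
  unfolding cl_def using GG_pw[of j] hpart_GG by blast

lemma cl_inj: "g \<in> GG j \<Longrightarrow> cl j g = cl j g' \<Longrightarrow> g = g'"
  using GG_in_cl[of g j] hpart_GG[of g j] unfolding cl_def by auto

text \<open>Lowest components multiply because constant terms of coefficients do. This makes
  products of cosets independent of representatives.\<close>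

lemma hpart_pw_mult:
  assumes x: "x \<in> pw i" and y: "y \<in> pw j"
  shows "hpart (int d * int (i + j)) (x * y) = hpart (int d * int i) x * hpart (int d * int j) y"
proof -
  obtain t r where t: "t \<subseteq> GG i" "x = (\<Sum>g\<in>t. r g * g)" using x by (rule pw_explicit)
  obtain t' r' where t': "t' \<subseteq> GG j" "y = (\<Sum>g\<in>t'. r' g * g)" using y by (rule pw_explicit)
  have h0: "hpart 0 (a * b) = hpart 0 a * hpart 0 b" for a b :: "('n, 'k) mpoly"
  proof -
    have "a * b = hpart 0 b * a + (b - hpart 0 b) * a" by (simp add: algebra_simps)
    then have "hpart 0 (a * b) = hpart 0 (hpart 0 b * a) + hpart 0 ((b - hpart 0 b) * a)"
      by (simp only: rst_add)
    also have "hpart 0 ((b - hpart 0 b) * a) = 0"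
      by (intro hpart_0_irrelevant in_irrelevant_idealI) (simp add: lookup_minus lookup_rst)
    also have "hpart 0 (hpart 0 b * a) = hpart 0 b * hpart 0 a"
      using hpart_mult[OF hpart_in_forms[of 0 b], of 0 a] by simp
    finally show ?thesis by (simp add: mult.commute)
  qed
  have "hpart (int d * int (i + j)) (r g * g * (r' g' * g')) = hpart 0 (r g) * g * (hpart 0 (r' g') * g')"
    if "g \<in> t" "g' \<in> t'" for g g'
  proof -
    have "g * g' \<in> GG (i + j)" using that t(1) t'(1) GG_mult by blast
    then have gg: "g * g' \<in> forms (int d * int (i + j))" using GG_forms by blast
    have eq: "r g * g * (r' g' * g') = (g * g') * (r g * r' g')" by (simp only: ac_simps)
    have "hpart (int d * int (i + j)) (r g * g * (r' g' * g')) = (g * g') * hpart 0 (r g * r' g')"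
      unfolding eq using hpart_mult[OF gg, of "int d * int (i + j)" "r g * r' g'"] by simp
    then show ?thesis unfolding h0 by (simp only: ac_simps)
  qed
  then have "hpart (int d * int (i + j)) (x * y) = (\<Sum>g\<in>t. \<Sum>g'\<in>t'. hpart 0 (r g) * g * (hpart 0 (r' g') * g'))"
    unfolding t(2) t'(2) sum_product rst_sum by (intro sum.cong refl)
  also have "\<dots> = (\<Sum>g\<in>t. hpart 0 (r g) * g) * (\<Sum>g'\<in>t'. hpart 0 (r' g') * g')"
    by (rule sum_product[symmetric])
  finally show ?thesis
    using hpart_pw_sum[OF t(1), of "int d * int i" r] hpart_pw_sum[OF t'(1), of "int d * int j" r']
    unfolding t(2) t'(2) by simp
qed

text \<open>Since \<open>I\<close> is generated in one degree, the fiber ring is the subalgebra of \<open>A[t]\<close> generated by \<open>I\<^sub>d t\<close>.\<close>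

definition SS :: "('n, 'k) mpoly poly set" where
  "SS = {p. \<forall>j. Polynomial.coeff p j \<in> GG j}"

definition \<theta> :: "('n, 'k) mpoly poly \<Rightarrow> nat \<Rightarrow> ('n, 'k) mpoly set" where
  "\<theta> p = (\<lambda>j. cl j (Polynomial.coeff p j))"

lemma SS_coeff: "p \<in> SS \<Longrightarrow> Polynomial.coeff p j \<in> GG j"
  unfolding SS_def by blast

lemma subrng_SS: "subrng SS"
  unfolding subrng_def opsub_def
proof (intro conjI ballI)
  show "0 \<in> SS" unfolding SS_def using opsub_0[OF opsub_GG] by simp
  show "u - v \<in> SS" if "u \<in> SS" "v \<in> SS" for u v
    unfolding SS_def mem_Collect_eq coeff_diff
    using opsub_diff[OF opsub_GG SS_coeff[OF that(1)] SS_coeff[OF that(2)]] by blast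
  show "1 \<in> SS" unfolding SS_def
  proof (intro CollectI allI)
    show "Polynomial.coeff 1 j \<in> GG j" for j
      using one_G opsub_0[OF opsub_GG] by (cases "j = 0") simp_all
  qed
  show "u * v \<in> SS" if "u \<in> SS" "v \<in> SS" for u v
    unfolding SS_def mem_Collect_eq coeff_mult
  proof (intro allI opsub_sum[OF opsub_GG])
    fix j i :: nat assume "i \<in> {..j}"
    then have "Polynomial.coeff u i * Polynomial.coeff v (j - i) \<in> GG (i + (j - i))" "i + (j - i) = j"
      using GG_mult[OF SS_coeff[OF that(1), of i] SS_coeff[OF that(2), of "j - i"]] \<open>i \<in> {..j}\<close> by simp_all
    then show "Polynomial.coeff u i * Polynomial.coeff v (j - i) \<in> GG j" by simp
  qed
qed simp

text \<open>Every coset of mI^j in I^j contains exactly one element of \<open>GG j\<close>, namely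
  the common degree dj component of its members; hence the bijection, and lowest components respect
  both operations.\<close>

lemma \<theta>_iso: "\<theta> \<in> ring_iso (sring SS) (fiber_ring I)"
proof (rule ring_iso_memI)
  have fin: "finite {j. \<theta> p j \<noteq> fiber_denom I j}" for p
  proof (rule finite_subset)
    show "{j. \<theta> p j \<noteq> fiber_denom I j} \<subseteq> {..degree p}"
    proof
      fix j assume j: "j \<in> {j. \<theta> p j \<noteq> fiber_denom I j}"
      show "j \<in> {..degree p}"
      proof (rule ccontr)
        assume "j \<notin> {..degree p}"
        then have "Polynomial.coeff p j = 0" by (intro coeff_eq_0) simp
        then show False using j unfolding \<theta>_def fiber_denom_cl by simp
      qed
    qed
  qed simp
  have carr: "\<theta> p \<in> carrier (fiber_ring I)" if "p \<in> SS" for p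
  proof -
    have "\<theta> p j = fiber_denom I j +>\<^bsub>mpoly_ring\<^esub> Polynomial.coeff p j" "Polynomial.coeff p j \<in> pw j" for j
    proof -
      show pwj: "Polynomial.coeff p j \<in> pw j" using SS_coeff[OF that] GG_pw by blast
      show "\<theta> p j = fiber_denom I j +>\<^bsub>mpoly_ring\<^esub> Polynomial.coeff p j"
        unfolding coset_eq_cl[OF pwj] hpart_GG[OF SS_coeff[OF that]] \<theta>_def ..
    qed
    then have "\<forall>j. \<exists>x\<in>pw j. \<theta> p j = fiber_denom I j +>\<^bsub>mpoly_ring\<^esub> x" by blast
    then show ?thesis using fin[of p] by (simp add: fiber_ring_def)
  qed
  then show "\<theta> x \<in> carrier (fiber_ring I)" if "x \<in> carrier (sring SS)" for x using that by (simp add: sring_simps)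
  show "\<theta> (x \<otimes>\<^bsub>sring SS\<^esub> y) = \<theta> x \<otimes>\<^bsub>fiber_ring I\<^esub> \<theta> y"
    if "x \<in> carrier (sring SS)" "y \<in> carrier (sring SS)" for x y
  proof
    fix j
    have xy: "x \<in> SS" "y \<in> SS" using that by (simp_all add: sring_simps)
    \<comment> \<open>The product in \<open>fiber_ring\<close> is a union over all choices of
      representatives; every choice gives the same coset.\<close>
    have key: "fiber_denom I j +>\<^bsub>mpoly_ring\<^esub> (\<Sum>i\<le>j. a i * b (j - i)) = cl j (Polynomial.coeff (x * y) j)"
      if ab: "\<forall>i\<le>j. a i \<in> \<theta> x i \<and> b i \<in> \<theta> y i" for a b
    proof -
      have a: "a i \<in> pw i" "hpart (int d * int i) (a i) = Polynomial.coeff x i" if "i \<le> j" for i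
        using ab that unfolding \<theta>_def cl_def by blast+
      have b: "b i \<in> pw i" "hpart (int d * int i) (b i) = Polynomial.coeff y i" if "i \<le> j" for i
        using ab that unfolding \<theta>_def cl_def by blast+
      have prod: "a i * b (j - i) \<in> pw j" "hpart (int d * int j) (a i * b (j - i)) = Polynomial.coeff x i * Polynomial.coeff y (j - i)"
        if i: "i \<le> j" for i
        using pw_mult[OF a(1)[OF i] b(1)[of "j - i"]] hpart_pw_mult[OF a(1)[OF i] b(1)[of "j - i"]]
          a(2)[OF i] b(2)[of "j - i"] i by simp_all
      have "(\<Sum>i\<le>j. a i * b (j - i)) \<in> pw j" using prod(1) by (intro opsub_sum[OF opsub_pw]) simp
      moreover have "hpart (int d * int j) (\<Sum>i\<le>j. a i * b (j - i)) = Polynomial.coeff (x * y) j"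
        unfolding rst_sum coeff_mult using prod(2) by (intro sum.cong refl) simp
      ultimately show ?thesis using coset_eq_cl by simp
    qed
    have wit: "\<forall>i\<le>j. Polynomial.coeff x i \<in> \<theta> x i \<and> Polynomial.coeff y i \<in> \<theta> y i"
      unfolding \<theta>_def using GG_in_cl SS_coeff xy by blast
    have "(\<theta> x \<otimes>\<^bsub>fiber_ring I\<^esub> \<theta> y) j = {z. \<exists>a b. (\<forall>i\<le>j. a i \<in> \<theta> x i \<and> b i \<in> \<theta> y i) \<and>
      z \<in> fiber_denom I j +>\<^bsub>mpoly_ring\<^esub> (\<Sum>i\<le>j. a i * b (j - i))}" by (simp add: fiber_ring_def)
    also have "\<dots> = cl j (Polynomial.coeff (x * y) j)"
    proof (intro equalityI subsetI)
      fix z assume "z \<in> {z. \<exists>a b. (\<forall>i\<le>j. a i \<in> \<theta> x i \<and> b i \<in> \<theta> y i) \<and>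
        z \<in> fiber_denom I j +>\<^bsub>mpoly_ring\<^esub> (\<Sum>i\<le>j. a i * b (j - i))}"
      then obtain a b where ab: "\<forall>i\<le>j. a i \<in> \<theta> x i \<and> b i \<in> \<theta> y i"
        "z \<in> fiber_denom I j +>\<^bsub>mpoly_ring\<^esub> (\<Sum>i\<le>j. a i * b (j - i))" by blast
      then show "z \<in> cl j (Polynomial.coeff (x * y) j)" using key[OF ab(1)] by blast
    next
      fix z assume "z \<in> cl j (Polynomial.coeff (x * y) j)"
      then have "z \<in> fiber_denom I j +>\<^bsub>mpoly_ring\<^esub> (\<Sum>i\<le>j. Polynomial.coeff x i * Polynomial.coeff y (j - i))"
        using key[OF wit] by blast
      then show "z \<in> {z. \<exists>a b. (\<forall>i\<le>j. a i \<in> \<theta> x i \<and> b i \<in> \<theta> y i) \<and>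
        z \<in> fiber_denom I j +>\<^bsub>mpoly_ring\<^esub> (\<Sum>i\<le>j. a i * b (j - i))}"
        using wit by (intro CollectI exI[of _ "Polynomial.coeff x"] exI[of _ "Polynomial.coeff y"] conjI)
    qed
    finally show "\<theta> (x \<otimes>\<^bsub>sring SS\<^esub> y) j = (\<theta> x \<otimes>\<^bsub>fiber_ring I\<^esub> \<theta> y) j"
      by (simp add: \<theta>_def sring_simps)
  qed
  show "\<theta> (x \<oplus>\<^bsub>sring SS\<^esub> y) = \<theta> x \<oplus>\<^bsub>fiber_ring I\<^esub> \<theta> y"
    if "x \<in> carrier (sring SS)" "y \<in> carrier (sring SS)" for x y
  proof
    fix j
    have xy: "Polynomial.coeff x j \<in> GG j" "Polynomial.coeff y j \<in> GG j"
      using that SS_coeff by (simp_all add: sring_simps)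
    have "(\<theta> x \<oplus>\<^bsub>fiber_ring I\<^esub> \<theta> y) j = (\<Union>h\<in>\<theta> x j. \<Union>k\<in>\<theta> y j. {h + k})"
      by (simp add: fiber_ring_def set_add_def' sring_simps)
    also have "\<dots> = cl j (Polynomial.coeff (x + y) j)"
    proof (intro equalityI subsetI)
      fix z assume "z \<in> (\<Union>h\<in>\<theta> x j. \<Union>k\<in>\<theta> y j. {h + k})"
      then obtain h k where hk: "h \<in> cl j (Polynomial.coeff x j)" "k \<in> cl j (Polynomial.coeff y j)" "z = h + k"
        unfolding \<theta>_def by blast
      then show "z \<in> cl j (Polynomial.coeff (x + y) j)"
        using opsub_add[OF opsub_pw, of h j k] unfolding cl_def by (simp add: rst_add)
    next
      fix z assume z: "z \<in> cl j (Polynomial.coeff (x + y) j)"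
      have yp: "Polynomial.coeff y j \<in> pw j" "hpart (int d * int j) (Polynomial.coeff y j) = Polynomial.coeff y j"
        using xy(2) GG_pw hpart_GG by blast+
      have "z - Polynomial.coeff y j \<in> \<theta> x j"
        using z opsub_diff[OF opsub_pw _ yp(1), of z] yp(2) unfolding \<theta>_def cl_def by (simp add: rst_diff)
      moreover have "Polynomial.coeff y j \<in> \<theta> y j" unfolding \<theta>_def by (rule GG_in_cl[OF xy(2)])
      ultimately show "z \<in> (\<Union>h\<in>\<theta> x j. \<Union>k\<in>\<theta> y j. {h + k})" by force
    qed
    finally show "\<theta> (x \<oplus>\<^bsub>sring SS\<^esub> y) j = (\<theta> x \<oplus>\<^bsub>fiber_ring I\<^esub> \<theta> y) j"
      by (simp add: \<theta>_def sring_simps)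
  qed
  show "\<theta> \<one>\<^bsub>sring SS\<^esub> = \<one>\<^bsub>fiber_ring I\<^esub>"
  proof
    fix j
    have "hpart (int d * int 0) 1 = (1 :: ('n, 'k) mpoly)" using hpart_GG[OF one_G] .
    then have "fiber_denom I 0 +>\<^bsub>mpoly_ring\<^esub> 1 = cl 0 1" using coset_eq_cl[of 1 0] pw_0 by simp
    then show "\<theta> \<one>\<^bsub>sring SS\<^esub> j = \<one>\<^bsub>fiber_ring I\<^esub> j"
      by (simp add: \<theta>_def sring_simps fiber_ring_def fiber_denom_cl)
  qed
  show "bij_betw \<theta> (carrier (sring SS)) (carrier (fiber_ring I))"
    unfolding bij_betw_def
  proof
    show "inj_on \<theta> (carrier (sring SS))"
    proof (rule inj_onI)
      fix p q assume "p \<in> carrier (sring SS)" "q \<in> carrier (sring SS)" and eq: "\<theta> p = \<theta> q"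
      then have p: "p \<in> SS" by (simp add: sring_simps)
      show "p = q"
      proof (rule poly_eqI)
        show "Polynomial.coeff p j = Polynomial.coeff q j" for j
          using fun_cong[OF eq, of j] cl_inj[OF SS_coeff[OF p]] unfolding \<theta>_def by blast
      qed
    qed
    show "\<theta> ` carrier (sring SS) = carrier (fiber_ring I)"
    proof (intro equalityI subsetI)
      fix F assume "F \<in> \<theta> ` carrier (sring SS)"
      then show "F \<in> carrier (fiber_ring I)" using carr by (auto simp: sring_simps)
    next
      fix F assume "F \<in> carrier (fiber_ring I)"
      then have F: "\<And>j. \<exists>x\<in>pw j. F j = fiber_denom I j +>\<^bsub>mpoly_ring\<^esub> x" "finite {j. F j \<noteq> fiber_denom I j}"
        unfolding fiber_ring_def by simp_all
      have "\<exists>g. g \<in> GG j \<and> F j = cl j g" for j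
        using F(1)[of j] coset_eq_cl hpart_pw_GG by blast
      then have "\<forall>j. \<exists>g. g \<in> GG j \<and> F j = cl j g" by blast
      then obtain g where g: "\<forall>j. g j \<in> GG j \<and> F j = cl j (g j)" by (rule choice[THEN exE])
      have "{j. g j \<noteq> 0} \<subseteq> {j. F j \<noteq> fiber_denom I j}"
      proof
        fix j assume "j \<in> {j. g j \<noteq> 0}"
        then show "j \<in> {j. F j \<noteq> fiber_denom I j}"
          using g cl_inj[of "g j" j 0] unfolding fiber_denom_cl by auto
      qed
      then have fin_g: "finite {j. g j \<noteq> 0}" using F(2) by (rule finite_subset)
      have ev: "\<forall>\<^sub>\<infinity>j. g j = 0" unfolding eventually_cofinite using fin_g by simp
      define p where "p = Abs_poly g"
      have cp: "Polynomial.coeff p = g" unfolding p_def using ev by (intro Abs_poly_inverse) simp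
      have "p \<in> SS" unfolding SS_def using g by (simp add: cp)
      moreover have "\<theta> p = F" using g by (intro ext) (simp add: \<theta>_def cp)
      ultimately show "F \<in> \<theta> ` carrier (sring SS)" by (auto simp: sring_simps)
    qed
  qed
qed

lemma cring_fiber: "cring (fiber_ring I)"
proof -
  interpret S: cring "sring SS" by (rule cring_sring[OF subrng_SS])
  have "\<theta> \<zero>\<^bsub>sring SS\<^esub> = fiber_denom I"
    by (rule ext) (simp add: sring_simps \<theta>_def fiber_denom_cl)
  then have "fiber_ring I\<lparr>zero := \<theta> \<zero>\<^bsub>sring SS\<^esub>\<rparr> = fiber_ring I" by (simp add: fiber_ring_def)
  then show ?thesis using S.ring_iso_imp_img_cring[OF \<theta>_iso] by simp
qed

section \<open>From graded primes to chains of primes in the fiber ring\<close>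

definition prm :: "(nat \<Rightarrow> ('n, 'k) mpoly set) \<Rightarrow> ('n, 'k) mpoly poly set" where
  "prm P = {p. \<forall>j. Polynomial.coeff p j \<in> P j}"

text \<open>Primality on homogeneous elements suffices. If neither factor is in the ideal, take in
  each the highest coefficient outside \<open>P\<close>, at positions i and j. In the coefficient of
  degree i + j of the product all other terms lie in \<open>P\<close>, and so would the product of
  these two.\<close>

lemma primeideal_prm:
  assumes P: "gprime P"
  shows "primeideal (prm P) (sring SS)"
proof -
  have gi: "gideal P" and one: "1 \<notin> P 0"
    and pr: "\<And>i j a b. a \<in> GG i \<Longrightarrow> b \<in> GG j \<Longrightarrow> a * b \<in> P (i + j) \<Longrightarrow> a \<in> P i \<or> b \<in> P j"
    using P unfolding gprime_def by blast+
  note Pg = gidealD(1)[OF gi]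
  have PG: "P j \<subseteq> GG j" for j by (rule gidealD(2)[OF gi])
  have op: "opsub {} (P j)" for j by (rule gm_opsub[OF Pg])
  have absorb: "x * y \<in> P j" if "x \<in> GG i" "y \<in> P (j - i)" "i \<le> j" for x y i j
    using gm_scale[OF Pg that(1,2)] that(3) by simp
  show ?thesis
  proof (rule primeidealI)
    show "cring (sring SS)" by (rule cring_sring[OF subrng_SS])
    show "ideal (prm P) (sring SS)"
      unfolding ideal_sring_iff[OF subrng_SS]
    proof (intro conjI ballI)
      show "prm P \<subseteq> SS" unfolding prm_def SS_def using PG by blast
      show "opsub {} (prm P)"
        unfolding opsub_def prm_def mem_Collect_eq
        by (simp add: opsub_0[OF op] opsub_diff[OF op])
      fix p q assume p: "p \<in> SS" and q: "q \<in> prm P"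
      show "p * q \<in> prm P"
        unfolding prm_def mem_Collect_eq coeff_mult
      proof (intro allI opsub_sum[OF op])
        fix j i :: nat assume "i \<in> {..j}"
        then show "Polynomial.coeff p i * Polynomial.coeff q (j - i) \<in> P j"
          using SS_coeff[OF p] q unfolding prm_def by (intro absorb) auto
      qed
    qed
    have "1 \<notin> prm P" using one unfolding prm_def by (auto dest: spec[of _ 0])
    moreover have "1 \<in> SS" using subrng_SS unfolding subrng_def by blast
    ultimately show "carrier (sring SS) \<noteq> prm P" by (auto simp: sring_simps)
    fix p q assume "p \<in> carrier (sring SS)" "q \<in> carrier (sring SS)" "p \<otimes>\<^bsub>sring SS\<^esub> q \<in> prm P"
    then have pq: "p \<in> SS" "q \<in> SS" "p * q \<in> prm P" by (simp_all add: sring_simps)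
    show "p \<in> prm P \<or> q \<in> prm P"
    proof (rule ccontr)
      assume not: "\<not> (p \<in> prm P \<or> q \<in> prm P)"
      have top: "\<exists>i. Polynomial.coeff r i \<notin> P i \<and> (\<forall>k>i. Polynomial.coeff r k \<in> P k)" if "r \<notin> prm P" for r
      proof -
        have "Polynomial.coeff r k \<in> P k" if "k > degree r" for k
          using coeff_eq_0[OF that] opsub_0[OF op] by simp
        then have sub: "{k. Polynomial.coeff r k \<notin> P k} \<subseteq> {..degree r}"
          by (intro subsetI) (metis atMost_iff mem_Collect_eq not_le)
        define i where "i = Max {k. Polynomial.coeff r k \<notin> P k}"
        have fin: "finite {k. Polynomial.coeff r k \<notin> P k}" by (rule finite_subset[OF sub finite_atMost])
        obtain k0 where "Polynomial.coeff r k0 \<notin> P k0" using \<open>r \<notin> prm P\<close> unfolding prm_def by blast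
        then have "{k. Polynomial.coeff r k \<notin> P k} \<noteq> {}" by blast
        then have "i \<in> {k. Polynomial.coeff r k \<notin> P k}" unfolding i_def by (rule Max_in[OF fin])
        moreover have "Polynomial.coeff r k \<in> P k" if "k > i" for k
        proof (rule ccontr)
          assume "Polynomial.coeff r k \<notin> P k"
          then have "k \<le> i" unfolding i_def by (intro Max_ge[OF fin]) simp
          then show False using that by simp
        qed
        ultimately show ?thesis by (intro exI[of _ i]) simp
      qed
      obtain i where i: "Polynomial.coeff p i \<notin> P i" "\<And>k. k > i \<Longrightarrow> Polynomial.coeff p k \<in> P k"
        using top[of p] not by blast
      obtain j where j: "Polynomial.coeff q j \<notin> P j" "\<And>k. k > j \<Longrightarrow> Polynomial.coeff q k \<in> P k"
        using top[of q] not by blast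
      let ?f = "\<lambda>k. Polynomial.coeff p k * Polynomial.coeff q (i + j - k)"
      have rest: "sum ?f ({..i + j} - {i}) \<in> P (i + j)"
      proof (rule opsub_sum[OF op])
        fix k assume k: "k \<in> {..i + j} - {i}"
        show "?f k \<in> P (i + j)"
        proof (cases "k < i")
          case True
          then have "i + j - k > j" by simp
          then have "Polynomial.coeff q (i + j - k) \<in> P (i + j - k)" by (rule j(2))
          then show ?thesis by (rule absorb[OF SS_coeff[OF pq(1)]]) (use True in simp)
        next
          case False
          then have "Polynomial.coeff p k \<in> P k" using k by (intro i(2)) auto
          then have "Polynomial.coeff p k \<in> P (i + j - (i + j - k))" using k by simp
          then have "Polynomial.coeff q (i + j - k) * Polynomial.coeff p k \<in> P (i + j)"
            by (rule absorb[OF SS_coeff[OF pq(2)]]) simp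
          then show ?thesis by (simp only: mult.commute)
        qed
      qed
      have "Polynomial.coeff (p * q) (i + j) = ?f i + sum ?f ({..i + j} - {i})"
        unfolding coeff_mult by (rule sum.remove) simp_all
      then have "?f i = Polynomial.coeff (p * q) (i + j) - sum ?f ({..i + j} - {i})" by simp
      moreover have "Polynomial.coeff (p * q) (i + j) \<in> P (i + j)" using pq(3) unfolding prm_def by blast
      ultimately have "?f i \<in> P (i + j)" using opsub_diff[OF op _ rest] by simp
      then have "Polynomial.coeff p i * Polynomial.coeff q j \<in> P (i + j)" by simp
      then show False using pr[OF SS_coeff[OF pq(1)] SS_coeff[OF pq(2)]] i(1) j(1) by blast
    qed
  qed
qed

lemma prm_strict:
  assumes "gprime P" "gprime P'" "P < P'"
  shows "prm P \<subset> prm P'"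
proof -
  have le: "P j \<subseteq> P' j" for j using assms(3) unfolding less_le le_fun_def by blast
  have "P \<noteq> P'" using assms(3) by simp
  then obtain j where "P j \<noteq> P' j" by (meson ext)
  then obtain x where x: "x \<in> P' j" "x \<notin> P j" using le[of j] by blast
  have "gm (*) P'" using assms(2) gidealD(1) unfolding gprime_def by blast
  then have z: "0 \<in> P' i" for i using opsub_0[OF gm_opsub] by blast
  have "Polynomial.monom x j \<in> prm P'" unfolding prm_def using x(1) z by simp
  moreover have "Polynomial.monom x j \<notin> prm P" unfolding prm_def using x(2) by (auto dest: spec[of _ j])
  moreover have "prm P \<subseteq> prm P'" unfolding prm_def using le by blast
  ultimately show ?thesis by blast
qed

lemma chain_sequence:
  "chain P r \<Longrightarrow> \<exists>f. (\<forall>i\<le>r. gprime (f i)) \<and> (\<forall>i<r. f i < f (Suc i)) \<and> f 0 = P"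
proof (induction r arbitrary: P)
  case 0
  then show ?case by (intro exI[of _ "\<lambda>_. P"]) simp
next
  case (Suc r)
  then obtain P' where P': "gprime P" "P < P'" "chain P' r" by auto
  obtain f where f: "\<forall>i\<le>r. gprime (f i)" "\<forall>i<r. f i < f (Suc i)" "f 0 = P'"
    using Suc.IH[OF P'(3)] by blast
  show ?case
  proof (intro exI[of _ "\<lambda>i. case i of 0 \<Rightarrow> P | Suc i \<Rightarrow> f i"] conjI allI impI)
    show "gprime (case i of 0 \<Rightarrow> P | Suc i \<Rightarrow> f i)" if "i \<le> Suc r" for i
      using that P'(1) f(1) by (cases i) simp_all
    show "(case i of 0 \<Rightarrow> P | Suc i \<Rightarrow> f i) < (case Suc i of 0 \<Rightarrow> P | Suc i \<Rightarrow> f i)" if "i < Suc r" for i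
      using that P'(2) f(2,3) by (cases i) simp_all
  qed simp
qed

text \<open>\<open>prm\<close> turns graded primes into primes of \<open>SS\<close> and
  \<open>\<theta>\<close> carries these to the fiber ring; both steps preserve strict
  inclusions.\<close>

lemma chain_analytic_spread: "chain P r \<Longrightarrow> enat r \<le> analytic_spread I"
proof -
  assume "chain P r"
  then obtain f where f: "\<forall>i\<le>r. gprime (f i)" "\<forall>i<r. f i < f (Suc i)" using chain_sequence by blast
  have inj: "inj_on \<theta> SS" using ring_iso_memE(5)[OF \<theta>_iso] unfolding bij_betw_def by (simp add: sring_simps)
  have sub: "prm (f i) \<subseteq> SS" if "i \<le> r" for i
  proof -
    have "ideal (prm (f i)) (sring SS)" using primeideal_prm f(1) that primeideal.axioms(1) by blast
    then show ?thesis unfolding ideal_sring_iff[OF subrng_SS] by blast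
  qed
  have "primeideal (\<theta> ` prm (f i)) (fiber_ring I)" if "i \<le> r" for i
    using f(1) that by (intro primeideal_iso_image[OF \<theta>_iso cring_sring[OF subrng_SS] cring_fiber] primeideal_prm) blast
  moreover have "\<theta> ` prm (f i) \<subset> \<theta> ` prm (f (Suc i))" if "i < r" for i
  proof -
    have "prm (f i) \<subset> prm (f (Suc i))" using f that by (intro prm_strict) auto
    then show ?thesis using inj sub[of i] sub[of "Suc i"] that
      by (metis Suc_leI image_mono inj_on_image_eq_iff less_imp_le psubset_eq)
  qed
  ultimately have "enat r \<in> {enat r | r. \<exists>P :: nat \<Rightarrow> (nat \<Rightarrow> ('n, 'k) mpoly set) set.
     (\<forall>i\<le>r. primeideal (P i) (fiber_ring I)) \<and> (\<forall>i<r. P i \<subset> P (Suc i))}"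
    by (intro CollectI exI[of _ r] conjI exI[of _ "\<lambda>i. \<theta> ` prm (f i)"]) blast+
  then show ?thesis unfolding analytic_spread_def krull_dim_def by (rule Sup_upper)
qed

end

section \<open>Grade and the vanishing of Betti numbers\<close>

lemma genideal_sring:
  assumes S: "subrng S" and T: "T \<subseteq> S"
  shows "genideal (sring S) T \<subseteq> S" "opsub {} (genideal (sring S) T)"
    "a \<in> S \<Longrightarrow> b \<in> genideal (sring S) T \<Longrightarrow> a * b \<in> genideal (sring S) T"
    "T \<subseteq> genideal (sring S) T"
    "J \<subseteq> S \<Longrightarrow> opsub {} J \<Longrightarrow> (\<And>a b. a \<in> S \<Longrightarrow> b \<in> J \<Longrightarrow> a * b \<in> J) \<Longrightarrow> T \<subseteq> J \<Longrightarrow> genideal (sring S) T \<subseteq> J"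
proof -
  interpret cring "sring S" by (rule cring_sring[OF S])
  have T': "T \<subseteq> carrier (sring S)" using T by (simp add: sring_simps)
  have id: "genideal (sring S) T \<subseteq> S \<and> opsub {} (genideal (sring S) T) \<and>
      (\<forall>a\<in>S. \<forall>b\<in>genideal (sring S) T. a * b \<in> genideal (sring S) T)"
    using genideal_ideal[OF T'] unfolding ideal_sring_iff[OF S] .
  show "genideal (sring S) T \<subseteq> S" "opsub {} (genideal (sring S) T)" using id by blast+
  show "a * b \<in> genideal (sring S) T" if "a \<in> S" "b \<in> genideal (sring S) T" using id that by blast
  show "T \<subseteq> genideal (sring S) T" by (rule genideal_self[OF T'])
  show "genideal (sring S) T \<subseteq> J" if J: "J \<subseteq> S" "opsub {} J" "\<And>a b. a \<in> S \<Longrightarrow> b \<in> J \<Longrightarrow> a * b \<in> J" "T \<subseteq> J"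
  proof (rule genideal_minimal[OF _ J(4)])
    show "ideal J (sring S)" unfolding ideal_sring_iff[OF S] using J(1-3) by blast
  qed
qed

context rees
begin

declare A.scale_scale [simp del]

definition RR :: "('n, 'k) mpoly poly set" where
  "RR = {p. \<forall>j. Polynomial.coeff p j \<in> pw j}"

lemma rees_ring_eq: "rees_ring I = sring RR"
  by (simp add: rees_ring_def RR_def)

lemma RR_coeff: "p \<in> RR \<Longrightarrow> Polynomial.coeff p j \<in> pw j"
  unfolding RR_def by blast

lemma subrng_RR: "subrng RR"
  unfolding subrng_def opsub_def
proof (intro conjI ballI)
  show "0 \<in> RR" unfolding RR_def using opsub_0[OF opsub_pw] by simp
  show "u - v \<in> RR" if "u \<in> RR" "v \<in> RR" for u v
    unfolding RR_def mem_Collect_eq coeff_diff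
    using opsub_diff[OF opsub_pw RR_coeff[OF that(1)] RR_coeff[OF that(2)]] by blast
  show "1 \<in> RR" unfolding RR_def
  proof (intro CollectI allI)
    show "Polynomial.coeff 1 j \<in> pw j" for j
      using pw_0 opsub_0[OF opsub_pw] by (cases "j = 0") simp_all
  qed
  show "u * v \<in> RR" if "u \<in> RR" "v \<in> RR" for u v
    unfolding RR_def mem_Collect_eq coeff_mult
  proof (intro allI opsub_sum[OF opsub_pw])
    fix j i :: nat assume "i \<in> {..j}"
    then show "Polynomial.coeff u i * Polynomial.coeff v (j - i) \<in> pw j"
      using pw_mult[OF RR_coeff[OF that(1), of i] RR_coeff[OF that(2), of "j - i"]] by simp
  qed
qed simp

lemma const_RR: "[:a:] \<in> RR"
  unfolding RR_def
proof (intro CollectI allI)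
  fix j
  have "Polynomial.coeff [:a:] j = (if j = 0 then a else 0)" by (cases j) simp_all
  then show "Polynomial.coeff [:a:] j \<in> pw j" using pw_0 opsub_0[OF opsub_pw] by (cases "j = 0") auto
qed

abbreviation xp :: "nat \<Rightarrow> ('n, 'k) mpoly poly" where
  "xp l \<equiv> [:xv l:]"

text \<open>Provides the coefficients in the Rees algebra with which a member of a regular sequence
  is written through the variables; the homotopy in the vanishing lemma is made from them.\<close>

lemma irrelevant_rees_decomp:
  assumes "y \<in> irrelevant_rees I"
  shows "\<exists>r. y = (\<Sum>l<CARD('n). xp l * r l) \<and> (\<forall>l. r l \<in> RR)"
proof -
  let ?J = "{\<Sum>l<CARD('n). xp l * r l | r. \<forall>l. r l \<in> RR}"
  have R: "opsub {} RR" "\<And>a b. a \<in> RR \<Longrightarrow> b \<in> RR \<Longrightarrow> a * b \<in> RR"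
    using subrng_RR unfolding subrng_def by blast+
  have "genideal (sring RR) ((\<lambda>a. [:a:]) ` irrelevant_ideal) \<subseteq> ?J"
  proof (rule genideal_sring(5)[OF subrng_RR])
    show "(\<lambda>a. [:a:]) ` irrelevant_ideal \<subseteq> RR" using const_RR by blast
    show "?J \<subseteq> RR"
    proof
      fix y assume "y \<in> ?J"
      then obtain r where r: "y = (\<Sum>l<CARD('n). xp l * r l)" "\<And>l. r l \<in> RR" by blast
      show "y \<in> RR" unfolding r(1) by (intro opsub_sum[OF R(1)] R(2)[OF const_RR r(2)])
    qed
    show "opsub {} ?J"
      unfolding opsub_def
    proof (intro conjI ballI)
      show "0 \<in> ?J" using opsub_0[OF R(1)] by (intro CollectI exI[of _ "\<lambda>_. 0"]) simp
      fix u v assume "u \<in> ?J" "v \<in> ?J"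
      then obtain r r' where r: "u = (\<Sum>l<CARD('n). xp l * r l)" "\<forall>l. r l \<in> RR"
        "v = (\<Sum>l<CARD('n). xp l * r' l)" "\<forall>l. r' l \<in> RR" by blast
      have "u - v = (\<Sum>l<CARD('n). xp l * (r l - r' l))"
        unfolding r(1,3) sum_subtractf[symmetric] by (simp only: right_diff_distrib)
      moreover have "\<forall>l. r l - r' l \<in> RR" using r(2,4) opsub_diff[OF R(1)] by blast
      ultimately show "u - v \<in> ?J" by (intro CollectI exI[of _ "\<lambda>l. r l - r' l"] conjI)
    qed simp
    fix a b assume a: "a \<in> RR" and "b \<in> ?J"
    then obtain r where r: "b = (\<Sum>l<CARD('n). xp l * r l)" "\<forall>l. r l \<in> RR" by blast
    have "a * b = (\<Sum>l<CARD('n). xp l * (a * r l))"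
      unfolding r(1) sum_distrib_left by (intro sum.cong refl) (simp only: ac_simps)
    moreover have "\<forall>l. a * r l \<in> RR" using r(2) R(2)[OF a] by blast
    ultimately show "a * b \<in> ?J" by (intro CollectI exI[of _ "\<lambda>l. a * r l"] conjI)
  next
    show "(\<lambda>a. [:a:]) ` irrelevant_ideal \<subseteq> ?J"
    proof
      fix y assume "y \<in> (\<lambda>a. [:a:]) ` (irrelevant_ideal :: ('n, 'k) mpoly set)"
      then obtain a where a: "a \<in> irrelevant_ideal" "y = [:a:]" by blast
      obtain g where g: "a = (\<Sum>l<CARD('n). xv l * g l)" using irrelevant_ideal_cases(1)[OF a(1)] by blast
      have "y = (\<Sum>l<CARD('n). xp l * [:g l:])"
      proof (rule poly_eqI)
        show "Polynomial.coeff y j = Polynomial.coeff (\<Sum>l<CARD('n). xp l * [:g l:]) j" for j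
          unfolding a(2) g by (cases j) (simp_all add: coeff_sum mult.commute)
      qed
      then show "y \<in> ?J" using const_RR by (intro CollectI exI[of _ "\<lambda>l. [:g l:]"]) simp
    qed
  qed
  then show ?thesis using assms unfolding irrelevant_rees_def rees_ring_eq by blast
qed

text \<open>The cycle is placed in degree j of the Rees algebra. Vanishing of Koszul homology over
  that algebra, with the ideals of initial segments of \<open>xs\<close> and zero as the first of
  them, gives a bounding chain, whose coefficient at t^j bounds \<open>v\<close>.\<close>

lemma Zt_eq_Bt:
  assumes reg: "regular_sequence (rees_ring I) xs" "set xs \<subseteq> irrelevant_rees I"
    and p: "CARD('n) < p + length xs" and v: "v \<in> Zt p j"
  shows "v \<in> Bt p j"
proof -
  let ?n = "CARD('n)"
  define J where "J k = genideal (sring RR) (set (take k xs))" for k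
  have xs: "set xs \<subseteq> RR" using reg(1) unfolding regular_sequence_def rees_ring_eq by (simp add: sring_simps)
  have tk: "set (take k xs) \<subseteq> RR" for k using xs set_take_subset by fast
  note JG = genideal_sring[OF subrng_RR tk, folded J_def]
  have R: "opsub {} RR" "\<And>a b. a \<in> RR \<Longrightarrow> b \<in> RR \<Longrightarrow> a * b \<in> RR"
    using subrng_RR unfolding subrng_def by blast+
  have "\<forall>k. \<exists>r. k < length xs \<longrightarrow> xs ! k = (\<Sum>l<?n. xp l * r l) \<and> (\<forall>l. r l \<in> RR)"
  proof
    fix k
    show "\<exists>r. k < length xs \<longrightarrow> xs ! k = (\<Sum>l<?n. xp l * r l) \<and> (\<forall>l. r l \<in> RR)"
    proof (cases "k < length xs")
      case True
      then have "xs ! k \<in> irrelevant_rees I" using reg(2) by auto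
      then show ?thesis using irrelevant_rees_decomp by blast
    qed simp
  qed
  then obtain r where r: "\<forall>k. k < length xs \<longrightarrow> xs ! k = (\<Sum>l<?n. xp l * r k l) \<and> (\<forall>l. r k l \<in> RR)"
    by (rule choice[THEN exE])
  define v' where "v' T = Polynomial.monom (v T) j" for T
  have vk: "v \<in> kc p j" "ks v = 0" using v unfolding Zt_def by blast+
  \<comment> \<open>The variables are constant polynomials in t, so the differential commutes with
    taking the coefficient of t^j.\<close>
  have kos_coeff: "Polynomial.coeff (kos (*) ?n xp w T) j = kos (*) ?n xv (\<lambda>T. Polynomial.coeff (w T) j) T" for w T
    unfolding kos_def coeff_sum
  proof (intro sum.cong refl)
    fix l
    have "ksign l T = (1 :: ('n, 'k) mpoly poly) \<and> ksign l T = (1 :: ('n, 'k) mpoly) \<or>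
        ksign l T = (- 1 :: ('n, 'k) mpoly poly) \<and> ksign l T = (- 1 :: ('n, 'k) mpoly)"
      unfolding ksign_def by (cases "even (card {t \<in> T. t < l})") simp_all
    then show "Polynomial.coeff (if l \<in> T then 0 else ksign l T * xp l * w (insert l T)) j =
        (if l \<in> T then 0 else ksign l T * xv l * Polynomial.coeff (w (insert l T)) j)"
      by (elim disjE conjE) (simp_all only: mult_1_left mult_minus1 minus_mult_left[symmetric], simp_all)
  qed
  have "\<exists>w\<in>kchains ?n RR (Suc p). \<forall>T. v' T - kos (*) ?n xp w T \<in> J 0"
  proof (rule koszul_vanishing[where R = RR and J = J and g = "length xs" and y = "\<lambda>k. xs ! k" and r = r and k = 0])
    show "opsub {} RR" by (rule R(1))
    show "a * b \<in> RR" if "a \<in> RR" "b \<in> RR" for a b by (rule R(2)[OF that])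
    show "xp l \<in> RR" for l by (rule const_RR)
    show "opsub {} (J k)" for k by (rule JG(2))
    show "a * b \<in> J k" if "a \<in> RR" "b \<in> J k" for a b k by (rule JG(3)[OF that])
    show "xs ! k = (\<Sum>l<?n. xp l * r k l)" if "k < length xs" for k using r that by blast
    show "r k l \<in> RR" if "k < length xs" for k l using r that by blast
    show "\<exists>j\<in>J k. \<exists>u\<in>RR. a = j + xs ! k * u" if k: "k < length xs" and a: "a \<in> J (Suc k)" for k a
    proof -
      let ?K = "{j + xs ! k * u | j u. j \<in> J k \<and> u \<in> RR}"
      have yk: "xs ! k \<in> RR" using xs k by auto
      have "genideal (sring RR) (set (take (Suc k) xs)) \<subseteq> ?K"
      proof (rule genideal_sring(5)[OF subrng_RR tk])
        show "?K \<subseteq> RR" using JG(1)[of k] R(2)[OF yk] opsub_add[OF R(1)] by blast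
        show "opsub {} ?K"
          unfolding opsub_def
        proof (intro conjI ballI)
          show "0 \<in> ?K" using opsub_0[OF JG(2)] opsub_0[OF R(1)]
            by (intro CollectI exI[of _ 0]) simp
          fix u v assume "u \<in> ?K" "v \<in> ?K"
          then obtain a b a' b' where *: "u = a + xs ! k * b" "a \<in> J k" "b \<in> RR"
            "v = a' + xs ! k * b'" "a' \<in> J k" "b' \<in> RR" by blast
          have "u - v = (a - a') + xs ! k * (b - b')" unfolding *(1,4) by (simp add: right_diff_distrib)
          then show "u - v \<in> ?K" using opsub_diff[OF JG(2) *(2,5)] opsub_diff[OF R(1) *(3,6)] by blast
        qed simp
        fix c u assume c: "c \<in> RR" and "u \<in> ?K"
        then obtain a b where *: "u = a + xs ! k * b" "a \<in> J k" "b \<in> RR" by blast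
        have "c * u = c * a + xs ! k * (c * b)" unfolding *(1) distrib_left by (simp only: ac_simps)
        then show "c * u \<in> ?K" using JG(3)[OF c *(2)] R(2)[OF c *(3)] by blast
      next
        show "set (take (Suc k) xs) \<subseteq> ?K"
        proof
          fix y assume "y \<in> set (take (Suc k) xs)"
          then have "y = xs ! k \<or> y \<in> set (take k xs)" using k by (simp add: take_Suc_conv_app_nth)
          then show "y \<in> ?K"
          proof
            assume "y = xs ! k"
            moreover have "1 \<in> RR" using subrng_RR unfolding subrng_def by blast
            ultimately show ?thesis using opsub_0[OF JG(2)] by (intro CollectI exI[of _ 0] exI[of _ 1]) simp
          next
            assume "y \<in> set (take k xs)"
            then have "y \<in> J k" using JG(4) by blast
            then show ?thesis using opsub_0[OF R(1)] by (intro CollectI exI[of _ y] exI[of _ 0]) simp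
          qed
        qed
      qed
      then show ?thesis using a unfolding J_def by blast
    qed
    show "j + xs ! k * u \<in> J (Suc k)" if k: "k < length xs" and j: "j \<in> J k" and u: "u \<in> RR" for k j u
    proof -
      have sub: "set (take k xs) \<subseteq> set (take (Suc k) xs)" by (simp add: set_take_subset_set_take)
      have "genideal (sring RR) (set (take k xs)) \<subseteq> J (Suc k)"
        by (rule genideal_sring(5)[OF subrng_RR tk JG(1) JG(2) JG(3)]) (use sub JG(4) in blast)+
      then have "j \<in> J (Suc k)" using j unfolding J_def by blast
      moreover have "xs ! k \<in> set (take (Suc k) xs)" using k by (simp add: take_Suc_conv_app_nth)
      then have "u * xs ! k \<in> J (Suc k)" using JG(4) by (intro JG(3)[OF u]) blast
      then have "xs ! k * u \<in> J (Suc k)" by (simp only: mult.commute)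
      ultimately show ?thesis by (intro opsub_add[OF JG(2)])
    qed
    show "u \<in> J k" if "k < length xs" "u \<in> RR" "xs ! k * u \<in> J k" for k u
      using reg(1) that unfolding regular_sequence_def rees_ring_eq J_def by (simp add: sring_simps)
    show "v' \<in> kchains ?n RR p"
    proof (rule kchainsI)
      fix T assume T: "T \<subseteq> {..<?n}" "card T = p"
      then have "v T \<in> pw j" using kchainsD[OF vk(1)] by blast
      then show "v' T \<in> RR" unfolding RR_def v'_def using opsub_0[OF opsub_pw] by simp
    next
      fix T assume "\<not> (T \<subseteq> {..<?n} \<and> card T = p)"
      then show "v' T = 0" unfolding v'_def using kchains_outside[OF vk(1)] by simp
    qed
    show "kos (*) ?n xp v' T \<in> J 0" for T
    proof -
      have "kos (*) ?n xp v' T = Polynomial.monom (ks v T) j"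
      proof (rule poly_eqI)
        fix i
        show "Polynomial.coeff (kos (*) ?n xp v' T) i = Polynomial.coeff (Polynomial.monom (ks v T) j) i"
        proof (cases "i = j")
          case True
          then show ?thesis unfolding True kos_coeff by (simp add: v'_def)
        next
          case False
          have "Polynomial.coeff (ksign l T * xp l * Polynomial.monom (v (insert l T)) j) i = 0" for l
          proof -
            have "ksign l T * xp l * Polynomial.monom (v (insert l T)) j
              = xp l * (ksign l T * Polynomial.monom (v (insert l T)) j)" by (simp only: ac_simps)
            moreover have "ksign l T = (1 :: ('n, 'k) mpoly poly) \<or> ksign l T = (- 1 :: ('n, 'k) mpoly poly)" by (rule ksign_cases)
            ultimately show ?thesis using False by auto
          qed
          then show ?thesis using False unfolding kos_def v'_def coeff_sum by (simp add: sum.neutral)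
        qed
      qed
      then have "kos (*) ?n xp v' T = 0" using vk(2) by simp
      then show ?thesis using opsub_0[OF JG(2)] by simp
    qed
  qed (use p in auto)
  moreover have "J 0 \<subseteq> {0}" unfolding J_def
    by (rule genideal_sring(5)[OF subrng_RR]) (use opsub_0[OF R(1)] in \<open>auto simp: opsub_def\<close>)
  ultimately obtain w where w: "w \<in> kchains ?n RR (Suc p)" "\<And>T. v' T = kos (*) ?n xp w T" by fastforce
  let ?w = "\<lambda>T. Polynomial.coeff (w T) j"
  have "?w \<in> kc (Suc p) j"
    using kchainsD[OF w(1)] kchains_outside[OF w(1)] RR_coeff by (intro kchainsI) auto
  moreover have "v = ks ?w"
  proof
    show "v T = ks ?w T" for T
      unfolding kos_coeff[symmetric] w(2)[symmetric] v'_def by simp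
  qed
  ultimately show ?thesis unfolding Bt_def by blast
qed

text \<open>The grade is a supremum and need not come with a sequence attaining it. But if all
  sequences were shorter than n - s, it would be at most n - s - 1, contradicting the choice of
  \<open>s\<close>.\<close>

lemma exists_regular_sequence:
  assumes s: "enat s = enat CARD('n) - grade (rees_ring I) (irrelevant_rees I)" and sn: "s < CARD('n)"
  shows "\<exists>xs. regular_sequence (rees_ring I) xs \<and> set xs \<subseteq> irrelevant_rees I \<and> CARD('n) - s \<le> length xs"
proof (rule ccontr)
  assume "\<not> ?thesis"
  then have lt: "length xs < CARD('n) - s" if "regular_sequence (rees_ring I) xs \<and> set xs \<subseteq> irrelevant_rees I" for xs
    using that by (meson not_le)
  have "grade (rees_ring I) (irrelevant_rees I) \<le> enat (CARD('n) - s - 1)"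
    unfolding grade_def
  proof (rule Sup_least)
    fix e assume "e \<in> {enat (length xs) |xs. regular_sequence (rees_ring I) xs \<and> set xs \<subseteq> irrelevant_rees I}"
    then obtain xs where xs: "e = enat (length xs)" "regular_sequence (rees_ring I) xs \<and> set xs \<subseteq> irrelevant_rees I"
      by blast
    show "e \<le> enat (CARD('n) - s - 1)" using lt[OF xs(2)] unfolding xs(1) by simp
  qed
  then obtain g where g: "grade (rees_ring I) (irrelevant_rees I) = enat g" "g \<le> CARD('n) - s - 1"
    by (metis enat_ile enat_ord_simps(1))
  then have "s = CARD('n) - g" using s by simp
  then show False using g(2) sn by linarith
qed

text \<open>For s < n a regular sequence of length at least n - s kills the homology above degree
  \<open>s\<close>; for s at least n there are no chains above that degree.\<close>

lemma hb_zero_above: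
  assumes s: "enat s = enat CARD('n) - grade (rees_ring I) (irrelevant_rees I)" and p: "s < p"
  shows "hb (*) (M0 j) p e = 0"
proof -
  have ZB: "Zt p j \<subseteq> Bt p j"
  proof
    fix v assume v: "v \<in> Zt p j"
    show "v \<in> Bt p j"
    proof (cases "s < CARD('n)")
      case True
      then obtain xs where xs: "regular_sequence (rees_ring I) xs" "set xs \<subseteq> irrelevant_rees I" "CARD('n) - s \<le> length xs"
        using exists_regular_sequence[OF s] by blast
      show ?thesis by (rule Zt_eq_Bt[OF xs(1,2) _ v]) (use xs(3) p True in linarith)
    next
      case False
      have "v \<in> kc p j" using v unfolding Zt_def by blast
      then have "v = 0" by (rule kchains_gt[rotated]) (use False p in simp)
      then show ?thesis using opsub_0[OF opsub_Bt] by simp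
    qed
  qed
  define a where "a = e - int d * int j - int p"
  have e: "e = a + int d * int j + int p" by (simp add: a_def)
  have "ZZ (*) (M0 j) p e = BB (*) (M0 j) p e"
    unfolding e ZZ_eq BB_eq using ZB Bt_Zt by blast
  then show ?thesis unfolding hb_def by simp
qed

end

section \<open>The resolutions of the powers\<close>

lemma count_repeated_shifts:
  "count_list (repeated_shifts k c b) e = (\<Sum>i=1..k. if c i = e then b i else 0)"
proof (induction k)
  case (Suc k)
  have "repeated_shifts (Suc k) c b = repeated_shifts k c b @ replicate (b (Suc k)) (c (Suc k))"
    unfolding repeated_shifts_def by simp
  moreover have "count_list (replicate m x) e = (if x = e then m else 0)" for m and x :: int
    by (induction m) auto
  ultimately show ?case using Suc.IH by simp
qed (simp add: repeated_shifts_def)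

context rees
begin

declare A.scale_scale [simp del]

lemma gmod_M0: "gmod (*) (M0 j)"
  unfolding gmod_def
proof (intro conjI allI ballI)
  show "opsub {} (M0 j e)" for e
    unfolding opsub_def using opsub_0[OF opsub_pw] opsub_diff[OF opsub_pw]
      opsub_0[OF opsub_forms] opsub_diff[OF opsub_forms] by blast
  fix i e and a u :: "('n, 'k) mpoly" assume "a \<in> forms i" "u \<in> M0 j e"
  then show "a * u \<in> M0 j (e + i)" 
    using pw_scale forms_mult'[of a i u e "e + i"] by (auto simp: add.commute)
qed

lemma hb_M0_nonneg: "0 \<le> hb (*) (M0 j) p e"
  by (rule hb_nonneg[OF amod_mult gmod_M0 fdim_mono[OF fdim_forms]]) blast

lemma graded_resolutions:
  assumes s: "enat s = enat CARD('n) - grade (rees_ring I) (irrelevant_rees I)"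
  shows "\<exists>(k :: nat \<Rightarrow> nat) (\<alpha> :: nat \<Rightarrow> nat \<Rightarrow> int) (Q :: nat \<Rightarrow> int \<Rightarrow> rat poly)
            (\<beta> :: nat \<Rightarrow> nat \<Rightarrow> nat \<Rightarrow> nat).
           (\<forall>p\<le>s. inj_on (\<alpha> p) {1..k p}) \<and>
           (\<forall>p\<le>s. \<forall>i\<in>{1..k p}. Q p (\<alpha> p i) \<noteq> 0 \<longrightarrow>
              enat (Polynomial.degree (Q p (\<alpha> p i))) + 1 \<le> analytic_spread I) \<and>
           (\<exists>J. \<forall>j\<ge>J.
              (\<forall>p\<le>s. \<forall>i\<in>{1..k p}. of_nat (\<beta> p i j) = Polynomial.poly (Q p (\<alpha> p i)) (of_nat j)) \<and>
              has_graded_minimal_free_resolution (pw j)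
                (\<lambda>p. if p \<le> s
                     then repeated_shifts (k p) (\<lambda>i. \<alpha> p i + int d * int j) (\<lambda>i. \<beta> p i j)
                     else []))"
proof -
  let ?h = "\<lambda>p (c :: int) j. hb (*) (M0 j) p (c + int d * int j)"
  have "\<forall>p. \<exists>b0 :: nat. \<forall>a j. a < 0 \<or> int b0 < a \<longrightarrow> ?h p (a + int p) j = 0"
  proof
    fix p
    obtain b0 :: nat where "\<And>a j. a < 0 \<or> int b0 < a \<Longrightarrow> hb (*) (M0 j) p (a + int d * int j + int p) = 0"
      by (rule hb_zero_outside[of p]) (rule that)
    then show "\<exists>b0 :: nat. \<forall>a j. a < 0 \<or> int b0 < a \<longrightarrow> ?h p (a + int p) j = 0"
      by (intro exI[of _ b0]) (simp add: ac_simps)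
  qed
  then obtain b0 :: "nat \<Rightarrow> nat"
    where b0: "\<forall>p a j. a < 0 \<or> int (b0 p) < a \<longrightarrow> ?h p (a + int p) j = 0" by (rule choice[THEN exE])
  have "\<forall>x. \<exists>QJ :: rat poly \<times> nat. (\<forall>i. Polynomial.coeff (fst QJ) i \<noteq> 0 \<longrightarrow> (\<exists>P. chain P (Suc i))) \<and>
      (\<forall>j\<ge>snd QJ. of_int (?h (fst x) (snd x) j) = poly (fst QJ) (of_nat j))"
  proof
    fix x :: "nat \<times> int"
    have "(snd x - int (fst x)) + int d * int j + int (fst x) = snd x + int d * int j" for j by simp
    then have "eventual_poly {i. \<exists>P. chain P (Suc i)} (\<lambda>j. ?h (fst x) (snd x) j)"
      using hb_polynomial[of "fst x" "snd x - int (fst x)"] by (simp only:)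
    then obtain Q :: "rat poly" and J where "\<forall>i. Polynomial.coeff Q i \<noteq> 0 \<longrightarrow> i \<in> {i. \<exists>P. chain P (Suc i)}"
      "\<forall>j\<ge>J. of_int (?h (fst x) (snd x) j) = poly Q (of_nat j)"
      unfolding eventual_poly_def by blast
    then show "\<exists>QJ :: rat poly \<times> nat. (\<forall>i. Polynomial.coeff (fst QJ) i \<noteq> 0 \<longrightarrow> (\<exists>P. chain P (Suc i))) \<and>
      (\<forall>j\<ge>snd QJ. of_int (?h (fst x) (snd x) j) = poly (fst QJ) (of_nat j))"
      by (intro exI[of _ "(Q, J)"]) (simp only: fst_conv snd_conv mem_Collect_eq simp_thms)
  qed
  then obtain QJ :: "nat \<times> int \<Rightarrow> rat poly \<times> nat" where
    QJ: "\<forall>x. (\<forall>i. Polynomial.coeff (fst (QJ x)) i \<noteq> 0 \<longrightarrow> (\<exists>P. chain P (Suc i))) \<and>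
      (\<forall>j\<ge>snd (QJ x). of_int (?h (fst x) (snd x) j) = poly (fst (QJ x)) (of_nat j))"
    by (rule choice[THEN exE])
  \<comment> \<open>The possibly nonzero rows are a = 0, ..., \<open>b0 p\<close>, numbered by i = a
    + 1. The shift \<open>\<alpha> p i\<close> is a + p, since Koszul basis vectors in chain degree
    p have degree p.\<close>
  define k where "k p = Suc (b0 p)" for p
  define \<alpha> where "\<alpha> p i = int p + (int i - 1)" for p i
  define Q where "Q p c = fst (QJ (p, c))" for p c
  define \<beta> where "\<beta> p i j = nat (?h p (\<alpha> p i) j)" for p i j
  \<comment> \<open>Each pair of chain degree and shift has its own threshold for polynomiality;
    only finitely many pairs matter, so a common threshold exists.\<close>
  define ix_pairs where "ix_pairs = Sigma {..s} (\<lambda>p. \<alpha> p ` {1..k p})"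
  have fX: "finite ix_pairs" unfolding ix_pairs_def by simp
  define J where "J = Max (insert 0 ((\<lambda>x. snd (QJ x)) ` ix_pairs))"
  have J: "snd (QJ (p, \<alpha> p i)) \<le> J" if "p \<le> s" "i \<in> {1..k p}" for p i
  proof -
    have "(p, \<alpha> p i) \<in> ix_pairs" unfolding ix_pairs_def using that by blast
    then show ?thesis unfolding J_def using fX by (intro Max_ge) auto
  qed
  have \<beta>: "int (\<beta> p i j) = ?h p (\<alpha> p i) j" for p i j unfolding \<beta>_def by (simp add: hb_M0_nonneg)
  have 1: "\<forall>p\<le>s. inj_on (\<alpha> p) {1..k p}" unfolding inj_on_def \<alpha>_def by simp
  \<comment> \<open>The exponent i of a nonzero coefficient comes with a chain of i + 1 strict
    inclusions; applied to the leading coefficient this gives degree + 1.\<close>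
  have 2: "enat (degree (Q p c)) + 1 \<le> analytic_spread I" if "Q p c \<noteq> 0" for p c
  proof -
    have "Polynomial.coeff (Q p c) (degree (Q p c)) \<noteq> 0" using that by simp
    then obtain P where "chain P (Suc (degree (Q p c)))" using QJ unfolding Q_def by blast
    from chain_analytic_spread[OF this] show ?thesis by (simp add: eSuc_enat[symmetric] plus_1_eSuc)
  qed
  have 3: "of_nat (\<beta> p i j) = poly (Q p (\<alpha> p i)) (of_nat j)" if j: "J \<le> j" and p: "p \<le> s" "i \<in> {1..k p}" for j p i
  proof -
    have "of_nat (\<beta> p i j) = (of_int (int (\<beta> p i j)) :: rat)" by simp
    also have "\<dots> = of_int (?h p (\<alpha> p i) j)" unfolding \<beta> ..
    also have "\<dots> = poly (Q p (\<alpha> p i)) (of_nat j)"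
      using QJ[rule_format, of "(p, \<alpha> p i)"] J[OF p] j unfolding Q_def by simp
    finally show ?thesis .
  qed
  have 4: "has_graded_minimal_free_resolution (pw j) (\<lambda>p. if p \<le> s
      then repeated_shifts (k p) (\<lambda>i. \<alpha> p i + int d * int j) (\<lambda>i. \<beta> p i j) else [])" for j
  proof (rule minimal_resolution[OF pw_subspace hpart_pw])
    fix p e
    show "int (count_list (if p \<le> s then repeated_shifts (k p) (\<lambda>i. \<alpha> p i + int d * int j) (\<lambda>i. \<beta> p i j) else []) e)
      = hb (*) (M0 j) p e"
    proof (cases "p \<le> s")
      case False
      then show ?thesis using hb_zero_above[OF s] by simp
    next
      case True
      define a where "a = e - int d * int j - int p"
      have e: "e = (a + int p) + int d * int j" unfolding a_def by simp
      \<comment> \<open>Distinct rows have distinct shifts, so a degree \<open>e\<close> is produced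
        by at most one index i, that of its row.\<close>
      have "\<alpha> p i + int d * int j = e \<longleftrightarrow> int i = a + 1" for i unfolding e \<alpha>_def by auto
      then have count: "int (count_list (repeated_shifts (k p) (\<lambda>i. \<alpha> p i + int d * int j) (\<lambda>i. \<beta> p i j)) e)
        = int (\<Sum>i=1..k p. if int i = a + 1 then \<beta> p i j else 0)"
        unfolding count_repeated_shifts by (simp only:)
      show ?thesis
      proof (cases "a < 0 \<or> int (b0 p) < a")
        case out: True
        then have "(\<Sum>i=1..k p. if int i = a + 1 then \<beta> p i j else 0) = 0"
          unfolding k_def by (intro sum.neutral) auto
        moreover have "?h p (a + int p) j = 0" by (rule b0[rule_format, OF out])
        ultimately show ?thesis using True count unfolding e[symmetric] by simp
      next
        case False
        then have i: "nat a + 1 \<in> {1..k p}" "\<alpha> p (nat a + 1) = a + int p" unfolding k_def \<alpha>_def by auto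
        have "(\<Sum>i=1..k p. if int i = a + 1 then \<beta> p i j else 0) = (\<Sum>i=1..k p. if nat a + 1 = i then \<beta> p i j else 0)"
          using False by (intro sum.cong refl if_cong) auto
        also have "\<dots> = \<beta> p (nat a + 1) j" unfolding sum.delta'[OF finite_atLeastAtMost] using i(1) by simp
        finally have "int (count_list (repeated_shifts (k p) (\<lambda>i. \<alpha> p i + int d * int j) (\<lambda>i. \<beta> p i j)) e) = int (\<beta> p (nat a + 1) j)"
          unfolding count by simp
        then show ?thesis unfolding \<beta> i(2) e[symmetric] using True by simp
      qed
    qed
  qed
  show ?thesis using 1 2 3 4
    by (intro exI[of _ k] exI[of _ \<alpha>] exI[of _ Q] exI[of _ \<beta>] conjI allI impI ballI exI[of _ J]) simp_all
qed

end

theorem proposition40: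
  fixes I :: "('n::finite, 'k::field) mpoly set"
    and d s :: nat
  assumes I: "\<exists>G. G \<subseteq> forms (int d) \<and> I = genideal mpoly_ring G"
    and s: "enat s = enat CARD('n) - grade (rees_ring I) (irrelevant_rees I)"
  shows "\<exists>(k :: nat \<Rightarrow> nat) (\<alpha> :: nat \<Rightarrow> nat \<Rightarrow> int) (Q :: nat \<Rightarrow> int \<Rightarrow> rat poly)
            (\<beta> :: nat \<Rightarrow> nat \<Rightarrow> nat \<Rightarrow> nat).
           (\<forall>p\<le>s. inj_on (\<alpha> p) {1..k p}) \<and>
           (\<forall>p\<le>s. \<forall>i\<in>{1..k p}. Q p (\<alpha> p i) \<noteq> 0 \<longrightarrow>
              enat (Polynomial.degree (Q p (\<alpha> p i))) + 1 \<le> analytic_spread I) \<and>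
           (\<exists>J. \<forall>j\<ge>J.
              (\<forall>p\<le>s. \<forall>i\<in>{1..k p}. of_nat (\<beta> p i j) = Polynomial.poly (Q p (\<alpha> p i)) (of_nat j)) \<and>
              has_graded_minimal_free_resolution (ideal_power I j)
                (\<lambda>p. if p \<le> s
                     then repeated_shifts (k p) (\<lambda>i. \<alpha> p i + int d * int j) (\<lambda>i. \<beta> p i j)
                     else []))"
proof -
  obtain G where "G \<subseteq> forms (int d)" "I = genideal mpoly_ring G" using I by blast
  then have "rees I d G" unfolding rees_def genideal_eq_span by blast
  then show ?thesis using s by (rule rees.graded_resolutions)
qed

end
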